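(* Let $p:\mathcal C\to\mathcal B$ be a functor between essentially small categories which is a fibration, and which therefore induces a locally connected morphism of presheaf toposes $(p^*,p_* ):\widehat{\mathcal C}\to\widehat{\mathcal B}$. Let $\widehat{\mathcal B}_J\hookrightarrow\widehat{\mathcal B}$ be the subtopos defined by a topology $J$ of $\mathcal B$, and let $\widehat{\mathcal C}_{J'}\hookrightarrow\widehat{\mathcal C}$ be its inverse image by $\widehat{\mathcal C}\to\widehat{\mathcal B}$, defined by the Giraud topology $J'$ of $\mathcal C$ associated with $J$. Then: (i) The induced morphism of toposes $(p^*,p_* ):\widehat{\mathcal C}_{J'}\to\widehat{\mathcal B}_J$ is locally connected. (ii) The induced inverse image map of subtoposes $p^{-1}:({\rm ST}(\widehat{\mathcal B}_J),\supseteq)\to({\rm ST}(\widehat{\mathcal C}_{J'}),\supseteq)$ preserves arbitrary unions as well as arbitrary intersections, and it has both a right adjoint $$p_*:({\rm ST}(\widehat{\mathcal C}_{J'}),\supseteq)\to({\rm ST}(\widehat{\mathcal B}_J),\supseteq)$$ and a left adjoint, the extraordinary direct image map, $$p_!:({\rm ST}(\widehat{\mathcal C}_{J'}),\supseteq)\to({\rm ST}(\widehat{\mathcal B}_J),\supseteq).$$ (iii) For every subtopos $\widehat{\mathcal C}_{K'}\hookrightarrow\widehat{\mathcal C}_{J'}$ defined by a topology $K'\supseteq J'$ of $\mathcal C$ which is generated over $J'$ by a family of sieves $C_i\hookrightarrow y(X_i)$, $i\in I$, on objects $X_i$ of $\mathcal C$, its extraordinary direct image is the subtopos $\widehat{\mathcal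 B}_K\hookrightarrow\widehat{\mathcal B}_J$ defined by the topology $K$ of $\mathcal B$ generated over $J$ by the family of sieves $$(C_i)_p\hookrightarrow y(p(X_i)),\quad i\in I,$$ where, for every sieve $C\hookrightarrow y(X)$ on an object $X$ of $\mathcal C$, $C_p\hookrightarrow y(p(X))$ denotes the sieve on the object $p(X)$ of $\mathcal B$ consisting of the morphisms $Y\to p(X)$ a horizontal lifting $X'\to X$ of which is an element of $C$.
   Context: For a functor $p:\mathcal C\to\mathcal B$, a morphism $x:X'\to X$ of $\mathcal C$ is horizontal if for every $x_1:X''\to X$, every factorization $p(x_1)=p(x)\circ b'$ lifts to a unique $x':X''\to X'$ with $x_1=x\circ x'$ and $p(x')=b'$. $p$ is a fibration if for every object $X$ of $\mathcal C$ and every $b:Y\to p(X)$ there are a horizontal morphism $x:X'\to X$ and an isomorphism $p(X')\xrightarrow{\sim}Y$ whose composite with $b$ is $p(x)$; such an $x$ is a horizontal lifting of $b$ (unique up to unique isomorphism). $\widehat{\mathcal C}=[\mathcal C^{\rm op},{\rm Set}]$, $\widehat{\mathcal C}_J$ is the topos of $J$-sheaves, and $p^*:\widehat{\mathcal B}\to\widehat{\mathcal C}$ is composition with $p$, with right adjoint $p_*$. The Giraud topology $J'$ of $\mathcal C$ associated with $J$ is the topology defining the inverse image subtopos; a sieve $C\hookrightarrow y(X)$ is $J'$-covering iff $C_p\hookrightarrow y(p(X))$ is $J$-covering. A morphism of toposes $f:\mathcal E'\to\mathcal E$ is locally connected if $f^*$ has a left adjoint $f_!$ and the canonical morphisms $f_!(E'\times_{f^*E_1}f^*E_2)\to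 f_!E'\times_{E_1}E_2$ (for $E_2\to E_1$ in $\mathcal E$, $E'\to f^*E_1$ in $\mathcal E'$) are isomorphisms. ${\rm ST}(\mathcal E)$ is the set of subtoposes of $\mathcal E$ ordered by inclusion; unions and intersections are suprema and infima for inclusion. For $f:\mathcal E'\to\mathcal E$, the direct image of a subtopos of $\mathcal E'$ is the image of its composite with $f$, and the inverse image $f^{-1}$ of subtoposes is characterized by $f^{-1}\mathcal E_1\supseteq\mathcal E'_1\iff\mathcal E_1\supseteq f_*\mathcal E'_1$. The left adjoint $p_!$ is characterized by $p_!(\mathcal E'_1)\supseteq\mathcal E_1\iff\mathcal E'_1\supseteq p^{-1}\mathcal E_1$. A topology generated over $J$ by a family of sieves is the smallest topology containing $J$ and these sieves. *)

theory Defs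
  imports Main "HOL.Hull" "HOL-Library.FuncSet"
begin

unbundle cardinal_syntax

section \<open>Categories and functors\<close>

record ('o, 'm) cat =
  Obj :: "'o set"
  Arr :: "'m set"
  Dom :: "'m \<Rightarrow> 'o"
  Cod :: "'m \<Rightarrow> 'o"
  Ide :: "'o \<Rightarrow> 'm"
  Cmp :: "'m \<Rightarrow> 'm \<Rightarrow> 'm"  (infixl \<open>\<odot>\<index>\<close> 70)

definition Hom :: "('o, 'm, 'z) cat_scheme \<Rightarrow> 'o \<Rightarrow> 'o \<Rightarrow> 'm set" where
  "Hom C a b = {f \<in> Arr C. Dom C f = a \<and> Cod C f = b}"

text \<open>\<open>g \<odot> f\<close> is \<open>g\<close> after \<open>f\<close>.\<close>

locale category =
  fixes C :: "('o, 'm, 'z) cat_scheme" (structure)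
  assumes Dom_in: "f \<in> Arr C \<Longrightarrow> Dom C f \<in> Obj C"
    and Cod_in: "f \<in> Arr C \<Longrightarrow> Cod C f \<in> Obj C"
    and Ide_in: "a \<in> Obj C \<Longrightarrow> Ide C a \<in> Hom C a a"
    and Cmp_in: "f \<in> Hom C a b \<Longrightarrow> g \<in> Hom C b c \<Longrightarrow> g \<odot> f \<in> Hom C a c"
    and Ide_left: "f \<in> Hom C a b \<Longrightarrow> Ide C b \<odot> f = f"
    and Ide_right: "f \<in> Hom C a b \<Longrightarrow> f \<odot> Ide C a = f"
    and Cmp_assoc: "f \<in> Hom C a b \<Longrightarrow> g \<in> Hom C b c \<Longrightarrow> h \<in> Hom C c d \<Longrightarrow>
      (h \<odot> g) \<odot> f = h \<odot> (g \<odot> f)"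

definition is_iso :: "('o, 'm, 'z) cat_scheme \<Rightarrow> 'm \<Rightarrow> bool" where
  "is_iso C f \<longleftrightarrow> f \<in> Arr C \<and>
    (\<exists>g \<in> Hom C (Cod C f) (Dom C f).
      g \<odot>\<^bsub>C\<^esub> f = Ide C (Dom C f) \<and> f \<odot>\<^bsub>C\<^esub> g = Ide C (Cod C f))"

definition isomorphic :: "('o, 'm, 'z) cat_scheme \<Rightarrow> 'o \<Rightarrow> 'o \<Rightarrow> bool" where
  "isomorphic C a b \<longleftrightarrow> (\<exists>f \<in> Hom C a b. is_iso C f)"

definition full_subcat :: "('o, 'm) cat \<Rightarrow> 'o set \<Rightarrow> ('o, 'm) cat" where
  "full_subcat C S = C\<lparr>Obj := Obj C \<inter> S, Arr := {f \<in> Arr C. Dom C f \<in> S \<and> Cod C f \<in> S}\<rparr>"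

record ('o, 'm, 'b, 'n) cat_functor =
  FO :: "'o \<Rightarrow> 'b"
  FA :: "'m \<Rightarrow> 'n"

definition is_functor ::
    "('o, 'm) cat \<Rightarrow> ('b, 'n) cat \<Rightarrow> ('o, 'm, 'b, 'n) cat_functor \<Rightarrow> bool" where
  "is_functor C B F \<longleftrightarrow>
    (\<forall>a \<in> Obj C. FO F a \<in> Obj B) \<and>
    (\<forall>f \<in> Arr C. FA F f \<in> Hom B (FO F (Dom C f)) (FO F (Cod C f))) \<and>
    (\<forall>a \<in> Obj C. FA F (Ide C a) = Ide B (FO F a)) \<and>
    (\<forall>f \<in> Arr C. \<forall>g \<in> Arr C. Cod C f = Dom C g \<longrightarrow>
      FA F (g \<odot>\<^bsub>C\<^esub> f) = FA F g \<odot>\<^bsub>B\<^esub> FA F f)"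

definition id_functor :: "('o, 'm, 'o, 'm) cat_functor" where
  "id_functor = \<lparr>FO = (\<lambda>a. a), FA = (\<lambda>f. f)\<rparr>"

definition comp_functor ::
    "('b, 'n, 'd, 'k) cat_functor \<Rightarrow> ('o, 'm, 'b, 'n) cat_functor \<Rightarrow> ('o, 'm, 'd, 'k) cat_functor" where
  "comp_functor G F = \<lparr>FO = (\<lambda>a. FO G (FO F a)), FA = (\<lambda>f. FA G (FA F f))\<rparr>"

definition natural ::
    "('o, 'm) cat \<Rightarrow> ('b, 'n) cat \<Rightarrow> ('o, 'm, 'b, 'n) cat_functor \<Rightarrow> ('o, 'm, 'b, 'n) cat_functor \<Rightarrow>
      ('o \<Rightarrow> 'n) \<Rightarrow> bool" where
  "natural C B F G t \<longleftrightarrow>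
    (\<forall>a \<in> Obj C. t a \<in> Hom B (FO F a) (FO G a)) \<and>
    (\<forall>f \<in> Arr C. FA G f \<odot>\<^bsub>B\<^esub> t (Dom C f) = t (Cod C f) \<odot>\<^bsub>B\<^esub> FA F f)"

text \<open>\<open>L : D \<rightarrow> E\<close> is left adjoint to \<open>R : E \<rightarrow> D\<close> with unit \<open>\<eta>\<close> and counit \<open>\<epsilon>\<close>.\<close>

definition adjunction ::
    "('o, 'm) cat \<Rightarrow> ('b, 'n) cat \<Rightarrow> ('o, 'm, 'b, 'n) cat_functor \<Rightarrow> ('b, 'n, 'o, 'm) cat_functor \<Rightarrow>
      ('o \<Rightarrow> 'm) \<Rightarrow> ('b \<Rightarrow> 'n) \<Rightarrow> bool" where
  "adjunction D E L R \<eta> \<epsilon> \<longleftrightarrow>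
    is_functor D E L \<and> is_functor E D R \<and>
    natural D D id_functor (comp_functor R L) \<eta> \<and>
    natural E E (comp_functor L R) id_functor \<epsilon> \<and>
    (\<forall>a \<in> Obj D. \<epsilon> (FO L a) \<odot>\<^bsub>E\<^esub> FA L (\<eta> a) = Ide E (FO L a)) \<and>
    (\<forall>b \<in> Obj E. FA R (\<epsilon> b) \<odot>\<^bsub>D\<^esub> \<eta> (FO R b) = Ide D (FO R b))"

definition is_terminal :: "('o, 'm) cat \<Rightarrow> 'o \<Rightarrow> bool" where
  "is_terminal C t \<longleftrightarrow> t \<in> Obj C \<and> (\<forall>a \<in> Obj C. \<exists>!f. f \<in> Hom C a t)"

definition is_pullback :: "('o, 'm) cat \<Rightarrow> 'm \<Rightarrow> 'm \<Rightarrow> 'o \<Rightarrow> 'm \<Rightarrow> 'm \<Rightarrow> bool" where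
  "is_pullback C f g P p q \<longleftrightarrow>
    f \<in> Arr C \<and> g \<in> Arr C \<and> Cod C f = Cod C g \<and> P \<in> Obj C \<and>
    p \<in> Hom C P (Dom C f) \<and> q \<in> Hom C P (Dom C g) \<and> f \<odot>\<^bsub>C\<^esub> p = g \<odot>\<^bsub>C\<^esub> q \<and>
    (\<forall>a \<in> Obj C. \<forall>x \<in> Hom C a (Dom C f). \<forall>y \<in> Hom C a (Dom C g).
      f \<odot>\<^bsub>C\<^esub> x = g \<odot>\<^bsub>C\<^esub> y \<longrightarrow> (\<exists>!m. m \<in> Hom C a P \<and> p \<odot>\<^bsub>C\<^esub> m = x \<and> q \<odot>\<^bsub>C\<^esub> m = y))"

definition left_exact ::
    "('o, 'm) cat \<Rightarrow> ('b, 'n) cat \<Rightarrow> ('o, 'm, 'b, 'n) cat_functor \<Rightarrow> bool" where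
  "left_exact C B F \<longleftrightarrow> is_functor C B F \<and>
    (\<forall>t. is_terminal C t \<longrightarrow> is_terminal B (FO F t)) \<and>
    (\<forall>f g P p q. is_pullback C f g P p q \<longrightarrow>
      is_pullback B (FA F f) (FA F g) (FO F P) (FA F p) (FA F q))"

section \<open>Morphisms of toposes\<close>

text \<open>All toposes occurring below are of the form \<open>\<hat>C\<^sub>J\<close>, hence no predicate for being a topos.
  A morphism \<open>E' \<rightarrow> E\<close> is given by its inverse image and direct image functors.\<close>

record ('e, 'f, 'd, 'k) geom =
  inv_im :: "('e, 'f, 'd, 'k) cat_functor"
  dir_im :: "('d, 'k, 'e, 'f) cat_functor"

definition geometric_morphism ::
    "('d, 'k) cat \<Rightarrow> ('e, 'f) cat \<Rightarrow> ('e, 'f, 'd, 'k) geom \<Rightarrow> bool" where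
  "geometric_morphism E' E f \<longleftrightarrow>
    left_exact E E' (inv_im f) \<and> (\<exists>\<eta> \<epsilon>. adjunction E E' (inv_im f) (dir_im f) \<eta> \<epsilon>)"

text \<open>In the second condition, \<open>L\<close> is \<open>f\<^sub>!\<close>, \<open>u : E'\<^sub>0 \<rightarrow> f\<^sup>* E\<^sub>1\<close> has transpose
  \<open>\<epsilon> E\<^sub>1 \<odot> L u : f\<^sub>! E'\<^sub>0 \<rightarrow> E\<^sub>1\<close>, and \<open>m\<close> is the canonical morphism from
  \<open>f\<^sub>! P\<close>, \<open>P = E'\<^sub>0 \<times> f\<^sup>* E\<^sub>2\<close> over \<open>f\<^sup>* E\<^sub>1\<close>, to \<open>Q = f\<^sub>! E'\<^sub>0 \<times> E\<^sub>2\<close> over \<open>E\<^sub>1\<close>.\<close>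

definition locally_connected ::
    "('d, 'k) cat \<Rightarrow> ('e, 'f) cat \<Rightarrow> ('e, 'f, 'd, 'k) geom \<Rightarrow> bool" where
  "locally_connected E' E f \<longleftrightarrow> geometric_morphism E' E f \<and>
    (\<exists>L \<eta> \<epsilon>. adjunction E' E L (inv_im f) \<eta> \<epsilon> \<and>
      (\<forall>u v P p1 p2 Q q1 q2 m.
        u \<in> Arr E' \<and> v \<in> Arr E \<and> Cod E' u = FO (inv_im f) (Cod E v) \<and>
        is_pullback E' u (FA (inv_im f) v) P p1 p2 \<and>
        is_pullback E (\<epsilon> (Cod E v) \<odot>\<^bsub>E\<^esub> FA L u) v Q q1 q2 \<and>
        m \<in> Hom E (FO L P) Q \<and>
        q1 \<odot>\<^bsub>E\<^esub> m = FA L p1 \<and> q2 \<odot>\<^bsub>E\<^esub> m = \<epsilon> (Dom E v) \<odot>\<^bsub>E\<^esub> FA L p2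
        \<longrightarrow> is_iso E m))"

section \<open>Subtoposes\<close>

text \<open>A subtopos of \<open>E\<close>, i.e. an equivalence class of embeddings into \<open>E\<close>, is represented by the
  essential image of the direct image functors: a replete full subcategory whose inclusion is
  the direct image part of a morphism of toposes. Inclusion of subtoposes is then inclusion of
  the sets of objects.\<close>

definition ST :: "('e, 'f) cat \<Rightarrow> 'e set set" where
  "ST E = {S. S \<subseteq> Obj E \<and>
    (\<forall>a \<in> S. \<forall>b \<in> Obj E. isomorphic E a b \<longrightarrow> b \<in> S) \<and>
    (\<exists>r. geometric_morphism (full_subcat E S) E \<lparr>inv_im = r, dir_im = id_functor\<rparr>)}"

definition is_union :: "('e, 'f) cat \<Rightarrow> 'e set set \<Rightarrow> 'e set \<Rightarrow> bool" where
  "is_union E \<S> U \<longleftrightarrow> U \<in> ST E \<and> (\<forall>S \<in> \<S>. S \<subseteq> U) \<and>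
    (\<forall>T \<in> ST E. (\<forall>S \<in> \<S>. S \<subseteq> T) \<longrightarrow> U \<subseteq> T)"

definition is_intersection :: "('e, 'f) cat \<Rightarrow> 'e set set \<Rightarrow> 'e set \<Rightarrow> bool" where
  "is_intersection E \<S> U \<longleftrightarrow> U \<in> ST E \<and> (\<forall>S \<in> \<S>. U \<subseteq> S) \<and>
    (\<forall>T \<in> ST E. (\<forall>S \<in> \<S>. T \<subseteq> S) \<longrightarrow> T \<subseteq> U)"

text \<open>A morphism of toposes to \<open>E\<close> factors through a subtopos of \<open>E\<close> iff its direct image functor takes
  values in it. Hence the image of \<open>E'\<^sub>1 \<rightarrow> E' \<rightarrow> E\<close> is the smallest subtopos of \<open>E\<close>
  containing all \<open>f\<^sub>* a\<close> with \<open>a\<close> in \<open>E'\<^sub>1\<close>.\<close>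

definition direct_image :: "('e, 'f) cat \<Rightarrow> ('e, 'f, 'd, 'k) geom \<Rightarrow> 'd set \<Rightarrow> 'e set" where
  "direct_image E f S' = (\<lambda>T. T \<in> ST E) hull (FO (dir_im f) ` S')"

definition is_inverse_image ::
    "('d, 'k) cat \<Rightarrow> ('e, 'f) cat \<Rightarrow> ('e, 'f, 'd, 'k) geom \<Rightarrow> 'e set \<Rightarrow> 'd set \<Rightarrow> bool" where
  "is_inverse_image E' E f S S' \<longleftrightarrow> S' \<in> ST E' \<and>
    (\<forall>T' \<in> ST E'. S' \<supseteq> T' \<longleftrightarrow> S \<supseteq> direct_image E f T')"

definition inverse_image ::
    "('d, 'k) cat \<Rightarrow> ('e, 'f) cat \<Rightarrow> ('e, 'f, 'd, 'k) geom \<Rightarrow> 'e set \<Rightarrow> 'd set" where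
  "inverse_image E' E f S = (THE S'. is_inverse_image E' E f S S')"

definition is_ext_direct_image ::
    "('d, 'k) cat \<Rightarrow> ('e, 'f) cat \<Rightarrow> ('e, 'f, 'd, 'k) geom \<Rightarrow> 'd set \<Rightarrow> 'e set \<Rightarrow> bool" where
  "is_ext_direct_image E' E f S' S \<longleftrightarrow> S \<in> ST E \<and>
    (\<forall>T \<in> ST E. S \<supseteq> T \<longleftrightarrow> S' \<supseteq> inverse_image E' E f T)"

definition ext_direct_image ::
    "('d, 'k) cat \<Rightarrow> ('e, 'f) cat \<Rightarrow> ('e, 'f, 'd, 'k) geom \<Rightarrow> 'd set \<Rightarrow> 'e set" where
  "ext_direct_image E' E f S' = (THE S. is_ext_direct_image E' E f S' S)"

section \<open>Size\<close>

text \<open>The role of the universe is played by a set \<open>U\<close> whose cardinality is infinite, regular and strong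
  limit; a set of any type is small if it has smaller cardinality than \<open>U\<close>. The category \<open>Set\<close> is
  modelled by the small subsets of \<open>U\<close> with all maps between them.\<close>

definition universe :: "'u set \<Rightarrow> bool" where
  "universe U \<longleftrightarrow> infinite U \<and> regularCard |U| \<and> (\<forall>A \<subseteq> U. |A| <o |U| \<longrightarrow> |Pow A| <o |U| )"

definition small :: "'u set \<Rightarrow> 'a set \<Rightarrow> bool" where
  "small U A \<longleftrightarrow> |A| <o |U|"

definition essentially_small :: "'u set \<Rightarrow> ('o, 'm) cat \<Rightarrow> bool" where
  "essentially_small U C \<longleftrightarrow>
    (\<forall>a \<in> Obj C. \<forall>b \<in> Obj C. small U (Hom C a b)) \<and>
    (\<exists>T \<subseteq> Obj C. small U T \<and> (\<forall>a \<in> Obj C. \<exists>b \<in> T. isomorphic C a b))"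

section \<open>Presheaves\<close>

record ('o, 'm, 'u) presheaf =
  val :: "'o \<Rightarrow> 'u set"
  act :: "'m \<Rightarrow> 'u \<Rightarrow> 'u"

text \<open>Presheaves and transformations are extensional (undefined outside the relevant carriers),
  so that equality in the logic is equality of functors and of transformations.\<close>

definition is_presheaf :: "'u set \<Rightarrow> ('o, 'm) cat \<Rightarrow> ('o, 'm, 'u) presheaf \<Rightarrow> bool" where
  "is_presheaf U C P \<longleftrightarrow>
    val P \<in> (\<Pi>\<^sub>E a \<in> Obj C. {A. A \<subseteq> U \<and> small U A}) \<and>
    act P \<in> (\<Pi>\<^sub>E f \<in> Arr C. val P (Cod C f) \<rightarrow>\<^sub>E val P (Dom C f)) \<and>
    (\<forall>a \<in> Obj C. \<forall>s \<in> val P a. act P (Ide C a) s = s) \<and>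
    (\<forall>f \<in> Arr C. \<forall>g \<in> Arr C. Cod C f = Dom C g \<longrightarrow>
      (\<forall>s \<in> val P (Cod C g). act P (g \<odot>\<^bsub>C\<^esub> f) s = act P f (act P g s)))"

record ('o, 'm, 'u) nattrans =
  src :: "('o, 'm, 'u) presheaf"
  tgt :: "('o, 'm, 'u) presheaf"
  cmpt :: "'o \<Rightarrow> 'u \<Rightarrow> 'u"

definition is_nattrans :: "'u set \<Rightarrow> ('o, 'm) cat \<Rightarrow> ('o, 'm, 'u) nattrans \<Rightarrow> bool" where
  "is_nattrans U C t \<longleftrightarrow> is_presheaf U C (src t) \<and> is_presheaf U C (tgt t) \<and>
    cmpt t \<in> (\<Pi>\<^sub>E a \<in> Obj C. val (src t) a \<rightarrow>\<^sub>E val (tgt t) a) \<and>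
    (\<forall>f \<in> Arr C. \<forall>s \<in> val (src t) (Cod C f).
      act (tgt t) f (cmpt t (Cod C f) s) = cmpt t (Dom C f) (act (src t) f s))"

definition Psh ::
    "'u set \<Rightarrow> ('o, 'm) cat \<Rightarrow> (('o, 'm, 'u) presheaf, ('o, 'm, 'u) nattrans) cat" where
  "Psh U C = \<lparr>
    Obj = {P. is_presheaf U C P},
    Arr = {t. is_nattrans U C t},
    Dom = src,
    Cod = tgt,
    Ide = (\<lambda>P. \<lparr>src = P, tgt = P, cmpt = (\<lambda>a \<in> Obj C. \<lambda>s \<in> val P a. s)\<rparr>),
    Cmp = (\<lambda>g f. \<lparr>src = src f, tgt = tgt g,
      cmpt = (\<lambda>a \<in> Obj C. \<lambda>s \<in> val (src f) a. cmpt g a (cmpt f a s))\<rparr>)\<rparr>"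

definition pullback_functor ::
    "('o, 'm) cat \<Rightarrow> ('o, 'm, 'b, 'n) cat_functor \<Rightarrow>
      (('b, 'n, 'u) presheaf, ('b, 'n, 'u) nattrans, ('o, 'm, 'u) presheaf, ('o, 'm, 'u) nattrans)
        cat_functor" where
  "pullback_functor C p =
    (let po = (\<lambda>P. \<lparr>val = (\<lambda>a \<in> Obj C. val P (FO p a)), act = (\<lambda>f \<in> Arr C. act P (FA p f))\<rparr>)
     in \<lparr>FO = po,
         FA = (\<lambda>t. \<lparr>src = po (src t), tgt = po (tgt t), cmpt = (\<lambda>a \<in> Obj C. cmpt t (FO p a))\<rparr>)\<rparr>)"

section \<open>Topologies and sheaves\<close>

definition is_sieve :: "('o, 'm) cat \<Rightarrow> 'o \<Rightarrow> 'm set \<Rightarrow> bool" where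
  "is_sieve C a S \<longleftrightarrow> a \<in> Obj C \<and> S \<subseteq> {f \<in> Arr C. Cod C f = a} \<and>
    (\<forall>f \<in> S. \<forall>g \<in> Arr C. Cod C g = Dom C f \<longrightarrow> f \<odot>\<^bsub>C\<^esub> g \<in> S)"

definition pullback_sieve :: "('o, 'm) cat \<Rightarrow> 'm \<Rightarrow> 'm set \<Rightarrow> 'm set" where
  "pullback_sieve C f S = {g \<in> Arr C. Cod C g = Dom C f \<and> f \<odot>\<^bsub>C\<^esub> g \<in> S}"

text \<open>A topology is the set of pairs of an object and a covering sieve on it.\<close>

definition is_topology :: "('o, 'm) cat \<Rightarrow> ('o \<times> 'm set) set \<Rightarrow> bool" where
  "is_topology C J \<longleftrightarrow>
    (\<forall>(a, S) \<in> J. is_sieve C a S) \<and>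
    (\<forall>a \<in> Obj C. (a, {f \<in> Arr C. Cod C f = a}) \<in> J) \<and>
    (\<forall>(a, S) \<in> J. \<forall>f \<in> Arr C. Cod C f = a \<longrightarrow> (Dom C f, pullback_sieve C f S) \<in> J) \<and>
    (\<forall>(a, S) \<in> J. \<forall>T. is_sieve C a T \<and> (\<forall>f \<in> S. (Dom C f, pullback_sieve C f T) \<in> J)
      \<longrightarrow> (a, T) \<in> J)"

definition generated_topology ::
    "('o, 'm) cat \<Rightarrow> ('o \<times> 'm set) set \<Rightarrow> ('o \<times> 'm set) set \<Rightarrow> ('o \<times> 'm set) set" where
  "generated_topology C J G = is_topology C hull (J \<union> G)"

definition matching_family ::
    "('o, 'm) cat \<Rightarrow> ('o, 'm, 'u) presheaf \<Rightarrow> 'm set \<Rightarrow> ('m \<Rightarrow> 'u) \<Rightarrow> bool" where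
  "matching_family C P S x \<longleftrightarrow>
    (\<forall>f \<in> S. x f \<in> val P (Dom C f)) \<and>
    (\<forall>f \<in> S. \<forall>g \<in> Arr C. Cod C g = Dom C f \<longrightarrow> act P g (x f) = x (f \<odot>\<^bsub>C\<^esub> g))"

definition sheaves ::
    "'u set \<Rightarrow> ('o, 'm) cat \<Rightarrow> ('o \<times> 'm set) set \<Rightarrow> ('o, 'm, 'u) presheaf set" where
  "sheaves U C J = {P. is_presheaf U C P \<and>
    (\<forall>(a, S) \<in> J. \<forall>x. matching_family C P S x \<longrightarrow>
      (\<exists>!s. s \<in> val P a \<and> (\<forall>f \<in> S. act P f s = x f)))}"

definition Sh ::
    "'u set \<Rightarrow> ('o, 'm) cat \<Rightarrow> ('o \<times> 'm set) set \<Rightarrow>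
      (('o, 'm, 'u) presheaf, ('o, 'm, 'u) nattrans) cat" where
  "Sh U C J = full_subcat (Psh U C) (sheaves U C J)"

section \<open>Fibrations and the Giraud topology\<close>

definition horizontal ::
    "('o, 'm) cat \<Rightarrow> ('b, 'n) cat \<Rightarrow> ('o, 'm, 'b, 'n) cat_functor \<Rightarrow> 'm \<Rightarrow> bool" where
  "horizontal C B p x \<longleftrightarrow> x \<in> Arr C \<and>
    (\<forall>x1 \<in> Arr C. Cod C x1 = Cod C x \<longrightarrow>
      (\<forall>b' \<in> Hom B (FO p (Dom C x1)) (FO p (Dom C x)). FA p x1 = FA p x \<odot>\<^bsub>B\<^esub> b' \<longrightarrow>
        (\<exists>!x'. x' \<in> Hom C (Dom C x1) (Dom C x) \<and> x1 = x \<odot>\<^bsub>C\<^esub> x' \<and> FA p x' = b')))"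

definition horizontal_lifting ::
    "('o, 'm) cat \<Rightarrow> ('b, 'n) cat \<Rightarrow> ('o, 'm, 'b, 'n) cat_functor \<Rightarrow> 'o \<Rightarrow> 'n \<Rightarrow> 'm \<Rightarrow> bool" where
  "horizontal_lifting C B p a b x \<longleftrightarrow> horizontal C B p x \<and> Cod C x = a \<and>
    (\<exists>i \<in> Hom B (FO p (Dom C x)) (Dom B b). is_iso B i \<and> b \<odot>\<^bsub>B\<^esub> i = FA p x)"

definition is_fibration ::
    "('o, 'm) cat \<Rightarrow> ('b, 'n) cat \<Rightarrow> ('o, 'm, 'b, 'n) cat_functor \<Rightarrow> bool" where
  "is_fibration C B p \<longleftrightarrow> is_functor C B p \<and>
    (\<forall>a \<in> Obj C. \<forall>b \<in> Arr B. Cod B b = FO p a \<longrightarrow> (\<exists>x. horizontal_lifting C B p a b x))"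

text \<open>The sieve \<open>S\<^sub>p\<close> on \<open>p a\<close> for a sieve \<open>S\<close> on \<open>a\<close>.\<close>

definition sieve_image ::
    "('o, 'm) cat \<Rightarrow> ('b, 'n) cat \<Rightarrow> ('o, 'm, 'b, 'n) cat_functor \<Rightarrow> 'o \<Rightarrow> 'm set \<Rightarrow> 'n set" where
  "sieve_image C B p a S =
    {b \<in> Arr B. Cod B b = FO p a \<and> (\<exists>x \<in> S. horizontal_lifting C B p a b x)}"

definition giraud_topology ::
    "('o, 'm) cat \<Rightarrow> ('b, 'n) cat \<Rightarrow> ('o, 'm, 'b, 'n) cat_functor \<Rightarrow> ('b \<times> 'n set) set \<Rightarrow>
      ('o \<times> 'm set) set" where
  "giraud_topology C B p J = {(a, S). is_sieve C a S \<and> (FO p a, sieve_image C B p a S) \<in> J}"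

end

theory Submission
  imports Defs
begin

text \<open>
  Subtoposes are translated into topologies, and the functor \<open>p\<close> into a map between topologies.

  The subtoposes of the topos of \<open>J\<close>-sheaves are the classes of \<open>K\<close>-sheaves for the topologies \<open>K \<supseteq> J\<close>
  (\<open>ST_Sh_iff\<close>), and inclusion of classes is reverse inclusion of topologies (\<open>topology_le_iff_sheaves\<close>). That
  \<open>K\<close>-sheaves form a subtopos is the existence and left exactness of sheafification (\<open>sheaves_ST\<close>). That all
  subtoposes arise in this way is proved for the largest topology for which the objects of a given subtopos are
  sheaves, by pulling back inverted monomorphisms to sieves (\<open>ST_Psh_sheaves\<close>). The comparison of topologies
  uses the sheaf of closed sieves as a test object.

  For a fibration, \<open>S\<^sub>p\<close> is the largest sieve on \<open>p a\<close> whose preimage is contained in the sieve \<open>S\<close> on \<open>a\<close>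
  (\<open>preimage_subset_iff\<close>). For a topology \<open>T\<close> of \<open>B\<close> let \<open>T'\<close> be the Giraud topology, for which \<open>S\<close> is covering iff \<open>S\<^sub>p\<close>
  is covering for \<open>T\<close>. The functor \<open>p\<^sup>*\<close> takes \<open>T\<close>-sheaves to \<open>T'\<close>-sheaves, and \<open>p\<^sub>*\<close> takes all \<open>L\<close>-sheaves to \<open>T\<close>-sheaves iff
  \<open>T' \<subseteq> L\<close> (\<open>direct_image_sheaves_iff\<close>). The latter means that the inverse image of the subtopos of \<open>T\<close> is the
  subtopos of \<open>T'\<close>. If \<open>L\<close> is generated over \<open>J'\<close> by sieves \<open>S\<close>, and \<open>K\<close> over \<open>J\<close> by the sieves \<open>S\<^sub>p\<close>, then \<open>L \<subseteq> T'\<close> iff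
  \<open>K \<subseteq> T\<close>, by definition of \<open>T'\<close>; hence the subtopos of \<open>K\<close> is the extraordinary direct image of the subtopos of \<open>L\<close>
  (\<open>sheaves_ext_direct_image\<close>). A map of ordered sets with adjoints on both sides preserves suprema and infima.

  The functor \<open>p\<^sup>*\<close> between sheaves has as left adjoint the left Kan extension followed by sheafification. Locally, an
  element over \<open>b\<close> of its value at \<open>X\<close> is represented by an arrow \<open>\<beta> : b \<rightarrow> p a\<close> and an element of \<open>X\<close> over \<open>a\<close>. Replacing \<open>a\<close> by the
  source of a horizontal lifting of \<open>\<beta>\<close>, one may take \<open>\<beta>\<close> to be an isomorphism, along which an element over \<open>b\<close>
  of a sheaf \<open>E2\<close> can be transported to \<open>p\<^sup>* E2\<close>. In this way representatives of elements of a fibre product on \<open>B\<close> lift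
  to the fibre product on \<open>C\<close>, essentially uniquely, and the left adjoint is compatible with these fibre
  products (\<open>projection_formula\<close>). Presheaf toposes are the case of the topology in which only the maximal sieves cover.
\<close>

section \<open>Small sets\<close>

lemma small_subset: "small U A \<Longrightarrow> B \<subseteq> A \<Longrightarrow> small U B"
  unfolding small_def using card_of_mono1 ordLeq_ordLess_trans by blast

lemma small_image: "small U A \<Longrightarrow> small U (f ` A)"
  unfolding small_def using card_of_image ordLeq_ordLess_trans by blast

lemma small_surj: "small U A \<Longrightarrow> B \<subseteq> f ` A \<Longrightarrow> small U B"
  using small_image small_subset by metis

lemma small_inj: "small U B \<Longrightarrow> inj_on f A \<Longrightarrow> f ` A \<subseteq> B \<Longrightarrow> small U A"
  unfolding small_def using card_of_ordLeq[of A B] ordLeq_ordLess_trans by blast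

lemma small_finite: "universe U \<Longrightarrow> finite A \<Longrightarrow> small U A"
  unfolding small_def universe_def using finite_ordLess_infinite[of "|A|" "|U|"]
  by (metis Field_card_of card_of_Well_order)

lemma small_embed:
  assumes "small U A"
  obtains e where "inj_on e A" "e ` A \<subseteq> U"
  using assms card_of_ordLeq[of A U] ordLess_imp_ordLeq unfolding small_def by blast

lemma small_Pow:
  assumes "universe U" "small U A" shows "small U (Pow A)"
proof -
  obtain e where e: "inj_on e A" "e ` A \<subseteq> U" using small_embed assms(2) by blast
  have "small U (e ` A)" using assms(2) small_image by blast
  then have "small U (Pow (e ` A))" using assms(1) e(2) unfolding universe_def small_def by blast
  then show ?thesis
    by (rule small_inj[where f="image e"]) (use e in \<open>auto intro: inj_on_image_Pow\<close>)
qed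

lemma small_Sigma:
  assumes "universe U" "small U A" "\<And>a. a \<in> A \<Longrightarrow> small U (F a)"
  shows "small U (Sigma A F)"
proof -
  have "stable |U|"
    using assms(1) unfolding universe_def by (intro regularCard_stable) (auto simp: Field_card_of card_of_card_order_on)
  then show ?thesis using stable_elim assms(2,3) unfolding small_def by blast
qed

lemma small_UN:
  assumes "universe U" "small U A" "\<And>a. a \<in> A \<Longrightarrow> small U (F a)"
  shows "small U (\<Union>a\<in>A. F a)"
  by (rule small_surj[OF small_Sigma[OF assms], where f=snd]) (auto simp: image_iff)

section \<open>Categories and adjunctions\<close>

lemma HomI: "f \<in> Arr C \<Longrightarrow> Dom C f = a \<Longrightarrow> Cod C f = b \<Longrightarrow> f \<in> Hom C a b"
  by (simp add: Hom_def)

lemma HomD: "f \<in> Hom C a b \<Longrightarrow> f \<in> Arr C" "f \<in> Hom C a b \<Longrightarrow> Dom C f = a"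
    "f \<in> Hom C a b \<Longrightarrow> Cod C f = b"
  by (auto simp: Hom_def)

context category
begin

lemma Arr_Hom: "f \<in> Arr C \<Longrightarrow> f \<in> Hom C (Dom C f) (Cod C f)"
  by (simp add: Hom_def)

lemma comp_Arr [simp]:
  assumes "f \<in> Arr C" "g \<in> Arr C" "Cod C f = Dom C g"
  shows "g \<odot> f \<in> Arr C" "Dom C (g \<odot> f) = Dom C f" "Cod C (g \<odot> f) = Cod C g"
  using Cmp_in[of f "Dom C f" "Cod C f" g "Cod C g"] assms by (auto simp: Hom_def)

lemma comp_assoc [simp]:
  assumes "f \<in> Arr C" "g \<in> Arr C" "h \<in> Arr C" "Cod C f = Dom C g" "Cod C g = Dom C h"
  shows "(h \<odot> g) \<odot> f = h \<odot> (g \<odot> f)"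
  using Cmp_assoc[of f "Dom C f" "Cod C f" g "Cod C g" h "Cod C h"] assms by (auto simp: Hom_def)

lemma Ide_Arr [simp]:
  assumes "a \<in> Obj C" shows "Ide C a \<in> Arr C" "Dom C (Ide C a) = a" "Cod C (Ide C a) = a"
  using Ide_in[OF assms] by (auto simp: Hom_def)

lemma comp_Ide [simp]:
  assumes "f \<in> Arr C"
  shows "Ide C (Cod C f) \<odot> f = f" "f \<odot> Ide C (Dom C f) = f"
  using Ide_left Ide_right Arr_Hom[OF assms] by auto

lemma Dom_Obj [simp]: "f \<in> Arr C \<Longrightarrow> Dom C f \<in> Obj C"
  and Cod_Obj [simp]: "f \<in> Arr C \<Longrightarrow> Cod C f \<in> Obj C"
  using Dom_in Cod_in by auto

lemma Hom_Obj: "f \<in> Hom C a b \<Longrightarrow> a \<in> Obj C" "f \<in> Hom C a b \<Longrightarrow> b \<in> Obj C"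
  by (auto simp: Hom_def)

lemma is_isoI:
  assumes "f \<in> Hom C a b" "g \<in> Hom C b a" "g \<odot> f = Ide C a" "f \<odot> g = Ide C b"
  shows "is_iso C f"
  using assms unfolding is_iso_def by (auto simp: Hom_def)

lemma is_isoE:
  assumes "is_iso C f" "f \<in> Hom C a b"
  obtains g where "g \<in> Hom C b a" "g \<odot> f = Ide C a" "f \<odot> g = Ide C b"
  using assms unfolding is_iso_def by (auto simp: Hom_def)

end

lemma functor_Obj: "is_functor C B F \<Longrightarrow> a \<in> Obj C \<Longrightarrow> FO F a \<in> Obj B"
  by (simp add: is_functor_def)

lemma functor_Hom: "is_functor C B F \<Longrightarrow> f \<in> Hom C a b \<Longrightarrow> FA F f \<in> Hom B (FO F a) (FO F b)"
  by (auto simp: is_functor_def Hom_def)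

lemma functor_Ide: "is_functor C B F \<Longrightarrow> a \<in> Obj C \<Longrightarrow> FA F (Ide C a) = Ide B (FO F a)"
  by (simp add: is_functor_def)

lemma functor_comp: "is_functor C B F \<Longrightarrow> f \<in> Hom C a b \<Longrightarrow> g \<in> Hom C b c \<Longrightarrow>
    FA F (g \<odot>\<^bsub>C\<^esub> f) = FA F g \<odot>\<^bsub>B\<^esub> FA F f"
  by (auto simp: is_functor_def Hom_def)

lemma functor_Arr [simp]:
  assumes "is_functor C B F" "f \<in> Arr C"
  shows "FA F f \<in> Arr B" "Dom B (FA F f) = FO F (Dom C f)" "Cod B (FA F f) = FO F (Cod C f)"
  using assms by (auto simp: is_functor_def Hom_def)

lemma adjunction_left_universal:
  assumes "category D" "category E" and adj: "adjunction D E L R \<eta> \<epsilon>"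
    and a: "a \<in> Obj D" and b: "b \<in> Obj E" and h: "h \<in> Hom D a (FO R b)"
  shows "\<exists>!k. k \<in> Hom E (FO L a) b \<and> FA R k \<odot>\<^bsub>D\<^esub> \<eta> a = h"
proof -
  interpret D: category D by fact
  interpret E: category E by fact
  have L: "is_functor D E L" and R: "is_functor E D R"
    and eta: "\<And>a. a \<in> Obj D \<Longrightarrow> \<eta> a \<in> Hom D a (FO R (FO L a))"
    and etan: "\<And>f. f \<in> Arr D \<Longrightarrow> FA R (FA L f) \<odot>\<^bsub>D\<^esub> \<eta> (Dom D f) = \<eta> (Cod D f) \<odot>\<^bsub>D\<^esub> f"
    and eps: "\<And>b. b \<in> Obj E \<Longrightarrow> \<epsilon> b \<in> Hom E (FO L (FO R b)) b"
    and epsn: "\<And>f. f \<in> Arr E \<Longrightarrow> f \<odot>\<^bsub>E\<^esub> \<epsilon> (Dom E f) = \<epsilon> (Cod E f) \<odot>\<^bsub>E\<^esub> FA L (FA R f)"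
    and t1: "\<And>a. a \<in> Obj D \<Longrightarrow> \<epsilon> (FO L a) \<odot>\<^bsub>E\<^esub> FA L (\<eta> a) = Ide E (FO L a)"
    and t2: "\<And>b. b \<in> Obj E \<Longrightarrow> FA R (\<epsilon> b) \<odot>\<^bsub>D\<^esub> \<eta> (FO R b) = Ide D (FO R b)"
    using adj by (auto simp: adjunction_def natural_def id_functor_def comp_functor_def)
  show ?thesis
  proof (rule ex1I[where a="\<epsilon> b \<odot>\<^bsub>E\<^esub> FA L h"])
    have Lh: "FA L h \<in> Hom E (FO L a) (FO L (FO R b))" by (rule functor_Hom[OF L h])
    have "FA R (\<epsilon> b \<odot>\<^bsub>E\<^esub> FA L h) \<odot>\<^bsub>D\<^esub> \<eta> a = FA R (\<epsilon> b) \<odot>\<^bsub>D\<^esub> (FA R (FA L h) \<odot>\<^bsub>D\<^esub> \<eta> a)"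
      using functor_comp[OF R Lh eps[OF b]]
        D.Cmp_assoc[OF eta[OF a] functor_Hom[OF R Lh] functor_Hom[OF R eps[OF b]]] by simp
    also have "\<dots> = FA R (\<epsilon> b) \<odot>\<^bsub>D\<^esub> (\<eta> (FO R b) \<odot>\<^bsub>D\<^esub> h)"
      using etan[of h] h by (simp add: Hom_def)
    also have "\<dots> = h"
      using D.Cmp_assoc[OF h eta[OF functor_Obj[OF R b]] functor_Hom[OF R eps[OF b]]] t2[OF b] D.Ide_left[OF h]
      by simp
    finally show "\<epsilon> b \<odot>\<^bsub>E\<^esub> FA L h \<in> Hom E (FO L a) b \<and> FA R (\<epsilon> b \<odot>\<^bsub>E\<^esub> FA L h) \<odot>\<^bsub>D\<^esub> \<eta> a = h"
      using E.Cmp_in[OF Lh eps[OF b]] by simp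
  next
    fix k assume k: "k \<in> Hom E (FO L a) b \<and> FA R k \<odot>\<^bsub>D\<^esub> \<eta> a = h"
    then have kk: "k \<in> Hom E (FO L a) b" by simp
    have "\<epsilon> b \<odot>\<^bsub>E\<^esub> FA L h = \<epsilon> b \<odot>\<^bsub>E\<^esub> (FA L (FA R k) \<odot>\<^bsub>E\<^esub> FA L (\<eta> a))"
      using functor_comp[OF L eta[OF a] functor_Hom[OF R kk]] k by auto
    also have "\<dots> = (\<epsilon> b \<odot>\<^bsub>E\<^esub> FA L (FA R k)) \<odot>\<^bsub>E\<^esub> FA L (\<eta> a)"
      using E.Cmp_assoc[OF functor_Hom[OF L eta[OF a]] functor_Hom[OF L functor_Hom[OF R kk]] eps[OF b]] by simp
    also have "\<dots> = (k \<odot>\<^bsub>E\<^esub> \<epsilon> (FO L a)) \<odot>\<^bsub>E\<^esub> FA L (\<eta> a)"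
      using epsn[of k] kk by (simp add: Hom_def)
    also have "\<dots> = k"
      using E.Cmp_assoc[OF functor_Hom[OF L eta[OF a]] eps[OF functor_Obj[OF L a]] kk] t1[OF a] E.Ide_right[OF kk] by simp
    finally show "k = \<epsilon> b \<odot>\<^bsub>E\<^esub> FA L h" by simp
  qed
qed

text \<open>The counit is the transpose of the identity, and the triangle identities are instances of
  uniqueness of transposes.\<close>

lemma natural_universal_arrows_adjunction:
  assumes "category D" "category E" and L: "is_functor D E L" and R: "is_functor E D R"
    and eta: "natural D D id_functor (comp_functor R L) \<eta>"
    and univ: "\<And>a b h. a \<in> Obj D \<Longrightarrow> b \<in> Obj E \<Longrightarrow> h \<in> Hom D a (FO R b) \<Longrightarrow>
      \<exists>!k. k \<in> Hom E (FO L a) b \<and> FA R k \<odot>\<^bsub>D\<^esub> \<eta> a = h"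
  shows "\<exists>\<epsilon>. adjunction D E L R \<eta> \<epsilon>"
proof -
  interpret D: category D by fact
  interpret E: category E by fact
  define \<epsilon> where "\<epsilon> b = (THE k. k \<in> Hom E (FO L (FO R b)) b \<and> FA R k \<odot>\<^bsub>D\<^esub> \<eta> (FO R b) = Ide D (FO R b))" for b
  have eps: "\<epsilon> b \<in> Hom E (FO L (FO R b)) b \<and> FA R (\<epsilon> b) \<odot>\<^bsub>D\<^esub> \<eta> (FO R b) = Ide D (FO R b)"
    if b: "b \<in> Obj E" for b
    unfolding \<epsilon>_def using theI'[OF univ[OF functor_Obj[OF R b] b D.Ide_in[OF functor_Obj[OF R b]]]] .
  then have eps1: "\<And>b. b \<in> Obj E \<Longrightarrow> \<epsilon> b \<in> Hom E (FO L (FO R b)) b"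
    and eps2: "\<And>b. b \<in> Obj E \<Longrightarrow> FA R (\<epsilon> b) \<odot>\<^bsub>D\<^esub> \<eta> (FO R b) = Ide D (FO R b)" by auto
  have eta1: "\<And>a. a \<in> Obj D \<Longrightarrow> \<eta> a \<in> Hom D a (FO R (FO L a))"
    and etan: "\<And>f a b. f \<in> Hom D a b \<Longrightarrow> FA R (FA L f) \<odot>\<^bsub>D\<^esub> \<eta> a = \<eta> b \<odot>\<^bsub>D\<^esub> f"
    using eta by (auto simp: natural_def id_functor_def comp_functor_def Hom_def)
  have uniq: "k = k'" if "a \<in> Obj D" "k \<in> Hom E (FO L a) b" "k' \<in> Hom E (FO L a) b"
    "FA R k \<odot>\<^bsub>D\<^esub> \<eta> a = FA R k' \<odot>\<^bsub>D\<^esub> \<eta> a" for a b k k'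
  proof -
    have b: "b \<in> Obj E" using E.Hom_Obj that by blast
    have "FA R k \<odot>\<^bsub>D\<^esub> \<eta> a \<in> Hom D a (FO R b)"
      using D.Cmp_in[OF eta1[OF that(1)] functor_Hom[OF R that(2)]] .
    from univ[OF that(1) b this] that show ?thesis by metis
  qed
  have "natural E E (comp_functor L R) id_functor \<epsilon>"
    unfolding natural_def comp_functor_def id_functor_def
  proof (simp add: eps1, intro ballI)
    fix f assume f: "f \<in> Arr E"
    let ?a = "Dom E f" and ?b = "Cod E f"
    have ff: "f \<in> Hom E ?a ?b" and a: "?a \<in> Obj E" and b: "?b \<in> Obj E" using f by (auto simp: Hom_def)
    have Rf: "FA R f \<in> Hom D (FO R ?a) (FO R ?b)" using functor_Hom[OF R ff] .
    have LRf: "FA L (FA R f) \<in> Hom E (FO L (FO R ?a)) (FO L (FO R ?b))" using functor_Hom[OF L Rf] .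
    show "f \<odot>\<^bsub>E\<^esub> \<epsilon> ?a = \<epsilon> ?b \<odot>\<^bsub>E\<^esub> FA L (FA R f)"
    proof (rule uniq[of "FO R ?a" _ ?b])
      have "FA R (f \<odot>\<^bsub>E\<^esub> \<epsilon> ?a) \<odot>\<^bsub>D\<^esub> \<eta> (FO R ?a) = FA R f \<odot>\<^bsub>D\<^esub> (FA R (\<epsilon> ?a) \<odot>\<^bsub>D\<^esub> \<eta> (FO R ?a))"
        using functor_comp[OF R eps1[OF a] ff]
          D.Cmp_assoc[OF eta1[OF functor_Obj[OF R a]] functor_Hom[OF R eps1[OF a]] Rf] by simp
      also have "\<dots> = FA R f" using eps2[OF a] D.Ide_right[OF Rf] by simp
      also have "\<dots> = FA R (\<epsilon> ?b) \<odot>\<^bsub>D\<^esub> \<eta> (FO R ?b) \<odot>\<^bsub>D\<^esub> FA R f" using eps2[OF b] D.Ide_left[OF Rf] by simp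
      also have "\<dots> = FA R (\<epsilon> ?b) \<odot>\<^bsub>D\<^esub> (FA R (FA L (FA R f)) \<odot>\<^bsub>D\<^esub> \<eta> (FO R ?a))"
        using etan[OF Rf] D.Cmp_assoc[OF Rf eta1[OF functor_Obj[OF R b]] functor_Hom[OF R eps1[OF b]]] by simp
      also have "\<dots> = FA R (\<epsilon> ?b \<odot>\<^bsub>E\<^esub> FA L (FA R f)) \<odot>\<^bsub>D\<^esub> \<eta> (FO R ?a)"
        using functor_comp[OF R LRf eps1[OF b]]
          D.Cmp_assoc[OF eta1[OF functor_Obj[OF R a]] functor_Hom[OF R LRf] functor_Hom[OF R eps1[OF b]]] by simp
      finally show "FA R (f \<odot>\<^bsub>E\<^esub> \<epsilon> ?a) \<odot>\<^bsub>D\<^esub> \<eta> (FO R ?a) = FA R (\<epsilon> ?b \<odot>\<^bsub>E\<^esub> FA L (FA R f)) \<odot>\<^bsub>D\<^esub> \<eta> (FO R ?a)" .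
    qed (use functor_Obj[OF R a] E.Cmp_in[OF eps1[OF a] ff] E.Cmp_in[OF LRf eps1[OF b]] in auto)
  qed
  moreover have "\<epsilon> (FO L a) \<odot>\<^bsub>E\<^esub> FA L (\<eta> a) = Ide E (FO L a)" if a: "a \<in> Obj D" for a
  proof (rule uniq[OF a])
    have La: "FO L a \<in> Obj E" using functor_Obj[OF L a] .
    have Le: "FA L (\<eta> a) \<in> Hom E (FO L a) (FO L (FO R (FO L a)))" using functor_Hom[OF L eta1[OF a]] .
    have "FA R (\<epsilon> (FO L a) \<odot>\<^bsub>E\<^esub> FA L (\<eta> a)) \<odot>\<^bsub>D\<^esub> \<eta> a
        = FA R (\<epsilon> (FO L a)) \<odot>\<^bsub>D\<^esub> (\<eta> (FO R (FO L a)) \<odot>\<^bsub>D\<^esub> \<eta> a)"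
      using functor_comp[OF R Le eps1[OF La]] etan[OF eta1[OF a]]
          D.Cmp_assoc[OF eta1[OF a] functor_Hom[OF R Le] functor_Hom[OF R eps1[OF La]]] by simp
    also have "\<dots> = FA R (Ide E (FO L a)) \<odot>\<^bsub>D\<^esub> \<eta> a"
      using D.Cmp_assoc[OF eta1[OF a] eta1[OF functor_Obj[OF R La]] functor_Hom[OF R eps1[OF La]]]
        eps2[OF La] functor_Ide[OF R La] by simp
    finally show "FA R (\<epsilon> (FO L a) \<odot>\<^bsub>E\<^esub> FA L (\<eta> a)) \<odot>\<^bsub>D\<^esub> \<eta> a = FA R (Ide E (FO L a)) \<odot>\<^bsub>D\<^esub> \<eta> a" .
    show "\<epsilon> (FO L a) \<odot>\<^bsub>E\<^esub> FA L (\<eta> a) \<in> Hom E (FO L a) (FO L a)"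
      using E.Cmp_in[OF Le eps1[OF La]] .
    show "Ide E (FO L a) \<in> Hom E (FO L a) (FO L a)" using E.Ide_in[OF La] .
  qed
  ultimately have "adjunction D E L R \<eta> \<epsilon>"
    unfolding adjunction_def using L R eta eps2 by blast
  then show ?thesis by blast
qed

text \<open>A universal arrow for each object suffices: the action of the left adjoint on arrows is forced by
  uniqueness, and so is its functoriality.\<close>

lemma universal_arrows_left_adjoint:
  assumes "category D" "category E" and R: "is_functor E D R"
    and F: "\<And>a. a \<in> Obj D \<Longrightarrow> F a \<in> Obj E"
    and eta: "\<And>a. a \<in> Obj D \<Longrightarrow> \<eta> a \<in> Hom D a (FO R (F a))"
    and univ: "\<And>a b h. a \<in> Obj D \<Longrightarrow> b \<in> Obj E \<Longrightarrow> h \<in> Hom D a (FO R b) \<Longrightarrow>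
      \<exists>!k. k \<in> Hom E (F a) b \<and> FA R k \<odot>\<^bsub>D\<^esub> \<eta> a = h"
  shows "\<exists>L \<epsilon>. FO L = F \<and> adjunction D E L R \<eta> \<epsilon>"
proof -
  interpret D: category D by fact
  interpret E: category E by fact
  have eta2: "\<eta> b \<odot>\<^bsub>D\<^esub> f \<in> Hom D a (FO R (F b))" if "f \<in> Hom D a b" for f a b
    using D.Cmp_in[OF that eta[OF D.Hom_Obj(2)[OF that]]] .
  define L where "L = \<lparr>FO = F, FA = (\<lambda>f. THE k. k \<in> Hom E (F (Dom D f)) (F (Cod D f)) \<and>
      FA R k \<odot>\<^bsub>D\<^esub> \<eta> (Dom D f) = \<eta> (Cod D f) \<odot>\<^bsub>D\<^esub> f)\<rparr>"
  have FOL: "FO L = F" by (simp add: L_def)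
  have Lf: "FA L f \<in> Hom E (F a) (F b) \<and> FA R (FA L f) \<odot>\<^bsub>D\<^esub> \<eta> a = \<eta> b \<odot>\<^bsub>D\<^esub> f"
    if f: "f \<in> Hom D a b" for f a b
    using theI'[OF univ[OF _ _ eta2[OF f]]] D.Hom_Obj[OF f] F f by (simp add: L_def Hom_def)
  have uniq: "k = k'" if "a \<in> Obj D" "k \<in> Hom E (F a) b" "k' \<in> Hom E (F a) b"
    "FA R k \<odot>\<^bsub>D\<^esub> \<eta> a = FA R k' \<odot>\<^bsub>D\<^esub> \<eta> a" for a b k k'
  proof -
    have b: "b \<in> Obj E" using E.Hom_Obj that by blast
    have "FA R k \<odot>\<^bsub>D\<^esub> \<eta> a \<in> Hom D a (FO R b)"
      using D.Cmp_in[OF eta[OF that(1)] functor_Hom[OF R that(2)]] .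
    from univ[OF that(1) b this] that show ?thesis by metis
  qed
  have "is_functor D E L"
    unfolding is_functor_def FOL
  proof (intro conjI ballI impI)
    fix f assume "f \<in> Arr D"
    then show "FA L f \<in> Hom E (F (Dom D f)) (F (Cod D f))" using Lf by (simp add: Hom_def)
  next
    fix a assume a: "a \<in> Obj D"
    show "FA L (Ide D a) = Ide E (F a)"
    proof (rule uniq[OF a])
      show "FA L (Ide D a) \<in> Hom E (F a) (F a)" using Lf D.Ide_in[OF a] by blast
      show "Ide E (F a) \<in> Hom E (F a) (F a)" using E.Ide_in[OF F[OF a]] .
      show "FA R (FA L (Ide D a)) \<odot>\<^bsub>D\<^esub> \<eta> a = FA R (Ide E (F a)) \<odot>\<^bsub>D\<^esub> \<eta> a"
        using Lf[OF D.Ide_in[OF a]] functor_Ide[OF R F[OF a]] D.Ide_left[OF eta[OF a]] D.Ide_right[OF eta[OF a]]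
        by simp
    qed
  next
    fix f g assume fg: "f \<in> Arr D" "g \<in> Arr D" "Cod D f = Dom D g"
    let ?a = "Dom D f" and ?b = "Cod D f" and ?c = "Cod D g"
    have f: "f \<in> Hom D ?a ?b" and g: "g \<in> Hom D ?b ?c" using fg by (auto simp: Hom_def)
    have gf: "g \<odot>\<^bsub>D\<^esub> f \<in> Hom D ?a ?c" using D.Cmp_in[OF f g] .
    note Lf1 = Lf[OF f, THEN conjunct1] Lf[OF g, THEN conjunct1]
    note Lf2 = Lf[OF f, THEN conjunct2] Lf[OF g, THEN conjunct2]
    have a: "?a \<in> Obj D" "?b \<in> Obj D" "?c \<in> Obj D" using fg by auto
    show "FA L (g \<odot>\<^bsub>D\<^esub> f) = FA L g \<odot>\<^bsub>E\<^esub> FA L f"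
    proof (rule uniq[OF a(1)])
      show "FA L (g \<odot>\<^bsub>D\<^esub> f) \<in> Hom E (F ?a) (F ?c)" using Lf[OF gf] by simp
      show "FA L g \<odot>\<^bsub>E\<^esub> FA L f \<in> Hom E (F ?a) (F ?c)" using E.Cmp_in[OF Lf1] .
      have "FA R (FA L g \<odot>\<^bsub>E\<^esub> FA L f) \<odot>\<^bsub>D\<^esub> \<eta> ?a = FA R (FA L g) \<odot>\<^bsub>D\<^esub> (FA R (FA L f) \<odot>\<^bsub>D\<^esub> \<eta> ?a)"
        using functor_comp[OF R Lf1] D.Cmp_assoc[OF eta[OF a(1)] functor_Hom[OF R Lf1(1)] functor_Hom[OF R Lf1(2)]]
        by simp
      also have "\<dots> = (FA R (FA L g) \<odot>\<^bsub>D\<^esub> \<eta> ?b) \<odot>\<^bsub>D\<^esub> f"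
        using Lf2(1) D.Cmp_assoc[OF f eta[OF a(2)] functor_Hom[OF R Lf1(2)]] by simp
      also have "\<dots> = \<eta> ?c \<odot>\<^bsub>D\<^esub> (g \<odot>\<^bsub>D\<^esub> f)"
        using Lf2(2) D.Cmp_assoc[OF f g eta[OF a(3)]] by simp
      finally show "FA R (FA L (g \<odot>\<^bsub>D\<^esub> f)) \<odot>\<^bsub>D\<^esub> \<eta> ?a = FA R (FA L g \<odot>\<^bsub>E\<^esub> FA L f) \<odot>\<^bsub>D\<^esub> \<eta> ?a"
        using Lf[OF gf] by simp
    qed
  qed (use F in auto)
  moreover have "natural D D id_functor (comp_functor R L) \<eta>"
    using eta Lf by (auto simp: natural_def id_functor_def comp_functor_def FOL Hom_def)
  ultimately have "\<exists>\<epsilon>. adjunction D E L R \<eta> \<epsilon>"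
    by (intro natural_universal_arrows_adjunction[OF assms(1,2) _ R]) (auto simp: FOL univ)
  then show ?thesis using FOL by blast
qed

section \<open>Duality\<close>

text \<open>Opposite categories serve to read the statements on left adjoints as statements on right adjoints.\<close>

definition op_cat :: "('o, 'm) cat \<Rightarrow> ('o, 'm) cat" where
  "op_cat C = \<lparr>Obj = Obj C, Arr = Arr C, Dom = Cod C, Cod = Dom C, Ide = Ide C, Cmp = (\<lambda>g f. Cmp C f g)\<rparr>"

lemma op_cat_simps [simp]:
  "Obj (op_cat C) = Obj C" "Arr (op_cat C) = Arr C" "Dom (op_cat C) = Cod C" "Cod (op_cat C) = Dom C"
  "Ide (op_cat C) = Ide C" "Cmp (op_cat C) g f = Cmp C f g"
  by (auto simp: op_cat_def)

lemma Hom_op [simp]: "Hom (op_cat C) a b = Hom C b a"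
  by (auto simp: Hom_def)

lemma category_op: "category C \<Longrightarrow> category (op_cat C)"
  by (rule category.intro) (auto simp: category.Dom_in category.Cod_in category.Ide_in category.Cmp_in
      category.Ide_left category.Ide_right category.Cmp_assoc)

lemma is_functor_op [simp]: "is_functor (op_cat C) (op_cat B) F \<longleftrightarrow> is_functor C B F"
  by (auto simp: is_functor_def)

lemma adjunction_op: "adjunction (op_cat E) (op_cat D) R L \<epsilon> \<eta> \<longleftrightarrow> adjunction D E L R \<eta> \<epsilon>"
  unfolding adjunction_def natural_def is_functor_op
  by (auto simp: id_functor_def comp_functor_def)

lemma adjunction_right_universal:
  assumes "category D" "category E" and adj: "adjunction D E L R \<eta> \<epsilon>"
    and "a \<in> Obj D" and "b \<in> Obj E" and "h \<in> Hom E (FO L a) b"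
  shows "\<exists>!k. k \<in> Hom D a (FO R b) \<and> \<epsilon> b \<odot>\<^bsub>E\<^esub> FA L k = h"
  using adjunction_left_universal[OF category_op[OF assms(2)] category_op[OF assms(1)], of R L \<epsilon> \<eta> b a h] assms
  by (simp add: adjunction_op)

lemma universal_arrows_right_adjoint:
  assumes "category D" "category E" and "is_functor D E L"
    and "\<And>b. b \<in> Obj E \<Longrightarrow> G b \<in> Obj D"
    and "\<And>b. b \<in> Obj E \<Longrightarrow> \<epsilon> b \<in> Hom E (FO L (G b)) b"
    and univ: "\<And>a b h. a \<in> Obj D \<Longrightarrow> b \<in> Obj E \<Longrightarrow> h \<in> Hom E (FO L a) b \<Longrightarrow>
      \<exists>!k. k \<in> Hom D a (G b) \<and> \<epsilon> b \<odot>\<^bsub>E\<^esub> FA L k = h"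
  shows "\<exists>R \<eta>. FO R = G \<and> adjunction D E L R \<eta> \<epsilon>"
  using universal_arrows_left_adjoint[OF category_op[OF assms(2)] category_op[OF assms(1)], of L G \<epsilon>] assms
  by (auto simp: adjunction_op)

text \<open>This reduces statements on an arbitrary direct image functor, up to isomorphism of its values, to
  the one given by the explicit right Kan extension.\<close>

lemma right_adjoint_unique:
  assumes D: "category D" and E: "category E"
    and adj: "adjunction D E L R \<eta> \<epsilon>" and adj': "adjunction D E L R' \<eta>' \<epsilon>'"
    and b: "b \<in> Obj E"
  shows "isomorphic D (FO R b) (FO R' b)"
proof -
  interpret D: category D by fact
  interpret E: category E by fact
  have L: "is_functor D E L" and R: "is_functor E D R" and R': "is_functor E D R'"
    using adj adj' by (auto simp: adjunction_def)
  have eps: "\<epsilon> b \<in> Hom E (FO L (FO R b)) b" "\<epsilon>' b \<in> Hom E (FO L (FO R' b)) b"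
    using adj adj' b by (auto simp: adjunction_def natural_def id_functor_def comp_functor_def)
  have o: "FO R b \<in> Obj D" "FO R' b \<in> Obj D" using functor_Obj[OF R b] functor_Obj[OF R' b] by auto
  obtain f where f: "f \<in> Hom D (FO R b) (FO R' b)" "\<epsilon>' b \<odot>\<^bsub>E\<^esub> FA L f = \<epsilon> b"
    using adjunction_right_universal[OF D E adj' o(1) b eps(1)] by blast
  obtain g where g: "g \<in> Hom D (FO R' b) (FO R b)" "\<epsilon> b \<odot>\<^bsub>E\<^esub> FA L g = \<epsilon>' b"
    using adjunction_right_universal[OF D E adj o(2) b eps(2)] by blast
  have 1: "\<epsilon> b \<odot>\<^bsub>E\<^esub> FA L (g \<odot>\<^bsub>D\<^esub> f) = \<epsilon> b"
    using functor_comp[OF L f(1) g(1)] f(2) g(2)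
      E.Cmp_assoc[OF functor_Hom[OF L f(1)] functor_Hom[OF L g(1)] eps(1)] by simp
  have 2: "\<epsilon>' b \<odot>\<^bsub>E\<^esub> FA L (f \<odot>\<^bsub>D\<^esub> g) = \<epsilon>' b"
    using functor_comp[OF L g(1) f(1)] f(2) g(2)
      E.Cmp_assoc[OF functor_Hom[OF L g(1)] functor_Hom[OF L f(1)] eps(2)] by simp
  have "g \<odot>\<^bsub>D\<^esub> f = Ide D (FO R b)"
    using adjunction_right_universal[OF D E adj o(1) b eps(1)] 1 D.Cmp_in[OF f(1) g(1)] D.Ide_in[OF o(1)]
      functor_Ide[OF L o(1)] E.Ide_right[OF eps(1)] by metis
  moreover have "f \<odot>\<^bsub>D\<^esub> g = Ide D (FO R' b)"
    using adjunction_right_universal[OF D E adj' o(2) b eps(2)] 2 D.Cmp_in[OF g(1) f(1)] D.Ide_in[OF o(2)]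
      functor_Ide[OF L o(2)] E.Ide_right[OF eps(2)] by metis
  ultimately show ?thesis
    unfolding isomorphic_def using D.is_isoI[OF f(1) g(1)] f(1) by blast
qed

section \<open>Full subcategories, pullbacks\<close>

lemma full_subcat_simps [simp]:
  "Obj (full_subcat C S) = Obj C \<inter> S" "Dom (full_subcat C S) = Dom C" "Cod (full_subcat C S) = Cod C"
  "Ide (full_subcat C S) = Ide C" "Cmp (full_subcat C S) = Cmp C"
  "Arr (full_subcat C S) = {f \<in> Arr C. Dom C f \<in> S \<and> Cod C f \<in> S}"
  by (auto simp: full_subcat_def)

lemma Hom_full_subcat: "f \<in> Hom (full_subcat C S) a b \<longleftrightarrow> f \<in> Hom C a b \<and> a \<in> S \<and> b \<in> S"
  by (auto simp: Hom_def)

lemma category_full_subcat: "category C \<Longrightarrow> category (full_subcat C S)"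
  by (rule category.intro) (auto simp: Hom_full_subcat category.Dom_in category.Cod_in category.Ide_in
      category.Cmp_in category.Ide_left category.Ide_right category.Cmp_assoc)

lemma full_subcat_full_subcat: "T \<subseteq> S \<Longrightarrow> full_subcat (full_subcat C S) T = full_subcat C T"
  unfolding full_subcat_def by (intro cat.equality) auto

lemma full_subcat_Obj:
  assumes "category C" "Obj C \<subseteq> S" shows "full_subcat C S = C"
proof -
  have "Obj C \<inter> S = Obj C" "{f \<in> Arr C. Dom C f \<in> S \<and> Cod C f \<in> S} = Arr C"
    using assms category.Dom_in[OF assms(1)] category.Cod_in[OF assms(1)] by auto
  then show ?thesis by (simp add: full_subcat_def)
qed

lemma pullback_unique_up_to_iso:
  assumes "category C" and P: "is_pullback C f g P p q" and P': "is_pullback C f g P' p' q'"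
  shows "\<exists>m \<in> Hom C P P'. \<exists>n \<in> Hom C P' P. n \<odot>\<^bsub>C\<^esub> m = Ide C P \<and> m \<odot>\<^bsub>C\<^esub> n = Ide C P' \<and>
    p' \<odot>\<^bsub>C\<^esub> m = p \<and> q' \<odot>\<^bsub>C\<^esub> m = q"
proof -
  interpret C: category C by fact
  have u: "\<And>a x y. a \<in> Obj C \<Longrightarrow> x \<in> Hom C a (Dom C f) \<Longrightarrow> y \<in> Hom C a (Dom C g) \<Longrightarrow> f \<odot>\<^bsub>C\<^esub> x = g \<odot>\<^bsub>C\<^esub> y \<Longrightarrow>
     \<exists>!m. m \<in> Hom C a P \<and> p \<odot>\<^bsub>C\<^esub> m = x \<and> q \<odot>\<^bsub>C\<^esub> m = y"
    and p: "p \<in> Hom C P (Dom C f)" "q \<in> Hom C P (Dom C g)" "f \<odot>\<^bsub>C\<^esub> p = g \<odot>\<^bsub>C\<^esub> q" "P \<in> Obj C"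
    using P unfolding is_pullback_def by auto
  have u': "\<And>a x y. a \<in> Obj C \<Longrightarrow> x \<in> Hom C a (Dom C f) \<Longrightarrow> y \<in> Hom C a (Dom C g) \<Longrightarrow> f \<odot>\<^bsub>C\<^esub> x = g \<odot>\<^bsub>C\<^esub> y \<Longrightarrow>
     \<exists>!m. m \<in> Hom C a P' \<and> p' \<odot>\<^bsub>C\<^esub> m = x \<and> q' \<odot>\<^bsub>C\<^esub> m = y"
    and p': "p' \<in> Hom C P' (Dom C f)" "q' \<in> Hom C P' (Dom C g)" "f \<odot>\<^bsub>C\<^esub> p' = g \<odot>\<^bsub>C\<^esub> q'" "P' \<in> Obj C"
    using P' unfolding is_pullback_def by auto
  obtain m where m: "m \<in> Hom C P P'" "p' \<odot>\<^bsub>C\<^esub> m = p" "q' \<odot>\<^bsub>C\<^esub> m = q"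
    using u'[OF p(4,1,2,3)] by blast
  obtain n where n: "n \<in> Hom C P' P" "p \<odot>\<^bsub>C\<^esub> n = p'" "q \<odot>\<^bsub>C\<^esub> n = q'"
    using u[OF p'(4,1,2,3)] by blast
  have "p \<odot>\<^bsub>C\<^esub> (n \<odot>\<^bsub>C\<^esub> m) = p" "q \<odot>\<^bsub>C\<^esub> (n \<odot>\<^bsub>C\<^esub> m) = q"
    using C.Cmp_assoc[OF m(1) n(1) p(1)] C.Cmp_assoc[OF m(1) n(1) p(2)] m n by auto
  then have 1: "n \<odot>\<^bsub>C\<^esub> m = Ide C P"
    using u[OF p(4,1,2,3)] C.Cmp_in[OF m(1) n(1)] C.Ide_in[OF p(4)] C.Ide_right[OF p(1)] C.Ide_right[OF p(2)] by metis
  have "p' \<odot>\<^bsub>C\<^esub> (m \<odot>\<^bsub>C\<^esub> n) = p'" "q' \<odot>\<^bsub>C\<^esub> (m \<odot>\<^bsub>C\<^esub> n) = q'"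
    using C.Cmp_assoc[OF n(1) m(1) p'(1)] C.Cmp_assoc[OF n(1) m(1) p'(2)] m n by auto
  then have "m \<odot>\<^bsub>C\<^esub> n = Ide C P'"
    using u'[OF p'(4,1,2,3)] C.Cmp_in[OF n(1) m(1)] C.Ide_in[OF p'(4)] C.Ide_right[OF p'(1)] C.Ide_right[OF p'(2)] by metis
  then show ?thesis using 1 m n by blast
qed

lemma pullback_iso:
  assumes "category C" and P: "is_pullback C f g P p q" and iso: "is_iso C g"
  shows "is_iso C p"
proof -
  interpret C: category C by fact
  have u: "\<And>a x y. a \<in> Obj C \<Longrightarrow> x \<in> Hom C a (Dom C f) \<Longrightarrow> y \<in> Hom C a (Dom C g) \<Longrightarrow> f \<odot>\<^bsub>C\<^esub> x = g \<odot>\<^bsub>C\<^esub> y \<Longrightarrow>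
     \<exists>!m. m \<in> Hom C a P \<and> p \<odot>\<^bsub>C\<^esub> m = x \<and> q \<odot>\<^bsub>C\<^esub> m = y"
    and p: "p \<in> Hom C P (Dom C f)" "q \<in> Hom C P (Dom C g)" "f \<odot>\<^bsub>C\<^esub> p = g \<odot>\<^bsub>C\<^esub> q" "P \<in> Obj C"
    and fg: "f \<in> Arr C" "g \<in> Arr C" "Cod C f = Cod C g"
    using P unfolding is_pullback_def by auto
  let ?a = "Dom C f" and ?b = "Dom C g" and ?c = "Cod C g"
  have f: "f \<in> Hom C ?a ?c" and g: "g \<in> Hom C ?b ?c" using fg by (auto simp: Hom_def)
  obtain h where h: "h \<in> Hom C ?c ?b" "h \<odot>\<^bsub>C\<^esub> g = Ide C ?b" "g \<odot>\<^bsub>C\<^esub> h = Ide C ?c"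
    using C.is_isoE[OF iso g] .
  have a: "?a \<in> Obj C" using fg by simp
  have hf: "h \<odot>\<^bsub>C\<^esub> f \<in> Hom C ?a ?b" using C.Cmp_in[OF f h(1)] .
  have "f \<odot>\<^bsub>C\<^esub> Ide C ?a = g \<odot>\<^bsub>C\<^esub> (h \<odot>\<^bsub>C\<^esub> f)"
    using C.Ide_right[OF f] C.Cmp_assoc[OF f h(1) g] h(3) C.Ide_left[OF f] by simp
  then obtain m where m: "m \<in> Hom C ?a P" "p \<odot>\<^bsub>C\<^esub> m = Ide C ?a" "q \<odot>\<^bsub>C\<^esub> m = h \<odot>\<^bsub>C\<^esub> f"
    using u[OF a C.Ide_in[OF a] hf] by blast
  have "p \<odot>\<^bsub>C\<^esub> (m \<odot>\<^bsub>C\<^esub> p) = p"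
    using C.Cmp_assoc[OF p(1) m(1) p(1)] m(2) C.Ide_left[OF p(1)] by simp
  moreover have "q \<odot>\<^bsub>C\<^esub> (m \<odot>\<^bsub>C\<^esub> p) = q"
    using C.Cmp_assoc[OF p(1) m(1) p(2)] m(3) C.Cmp_assoc[OF p(1) f h(1)] p(3)
      C.Cmp_assoc[OF p(2) g h(1)] h(2) C.Ide_left[OF p(2)] by simp
  ultimately have "m \<odot>\<^bsub>C\<^esub> p = Ide C P"
    using u[OF p(4,1,2,3)] C.Cmp_in[OF p(1) m(1)] C.Ide_in[OF p(4)] C.Ide_right[OF p(1)] C.Ide_right[OF p(2)] by metis
  then show ?thesis using C.is_isoI[OF p(1) m(1)] m(2) by simp
qed

section \<open>Presheaves\<close>

lemma Psh_simps [simp]: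
  "Obj (Psh U C) = {P. is_presheaf U C P}" "Arr (Psh U C) = {t. is_nattrans U C t}"
  "Dom (Psh U C) = src" "Cod (Psh U C) = tgt"
  "Ide (Psh U C) P = \<lparr>src = P, tgt = P, cmpt = (\<lambda>a \<in> Obj C. \<lambda>s \<in> val P a. s)\<rparr>"
  by (simp_all add: Psh_def)

lemma Psh_comp [simp]:
  "src (g \<odot>\<^bsub>Psh U C\<^esub> f) = src f" "tgt (g \<odot>\<^bsub>Psh U C\<^esub> f) = tgt g"
  by (simp_all add: Psh_def)

lemma cmpt_comp [simp]:
  "a \<in> Obj C \<Longrightarrow> s \<in> val (src f) a \<Longrightarrow> cmpt (g \<odot>\<^bsub>Psh U C\<^esub> f) a s = cmpt g a (cmpt f a s)"
  by (simp add: Psh_def)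

lemma cmpt_comp_eq:
  "g \<odot>\<^bsub>Psh U C\<^esub> f = h \<Longrightarrow> a \<in> Obj C \<Longrightarrow> s \<in> val (src f) a \<Longrightarrow> cmpt g a (cmpt f a s) = cmpt h a s"
  using cmpt_comp by metis

lemma Hom_Psh: "t \<in> Hom (Psh U C) P Q \<longleftrightarrow> is_nattrans U C t \<and> src t = P \<and> tgt t = Q"
  by (simp add: Hom_def)

lemma nattrans_eqI:
  assumes "is_nattrans U C t" "is_nattrans U C t'" "src t = src t'" "tgt t = tgt t'"
    and eq: "\<And>a s. a \<in> Obj C \<Longrightarrow> s \<in> val (src t) a \<Longrightarrow> cmpt t a s = cmpt t' a s"
  shows "t = t'"
proof -
  have 1: "cmpt t \<in> (\<Pi>\<^sub>E a \<in> Obj C. val (src t) a \<rightarrow>\<^sub>E val (tgt t) a)"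
    "cmpt t' \<in> (\<Pi>\<^sub>E a \<in> Obj C. val (src t) a \<rightarrow>\<^sub>E val (tgt t) a)"
    using assms by (auto simp: is_nattrans_def)
  have "cmpt t = cmpt t'"
  proof (rule PiE_ext[OF 1])
    fix a assume a: "a \<in> Obj C"
    show "cmpt t a = cmpt t' a"
      by (rule PiE_ext[where k="val (src t) a" and s="\<lambda>_. val (tgt t) a"]) (use 1 a eq in \<open>auto simp: PiE_iff\<close>)
  qed
  then show ?thesis using assms by (intro nattrans.equality) auto
qed

lemma Hom_Psh_eqI:
  assumes "t \<in> Hom (Psh U C) P Q" "t' \<in> Hom (Psh U C) P Q"
    and "\<And>a s. a \<in> Obj C \<Longrightarrow> s \<in> val P a \<Longrightarrow> cmpt t a s = cmpt t' a s"
  shows "t = t'"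
  using assms by (intro nattrans_eqI) (auto simp: Hom_Psh)

lemma Hom_Psh_presheaf:
  "t \<in> Hom (Psh U C) P Q \<Longrightarrow> is_presheaf U C P" "t \<in> Hom (Psh U C) P Q \<Longrightarrow> is_presheaf U C Q"
  by (auto simp: Hom_Psh is_nattrans_def)

lemma cmpt_in: "t \<in> Hom (Psh U C) P Q \<Longrightarrow> a \<in> Obj C \<Longrightarrow> s \<in> val P a \<Longrightarrow> cmpt t a s \<in> val Q a"
  by (fastforce simp: Hom_Psh is_nattrans_def PiE_iff)

lemma cmpt_act: "t \<in> Hom (Psh U C) P Q \<Longrightarrow> f \<in> Arr C \<Longrightarrow> s \<in> val P (Cod C f) \<Longrightarrow>
    act Q f (cmpt t (Cod C f) s) = cmpt t (Dom C f) (act P f s)"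
  by (auto simp: Hom_Psh is_nattrans_def)

text \<open>The components are cut off outside the carriers, because transformations are compared by equality
  of records.\<close>

definition transf :: "('o, 'm) cat \<Rightarrow> ('o, 'm, 'u) presheaf \<Rightarrow> ('o, 'm, 'u) presheaf \<Rightarrow>
    ('o \<Rightarrow> 'u \<Rightarrow> 'u) \<Rightarrow> ('o, 'm, 'u) nattrans" where
  "transf C P Q h = \<lparr>src = P, tgt = Q, cmpt = (\<lambda>a \<in> Obj C. \<lambda>s \<in> val P a. h a s)\<rparr>"

lemma transf_simps [simp]:
  "src (transf C P Q h) = P" "tgt (transf C P Q h) = Q"
  "a \<in> Obj C \<Longrightarrow> s \<in> val P a \<Longrightarrow> cmpt (transf C P Q h) a s = h a s"
  by (auto simp: transf_def)

locale plain_category = category C for C :: "('o, 'm) cat" (structure)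

locale psh_cat = plain_category C for C :: "('o, 'm) cat" (structure) +
  fixes U :: "'u set"
  assumes universe: "universe U" and ess_small: "essentially_small U C"
begin

abbreviation psh where "psh P \<equiv> is_presheaf U C P"
abbreviation hom where "hom P Q \<equiv> Hom (Psh U C) P Q"

lemma act_in [simp]: "psh P \<Longrightarrow> f \<in> Arr C \<Longrightarrow> s \<in> val P (Cod C f) \<Longrightarrow> act P f s \<in> val P (Dom C f)"
  by (fastforce simp: is_presheaf_def PiE_iff)

lemma act_in': "psh P \<Longrightarrow> f \<in> Arr C \<Longrightarrow> Cod C f = a \<Longrightarrow> s \<in> val P a \<Longrightarrow> act P f s \<in> val P (Dom C f)"
  by auto

lemma act_Ide [simp]: "psh P \<Longrightarrow> a \<in> Obj C \<Longrightarrow> s \<in> val P a \<Longrightarrow> act P (Ide C a) s = s"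
  by (simp add: is_presheaf_def)

lemma act_comp: "psh P \<Longrightarrow> f \<in> Arr C \<Longrightarrow> g \<in> Arr C \<Longrightarrow> Cod C f = Dom C g \<Longrightarrow> s \<in> val P (Cod C g) \<Longrightarrow>
    act P f (act P g s) = act P (g \<odot> f) s"
  by (simp add: is_presheaf_def)

lemma val_small: "psh P \<Longrightarrow> a \<in> Obj C \<Longrightarrow> small U (val P a)"
  by (auto simp: is_presheaf_def PiE_iff)

text \<open>A small set of objects of which every object is a retract. Families indexed by all objects which
  are natural are determined by their values on such a set, and this bounds their number.\<close>

definition skeletal :: "'o set \<Rightarrow> bool" where
  "skeletal T \<longleftrightarrow> T \<subseteq> Obj C \<and> small U T \<and>
    (\<forall>a \<in> Obj C. \<exists>i j. i \<in> Arr C \<and> Dom C i = a \<and> Cod C i \<in> T \<and>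
      j \<in> Arr C \<and> Dom C j = Cod C i \<and> Cod C j = a \<and> j \<odot> i = Ide C a)"

lemma
  assumes "skeletal T"
  shows skeletal_Obj: "T \<subseteq> Obj C" and skeletal_small: "small U T"
    and skeletal_iso: "a \<in> Obj C \<Longrightarrow> \<exists>i j. i \<in> Arr C \<and> Dom C i = a \<and> Cod C i \<in> T \<and>
      j \<in> Arr C \<and> Dom C j = Cod C i \<and> Cod C j = a \<and> j \<odot> i = Ide C a"
  using assms by (simp_all add: skeletal_def)

lemma skeletal_exists: "\<exists>T. skeletal T"
proof -
  obtain T where T: "T \<subseteq> Obj C" "small U T" "\<And>a. a \<in> Obj C \<Longrightarrow> \<exists>b\<in>T. isomorphic C a b"
    using ess_small unfolding essentially_small_def by blast
  have "\<exists>i j. i \<in> Arr C \<and> Dom C i = a \<and> Cod C i \<in> T \<and> j \<in> Arr C \<and> Dom C j = Cod C i \<and> Cod C j = a \<and> j \<odot> i = Ide C a"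
    if "a \<in> Obj C" for a
    using T(3)[OF that] unfolding isomorphic_def is_iso_def Hom_def by auto
  then show ?thesis using T unfolding skeletal_def by blast
qed

lemma small_Hom: "a \<in> Obj C \<Longrightarrow> b \<in> Obj C \<Longrightarrow> small U (Hom C a b)"
  using ess_small unfolding essentially_small_def by blast

lemma transf_hom:
  assumes "psh P" "psh Q" "\<And>a s. a \<in> Obj C \<Longrightarrow> s \<in> val P a \<Longrightarrow> h a s \<in> val Q a"
    "\<And>f s. f \<in> Arr C \<Longrightarrow> s \<in> val P (Cod C f) \<Longrightarrow> act Q f (h (Cod C f) s) = h (Dom C f) (act P f s)"
  shows "transf C P Q h \<in> hom P Q"
  unfolding Hom_Psh is_nattrans_def using assms by (auto simp: transf_def PiE_iff extensional_def)

lemma comp_hom: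
  assumes "f \<in> hom P Q" "g \<in> hom Q R" shows "g \<odot>\<^bsub>Psh U C\<^esub> f \<in> hom P R"
proof -
  have s: "src f = P" "tgt f = Q" "src g = Q" "tgt g = R" using assms by (auto simp: Hom_Psh)
  have "g \<odot>\<^bsub>Psh U C\<^esub> f = transf C P R (\<lambda>a s. cmpt g a (cmpt f a s))"
    by (auto simp: Psh_def transf_def s)
  also have "\<dots> \<in> hom P R"
    using assms Hom_Psh_presheaf[OF assms(1)] Hom_Psh_presheaf[OF assms(2)]
    by (intro transf_hom) (auto simp: cmpt_in cmpt_act)
  finally show ?thesis .
qed

lemma Ide_hom: assumes "psh P" shows "Ide (Psh U C) P \<in> hom P P"
proof -
  have "Ide (Psh U C) P = transf C P P (\<lambda>a s. s)" by (simp add: transf_def)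
  also have "\<dots> \<in> hom P P" using assms by (intro transf_hom) auto
  finally show ?thesis .
qed

lemma category_Psh: "category (Psh U C)"
proof (rule category.intro)
  fix f g P Q R S h
  assume f: "f \<in> hom P Q"
  then show "Ide (Psh U C) Q \<odot>\<^bsub>Psh U C\<^esub> f = f"
    by (intro Hom_Psh_eqI[OF comp_hom[OF f Ide_hom] f]) (auto simp: Hom_Psh_presheaf[OF f] Hom_Psh cmpt_in[OF f])
  show "f \<odot>\<^bsub>Psh U C\<^esub> Ide (Psh U C) P = f"
    by (intro Hom_Psh_eqI[OF comp_hom[OF Ide_hom f] f]) (auto simp: Hom_Psh_presheaf[OF f])
  assume g: "g \<in> hom Q R"
  show "g \<odot>\<^bsub>Psh U C\<^esub> f \<in> hom P R" by (rule comp_hom[OF f g])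
  assume h: "h \<in> hom R S"
  have s: "src f = P" "src g = Q" using f g by (auto simp: Hom_Psh)
  show "(h \<odot>\<^bsub>Psh U C\<^esub> g) \<odot>\<^bsub>Psh U C\<^esub> f = h \<odot>\<^bsub>Psh U C\<^esub> (g \<odot>\<^bsub>Psh U C\<^esub> f)"
    by (intro Hom_Psh_eqI[OF comp_hom[OF f comp_hom[OF g h]] comp_hom[OF comp_hom[OF f g] h]])
      (auto simp: s cmpt_in[OF f])
qed (use Ide_hom in \<open>auto simp: is_nattrans_def\<close>)

text \<open>Constructions on presheaves naturally take values in small sets of sets, of tuples or of
  functions. Each of these sets can be injected into the universe, and the functor transported.\<close>

definition raw_presheaf :: "('o \<Rightarrow> 'x set) \<Rightarrow> ('m \<Rightarrow> 'x \<Rightarrow> 'x) \<Rightarrow> bool" where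
  "raw_presheaf V A \<longleftrightarrow>
    (\<forall>a \<in> Obj C. small U (V a)) \<and>
    (\<forall>f \<in> Arr C. \<forall>x \<in> V (Cod C f). A f x \<in> V (Dom C f)) \<and>
    (\<forall>a \<in> Obj C. \<forall>x \<in> V a. A (Ide C a) x = x) \<and>
    (\<forall>f \<in> Arr C. \<forall>g \<in> Arr C. Cod C f = Dom C g \<longrightarrow> (\<forall>x \<in> V (Cod C g). A (g \<odot> f) x = A f (A g x)))"

text \<open>Encoding \<open>e\<close> and decoding \<open>d\<close> are both recorded: elements of \<open>P\<close> are then handled through \<open>d\<close>, without
  inverting bijections.\<close>

definition encoding :: "('o \<Rightarrow> 'x set) \<Rightarrow> ('m \<Rightarrow> 'x \<Rightarrow> 'x) \<Rightarrow> ('o, 'm, 'u) presheaf \<Rightarrow>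
    ('o \<Rightarrow> 'x \<Rightarrow> 'u) \<Rightarrow> ('o \<Rightarrow> 'u \<Rightarrow> 'x) \<Rightarrow> bool" where
  "encoding V A P e d \<longleftrightarrow> psh P \<and>
    (\<forall>a \<in> Obj C. \<forall>x \<in> V a. e a x \<in> val P a \<and> d a (e a x) = x) \<and>
    (\<forall>a \<in> Obj C. \<forall>s \<in> val P a. d a s \<in> V a \<and> e a (d a s) = s) \<and>
    (\<forall>f \<in> Arr C. \<forall>x \<in> V (Cod C f). act P f (e (Cod C f) x) = e (Dom C f) (A f x))"

lemma
  assumes "raw_presheaf V A"
  shows raw_in: "f \<in> Arr C \<Longrightarrow> x \<in> V (Cod C f) \<Longrightarrow> A f x \<in> V (Dom C f)"
    and raw_comp: "f \<in> Arr C \<Longrightarrow> g \<in> Arr C \<Longrightarrow> Cod C f = Dom C g \<Longrightarrow> x \<in> V (Cod C g) \<Longrightarrow> A (g \<odot> f) x = A f (A g x)"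
    and raw_Ide: "a \<in> Obj C \<Longrightarrow> x \<in> V a \<Longrightarrow> A (Ide C a) x = x"
  using assms by (simp_all add: raw_presheaf_def)

lemma encoding_exists:
  assumes raw: "raw_presheaf V A" shows "\<exists>P e d. encoding V A P e d"
proof -
  have "\<exists>e. inj_on e (V a) \<and> e ` V a \<subseteq> U" if "a \<in> Obj C" for a
    using raw that small_embed[of U "V a"] unfolding raw_presheaf_def by metis
  then obtain e where e: "\<And>a. a \<in> Obj C \<Longrightarrow> inj_on (e a) (V a)" "\<And>a. a \<in> Obj C \<Longrightarrow> e a ` V a \<subseteq> U"
    by metis
  define d where "d a = inv_into (V a) (e a)" for a
  define P where "P = \<lparr>val = (\<lambda>a \<in> Obj C. e a ` V a),
    act = (\<lambda>f \<in> Arr C. \<lambda>s \<in> e (Cod C f) ` V (Cod C f). e (Dom C f) (A f (d (Cod C f) s)))\<rparr>"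
  have d: "d a (e a x) = x" if "a \<in> Obj C" "x \<in> V a" for a x
    using inv_into_f_f[OF e(1)] that by (simp add: d_def)
  have v: "val P a = e a ` V a" if "a \<in> Obj C" for a using that by (simp add: P_def)
  have ac: "act P f (e (Cod C f) x) = e (Dom C f) (A f x)" if "f \<in> Arr C" "x \<in> V (Cod C f)" for f x
    using that d by (simp add: P_def)
  have "psh P"
    unfolding is_presheaf_def
  proof (intro conjI ballI impI)
    show "val P \<in> (\<Pi>\<^sub>E a\<in>Obj C. {A. A \<subseteq> U \<and> small U A})"
      using raw e unfolding raw_presheaf_def by (auto simp: P_def intro: small_image)
    show "act P \<in> (\<Pi>\<^sub>E f\<in>Arr C. val P (Cod C f) \<rightarrow>\<^sub>E val P (Dom C f))"
      using raw_in[OF raw] d by (auto simp: P_def)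
    fix a s assume "a \<in> Obj C" "s \<in> val P a"
    then show "act P (Ide C a) s = s" using ac[of "Ide C a"] raw_Ide[OF raw] v by auto
  next
    fix f g s assume fg: "f \<in> Arr C" "g \<in> Arr C" "Cod C f = Dom C g" and "s \<in> val P (Cod C g)"
    then obtain x where x: "x \<in> V (Cod C g)" "s = e (Cod C g) x" using v by auto
    then show "act P (g \<odot> f) s = act P f (act P g s)"
      using ac[of "g \<odot> f" x] ac[of g x] ac[of f "A g x"] fg raw_comp[OF raw fg x(1)] raw_in[OF raw fg(2) x(1)] by simp
  qed
  then have "encoding V A P e d" unfolding encoding_def using v d ac by auto
  then show ?thesis by blast
qed

lemma
  assumes "encoding V A P e d"
  shows enc_psh: "psh P"
    and enc_in: "a \<in> Obj C \<Longrightarrow> x \<in> V a \<Longrightarrow> e a x \<in> val P a"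
    and dec_enc: "a \<in> Obj C \<Longrightarrow> x \<in> V a \<Longrightarrow> d a (e a x) = x"
    and dec_in: "a \<in> Obj C \<Longrightarrow> s \<in> val P a \<Longrightarrow> d a s \<in> V a"
    and enc_dec: "a \<in> Obj C \<Longrightarrow> s \<in> val P a \<Longrightarrow> e a (d a s) = s"
    and act_enc: "f \<in> Arr C \<Longrightarrow> x \<in> V (Cod C f) \<Longrightarrow> act P f (e (Cod C f) x) = e (Dom C f) (A f x)"
  using assms by (simp_all add: encoding_def)

lemma dec_act:
  assumes "raw_presheaf V A" and e: "encoding V A P e d" and f: "f \<in> Arr C" and s: "s \<in> val P (Cod C f)"
  shows "d (Dom C f) (act P f s) = A f (d (Cod C f) s)"
  using act_enc[OF e f dec_in[OF e _ s]] enc_dec[OF e _ s] dec_enc[OF e _ raw_in[OF assms(1) f dec_in[OF e _ s]]] f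
  by simp

end

section \<open>Topologies\<close>

text \<open>A quantifier: \<open>\<Phi>\<close> holds on a covering sieve. The rules of weakening, restriction, conjunction and
  transitivity below replace the manipulation of explicit covering sieves.\<close>

definition locally :: "('o, 'm) cat \<Rightarrow> ('o \<times> 'm set) set \<Rightarrow> 'o \<Rightarrow> ('m \<Rightarrow> bool) \<Rightarrow> bool" where
  "locally C K a \<Phi> \<longleftrightarrow> (\<exists>S. (a, S) \<in> K \<and> (\<forall>f \<in> S. \<Phi> f))"

lemma sieve_closed: "is_sieve C a S \<Longrightarrow> f \<in> S \<Longrightarrow> g \<in> Arr C \<Longrightarrow> Cod C g = Dom C f \<Longrightarrow> f \<odot>\<^bsub>C\<^esub> g \<in> S"
  by (auto simp: is_sieve_def)

lemma sieve_arr: "is_sieve C a S \<Longrightarrow> f \<in> S \<Longrightarrow> f \<in> Arr C" "is_sieve C a S \<Longrightarrow> f \<in> S \<Longrightarrow> Cod C f = a"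
  by (auto simp: is_sieve_def)

context plain_category
begin

lemma pullback_sieve_comp:
  "f \<in> Arr C \<Longrightarrow> g \<in> Arr C \<Longrightarrow> Cod C g = Dom C f \<Longrightarrow>
    pullback_sieve C g (pullback_sieve C f S) = pullback_sieve C (f \<odot> g) S"
  by (auto simp: pullback_sieve_def)

lemma pullback_sieve_Ide: "is_sieve C a S \<Longrightarrow> pullback_sieve C (Ide C a) S = S"
  using comp_Ide(1) by (force simp: pullback_sieve_def is_sieve_def)

lemma is_sieve_pullback:
  "is_sieve C a S \<Longrightarrow> f \<in> Arr C \<Longrightarrow> Cod C f = a \<Longrightarrow> is_sieve C (Dom C f) (pullback_sieve C f S)"
  by (auto simp: pullback_sieve_def is_sieve_def)

lemma is_sieve_max: "a \<in> Obj C \<Longrightarrow> is_sieve C a {f \<in> Arr C. Cod C f = a}"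
  by (auto simp: is_sieve_def)

end

locale site = plain_category C for C :: "('o, 'm) cat" (structure) +
  fixes K :: "('o \<times> 'm set) set"
  assumes topology: "is_topology C K"
begin

lemma covering_sieve: "(a, S) \<in> K \<Longrightarrow> is_sieve C a S"
  using topology unfolding is_topology_def by auto

lemma covering_obj: "(a, S) \<in> K \<Longrightarrow> a \<in> Obj C"
  using covering_sieve unfolding is_sieve_def by auto

lemma covering_pullback:
  assumes "(a, S) \<in> K" "f \<in> Arr C" "Cod C f = a" shows "(Dom C f, pullback_sieve C f S) \<in> K"
proof -
  have "\<forall>(a, S)\<in>K. \<forall>f\<in>Arr C. Cod C f = a \<longrightarrow> (Dom C f, pullback_sieve C f S) \<in> K"
    using topology unfolding is_topology_def by (elim conjE)
  then show ?thesis using assms by blast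
qed

lemma covering_trans:
  assumes "(a, S) \<in> K" "is_sieve C a T" "\<And>f. f \<in> S \<Longrightarrow> (Dom C f, pullback_sieve C f T) \<in> K"
  shows "(a, T) \<in> K"
  using topology assms unfolding is_topology_def by blast

lemma covering_max: "a \<in> Obj C \<Longrightarrow> (a, {f \<in> Arr C. Cod C f = a}) \<in> K"
  using topology unfolding is_topology_def by blast

lemma covering_superset:
  assumes S: "(a, S) \<in> K" and T: "is_sieve C a T" and ST: "S \<subseteq> T"
  shows "(a, T) \<in> K"
proof (rule covering_trans[OF S T])
  fix f assume f: "f \<in> S"
  have "f \<in> Arr C" using sieve_arr(1)[OF covering_sieve[OF S] f] .
  moreover have "pullback_sieve C f T = {g \<in> Arr C. Cod C g = Dom C f}"
    using sieve_closed[OF T, of f] f ST by (auto simp: pullback_sieve_def)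
  ultimately show "(Dom C f, pullback_sieve C f T) \<in> K" using covering_max by simp
qed

lemma locallyI: "(a, S) \<in> K \<Longrightarrow> (\<And>f. f \<in> S \<Longrightarrow> \<Phi> f) \<Longrightarrow> locally C K a \<Phi>"
  unfolding locally_def by blast

lemma sieve_locally: "is_sieve C a S \<Longrightarrow> (a, S) \<in> K \<longleftrightarrow> locally C K a (\<lambda>f. f \<in> S)"
  using covering_superset[of a _ S] by (auto simp: locally_def)

lemma locally_triv:
  "a \<in> Obj C \<Longrightarrow> (\<And>f. f \<in> Arr C \<Longrightarrow> Cod C f = a \<Longrightarrow> \<Phi> f) \<Longrightarrow> locally C K a \<Phi>"
  by (rule locallyI[OF covering_max]) auto

lemma locally_mono:
  assumes "locally C K a \<Phi>" "\<And>f. f \<in> Arr C \<Longrightarrow> Cod C f = a \<Longrightarrow> \<Phi> f \<Longrightarrow> \<Psi> f"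
  shows "locally C K a \<Psi>"
  using assms sieve_arr[OF covering_sieve] unfolding locally_def by metis

lemma locally_pull:
  assumes "locally C K a \<Phi>" "k \<in> Arr C" "Cod C k = a"
  shows "locally C K (Dom C k) (\<lambda>g. \<Phi> (k \<odot> g))"
proof -
  obtain S where "(a, S) \<in> K" "\<forall>f \<in> S. \<Phi> f" using assms(1) unfolding locally_def by blast
  then show ?thesis using covering_pullback[OF _ assms(2,3)] by (intro locallyI) (auto simp: pullback_sieve_def)
qed

lemma locally_trans:
  assumes loc: "locally C K a \<Phi>"
    and all: "\<And>f. f \<in> Arr C \<Longrightarrow> Cod C f = a \<Longrightarrow> \<Phi> f \<Longrightarrow> locally C K (Dom C f) (\<lambda>g. \<Psi> (f \<odot> g))"
  shows "locally C K a \<Psi>"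
proof -
  obtain S where S: "(a, S) \<in> K" "\<forall>f \<in> S. \<Phi> f" using loc unfolding locally_def by blast
  \<comment> \<open>\<open>\<Psi>\<close> need not be stable under composition, hence the closure under all composites.\<close>
  let ?T = "{h \<in> Arr C. Cod C h = a \<and> (\<forall>k \<in> Arr C. Cod C k = Dom C h \<longrightarrow> \<Psi> (h \<odot> k))}"
  have T: "is_sieve C a ?T" using covering_obj[OF S(1)] by (auto simp: is_sieve_def)
  have "(a, ?T) \<in> K"
  proof (rule covering_trans[OF S(1) T])
    fix f assume f: "f \<in> S"
    then have fa: "f \<in> Arr C" "Cod C f = a" using sieve_arr[OF covering_sieve[OF S(1)]] by auto
    then obtain R where R: "(Dom C f, R) \<in> K" "\<forall>g \<in> R. \<Psi> (f \<odot> g)"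
      using all[of f] S(2) f unfolding locally_def by blast
    have "R \<subseteq> pullback_sieve C f ?T"
      using sieve_arr[OF covering_sieve[OF R(1)]] sieve_closed[OF covering_sieve[OF R(1)]] R(2) fa
      by (auto simp: pullback_sieve_def)
    then show "(Dom C f, pullback_sieve C f ?T) \<in> K"
      by (rule covering_superset[OF R(1) is_sieve_pullback[OF T fa]])
  qed
  then show ?thesis
  proof (rule locallyI)
    fix h assume "h \<in> ?T"
    then have h: "h \<in> Arr C" and "\<forall>k \<in> Arr C. Cod C k = Dom C h \<longrightarrow> \<Psi> (h \<odot> k)" by auto
    from this(2)[THEN bspec, of "Ide C (Dom C h)"] h show "\<Psi> h" using comp_Ide(2) by simp
  qed
qed

lemma locally_conj:
  assumes "locally C K a \<Phi>" "locally C K a \<Psi>" shows "locally C K a (\<lambda>f. \<Phi> f \<and> \<Psi> f)"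
proof -
  obtain S where S: "(a, S) \<in> K" "\<forall>f \<in> S. \<Phi> f" using assms(1) unfolding locally_def by blast
  have sv: "is_sieve C a S" using covering_sieve[OF S(1)] .
  have "locally C K a (\<lambda>f. f \<in> S)" using S(1) by (rule locallyI)
  then show ?thesis
    by (rule locally_trans, intro locally_mono[OF locally_pull[OF assms(2)]]) (use S(2) sieve_closed[OF sv] in auto)
qed

lemma locally_cong:
  "(\<And>f. f \<in> Arr C \<Longrightarrow> Cod C f = a \<Longrightarrow> \<Phi> f = \<Psi> f) \<Longrightarrow> locally C K a \<Phi> = locally C K a \<Psi>"
  using locally_mono[of a \<Phi> \<Psi>] locally_mono[of a \<Psi> \<Phi>] by blast

end

definition min_topology :: "('o, 'm) cat \<Rightarrow> ('o \<times> 'm set) set" where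
  "min_topology C = {(a, S). a \<in> Obj C \<and> S = {f \<in> Arr C. Cod C f = a}}"

lemma (in plain_category) min_topology: "is_topology C (min_topology C)"
proof -
  have "T = {f \<in> Arr C. Cod C f = a}" if a: "a \<in> Obj C" and T: "is_sieve C a T"
    and p: "pullback_sieve C (Ide C a) T = {f \<in> Arr C. Cod C f = a}" for a T
  proof -
    have "Ide C a \<in> pullback_sieve C (Ide C a) T" using p a by simp
    then have "Ide C a \<in> T" using a comp_Ide[of "Ide C a"] by (auto simp: pullback_sieve_def)
    then have "f \<in> T" if "f \<in> Arr C" "Cod C f = a" for f
      using sieve_closed[OF T, of "Ide C a" f] that a comp_Ide(1)[of f] by auto
    then show ?thesis using sieve_arr[OF T] by blast
  qed
  moreover have "is_sieve C a {f \<in> Arr C. Cod C f = a}" if "a \<in> Obj C" for a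
    using that by (auto simp: is_sieve_def)
  moreover have "pullback_sieve C f {fa \<in> Arr C. Cod C fa = Cod C f} = {g \<in> Arr C. Cod C g = Dom C f}"
    if "f \<in> Arr C" for f using that by (auto simp: pullback_sieve_def)
  ultimately show ?thesis
    unfolding is_topology_def min_topology_def by auto
qed

lemma min_topology_least: "is_topology C J \<Longrightarrow> min_topology C \<subseteq> J"
  by (auto simp: min_topology_def is_topology_def)

section \<open>Sheaves\<close>

lemma sheaf_presheaf: "P \<in> sheaves U C K \<Longrightarrow> is_presheaf U C P"
  by (simp add: sheaves_def)

lemma sheaf_glue:
  assumes "P \<in> sheaves U C K" "(a, S) \<in> K" "matching_family C P S x"
  shows "\<exists>s \<in> val P a. \<forall>f \<in> S. act P f s = x f"
  using assms unfolding sheaves_def by blast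

lemma sheaf_unique:
  assumes "P \<in> sheaves U C K" "(a, S) \<in> K" "matching_family C P S x"
    "s \<in> val P a" "\<And>f. f \<in> S \<Longrightarrow> act P f s = x f" "t \<in> val P a" "\<And>f. f \<in> S \<Longrightarrow> act P f t = x f"
  shows "s = t"
  using assms unfolding sheaves_def by blast

lemma sheaves_antimono: "J \<subseteq> K \<Longrightarrow> sheaves U C K \<subseteq> sheaves U C J"
  unfolding sheaves_def by blast

lemma (in psh_cat) restrictions_matching:
  assumes R: "is_sieve C X R" and F: "psh F" and s: "s \<in> val F X"
  shows "matching_family C F R (\<lambda>f. act F f s)"
  unfolding matching_family_def using sieve_arr[OF R] act_in'[OF F] act_comp[OF F] s by simp

locale sheaf_site = psh_cat C U + site C K
  for C :: "('o, 'm) cat" (structure) and U :: "'u set" and K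
begin

lemma sheaf_separated:
  assumes P: "P \<in> sheaves U C K" and s: "s \<in> val P a" and t: "t \<in> val P a"
    and loc: "locally C K a (\<lambda>f. act P f s = act P f t)"
  shows "s = t"
proof -
  obtain S where S: "(a, S) \<in> K" "\<forall>f \<in> S. act P f s = act P f t" using loc unfolding locally_def by blast
  show ?thesis
    by (rule sheaf_unique[OF P S(1) restrictions_matching[OF covering_sieve[OF S(1)] sheaf_presheaf[OF P] t]])
      (use s t S in auto)
qed

lemma sheafI:
  assumes p: "psh P"
    and sep: "\<And>a s t. a \<in> Obj C \<Longrightarrow> s \<in> val P a \<Longrightarrow> t \<in> val P a \<Longrightarrow>
      locally C K a (\<lambda>f. act P f s = act P f t) \<Longrightarrow> s = t"
    and glue: "\<And>a S x. (a, S) \<in> K \<Longrightarrow> is_sieve C a S \<Longrightarrow> matching_family C P S x \<Longrightarrow>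
      \<exists>s \<in> val P a. \<forall>f \<in> S. act P f s = x f"
  shows "P \<in> sheaves U C K"
proof -
  have "\<exists>!s. s \<in> val P a \<and> (\<forall>f \<in> S. act P f s = x f)" if S: "(a, S) \<in> K" and x: "matching_family C P S x" for a S x
  proof -
    have sv: "is_sieve C a S" using covering_sieve[OF S] .
    have "s = t" if "s \<in> val P a \<and> (\<forall>f\<in>S. act P f s = x f)" "t \<in> val P a \<and> (\<forall>f\<in>S. act P f t = x f)" for s t
    proof (rule sep[of a])
      have "locally C K a (\<lambda>f. f \<in> S)" using S sieve_locally[OF sv] by simp
      then show "locally C K a (\<lambda>f. act P f s = act P f t)"
        by (rule locally_mono) (use that in auto)
    qed (use that covering_obj[OF S] in auto)
    then show ?thesis using glue[OF S sv x] by blast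
  qed
  then show ?thesis using p unfolding sheaves_def by blast
qed

text \<open>The form in which gluing is used below: a relation \<open>R\<close> describes the restrictions of the section to be
  found. That values chosen on a covering sieve match follows from single-valuedness.\<close>

lemma sheaf_local_description:
  assumes G: "G \<in> sheaves U C K" and loc: "locally C K a (\<lambda>f. \<exists>z. R f z)"
    and R_in: "\<And>f z. f \<in> Arr C \<Longrightarrow> Cod C f = a \<Longrightarrow> R f z \<Longrightarrow> z \<in> val G (Dom C f)"
    and restr: "\<And>f g z. f \<in> Arr C \<Longrightarrow> Cod C f = a \<Longrightarrow> R f z \<Longrightarrow> g \<in> Arr C \<Longrightarrow> Cod C g = Dom C f \<Longrightarrow>
        R (f \<odot> g) (act G g z)"
    and uniq: "\<And>f z z'. f \<in> Arr C \<Longrightarrow> Cod C f = a \<Longrightarrow> R f z \<Longrightarrow> R f z' \<Longrightarrow> z = z'"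
  shows "\<exists>z \<in> val G a. \<forall>f z'. f \<in> Arr C \<longrightarrow> Cod C f = a \<longrightarrow> R f z' \<longrightarrow> act G f z = z'"
proof -
  have g: "psh G" using G by (rule sheaf_presheaf)
  obtain S where S: "(a, S) \<in> K" and SR: "\<And>f. f \<in> S \<Longrightarrow> \<exists>z. R f z" using loc unfolding locally_def by blast
  note sv = covering_sieve[OF S]
  define x where "x f = (SOME z. R f z)" for f
  have x: "R f (x f)" if "R f z" for f z using that unfolding x_def by (rule someI)
  have xS: "R f (x f)" "f \<in> Arr C" "Cod C f = a" if "f \<in> S" for f using SR[OF that] x sieve_arr[OF sv that] by auto
  have "matching_family C G S x"
    unfolding matching_family_def
  proof (intro conjI ballI impI)
    fix f assume f: "f \<in> S"
    show "x f \<in> val G (Dom C f)" using R_in xS[OF f] by blast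
    fix g assume g: "g \<in> Arr C" "Cod C g = Dom C f"
    have fg: "f \<odot> g \<in> S" using sieve_closed[OF sv f g] .
    show "act G g (x f) = x (f \<odot> g)"
      using uniq[OF xS(2,3)[OF fg] restr[OF xS(2,3,1)[OF f] g] xS(1)[OF fg]] .
  qed
  from sheaf_glue[OF G S this] obtain s where s: "s \<in> val G a" "\<forall>f \<in> S. act G f s = x f" by blast
  have "act G f s = z'" if f: "f \<in> Arr C" "Cod C f = a" and z: "R f z'" for f z'
  proof (rule sheaf_separated[OF G act_in'[OF g f s(1)] R_in[OF f z]])
    have "locally C K (Dom C f) (\<lambda>k. f \<odot> k \<in> S)"
      using locally_pull[of a "\<lambda>f. f \<in> S" f] locallyI[OF S, of "\<lambda>f. f \<in> S"] f by blast
    then show "locally C K (Dom C f) (\<lambda>k. act G k (act G f s) = act G k z')"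
    proof (rule locally_mono)
      fix k assume k: "k \<in> Arr C" "Cod C k = Dom C f" and fk: "f \<odot> k \<in> S"
      show "act G k (act G f s) = act G k z'"
        using s(2) fk uniq[OF xS(2,3)[OF fk] xS(1)[OF fk] restr[OF f z k]] act_comp[OF g k(1) f(1) k(2)] s(1) f by simp
    qed
  qed
  then show ?thesis using s by blast
qed

lemma Sh_simps [simp]:
  "Obj (Sh U C K) = sheaves U C K" "Dom (Sh U C K) = src" "Cod (Sh U C K) = tgt"
  "Ide (Sh U C K) = Ide (Psh U C)" "Cmp (Sh U C K) = Cmp (Psh U C)"
  using sheaf_presheaf by (auto simp: Sh_def)

lemma Hom_Sh: "t \<in> Hom (Sh U C K) P Q \<longleftrightarrow> t \<in> hom P Q \<and> P \<in> sheaves U C K \<and> Q \<in> sheaves U C K"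
  by (simp add: Sh_def Hom_full_subcat)

lemma Arr_Sh: "t \<in> Arr (Sh U C K) \<longleftrightarrow> t \<in> hom (src t) (tgt t) \<and> src t \<in> sheaves U C K \<and> tgt t \<in> sheaves U C K"
  by (auto simp: Sh_def Hom_Psh)

lemma category_Sh: "category (Sh U C K)"
  unfolding Sh_def by (rule category_full_subcat[OF category_Psh])

end

text \<open>For the topology in which only maximal sieves cover, statements on sheaf toposes specialize to
  statements on presheaf toposes.\<close>

lemma (in psh_cat) sheaves_min: "sheaves U C (min_topology C) = {P. psh P}"
proof -
  have "\<exists>!s. s \<in> val P a \<and> (\<forall>f \<in> {f \<in> Arr C. Cod C f = a}. act P f s = x f)"
    if p: "psh P" and a: "a \<in> Obj C" and x: "matching_family C P {f \<in> Arr C. Cod C f = a} x" for P a x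
  proof (rule ex1I[where a="x (Ide C a)"])
    have i: "Ide C a \<in> {f \<in> Arr C. Cod C f = a}" using a by simp
    have "act P f (x (Ide C a)) = x f" if f: "f \<in> Arr C" "Cod C f = a" for f
      using x i f a comp_Ide(1)[of f] unfolding matching_family_def by auto
    moreover have "x (Ide C a) \<in> val P (Dom C (Ide C a))" using x i unfolding matching_family_def by blast
    ultimately show "x (Ide C a) \<in> val P a \<and> (\<forall>f \<in> {f \<in> Arr C. Cod C f = a}. act P f (x (Ide C a)) = x f)"
      using a by simp
    fix s assume "s \<in> val P a \<and> (\<forall>f \<in> {f \<in> Arr C. Cod C f = a}. act P f s = x f)"
    then have "act P (Ide C a) s = x (Ide C a)" "s \<in> val P a" using i by blast+
    then show "s = x (Ide C a)" using act_Ide[OF p a] by simp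
  qed
  then show ?thesis unfolding sheaves_def min_topology_def by blast
qed

lemma (in psh_cat) Sh_min: "Sh U C (min_topology C) = Psh U C"
  unfolding Sh_def sheaves_min by (rule full_subcat_Obj[OF category_Psh]) simp

section \<open>Limits of sheaves\<close>

text \<open>Pullbacks of sets over every object. By \<open>pullback_Sh_iff\<close> these are the pullbacks of sheaves, so that all
  later arguments on limits are about elements.\<close>

definition ptwise_pullback ::
  "('o, 'm) cat \<Rightarrow> ('o, 'm, 'u) nattrans \<Rightarrow> ('o, 'm, 'u) nattrans \<Rightarrow> ('o, 'm, 'u) nattrans \<Rightarrow>
    ('o, 'm, 'u) nattrans \<Rightarrow> bool" where
  "ptwise_pullback C f g p q \<longleftrightarrow> (\<forall>a \<in> Obj C.
    (\<forall>z \<in> val (src p) a. cmpt f a (cmpt p a z) = cmpt g a (cmpt q a z)) \<and>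
    (\<forall>x \<in> val (src f) a. \<forall>y \<in> val (src g) a. cmpt f a x = cmpt g a y \<longrightarrow>
      (\<exists>!z. z \<in> val (src p) a \<and> cmpt p a z = x \<and> cmpt q a z = y)))"

definition ptwise_bij :: "('o, 'm) cat \<Rightarrow> ('o, 'm, 'u) nattrans \<Rightarrow> bool" where
  "ptwise_bij C m \<longleftrightarrow> (\<forall>a \<in> Obj C. bij_betw (cmpt m a) (val (src m) a) (val (tgt m) a))"

context psh_cat
begin

lemma hom_src: "t \<in> hom P Q \<Longrightarrow> src t = P" "t \<in> hom P Q \<Longrightarrow> tgt t = Q"
  by (auto simp: Hom_Psh)

lemma ptwise_bij_inverse:
  assumes m: "m \<in> hom P Q" and bij: "ptwise_bij C m"
  obtains n where "n \<in> hom Q P" "n \<odot>\<^bsub>Psh U C\<^esub> m = Ide (Psh U C) P" "m \<odot>\<^bsub>Psh U C\<^esub> n = Ide (Psh U C) Q"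
    "ptwise_bij C n"
proof -
  note sm = hom_src[OF m] and pq = Hom_Psh_presheaf[OF m]
  define h where "h a = inv_into (val P a) (cmpt m a)" for a
  have bj: "bij_betw (cmpt m a) (val P a) (val Q a)" if "a \<in> Obj C" for a
    using bij that by (simp add: ptwise_bij_def sm)
  have h: "h a y \<in> val P a" "cmpt m a (h a y) = y" if "a \<in> Obj C" "y \<in> val Q a" for a y
    using bj[OF that(1)] that(2) unfolding h_def bij_betw_def by (auto intro: inv_into_into f_inv_into_f)
  have h': "h a (cmpt m a x) = x" if "a \<in> Obj C" "x \<in> val P a" for a x
    using bj[OF that(1)] that(2) unfolding h_def bij_betw_def by simp
  let ?n = "transf C Q P h"
  have n: "?n \<in> hom Q P"
  proof (rule transf_hom[OF pq(2,1)])
    fix f s assume f: "f \<in> Arr C" and s: "s \<in> val Q (Cod C f)"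
    have "act P f (h (Cod C f) s) = h (Dom C f) (cmpt m (Dom C f) (act P f (h (Cod C f) s)))"
      using h' h f s pq by simp
    also have "\<dots> = h (Dom C f) (act Q f s)"
      using cmpt_act[OF m f, symmetric] h f s by simp
    finally show "act P f (h (Cod C f) s) = h (Dom C f) (act Q f s)" .
  qed (use h in auto)
  show ?thesis
  proof (rule that[OF n])
    show "?n \<odot>\<^bsub>Psh U C\<^esub> m = Ide (Psh U C) P"
      by (rule Hom_Psh_eqI[OF comp_hom[OF m n] Ide_hom[OF pq(1)]]) (use h' cmpt_in[OF m] sm in simp)
    show "m \<odot>\<^bsub>Psh U C\<^esub> ?n = Ide (Psh U C) Q"
      by (rule Hom_Psh_eqI[OF comp_hom[OF n m] Ide_hom[OF pq(2)]]) (use h sm in simp)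
    show "ptwise_bij C ?n"
      unfolding ptwise_bij_def
    proof
      fix a assume a: "a \<in> Obj C"
      have "bij_betw (h a) (val Q a) (val P a)" unfolding h_def by (rule bij_betw_inv_into[OF bj[OF a]])
      then show "bij_betw (cmpt ?n a) (val (src ?n) a) (val (tgt ?n) a)"
        using a by (subst bij_betw_cong[where g="h a"]) auto
    qed
  qed
qed

lemma ptwise_bij_iff_inverse:
  assumes m: "m \<in> hom P Q" and n: "n \<in> hom Q P"
    and "n \<odot>\<^bsub>Psh U C\<^esub> m = Ide (Psh U C) P" "m \<odot>\<^bsub>Psh U C\<^esub> n = Ide (Psh U C) Q"
  shows "ptwise_bij C m"
  unfolding ptwise_bij_def
proof
  fix a assume a: "a \<in> Obj C"
  show "bij_betw (cmpt m a) (val (src m) a) (val (tgt m) a)"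
    unfolding hom_src[OF m]
  proof (rule bij_betw_byWitness[where f'="cmpt n a"])
    show "\<forall>s\<in>val P a. cmpt n a (cmpt m a s) = s"
      using cmpt_comp_eq[OF assms(3) a] a hom_src[OF m] by auto
    show "\<forall>s\<in>val Q a. cmpt m a (cmpt n a s) = s"
      using cmpt_comp_eq[OF assms(4) a] a hom_src[OF n] by auto
  qed (use cmpt_in[OF m a] cmpt_in[OF n a] in auto)
qed

lemma ptwise_pullback_exists:
  assumes f: "f \<in> hom F1 F3" and g: "g \<in> hom F2 F3"
  obtains P p q where "p \<in> hom P F1" "q \<in> hom P F2" "ptwise_pullback C f g p q"
proof -
  note p1 = Hom_Psh_presheaf(1)[OF f] and p2 = Hom_Psh_presheaf(1)[OF g]
  define V where "V a = {z. fst z \<in> val F1 a \<and> snd z \<in> val F2 a \<and> cmpt f a (fst z) = cmpt g a (snd z)}" for a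
  define A where "A h z = (act F1 h (fst z), act F2 h (snd z))" for h z
  have raw: "raw_presheaf V A"
    unfolding raw_presheaf_def
  proof (intro conjI ballI impI)
    fix a assume a: "a \<in> Obj C"
    have "small U (val F1 a \<times> val F2 a)"
      by (rule small_Sigma[OF universe val_small[OF p1 a] val_small[OF p2 a]])
    then show "small U (V a)" by (rule small_subset) (auto simp: V_def)
  next
    fix h z assume h: "h \<in> Arr C" and z: "z \<in> V (Cod C h)"
    then show "A h z \<in> V (Dom C h)"
      using p1 p2 cmpt_act[OF f h, of "fst z"] cmpt_act[OF g h, of "snd z"] by (simp add: A_def V_def)
  qed (use p1 p2 in \<open>auto simp: A_def V_def act_comp\<close>)
  obtain P e d where e: "encoding V A P e d" using encoding_exists[OF raw] by blast
  note P = enc_psh[OF e] and d = dec_in[OF e] enc_dec[OF e] and da = dec_act[OF raw e]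
  let ?p = "transf C P F1 (\<lambda>a s. fst (d a s))" and ?q = "transf C P F2 (\<lambda>a s. snd (d a s))"
  have p: "?p \<in> hom P F1"
    by (rule transf_hom[OF P p1]) (use d in \<open>auto simp: V_def da A_def\<close>)
  have q: "?q \<in> hom P F2"
    by (rule transf_hom[OF P p2]) (use d in \<open>auto simp: V_def da A_def\<close>)
  have "ptwise_pullback C f g ?p ?q"
    unfolding ptwise_pullback_def
  proof (intro ballI conjI impI)
    fix a z assume "a \<in> Obj C" "z \<in> val (src ?p) a"
    then show "cmpt f a (cmpt ?p a z) = cmpt g a (cmpt ?q a z)"
      using d(1)[of a z] by (simp add: V_def)
  next
    fix a x y assume a: "a \<in> Obj C" and xy: "x \<in> val (src f) a" "y \<in> val (src g) a" "cmpt f a x = cmpt g a y"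
    have v: "(x, y) \<in> V a" using xy by (simp add: V_def hom_src[OF f] hom_src[OF g])
    show "\<exists>!z. z \<in> val (src ?p) a \<and> cmpt ?p a z = x \<and> cmpt ?q a z = y"
    proof (rule ex1I[where a="e a (x, y)"])
      show "e a (x, y) \<in> val (src ?p) a \<and> cmpt ?p a (e a (x, y)) = x \<and> cmpt ?q a (e a (x, y)) = y"
        using enc_in[OF e a v] dec_enc[OF e a v] a by simp
      fix z assume z: "z \<in> val (src ?p) a \<and> cmpt ?p a z = x \<and> cmpt ?q a z = y"
      then have "d a z = (x, y)" using a by (auto intro: prod_eqI)
      then show "z = e a (x, y)" using d(2)[OF a, of z] z by simp
    qed
  qed
  then show ?thesis using that p q by blast
qed

lemma terminal_presheaf_exists: "\<exists>P. psh P \<and> (\<forall>a \<in> Obj C. \<exists>!s. s \<in> val P a)"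
proof -
  have "raw_presheaf (\<lambda>a. {()}) (\<lambda>f x. x)"
    unfolding raw_presheaf_def by (simp add: small_finite[OF universe])
  then obtain P d and e :: "'o \<Rightarrow> unit \<Rightarrow> 'u" where e: "encoding (\<lambda>a. {()}) (\<lambda>f x. x) P e d"
    using encoding_exists by blast
  have "\<exists>!s. s \<in> val P a" if "a \<in> Obj C" for a
    using enc_in[OF e that, of "()"] enc_dec[OF e that] by (metis unit_eq singletonI)
  then show ?thesis using enc_psh[OF e] by blast
qed

end

context sheaf_site
begin

lemma iso_Sh_iff:
  assumes "m \<in> Hom (Sh U C K) P Q"
  shows "is_iso (Sh U C K) m \<longleftrightarrow> ptwise_bij C m"
proof
  interpret S: category "Sh U C K" by (rule category_Sh)
  assume "is_iso (Sh U C K) m"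
  then obtain n where "n \<in> Hom (Sh U C K) Q P" "n \<odot>\<^bsub>Sh U C K\<^esub> m = Ide (Sh U C K) P"
    "m \<odot>\<^bsub>Sh U C K\<^esub> n = Ide (Sh U C K) Q" using S.is_isoE[OF _ assms] by blast
  then show "ptwise_bij C m" using assms by (intro ptwise_bij_iff_inverse[of m P Q n]) (auto simp: Hom_Sh)
next
  interpret S: category "Sh U C K" by (rule category_Sh)
  assume b: "ptwise_bij C m"
  have m: "m \<in> hom P Q" using assms by (simp add: Hom_Sh)
  obtain n where "n \<in> hom Q P" "n \<odot>\<^bsub>Psh U C\<^esub> m = Ide (Psh U C) P" "m \<odot>\<^bsub>Psh U C\<^esub> n = Ide (Psh U C) Q"
    using ptwise_bij_inverse[OF m b] .
  then show "is_iso (Sh U C K) m" using assms by (intro S.is_isoI[of m P Q n]) (auto simp: Hom_Sh simp del: Psh_simps)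
qed

text \<open>A compatible family in the pullback has two compatible families as projections; the glued sections
  agree in \<open>F3\<close> because they do so locally.\<close>

lemma ptwise_pullback_sheaf:
  assumes f: "f \<in> hom F1 F3" and g: "g \<in> hom F2 F3" and p: "p \<in> hom P F1" and q: "q \<in> hom P F2"
    and pb: "ptwise_pullback C f g p q"
    and F: "F1 \<in> sheaves U C K" "F2 \<in> sheaves U C K" "F3 \<in> sheaves U C K"
  shows "P \<in> sheaves U C K"
proof -
  note P = Hom_Psh_presheaf(1)[OF p]
  have Fp: "psh F1" "psh F2" "psh F3" using F sheaf_presheaf by auto
  have u: "\<exists>!z. z \<in> val P a \<and> cmpt p a z = x \<and> cmpt q a z = y"
    if "a \<in> Obj C" "x \<in> val F1 a" "y \<in> val F2 a" "cmpt f a x = cmpt g a y" for a x y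
    using pb that by (simp add: ptwise_pullback_def hom_src[OF f] hom_src[OF g] hom_src[OF p])
  have c: "cmpt f a (cmpt p a z) = cmpt g a (cmpt q a z)" if "a \<in> Obj C" "z \<in> val P a" for a z
    using pb that by (simp add: ptwise_pullback_def hom_src[OF p])
  show ?thesis
  proof (rule sheafI[OF P])
    fix a s t assume a: "a \<in> Obj C" and s: "s \<in> val P a" and t: "t \<in> val P a"
      and loc: "locally C K a (\<lambda>f. act P f s = act P f t)"
    have "cmpt p a s = cmpt p a t"
    proof (rule sheaf_separated[OF F(1)])
      show "locally C K a (\<lambda>f. act F1 f (cmpt p a s) = act F1 f (cmpt p a t))"
        by (rule locally_mono[OF loc]) (use cmpt_in[OF p] cmpt_act[OF p] s t a in auto)
    qed (use cmpt_in[OF p] s t a in auto)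
    moreover have "cmpt q a s = cmpt q a t"
    proof (rule sheaf_separated[OF F(2)])
      show "locally C K a (\<lambda>f. act F2 f (cmpt q a s) = act F2 f (cmpt q a t))"
        by (rule locally_mono[OF loc]) (use cmpt_in[OF q] cmpt_act[OF q] s t a in auto)
    qed (use cmpt_in[OF q] s t a in auto)
    ultimately show "s = t"
      using u[OF a cmpt_in[OF p a t] cmpt_in[OF q a t] c[OF a t]] s t by metis
  next
    fix a S x assume S: "(a, S) \<in> K" "is_sieve C a S" and x: "matching_family C P S x"
    have a: "a \<in> Obj C" using covering_obj[OF S(1)] .
    have xv: "x h \<in> val P (Dom C h)" if "h \<in> S" for h using x that unfolding matching_family_def by blast
    have xr: "act P k (x h) = x (h \<odot> k)" if "h \<in> S" "k \<in> Arr C" "Cod C k = Dom C h" for h k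
      using x that unfolding matching_family_def by blast
    have ar: "h \<in> Arr C" "Cod C h = a" if "h \<in> S" for h using sieve_arr[OF S(2) that] .
    have m1: "matching_family C F1 S (\<lambda>h. cmpt p (Dom C h) (x h))"
      unfolding matching_family_def
    proof (intro conjI ballI impI)
      fix h assume h: "h \<in> S"
      show "cmpt p (Dom C h) (x h) \<in> val F1 (Dom C h)" using cmpt_in[OF p _ xv[OF h]] ar[OF h] by simp
      fix k assume k: "k \<in> Arr C" "Cod C k = Dom C h"
      show "act F1 k (cmpt p (Dom C h) (x h)) = cmpt p (Dom C (h \<odot> k)) (x (h \<odot> k))"
        using cmpt_act[OF p k(1), of "x h"] xv[OF h] xr[OF h k] ar[OF h] k by simp
    qed
    have m2: "matching_family C F2 S (\<lambda>h. cmpt q (Dom C h) (x h))"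
      unfolding matching_family_def
    proof (intro conjI ballI impI)
      fix h assume h: "h \<in> S"
      show "cmpt q (Dom C h) (x h) \<in> val F2 (Dom C h)" using cmpt_in[OF q _ xv[OF h]] ar[OF h] by simp
      fix k assume k: "k \<in> Arr C" "Cod C k = Dom C h"
      show "act F2 k (cmpt q (Dom C h) (x h)) = cmpt q (Dom C (h \<odot> k)) (x (h \<odot> k))"
        using cmpt_act[OF q k(1), of "x h"] xv[OF h] xr[OF h k] ar[OF h] k by simp
    qed
    obtain y1 where y1: "y1 \<in> val F1 a" "\<And>h. h \<in> S \<Longrightarrow> act F1 h y1 = cmpt p (Dom C h) (x h)"
      using sheaf_glue[OF F(1) S(1) m1] by blast
    obtain y2 where y2: "y2 \<in> val F2 a" "\<And>h. h \<in> S \<Longrightarrow> act F2 h y2 = cmpt q (Dom C h) (x h)"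
      using sheaf_glue[OF F(2) S(1) m2] by blast
    have fy: "cmpt f a y1 = cmpt g a y2"
    proof (rule sheaf_separated[OF F(3)])
      have "locally C K a (\<lambda>h. h \<in> S)" using S sieve_locally[OF S(2)] by simp
      then show "locally C K a (\<lambda>h. act F3 h (cmpt f a y1) = act F3 h (cmpt g a y2))"
        by (rule locally_mono)
          (use cmpt_in[OF f] cmpt_in[OF g] cmpt_act[OF f] cmpt_act[OF g] y1 y2 a c xv in auto)
    qed (use cmpt_in[OF f] cmpt_in[OF g] y1 y2 a in auto)
    obtain z where z: "z \<in> val P a" "cmpt p a z = y1" "cmpt q a z = y2"
      using u[OF a y1(1) y2(1) fy] by blast
    have "act P h z = x h" if h: "h \<in> S" for h
    proof -
      note hh = ar[OF h]
      have d: "Dom C h \<in> Obj C" using hh by simp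
      have az: "act P h z \<in> val P (Dom C h)" using P hh z by simp
      have "cmpt p (Dom C h) (act P h z) = cmpt p (Dom C h) (x h)" "cmpt q (Dom C h) (act P h z) = cmpt q (Dom C h) (x h)"
        using cmpt_act[OF p hh(1), of z] cmpt_act[OF q hh(1), of z] hh z y1(2)[OF h] y2(2)[OF h] by auto
      then show ?thesis
        using u[OF d cmpt_in[OF p d xv[OF h]] cmpt_in[OF q d xv[OF h]] c[OF d xv[OF h]]] az xv[OF h] by metis
    qed
    then show "\<exists>s\<in>val P a. \<forall>f\<in>S. act P f s = x f" using z by blast
  qed
qed

text \<open>An isomorphism exhibits its source as a pullback of identities, so that invariance under isomorphism
  is an instance of the stability of sheaves under pullbacks.\<close>

lemma sheaf_transport:
  assumes m: "m \<in> hom P Q" and bij: "ptwise_bij C m" and P: "P \<in> sheaves U C K"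
  shows "Q \<in> sheaves U C K"
proof -
  obtain n where n: "n \<in> hom Q P" "ptwise_bij C n" by (rule ptwise_bij_inverse[OF m bij])
  have i: "Ide (Psh U C) P \<in> hom P P" using Ide_hom sheaf_presheaf[OF P] by blast
  have bj: "bij_betw (cmpt n a) (val Q a) (val P a)" if "a \<in> Obj C" for a
    using n that by (simp add: ptwise_bij_def hom_src[OF n(1)])
  have "\<exists>!z. z \<in> val Q a \<and> cmpt n a z = x \<and> cmpt n a z = x" if a: "a \<in> Obj C" and x: "x \<in> val P a" for a x
  proof -
    obtain z where "z \<in> val Q a" "cmpt n a z = x"
      using bij_betw_imp_surj_on[OF bj[OF a]] x by (metis imageE)
    then show ?thesis using bij_betw_imp_inj_on[OF bj[OF a]] by (auto dest: inj_onD)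
  qed
  then have "ptwise_pullback C (Ide (Psh U C) P) (Ide (Psh U C) P) n n"
    unfolding ptwise_pullback_def by (auto simp: hom_src[OF n(1)])
  from ptwise_pullback_sheaf[OF i i n(1) n(1) this P P P] show ?thesis .
qed

lemma ptwise_pullback_is_pullback:
  assumes f: "f \<in> Hom (Sh U C K) F1 F3" and g: "g \<in> Hom (Sh U C K) F2 F3"
    and p: "p \<in> hom P F1" and q: "q \<in> hom P F2" and P: "P \<in> sheaves U C K"
    and pb: "ptwise_pullback C f g p q"
  shows "is_pullback (Sh U C K) f g P p q"
proof -
  have f': "f \<in> hom F1 F3" and g': "g \<in> hom F2 F3" and F: "F1 \<in> sheaves U C K" "F2 \<in> sheaves U C K"
    using f g by (auto simp: Hom_Sh)
  note s = hom_src[OF f'] hom_src[OF g'] hom_src[OF p] hom_src[OF q]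
  have u: "\<exists>!z. z \<in> val P a \<and> cmpt p a z = x \<and> cmpt q a z = y"
    if "a \<in> Obj C" "x \<in> val F1 a" "y \<in> val F2 a" "cmpt f a x = cmpt g a y" for a x y
    using pb that by (simp add: ptwise_pullback_def s)
  have c: "cmpt f a (cmpt p a z) = cmpt g a (cmpt q a z)" if "a \<in> Obj C" "z \<in> val P a" for a z
    using pb that by (simp add: ptwise_pullback_def s)
  have comm: "f \<odot>\<^bsub>Psh U C\<^esub> p = g \<odot>\<^bsub>Psh U C\<^esub> q"
    by (rule Hom_Psh_eqI[OF comp_hom[OF p f'] comp_hom[OF q g']]) (auto simp: s c)
  have "\<exists>!m. m \<in> Hom (Sh U C K) A P \<and> p \<odot>\<^bsub>Psh U C\<^esub> m = x \<and> q \<odot>\<^bsub>Psh U C\<^esub> m = y"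
    if A: "A \<in> sheaves U C K" and x: "x \<in> hom A F1" and y: "y \<in> hom A F2"
      and xy: "f \<odot>\<^bsub>Psh U C\<^esub> x = g \<odot>\<^bsub>Psh U C\<^esub> y" for A x y
  proof -
    note sx = hom_src[OF x] hom_src[OF y]
    have A': "psh A" using A by (rule sheaf_presheaf)
    have P': "psh P" using P by (rule sheaf_presheaf)
    have cxy: "cmpt f a (cmpt x a s) = cmpt g a (cmpt y a s)" if "a \<in> Obj C" "s \<in> val A a" for a s
      using cmpt_comp_eq[OF xy that(1)] that by (simp add: sx)
    have uu: "\<exists>!z. z \<in> val P a \<and> cmpt p a z = cmpt x a s \<and> cmpt q a z = cmpt y a s"
      if "a \<in> Obj C" "s \<in> val A a" for a s
      using u[OF that(1) cmpt_in[OF x that] cmpt_in[OF y that] cxy[OF that]] .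
    define h where "h a s = (THE z. z \<in> val P a \<and> cmpt p a z = cmpt x a s \<and> cmpt q a z = cmpt y a s)" for a s
    have h: "h a s \<in> val P a" "cmpt p a (h a s) = cmpt x a s" "cmpt q a (h a s) = cmpt y a s"
      if "a \<in> Obj C" "s \<in> val A a" for a s
      using theI'[OF uu[OF that]] by (simp_all add: h_def)
    have hu: "z = h a s" if "a \<in> Obj C" "s \<in> val A a" "z \<in> val P a" "cmpt p a z = cmpt x a s" "cmpt q a z = cmpt y a s" for a s z
      using uu[OF that(1,2)] h[OF that(1,2)] that by blast
    have m: "transf C A P h \<in> hom A P"
    proof (rule transf_hom[OF A' P'])
      fix k s assume k: "k \<in> Arr C" and s: "s \<in> val A (Cod C k)"
      have "cmpt p (Dom C k) (act P k (h (Cod C k) s)) = cmpt x (Dom C k) (act A k s)"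
        "cmpt q (Dom C k) (act P k (h (Cod C k) s)) = cmpt y (Dom C k) (act A k s)"
        using cmpt_act[OF p k] cmpt_act[OF q k] cmpt_act[OF x k] cmpt_act[OF y k] h s k by (metis Cod_Obj)+
      then show "act P k (h (Cod C k) s) = h (Dom C k) (act A k s)"
        using h k s A' P' by (intro hu) auto
    qed (use h in auto)
    show ?thesis
    proof (rule ex1I[where a="transf C A P h"])
      show "transf C A P h \<in> Hom (Sh U C K) A P \<and> p \<odot>\<^bsub>Psh U C\<^esub> transf C A P h = x \<and> q \<odot>\<^bsub>Psh U C\<^esub> transf C A P h = y"
        using m A P Hom_Psh_eqI[OF comp_hom[OF m p] x] Hom_Psh_eqI[OF comp_hom[OF m q] y] by (auto simp: Hom_Sh h)
      fix n assume n: "n \<in> Hom (Sh U C K) A P \<and> p \<odot>\<^bsub>Psh U C\<^esub> n = x \<and> q \<odot>\<^bsub>Psh U C\<^esub> n = y"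
      then have n': "n \<in> hom A P" by (simp add: Hom_Sh)
      show "n = transf C A P h"
      proof (rule Hom_Psh_eqI[OF n' m])
        fix a s assume as: "a \<in> Obj C" "s \<in> val A a"
        have "cmpt p a (cmpt n a s) = cmpt x a s" "cmpt q a (cmpt n a s) = cmpt y a s"
          using cmpt_comp_eq[of U C p n x a s] cmpt_comp_eq[of U C q n y a s] n as hom_src[OF n'] by auto
        then show "cmpt n a s = cmpt (transf C A P h) a s"
          using as hu cmpt_in[OF n' as] by simp
      qed
    qed
  qed
  then show ?thesis
    unfolding is_pullback_def using f g p q P comm F by (auto simp: s Hom_Sh Arr_Sh)
qed

text \<open>The pointwise pullback exists and is a pullback of sheaves; any other one is isomorphic to it.\<close>

lemma pullback_Sh_iff:
  assumes f: "f \<in> Hom (Sh U C K) F1 F3" and g: "g \<in> Hom (Sh U C K) F2 F3"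
  shows "is_pullback (Sh U C K) f g P p q \<longleftrightarrow>
    P \<in> sheaves U C K \<and> p \<in> hom P F1 \<and> q \<in> hom P F2 \<and> ptwise_pullback C f g p q"
proof
  assume pb: "is_pullback (Sh U C K) f g P p q"
  have f': "f \<in> hom F1 F3" and g': "g \<in> hom F2 F3"
    and F: "F1 \<in> sheaves U C K" "F2 \<in> sheaves U C K" "F3 \<in> sheaves U C K"
    using f g by (auto simp: Hom_Sh)
  have p: "p \<in> hom P F1" and q: "q \<in> hom P F2" and P: "P \<in> sheaves U C K"
    using pb by (auto simp: is_pullback_def Hom_Sh hom_src[OF f'] hom_src[OF g'])
  obtain P' p' q' where p': "p' \<in> hom P' F1" and q': "q' \<in> hom P' F2" and pb': "ptwise_pullback C f g p' q'"
    using ptwise_pullback_exists[OF f' g'] .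
  have P': "P' \<in> sheaves U C K" by (rule ptwise_pullback_sheaf[OF f' g' p' q' pb' F])
  obtain m n where m: "m \<in> hom P P'" and n: "n \<in> hom P' P"
    and nm: "n \<odot>\<^bsub>Psh U C\<^esub> m = Ide (Psh U C) P" "m \<odot>\<^bsub>Psh U C\<^esub> n = Ide (Psh U C) P'"
    and pm: "p' \<odot>\<^bsub>Psh U C\<^esub> m = p" "q' \<odot>\<^bsub>Psh U C\<^esub> m = q"
    using pullback_unique_up_to_iso[OF category_Sh pb ptwise_pullback_is_pullback[OF f g p' q' P' pb']]
    by (auto simp: Hom_Sh simp del: Psh_simps)
  have bij: "bij_betw (cmpt m a) (val P a) (val P' a)" if "a \<in> Obj C" for a
    using ptwise_bij_iff_inverse[OF m n nm] that by (simp add: ptwise_bij_def hom_src[OF m])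
  have pe: "cmpt p a z = cmpt p' a (cmpt m a z)" "cmpt q a z = cmpt q' a (cmpt m a z)"
    if "a \<in> Obj C" "z \<in> val P a" for a z
    using cmpt_comp_eq[OF pm(1) that(1)] cmpt_comp_eq[OF pm(2) that(1)] that by (auto simp: hom_src[OF m])
  have "ptwise_pullback C f g p q"
    unfolding ptwise_pullback_def hom_src[OF p] hom_src[OF f'] hom_src[OF g']
  proof (intro ballI conjI impI)
    fix a z assume az: "a \<in> Obj C" "z \<in> val P a"
    then show "cmpt f a (cmpt p a z) = cmpt g a (cmpt q a z)"
      using pe[OF az] pb' cmpt_in[OF m az] unfolding ptwise_pullback_def hom_src[OF p'] by auto
  next
    fix a x y assume a: "a \<in> Obj C" and xy: "x \<in> val F1 a" "y \<in> val F2 a" "cmpt f a x = cmpt g a y"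
    then obtain z' where z': "z' \<in> val P' a" "cmpt p' a z' = x" "cmpt q' a z' = y"
      and u: "\<And>w. w \<in> val P' a \<Longrightarrow> cmpt p' a w = x \<Longrightarrow> cmpt q' a w = y \<Longrightarrow> w = z'"
      using pb' unfolding ptwise_pullback_def hom_src[OF p'] hom_src[OF f'] hom_src[OF g'] by metis
    obtain z where z: "z \<in> val P a" "cmpt m a z = z'" using bij_betw_imp_surj_on[OF bij[OF a]] z'(1) by (metis imageE)
    show "\<exists>!z. z \<in> val P a \<and> cmpt p a z = x \<and> cmpt q a z = y"
    proof (rule ex1I[where a=z])
      show "z \<in> val P a \<and> cmpt p a z = x \<and> cmpt q a z = y" using z z' pe a by auto
      fix w assume w: "w \<in> val P a \<and> cmpt p a w = x \<and> cmpt q a w = y"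
      then have "cmpt m a w = z'" using u pe a cmpt_in[OF m a] by auto
      then show "w = z" using bij[OF a] z w unfolding bij_betw_def inj_on_def by auto
    qed
  qed
  then show "P \<in> sheaves U C K \<and> p \<in> hom P F1 \<and> q \<in> hom P F2 \<and> ptwise_pullback C f g p q" using P p q by blast
qed (use ptwise_pullback_is_pullback[OF f g] in blast)

lemma terminal_Sh_iff:
  "is_terminal (Sh U C K) P \<longleftrightarrow> P \<in> sheaves U C K \<and> (\<forall>a \<in> Obj C. \<exists>!s. s \<in> val P a)"
proof
  have trm: "is_terminal (Sh U C K) T" if T: "T \<in> sheaves U C K" "\<And>a. a \<in> Obj C \<Longrightarrow> \<exists>!s. s \<in> val T a" for T
  proof -
    have Tp: "psh T" using T sheaf_presheaf by blast
    have "\<exists>!f. f \<in> hom Q T" if Q: "psh Q" for Q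
    proof -
      define h where "h a s = (THE z. z \<in> val T a)" for a and s :: 'u
      have h: "h a s \<in> val T a" "\<And>z. z \<in> val T a \<Longrightarrow> z = h a s" if "a \<in> Obj C" for a s
        using theI'[OF T(2)[OF that]] T(2)[OF that] unfolding h_def by blast+
      have t: "transf C Q T h \<in> hom Q T"
      proof (rule transf_hom[OF Q Tp])
        fix f s assume f: "f \<in> Arr C"
        show "act T f (h (Cod C f) s) = h (Dom C f) (act Q f s)"
          using h(1)[of "Cod C f"] f Tp by (intro h(2)) auto
      qed (use h in auto)
      show ?thesis
      proof (rule ex1I[where a="transf C Q T h"])
        show "transf C Q T h \<in> hom Q T" by (rule t)
      next
        fix f assume f: "f \<in> hom Q T"
        show "f = transf C Q T h" by (rule Hom_Psh_eqI[OF f t]) (use cmpt_in[OF f] h in auto)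
      qed
    qed
    then have "\<exists>!f. f \<in> Hom (Sh U C K) Q T" if "Q \<in> sheaves U C K" for Q
      using that T(1) sheaf_presheaf[OF that] by (simp add: Hom_Sh)
    then show ?thesis unfolding is_terminal_def using T by simp
  qed
  show "P \<in> sheaves U C K \<and> (\<forall>a \<in> Obj C. \<exists>!s. s \<in> val P a) \<Longrightarrow> is_terminal (Sh U C K) P" using trm by blast
  assume P: "is_terminal (Sh U C K) P"
  obtain T where T: "psh T" "\<And>a. a \<in> Obj C \<Longrightarrow> \<exists>!s. s \<in> val T a" using terminal_presheaf_exists by blast
  have "T \<in> sheaves U C K"
  proof (rule sheafI[OF T(1)])
    fix a S x assume S: "(a, S) \<in> K" "is_sieve C a S" and x: "matching_family C T S x"
    have a: "a \<in> Obj C" using covering_obj[OF S(1)] .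
    obtain s where s: "s \<in> val T a" using T(2)[OF a] by blast
    have "act T f s = x f" if "f \<in> S" for f
      using T(2)[of "Dom C f"] act_in[OF T(1), of f s] x that sieve_arr[OF S(2) that] s unfolding matching_family_def by auto
    then show "\<exists>s\<in>val T a. \<forall>f\<in>S. act T f s = x f" using s by blast
  qed (use T in blast)
  then have tt: "is_terminal (Sh U C K) T" using trm T by blast
  have PT: "P \<in> sheaves U C K" "T \<in> sheaves U C K" using P tt unfolding is_terminal_def by auto
  obtain m where m: "m \<in> hom P T" using tt PT unfolding is_terminal_def by (auto simp: Hom_Sh)
  obtain n where n: "n \<in> hom T P" using P PT unfolding is_terminal_def by (auto simp: Hom_Sh)
  have "\<exists>!f. f \<in> hom P P" using P PT unfolding is_terminal_def by (auto simp: Hom_Sh)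
  then have nm: "n \<odot>\<^bsub>Psh U C\<^esub> m = Ide (Psh U C) P"
    using comp_hom[OF m n] Ide_hom sheaf_presheaf[OF PT(1)] by blast
  have "\<exists>!s. s \<in> val P a" if a: "a \<in> Obj C" for a
  proof -
    obtain t where t: "t \<in> val T a" "\<And>w. w \<in> val T a \<Longrightarrow> w = t" using T(2)[OF a] by blast
    have "s = cmpt n a t" if "s \<in> val P a" for s
      using cmpt_comp_eq[OF nm a] a that hom_src[OF m] t(2)[OF cmpt_in[OF m a that]] by auto
    then show ?thesis using cmpt_in[OF n a t(1)] by blast
  qed
  then show "P \<in> sheaves U C K \<and> (\<forall>a \<in> Obj C. \<exists>!s. s \<in> val P a)" using PT by blast
qed

end

context sheaf_site
begin

text \<open>The sheaf condition may be verified on a raw presheaf, before it is encoded in the universe.\<close>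

lemma raw_sheaf_encoding:
  assumes raw: "raw_presheaf V A" and e: "encoding V A P e d"
    and sep: "\<And>a s t. a \<in> Obj C \<Longrightarrow> s \<in> V a \<Longrightarrow> t \<in> V a \<Longrightarrow> locally C K a (\<lambda>f. A f s = A f t) \<Longrightarrow> s = t"
    and glue: "\<And>a S x. (a, S) \<in> K \<Longrightarrow> is_sieve C a S \<Longrightarrow> (\<And>f. f \<in> S \<Longrightarrow> x f \<in> V (Dom C f)) \<Longrightarrow>
      (\<And>f g. f \<in> S \<Longrightarrow> g \<in> Arr C \<Longrightarrow> Cod C g = Dom C f \<Longrightarrow> A g (x f) = x (f \<odot> g)) \<Longrightarrow>
      \<exists>s \<in> V a. \<forall>f \<in> S. A f s = x f"
  shows "P \<in> sheaves U C K"
proof (rule sheafI[OF enc_psh[OF e]])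
  fix a s t assume a: "a \<in> Obj C" and s: "s \<in> val P a" and t: "t \<in> val P a"
    and loc: "locally C K a (\<lambda>f. act P f s = act P f t)"
  have "locally C K a (\<lambda>f. A f (d a s) = A f (d a t))"
  proof (rule locally_mono[OF loc])
    fix f assume "f \<in> Arr C" "Cod C f = a" "act P f s = act P f t"
    then show "A f (d a s) = A f (d a t)" using dec_act[OF raw e, of f s] dec_act[OF raw e, of f t] s t by simp
  qed
  then have "d a s = d a t" using sep[OF a dec_in[OF e a s] dec_in[OF e a t]] by simp
  then show "s = t" using enc_dec[OF e a s] enc_dec[OF e a t] by metis
next
  fix a S x assume S: "(a, S) \<in> K" "is_sieve C a S" and x: "matching_family C P S x"
  have a: "a \<in> Obj C" using covering_obj[OF S(1)] .
  have xv: "x h \<in> val P (Dom C h)" if "h \<in> S" for h using x that unfolding matching_family_def by blast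
  have xr: "act P k (x h) = x (h \<odot> k)" if "h \<in> S" "k \<in> Arr C" "Cod C k = Dom C h" for h k
    using x that unfolding matching_family_def by blast
  have ar: "h \<in> Arr C" "Cod C h = a" if "h \<in> S" for h using sieve_arr[OF S(2) that] .
  have "\<exists>s \<in> V a. \<forall>f \<in> S. A f s = d (Dom C f) (x f)"
  proof (rule glue[OF S])
    fix f assume f: "f \<in> S"
    show "d (Dom C f) (x f) \<in> V (Dom C f)" using dec_in[OF e _ xv[OF f]] ar[OF f] by simp
    fix g assume g: "g \<in> Arr C" "Cod C g = Dom C f"
    show "A g (d (Dom C f) (x f)) = d (Dom C (f \<odot> g)) (x (f \<odot> g))"
      using dec_act[OF raw e g(1), of "x f"] xv[OF f] xr[OF f g] g ar[OF f] by simp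
  qed
  then obtain s where s: "s \<in> V a" "\<forall>f \<in> S. A f s = d (Dom C f) (x f)" by blast
  have "act P f (e a s) = x f" if f: "f \<in> S" for f
    using act_enc[OF e ar(1)[OF f], of s] ar[OF f] s f enc_dec[OF e _ xv[OF f]] by simp
  then show "\<exists>s\<in>val P a. \<forall>f\<in>S. act P f s = x f" using enc_in[OF e a s(1)] by blast
qed

end

section \<open>Locally bijective morphisms\<close>

text \<open>The relation between a presheaf and its sheafification, in terms of elements.\<close>

definition locally_bijective :: "('o, 'm) cat \<Rightarrow> ('o \<times> 'm set) set \<Rightarrow> ('o, 'm, 'u) nattrans \<Rightarrow> bool" where
  "locally_bijective C K w \<longleftrightarrow> (\<forall>a \<in> Obj C.
    (\<forall>s \<in> val (src w) a. \<forall>t \<in> val (src w) a. cmpt w a s = cmpt w a t \<longrightarrow>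
      locally C K a (\<lambda>f. act (src w) f s = act (src w) f t)) \<and>
    (\<forall>y \<in> val (tgt w) a. locally C K a (\<lambda>f. \<exists>s \<in> val (src w) (Dom C f). act (tgt w) f y = cmpt w (Dom C f) s)))"

context sheaf_site
begin

lemma
  assumes "locally_bijective C K w" "w \<in> hom P Q" "a \<in> Obj C"
  shows locally_bijective_inj: "\<And>s t. s \<in> val P a \<Longrightarrow> t \<in> val P a \<Longrightarrow> cmpt w a s = cmpt w a t \<Longrightarrow>
      locally C K a (\<lambda>f. act P f s = act P f t)"
    and locally_bijective_surj: "\<And>y. y \<in> val Q a \<Longrightarrow>
      locally C K a (\<lambda>f. \<exists>s \<in> val P (Dom C f). act Q f y = cmpt w (Dom C f) s)"
  using assms hom_src[OF assms(2)] by (auto simp: locally_bijective_def)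

lemma sheaf_separated_hom:
  assumes G: "G \<in> sheaves U C K" and h: "h \<in> hom P G" and a: "a \<in> Obj C" and s: "s \<in> val P a" and t: "t \<in> val P a"
    and loc: "locally C K a (\<lambda>f. act P f s = act P f t)"
  shows "cmpt h a s = cmpt h a t"
proof (rule sheaf_separated[OF G cmpt_in[OF h a s] cmpt_in[OF h a t]])
  show "locally C K a (\<lambda>f. act G f (cmpt h a s) = act G f (cmpt h a t))"
    by (rule locally_mono[OF loc])
      (use cmpt_in[OF h] cmpt_act[OF h] s t a in auto)
qed

text \<open>Locally an element of \<open>Q\<close> has a preimage in \<open>P\<close>, and two preimages have the same image under \<open>h\<close>, as they
  agree locally and \<open>G\<close> is separated. So the images under \<open>h\<close> describe a section of \<open>G\<close>.\<close>

lemma locally_bijective_extend: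
  assumes w: "w \<in> hom P Q" and lb: "locally_bijective C K w"
    and G: "G \<in> sheaves U C K" and h: "h \<in> hom P G"
  shows "\<exists>!k. k \<in> hom Q G \<and> k \<odot>\<^bsub>Psh U C\<^esub> w = h"
proof -
  note Pp = Hom_Psh_presheaf[OF w]
  have Gp: "psh G" using G by (rule sheaf_presheaf)
  define R where "R a y f z \<longleftrightarrow> (\<exists>s \<in> val P (Dom C f). act Q f y = cmpt w (Dom C f) s \<and> z = cmpt h (Dom C f) s)" for a :: 'o and y f z
  have "\<exists>z \<in> val G a. \<forall>f z'. f \<in> Arr C \<longrightarrow> Cod C f = a \<longrightarrow> R a y f z' \<longrightarrow> act G f z = z'"
    if a: "a \<in> Obj C" and y: "y \<in> val Q a" for a y
  proof (rule sheaf_local_description[OF G])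
    show "locally C K a (\<lambda>f. \<exists>z. R a y f z)"
      using locally_bijective_surj[OF lb w a y] unfolding R_def
      by (simp add: Bex_def ex_comm[of "\<lambda>z s. s \<in> _ \<and> _ s \<and> z = _ s"]) 
  next
    fix f z assume "f \<in> Arr C" "R a y f z"
    then show "z \<in> val G (Dom C f)" using cmpt_in[OF h] unfolding R_def by auto
  next
    fix f g z assume f: "f \<in> Arr C" "Cod C f = a" and R: "R a y f z" and g: "g \<in> Arr C" "Cod C g = Dom C f"
    obtain s where s: "s \<in> val P (Dom C f)" "act Q f y = cmpt w (Dom C f) s" "z = cmpt h (Dom C f) s"
      using R unfolding R_def by blast
    have "act Q (f \<odot> g) y = cmpt w (Dom C g) (act P g s)"
      using act_comp[OF Pp(2) g(1) f(1), of y] cmpt_act[OF w g(1), of s] f g y s by simp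
    moreover have "act G g z = cmpt h (Dom C g) (act P g s)" using cmpt_act[OF h g(1), of s] g s by simp
    ultimately show "R a y (f \<odot> g) (act G g z)"
      unfolding R_def using act_in[OF Pp(1) g(1), of s] f g s by auto
  next
    fix f z z' assume f: "f \<in> Arr C" "Cod C f = a" and R: "R a y f z" "R a y f z'"
    obtain s where s: "s \<in> val P (Dom C f)" "act Q f y = cmpt w (Dom C f) s" "z = cmpt h (Dom C f) s"
      using R(1) unfolding R_def by blast
    obtain s' where s': "s' \<in> val P (Dom C f)" "act Q f y = cmpt w (Dom C f) s'" "z' = cmpt h (Dom C f) s'"
      using R(2) unfolding R_def by blast
    have d: "Dom C f \<in> Obj C" using f by simp
    have "locally C K (Dom C f) (\<lambda>g. act P g s = act P g s')"
      by (rule locally_bijective_inj[OF lb w d s(1) s'(1)]) (use s s' in simp)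
    then show "z = z'" using sheaf_separated_hom[OF G h d s(1) s'(1)] s s' by simp
  qed
  then have "\<exists>k. \<forall>a\<in>Obj C. \<forall>y\<in>val Q a. k a y \<in> val G a \<and>
      (\<forall>f z'. f \<in> Arr C \<longrightarrow> Cod C f = a \<longrightarrow> R a y f z' \<longrightarrow> act G f (k a y) = z')"
    by (intro exI[where x="\<lambda>a y. SOME z. z \<in> val G a \<and>
      (\<forall>f z'. f \<in> Arr C \<longrightarrow> Cod C f = a \<longrightarrow> R a y f z' \<longrightarrow> act G f z = z')"] ballI) (rule someI_ex, blast)
  then obtain k where k_in: "\<And>a y. a \<in> Obj C \<Longrightarrow> y \<in> val Q a \<Longrightarrow> k a y \<in> val G a"
    and kR: "\<And>a y f z'. a \<in> Obj C \<Longrightarrow> y \<in> val Q a \<Longrightarrow> f \<in> Arr C \<Longrightarrow> Cod C f = a \<Longrightarrow> R a y f z' \<Longrightarrow> act G f (k a y) = z'"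
    by blast
  have k_eq: "act G f (k (Cod C f) y) = cmpt h (Dom C f) s"
    if "f \<in> Arr C" "y \<in> val Q (Cod C f)" "s \<in> val P (Dom C f)" "act Q f y = cmpt w (Dom C f) s" for f y s
    by (rule kR[OF _ that(2,1)]) (use that in \<open>auto simp: R_def\<close>)
  have k: "transf C Q G k \<in> hom Q G"
  proof (rule transf_hom[OF Pp(2) Gp k_in])
    fix f y assume f: "f \<in> Arr C" and y: "y \<in> val Q (Cod C f)"
    have fy: "act Q f y \<in> val Q (Dom C f)" and d: "Dom C f \<in> Obj C" using f y Pp by auto
    have ky: "k (Cod C f) y \<in> val G (Cod C f)" "k (Dom C f) (act Q f y) \<in> val G (Dom C f)" using k_in f y fy by auto
    show "act G f (k (Cod C f) y) = k (Dom C f) (act Q f y)"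
    proof (rule sheaf_separated[OF G])
      show "locally C K (Dom C f) (\<lambda>g. act G g (act G f (k (Cod C f) y)) = act G g (k (Dom C f) (act Q f y)))"
      proof (rule locally_mono[OF locally_bijective_surj[OF lb w d fy]])
        fix g assume g: "g \<in> Arr C" "Cod C g = Dom C f" and "\<exists>s\<in>val P (Dom C g). act Q g (act Q f y) = cmpt w (Dom C g) s"
        then obtain s where s: "s \<in> val P (Dom C g)" "act Q g (act Q f y) = cmpt w (Dom C g) s" by blast
        have "act Q (f \<odot> g) y = cmpt w (Dom C g) s" using s act_comp[OF Pp(2) g(1) f] g y by simp
        then show "act G g (act G f (k (Cod C f) y)) = act G g (k (Dom C f) (act Q f y))"
          using k_eq[of "f \<odot> g" y s] k_eq[of g "act Q f y" s] s f g y fy act_comp[OF Gp g(1) f _ ky(1)] by simp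
      qed
    qed (use ky f Gp in auto)
  qed
  have kw: "transf C Q G k \<odot>\<^bsub>Psh U C\<^esub> w = h"
  proof (rule Hom_Psh_eqI[OF comp_hom[OF w k] h])
    fix a s assume a: "a \<in> Obj C" and s: "s \<in> val P a"
    have ws: "cmpt w a s \<in> val Q a" using cmpt_in[OF w a s] .
    have "act G (Ide C a) (k a (cmpt w a s)) = cmpt h a s"
      using k_eq[of "Ide C a" "cmpt w a s" s] a s ws Pp by simp
    then show "cmpt (transf C Q G k \<odot>\<^bsub>Psh U C\<^esub> w) a s = cmpt h a s"
      using a s ws k_in[OF a ws] Gp hom_src[OF w] by simp
  qed
  show ?thesis
  proof (rule ex1I[where a="transf C Q G k"])
    fix k' assume k': "k' \<in> hom Q G \<and> k' \<odot>\<^bsub>Psh U C\<^esub> w = h"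
    then have k'h: "k' \<in> hom Q G" by simp
    show "k' = transf C Q G k"
    proof (rule Hom_Psh_eqI[OF k'h k])
      fix a y assume a: "a \<in> Obj C" and y: "y \<in> val Q a"
      show "cmpt k' a y = cmpt (transf C Q G k) a y"
      proof (rule sheaf_separated[OF G cmpt_in[OF k'h a y] cmpt_in[OF k a y]])
        show "locally C K a (\<lambda>f. act G f (cmpt k' a y) = act G f (cmpt (transf C Q G k) a y))"
        proof (rule locally_mono[OF locally_bijective_surj[OF lb w a y]])
          fix f assume f: "f \<in> Arr C" "Cod C f = a" and "\<exists>s\<in>val P (Dom C f). act Q f y = cmpt w (Dom C f) s"
          then obtain s where s: "s \<in> val P (Dom C f)" "act Q f y = cmpt w (Dom C f) s" by blast
          have "act G f (cmpt k' a y) = cmpt h (Dom C f) s"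
            using cmpt_act[OF k'h f(1), of y] f y s cmpt_comp_eq[of U C k' w h "Dom C f" s] k' hom_src[OF w] by simp
          then show "act G f (cmpt k' a y) = act G f (cmpt (transf C Q G k) a y)"
            using k_eq[OF f(1) _ s] f y a by simp
        qed
      qed
    qed
  qed (use k kw in blast)
qed

end

section \<open>Sheafification\<close>

context sheaf_site
begin

text \<open>A section over \<open>a\<close> of the sheafification is represented by the set of all pairs \<open>(h, s)\<close> such that \<open>s\<close> is
  locally its restriction along \<open>h\<close>. Such a relation is closed for the topology, locally single-valued and
  locally defined. Closedness makes the representation unique, so there are no equivalence classes, and
  one step yields a sheaf, where the plus construction would need two.\<close>

definition loc_sec :: "('o, 'm, 'u) presheaf \<Rightarrow> 'o \<Rightarrow> ('m \<times> 'u) set set" where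
  "loc_sec P a = {A. (\<forall>(h, s) \<in> A. h \<in> Arr C \<and> Cod C h = a \<and> s \<in> val P (Dom C h)) \<and>
    (\<forall>h \<in> Arr C. Cod C h = a \<longrightarrow> (\<forall>s \<in> val P (Dom C h).
      (h, s) \<in> A \<longleftrightarrow> locally C K (Dom C h) (\<lambda>g. (h \<odot> g, act P g s) \<in> A))) \<and>
    (\<forall>h s t. (h, s) \<in> A \<longrightarrow> (h, t) \<in> A \<longrightarrow> locally C K (Dom C h) (\<lambda>g. act P g s = act P g t)) \<and>
    locally C K a (\<lambda>h. \<exists>s. (h, s) \<in> A)}"

definition loc_sec_act :: "('o, 'm, 'u) presheaf \<Rightarrow> 'm \<Rightarrow> ('m \<times> 'u) set \<Rightarrow> ('m \<times> 'u) set" where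
  "loc_sec_act P k A = {(h, s). h \<in> Arr C \<and> Cod C h = Dom C k \<and> s \<in> val P (Dom C h) \<and> (k \<odot> h, s) \<in> A}"

lemma
  assumes "A \<in> loc_sec P a"
  shows loc_sec_arr: "\<And>h s. (h, s) \<in> A \<Longrightarrow> h \<in> Arr C \<and> Cod C h = a \<and> s \<in> val P (Dom C h)"
    and loc_sec_closed: "\<And>h s. h \<in> Arr C \<Longrightarrow> Cod C h = a \<Longrightarrow> s \<in> val P (Dom C h) \<Longrightarrow>
      locally C K (Dom C h) (\<lambda>g. (h \<odot> g, act P g s) \<in> A) \<Longrightarrow> (h, s) \<in> A"
    and loc_sec_locally: "\<And>h s. (h, s) \<in> A \<Longrightarrow> locally C K (Dom C h) (\<lambda>g. (h \<odot> g, act P g s) \<in> A)"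
    and loc_sec_single: "\<And>h s t. (h, s) \<in> A \<Longrightarrow> (h, t) \<in> A \<Longrightarrow> locally C K (Dom C h) (\<lambda>g. act P g s = act P g t)"
    and loc_sec_total: "locally C K a (\<lambda>h. \<exists>s. (h, s) \<in> A)"
  using assms by (auto simp: loc_sec_def)

lemma loc_sec_restrict:
  assumes P: "psh P" and A: "A \<in> loc_sec P a" and hs: "(h, s) \<in> A" and g: "g \<in> Arr C" "Cod C g = Dom C h"
  shows "(h \<odot> g, act P g s) \<in> A"
proof -
  have h: "h \<in> Arr C" "Cod C h = a" "s \<in> val P (Dom C h)" using loc_sec_arr[OF A hs] by auto
  show ?thesis
  proof (rule loc_sec_closed[OF A])
    have "locally C K (Dom C g) (\<lambda>k. (h \<odot> (g \<odot> k), act P (g \<odot> k) s) \<in> A)"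
      using locally_pull[OF loc_sec_locally[OF A hs] g] .
    then show "locally C K (Dom C (h \<odot> g)) (\<lambda>k. ((h \<odot> g) \<odot> k, act P k (act P g s)) \<in> A)"
      using h g by (subst locally_cong[where \<Psi>="\<lambda>k. (h \<odot> (g \<odot> k), act P (g \<odot> k) s) \<in> A"]) (auto simp: act_comp[OF P])
  qed (use h g P in auto)
qed

lemma loc_sec_raw:
  assumes P: "psh P" shows "raw_presheaf (loc_sec P) (loc_sec_act P)"
  unfolding raw_presheaf_def
proof (intro conjI ballI impI)
  fix a assume a: "a \<in> Obj C"
  obtain T where T: "skeletal T" using skeletal_exists by blast
  let ?H = "\<Union>b\<in>T. Hom C b a"
  let ?B = "SIGMA h: ?H. val P (Dom C h)"
  let ?r = "\<lambda>A :: ('m \<times> 'u) set. A \<inter> {z. Dom C (fst z) \<in> T}"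
  have "small U ?H" by (rule small_UN[OF universe skeletal_small[OF T]], rule small_Hom) (use a skeletal_Obj[OF T] in auto)
  then have "small U ?B" by (rule small_Sigma[OF universe]) (auto simp: Hom_def intro: val_small[OF P])
  then have sB: "small U (Pow ?B)" by (rule small_Pow[OF universe])
  have sub: "A \<subseteq> A'" if A: "A \<in> loc_sec P a" and A': "A' \<in> loc_sec P a" and eq: "?r A = ?r A'" for A A'
  proof
    fix z assume z: "z \<in> A"
    obtain h s where hs: "z = (h, s)" by fastforce
    have h: "h \<in> Arr C" "Cod C h = a" "s \<in> val P (Dom C h)" using loc_sec_arr[OF A] z hs by auto
    obtain i j where ij: "i \<in> Arr C" "Dom C i = Dom C h" "Cod C i \<in> T" "j \<in> Arr C" "Dom C j = Cod C i"
      "Cod C j = Dom C h" "j \<odot> i = Ide C (Dom C h)" using skeletal_iso[OF T Dom_Obj[OF h(1)]] by blast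
    have "(h \<odot> j, act P j s) \<in> A" using loc_sec_restrict[OF P A] z hs ij by simp
    then have "(h \<odot> j, act P j s) \<in> ?r A" using h ij by simp
    then have jA: "(h \<odot> j, act P j s) \<in> A'" unfolding eq by simp
    have "((h \<odot> j) \<odot> i, act P i (act P j s)) \<in> A'" using loc_sec_restrict[OF P A' jA, of i] h ij by simp
    then show "z \<in> A'" using hs h ij by (simp add: act_comp[OF P] P)
  qed
  show "small U (loc_sec P a)"
  proof (rule small_inj[OF sB, where f="?r"])
    show "inj_on ?r (loc_sec P a)"
    proof (rule inj_onI)
      fix A A' assume "A \<in> loc_sec P a" "A' \<in> loc_sec P a" "?r A = ?r A'"
      then show "A = A'" using sub[of A A'] sub[of A' A] by auto
    qed
    show "?r ` loc_sec P a \<subseteq> Pow ?B"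
      using loc_sec_arr by (fastforce simp: Hom_def)
  qed
next
  fix k A assume k: "k \<in> Arr C" and A: "A \<in> loc_sec P (Cod C k)"
  show "loc_sec_act P k A \<in> loc_sec P (Dom C k)"
    unfolding loc_sec_def
  proof (intro CollectI conjI ballI allI impI)
    fix z assume "z \<in> loc_sec_act P k A"
    then show "case z of (h, s) \<Rightarrow> h \<in> Arr C \<and> Cod C h = Dom C k \<and> s \<in> val P (Dom C h)"
      by (auto simp: loc_sec_act_def)
  next
    fix h s assume h: "h \<in> Arr C" "Cod C h = Dom C k" and s: "s \<in> val P (Dom C h)"
    have "(h, s) \<in> loc_sec_act P k A \<longleftrightarrow> (k \<odot> h, s) \<in> A" using h s by (simp add: loc_sec_act_def)
    also have "\<dots> \<longleftrightarrow> locally C K (Dom C h) (\<lambda>g. ((k \<odot> h) \<odot> g, act P g s) \<in> A)"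
      using loc_sec_locally[OF A, of "k \<odot> h" s] loc_sec_closed[OF A, of "k \<odot> h" s] h k s by auto
    also have "\<dots> \<longleftrightarrow> locally C K (Dom C h) (\<lambda>g. (h \<odot> g, act P g s) \<in> loc_sec_act P k A)"
      using h k s P by (intro locally_cong) (auto simp: loc_sec_act_def intro: act_in')
    finally show "(h, s) \<in> loc_sec_act P k A \<longleftrightarrow> locally C K (Dom C h) (\<lambda>g. (h \<odot> g, act P g s) \<in> loc_sec_act P k A)" .
  next
    fix h s t assume "(h, s) \<in> loc_sec_act P k A" "(h, t) \<in> loc_sec_act P k A"
    then show "locally C K (Dom C h) (\<lambda>g. act P g s = act P g t)"
      using loc_sec_single[OF A, of "k \<odot> h" s t] k by (auto simp: loc_sec_act_def)
  next
    have "locally C K (Dom C k) (\<lambda>h. \<exists>s. (k \<odot> h, s) \<in> A)"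
      using locally_pull[OF loc_sec_total[OF A] k refl] .
    then show "locally C K (Dom C k) (\<lambda>h. \<exists>s. (h, s) \<in> loc_sec_act P k A)"
      using k loc_sec_arr[OF A] by (subst locally_cong[where \<Psi>="\<lambda>h. \<exists>s. (k \<odot> h, s) \<in> A"]) (fastforce simp: loc_sec_act_def)+
  qed
next
  fix a A assume a: "a \<in> Obj C" and A: "A \<in> loc_sec P a"
  have "(h, s) \<in> loc_sec_act P (Ide C a) A \<longleftrightarrow> (h, s) \<in> A" for h s
    using loc_sec_arr[OF A, of h s] comp_Ide(1)[of h] a unfolding loc_sec_act_def
    by (cases "h \<in> Arr C \<and> Cod C h = a") auto
  then show "loc_sec_act P (Ide C a) A = A" by (simp add: set_eq_iff split_paired_all)
next
  fix f g A assume "f \<in> Arr C" "g \<in> Arr C" "Cod C f = Dom C g" "A \<in> loc_sec P (Cod C g)"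
  then show "loc_sec_act P (g \<odot> f) A = loc_sec_act P f (loc_sec_act P g A)"
    by (auto simp: loc_sec_act_def)
qed

lemma loc_sec_separated:
  assumes P: "psh P" and A: "A \<in> loc_sec P a" and B: "B \<in> loc_sec P a"
    and loc: "locally C K a (\<lambda>f. loc_sec_act P f A = loc_sec_act P f B)"
  shows "A \<subseteq> B"
proof
  fix z assume z: "z \<in> A"
  obtain h s where hs: "z = (h, s)" by fastforce
  have h: "h \<in> Arr C" "Cod C h = a" "s \<in> val P (Dom C h)" using loc_sec_arr[OF A] z hs by auto
  have "(h, s) \<in> B"
  proof (rule loc_sec_closed[OF B h])
    show "locally C K (Dom C h) (\<lambda>g. (h \<odot> g, act P g s) \<in> B)"
    proof (rule locally_mono[OF locally_pull[OF loc h(1,2)]])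
      fix g assume g: "g \<in> Arr C" "Cod C g = Dom C h" and eq: "loc_sec_act P (h \<odot> g) A = loc_sec_act P (h \<odot> g) B"
      have d: "Dom C g \<in> Obj C" using g by simp
      have e: "(h \<odot> g) \<odot> Ide C (Dom C g) = h \<odot> g" using comp_Ide(2)[of "h \<odot> g"] g h by simp
      have "(Ide C (Dom C g), act P g s) \<in> loc_sec_act P (h \<odot> g) A"
        unfolding loc_sec_act_def using d e g h P loc_sec_restrict[OF P A, of h s g] z hs
        by (simp add: act_in' del: comp_assoc)
      then show "(h \<odot> g, act P g s) \<in> B" using eq e unfolding loc_sec_act_def by (simp del: comp_assoc)
    qed
  qed
  then show "z \<in> B" using hs by simp
qed

lemma loc_sec_glue:
  assumes P: "psh P" and S: "(a, S) \<in> K" "is_sieve C a S"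
    and x: "\<And>f. f \<in> S \<Longrightarrow> x f \<in> loc_sec P (Dom C f)"
    and xr: "\<And>f g. f \<in> S \<Longrightarrow> g \<in> Arr C \<Longrightarrow> Cod C g = Dom C f \<Longrightarrow> loc_sec_act P g (x f) = x (f \<odot> g)"
  shows "\<exists>A \<in> loc_sec P a. \<forall>f \<in> S. loc_sec_act P f A = x f"
proof -
  \<comment> \<open>\<open>Q h s g\<close>: along \<open>h \<odot> g\<close>, where the family is defined, \<open>s\<close> restricts to a value of its member;
    the glued relation \<open>A\<close> is the closure of this.\<close>
  define Q where "Q h s g \<longleftrightarrow> h \<odot> g \<in> S \<and> (Ide C (Dom C g), act P g s) \<in> x (h \<odot> g)" for h s g
  define A where "A = {(h, s). h \<in> Arr C \<and> Cod C h = a \<and> s \<in> val P (Dom C h) \<and> locally C K (Dom C h) (Q h s)}"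
  have ar: "h \<in> Arr C" "Cod C h = a" if "h \<in> S" for h using sieve_arr[OF S(2) that] .
  have locS: "locally C K a (\<lambda>f. f \<in> S)" using S sieve_locally[OF S(2)] by simp
  have x1: "(h, s) \<in> x f \<longleftrightarrow> (Ide C (Dom C h), s) \<in> x (f \<odot> h)"
    if f: "f \<in> S" and h: "h \<in> Arr C" "Cod C h = Dom C f" and s: "s \<in> val P (Dom C h)" for f h s
    unfolding xr[OF f h, symmetric] loc_sec_act_def using h s comp_Ide(2)[OF h(1)] by simp
  have Q_pull: "Q (h \<odot> g) (act P g s) k \<longleftrightarrow> Q h s (g \<odot> k)"
    if "h \<in> Arr C" "g \<in> Arr C" "Cod C g = Dom C h" "k \<in> Arr C" "Cod C k = Dom C g" "s \<in> val P (Dom C h)" for h g s k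
    using that by (simp add: Q_def act_comp[OF P])
  have A_restr: "loc_sec_act P f A = x f" if f: "f \<in> S" for f
  proof -
    note xf = x[OF f] and fa = ar[OF f]
    have "(h, s) \<in> loc_sec_act P f A \<longleftrightarrow> (h, s) \<in> x f"
      if h: "h \<in> Arr C" "Cod C h = Dom C f" and s: "s \<in> val P (Dom C h)" for h s
    proof -
      have "(h, s) \<in> loc_sec_act P f A \<longleftrightarrow> locally C K (Dom C h) (Q (f \<odot> h) s)"
        using h s fa by (simp add: loc_sec_act_def A_def)
      also have "\<dots> \<longleftrightarrow> locally C K (Dom C h) (\<lambda>g. (h \<odot> g, act P g s) \<in> x f)"
      proof (rule locally_cong)
        fix g assume g: "g \<in> Arr C" "Cod C g = Dom C h"
        have "f \<odot> (h \<odot> g) \<in> S" using sieve_closed[OF S(2) f, of "h \<odot> g"] h g by simp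
        then show "Q (f \<odot> h) s g = ((h \<odot> g, act P g s) \<in> x f)"
          using x1[OF f, of "h \<odot> g" "act P g s"] g h fa act_in'[OF P g(1) g(2) s] by (simp add: Q_def)
      qed
      also have "\<dots> \<longleftrightarrow> (h, s) \<in> x f" using loc_sec_closed[OF xf h s] loc_sec_locally[OF xf] by blast
      finally show ?thesis .
    qed
    moreover have "(h, s) \<in> loc_sec_act P f A \<Longrightarrow> h \<in> Arr C \<and> Cod C h = Dom C f \<and> s \<in> val P (Dom C h)" for h s
      by (simp add: loc_sec_act_def)
    ultimately have "(h, s) \<in> loc_sec_act P f A \<longleftrightarrow> (h, s) \<in> x f" for h s
      using loc_sec_arr[OF xf, of h s] by metis
    then show ?thesis by (simp add: set_eq_iff split_paired_all)
  qed
  have "A \<in> loc_sec P a"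
    unfolding loc_sec_def
  proof (intro CollectI conjI ballI allI impI)
    fix z assume "z \<in> A"
    then show "case z of (h, s) \<Rightarrow> h \<in> Arr C \<and> Cod C h = a \<and> s \<in> val P (Dom C h)" by (auto simp: A_def)
  next
    fix h s assume h: "h \<in> Arr C" "Cod C h = a" and s: "s \<in> val P (Dom C h)"
    have e: "(h \<odot> g, act P g s) \<in> A \<longleftrightarrow> locally C K (Dom C g) (\<lambda>k. Q h s (g \<odot> k))"
      if g: "g \<in> Arr C" "Cod C g = Dom C h" for g
    proof -
      have "(h \<odot> g, act P g s) \<in> A \<longleftrightarrow> locally C K (Dom C g) (Q (h \<odot> g) (act P g s))"
        using g h act_in'[OF P g s] by (simp add: A_def)
      also have "\<dots> \<longleftrightarrow> locally C K (Dom C g) (\<lambda>k. Q h s (g \<odot> k))"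
        by (rule locally_cong) (use Q_pull g h s in auto)
      finally show ?thesis .
    qed
    show "(h, s) \<in> A \<longleftrightarrow> locally C K (Dom C h) (\<lambda>g. (h \<odot> g, act P g s) \<in> A)"
    proof
      assume "(h, s) \<in> A"
      then have l: "locally C K (Dom C h) (Q h s)" by (simp add: A_def)
      show "locally C K (Dom C h) (\<lambda>g. (h \<odot> g, act P g s) \<in> A)"
        by (rule locally_triv) (use h e locally_pull[OF l] in auto)
    next
      assume l: "locally C K (Dom C h) (\<lambda>g. (h \<odot> g, act P g s) \<in> A)"
      have "locally C K (Dom C h) (Q h s)"
        by (rule locally_trans[OF l]) (use e in auto)
      then show "(h, s) \<in> A" using h s by (simp add: A_def)
    qed
  next
    fix h s t assume hs: "(h, s) \<in> A" and ht: "(h, t) \<in> A"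
    have h: "h \<in> Arr C" "Cod C h = a" "s \<in> val P (Dom C h)" "t \<in> val P (Dom C h)" using hs ht by (auto simp: A_def)
    have "locally C K (Dom C h) (\<lambda>g. Q h s g \<and> Q h t g)"
      using hs ht by (intro locally_conj) (auto simp: A_def)
    then show "locally C K (Dom C h) (\<lambda>g. act P g s = act P g t)"
    proof (rule locally_trans)
      fix g assume g: "g \<in> Arr C" "Cod C g = Dom C h" and q: "Q h s g \<and> Q h t g"
      have "locally C K (Dom C g) (\<lambda>k. act P k (act P g s) = act P k (act P g t))"
        using loc_sec_single[OF x, of "h \<odot> g" "Ide C (Dom C g)" "act P g s" "act P g t"] q g h by (simp add: Q_def)
      then show "locally C K (Dom C g) (\<lambda>k. act P (g \<odot> k) s = act P (g \<odot> k) t)"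
        by (rule subst[OF locally_cong, rotated]) (use g h in \<open>simp add: act_comp[OF P]\<close>)
    qed
  next
    show "locally C K a (\<lambda>h. \<exists>s. (h, s) \<in> A)"
    proof (rule locally_trans[OF locS])
      fix f assume f: "f \<in> Arr C" "Cod C f = a" "f \<in> S"
      have "(f \<odot> h, s) \<in> A" if "(h, s) \<in> x f" for h s
        using that unfolding A_restr[OF f(3), symmetric] by (simp add: loc_sec_act_def)
      then show "locally C K (Dom C f) (\<lambda>g. \<exists>s. (f \<odot> g, s) \<in> A)"
        by (intro locally_mono[OF loc_sec_total[OF x[OF f(3)]]]) blast
    qed
  qed
  then show ?thesis using A_restr by blast
qed

definition loc_sec_unit :: "('o, 'm, 'u) presheaf \<Rightarrow> 'o \<Rightarrow> 'u \<Rightarrow> ('m \<times> 'u) set" where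
  "loc_sec_unit P a s = {(h, t). h \<in> Arr C \<and> Cod C h = a \<and> t \<in> val P (Dom C h) \<and>
    locally C K (Dom C h) (\<lambda>g. act P (h \<odot> g) s = act P g t)}"

lemma loc_sec_unit_in:
  assumes P: "psh P" and a: "a \<in> Obj C" and s: "s \<in> val P a"
  shows "loc_sec_unit P a s \<in> loc_sec P a"
  unfolding loc_sec_def
proof (intro CollectI conjI ballI allI impI)
  fix z assume "z \<in> loc_sec_unit P a s"
  then show "case z of (h, s) \<Rightarrow> h \<in> Arr C \<and> Cod C h = a \<and> s \<in> val P (Dom C h)" by (auto simp: loc_sec_unit_def)
next
  fix h t assume h: "h \<in> Arr C" "Cod C h = a" and t: "t \<in> val P (Dom C h)"
  have sh: "act P h s \<in> val P (Dom C h)" using act_in'[OF P h s] .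
  have c: "act P (h \<odot> g) s = act P g (act P h s)" if "g \<in> Arr C" "Cod C g = Dom C h" for g
    using that h s by (simp add: act_comp[OF P])
  have e0: "(h, t) \<in> loc_sec_unit P a s \<longleftrightarrow> locally C K (Dom C h) (\<lambda>g. act P g (act P h s) = act P g t)"
    unfolding loc_sec_unit_def using h t by (simp add: locally_cong[of "Dom C h", OF arg_cong2[where f="(=)", OF c refl]])
  have e: "(h \<odot> g, act P g t) \<in> loc_sec_unit P a s \<longleftrightarrow>
      locally C K (Dom C g) (\<lambda>k. act P (g \<odot> k) (act P h s) = act P (g \<odot> k) t)"
    if g: "g \<in> Arr C" "Cod C g = Dom C h" for g
  proof -
    have "(h \<odot> g, act P g t) \<in> loc_sec_unit P a s \<longleftrightarrow>
      locally C K (Dom C g) (\<lambda>k. act P ((h \<odot> g) \<odot> k) s = act P k (act P g t))"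
      unfolding loc_sec_unit_def using h g act_in'[OF P g t] by simp
    also have "\<dots> \<longleftrightarrow> locally C K (Dom C g) (\<lambda>k. act P (g \<odot> k) (act P h s) = act P (g \<odot> k) t)"
      by (rule locally_cong) (use g h t s in \<open>simp add: act_comp[OF P]\<close>)
    finally show ?thesis .
  qed
  show "(h, t) \<in> loc_sec_unit P a s \<longleftrightarrow> locally C K (Dom C h) (\<lambda>g. (h \<odot> g, act P g t) \<in> loc_sec_unit P a s)"
  proof
    assume "(h, t) \<in> loc_sec_unit P a s"
    then have l: "locally C K (Dom C h) (\<lambda>g. act P g (act P h s) = act P g t)" using e0 by simp
    show "locally C K (Dom C h) (\<lambda>g. (h \<odot> g, act P g t) \<in> loc_sec_unit P a s)"
      by (rule locally_triv) (use h e locally_pull[OF l] in auto)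
  next
    assume l: "locally C K (Dom C h) (\<lambda>g. (h \<odot> g, act P g t) \<in> loc_sec_unit P a s)"
    have "locally C K (Dom C h) (\<lambda>g. act P g (act P h s) = act P g t)"
      by (rule locally_trans[OF l]) (use e in auto)
    then show "(h, t) \<in> loc_sec_unit P a s" using e0 by simp
  qed
next
  fix h t t' assume t: "(h, t) \<in> loc_sec_unit P a s" and t': "(h, t') \<in> loc_sec_unit P a s"
  have "locally C K (Dom C h) (\<lambda>g. act P (h \<odot> g) s = act P g t \<and> act P (h \<odot> g) s = act P g t')"
    using t t' by (intro locally_conj) (auto simp: loc_sec_unit_def)
  then show "locally C K (Dom C h) (\<lambda>g. act P g t = act P g t')"
    by (rule locally_mono) (use t t' in \<open>auto simp: loc_sec_unit_def\<close>)
next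
  have "(h, act P h s) \<in> loc_sec_unit P a s" if h: "h \<in> Arr C" "Cod C h = a" for h
    unfolding loc_sec_unit_def using h act_in'[OF P h s] s by (auto intro!: locally_triv simp: act_comp[OF P])
  then show "locally C K a (\<lambda>h. \<exists>s'. (h, s') \<in> loc_sec_unit P a s)"
    by (intro locally_triv[OF a]) blast
qed

lemma loc_sec_unit_act:
  assumes P: "psh P" and k: "k \<in> Arr C" and s: "s \<in> val P (Cod C k)"
  shows "loc_sec_act P k (loc_sec_unit P (Cod C k) s) = loc_sec_unit P (Dom C k) (act P k s)"
proof -
  have "locally C K (Dom C h) (\<lambda>g. act P ((k \<odot> h) \<odot> g) s = act P g t) \<longleftrightarrow>
    locally C K (Dom C h) (\<lambda>g. act P (h \<odot> g) (act P k s) = act P g t)"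
    if h: "h \<in> Arr C" "Cod C h = Dom C k" for h t
    by (rule locally_cong) (use h k s in \<open>simp add: act_comp[OF P]\<close>)
  then show ?thesis using k by (auto simp: loc_sec_act_def loc_sec_unit_def)
qed

text \<open>Where a local section has a value, it is the image of that value; this is the local surjectivity of the
  unit of sheafification.\<close>

lemma loc_sec_local:
  assumes P: "psh P" and A: "A \<in> loc_sec P a" and f: "(f, s) \<in> A"
  shows "loc_sec_act P f A = loc_sec_unit P (Dom C f) s"
proof -
  have fa: "f \<in> Arr C" "Cod C f = a" and s: "s \<in> val P (Dom C f)" using loc_sec_arr[OF A f] by auto
  have "(f \<odot> h, t) \<in> A \<longleftrightarrow> locally C K (Dom C h) (\<lambda>g. act P (h \<odot> g) s = act P g t)"
    if h: "h \<in> Arr C" "Cod C h = Dom C f" and t: "t \<in> val P (Dom C h)" for h t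
  proof
    assume "(f \<odot> h, t) \<in> A"
    from loc_sec_single[OF A loc_sec_restrict[OF P A f h] this] h fa
    have "locally C K (Dom C h) (\<lambda>g. act P g (act P h s) = act P g t)" by simp
    then show "locally C K (Dom C h) (\<lambda>g. act P (h \<odot> g) s = act P g t)"
      by (rule subst[OF locally_cong, rotated]) (use h s in \<open>simp add: act_comp[OF P]\<close>)
  next
    assume l: "locally C K (Dom C h) (\<lambda>g. act P (h \<odot> g) s = act P g t)"
    have "locally C K (Dom C (f \<odot> h)) (\<lambda>g. ((f \<odot> h) \<odot> g, act P g t) \<in> A)"
      unfolding comp_Arr(2)[OF h(1) fa(1) h(2)]
    proof (rule locally_mono[OF l])
      fix g assume g: "g \<in> Arr C" "Cod C g = Dom C h" "act P (h \<odot> g) s = act P g t"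
      then show "((f \<odot> h) \<odot> g, act P g t) \<in> A"
        using loc_sec_restrict[OF P A f, of "h \<odot> g"] h fa by simp
    qed
    then show "(f \<odot> h, t) \<in> A" using loc_sec_closed[OF A, of "f \<odot> h" t] h fa t by simp
  qed
  then show ?thesis by (auto simp: loc_sec_act_def loc_sec_unit_def)
qed

lemma sheafification_exists:
  assumes P: "psh P"
  shows "\<exists>w F. F \<in> sheaves U C K \<and> w \<in> hom P F \<and> locally_bijective C K w"
proof -
  note raw = loc_sec_raw[OF P]
  obtain F e d where e: "encoding (loc_sec P) (loc_sec_act P) F e d" using encoding_exists[OF raw] by blast
  have F: "F \<in> sheaves U C K"
  proof (rule raw_sheaf_encoding[OF raw e])
    fix a s t assume "s \<in> loc_sec P a" "t \<in> loc_sec P a" "locally C K a (\<lambda>f. loc_sec_act P f s = loc_sec_act P f t)"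
    then show "s = t" using loc_sec_separated[OF P, of s a t] loc_sec_separated[OF P, of t a s] by (simp add: eq_commute)
  qed (rule loc_sec_glue[OF P])
  let ?w = "transf C P F (\<lambda>a s. e a (loc_sec_unit P a s))"
  have w: "?w \<in> hom P F"
    by (rule transf_hom[OF P enc_psh[OF e]])
      (simp_all add: enc_in[OF e] loc_sec_unit_in[OF P] act_enc[OF e] loc_sec_unit_act[OF P])
  have "locally_bijective C K ?w"
    unfolding locally_bijective_def transf_simps
  proof (intro ballI conjI impI)
    fix a s t assume a: "a \<in> Obj C" and s: "s \<in> val P a" and t: "t \<in> val P a" and eq: "cmpt ?w a s = cmpt ?w a t"
    have "loc_sec_unit P a s = loc_sec_unit P a t"
    proof -
      have "e a (loc_sec_unit P a s) = e a (loc_sec_unit P a t)" using eq a s t by simp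
      then show ?thesis using dec_enc[OF e a loc_sec_unit_in[OF P a s]] dec_enc[OF e a loc_sec_unit_in[OF P a t]] by metis
    qed
    moreover have "(Ide C a, t) \<in> loc_sec_unit P a t"
      using a t comp_Ide(1) by (auto simp: loc_sec_unit_def intro!: locally_triv)
    ultimately have "(Ide C a, t) \<in> loc_sec_unit P a s" by metis
    then have "locally C K a (\<lambda>g. act P (Ide C a \<odot> g) s = act P g t)"
      using a by (simp add: loc_sec_unit_def)
    then show "locally C K a (\<lambda>f. act P f s = act P f t)"
      by (rule subst[OF locally_cong, rotated]) (use comp_Ide(1) in auto)
  next
    fix a y assume a: "a \<in> Obj C" and y: "y \<in> val F a"
    let ?A = "d a y"
    have A: "?A \<in> loc_sec P a" using dec_in[OF e a y] .
    show "locally C K a (\<lambda>f. \<exists>s\<in>val P (Dom C f). act F f y = cmpt ?w (Dom C f) s)"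
    proof (rule locally_mono[OF loc_sec_total[OF A]])
      fix f assume f: "f \<in> Arr C" "Cod C f = a" and "\<exists>s. (f, s) \<in> ?A"
      then obtain s where s: "(f, s) \<in> ?A" by blast
      have sv: "s \<in> val P (Dom C f)" using loc_sec_arr[OF A s] by simp
      have "act F f y = e (Dom C f) (loc_sec_act P f ?A)"
        using act_enc[OF e f(1), of ?A] enc_dec[OF e a y] A f by simp
      then have "act F f y = cmpt ?w (Dom C f) s" using loc_sec_local[OF P A s] sv f by simp
      then show "\<exists>s\<in>val P (Dom C f). act F f y = cmpt ?w (Dom C f) s" using sv by blast
    qed
  qed
  then show ?thesis using F w by blast
qed

end

section \<open>Composing embeddings of subtoposes\<close>

lemma is_functor_comp:
  assumes F: "is_functor C D F" and G: "is_functor D E G"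
  shows "is_functor C E (comp_functor G F)"
proof -
  have "FA G (FA F (g \<odot>\<^bsub>C\<^esub> f)) = FA G (FA F g) \<odot>\<^bsub>E\<^esub> FA G (FA F f)"
    if "f \<in> Arr C" "g \<in> Arr C" "Cod C f = Dom C g" for f g
  proof -
    have f: "f \<in> Hom C (Dom C f) (Cod C f)" and g: "g \<in> Hom C (Cod C f) (Cod C g)"
      using that by (auto simp: Hom_def)
    show ?thesis using functor_comp[OF F f g] functor_comp[OF G functor_Hom[OF F f] functor_Hom[OF F g]] by simp
  qed
  then show ?thesis
    unfolding is_functor_def[of C E] comp_functor_def
    using functor_Obj[OF F] functor_Obj[OF G] functor_Ide[OF F] functor_Ide[OF G]
    by (simp add: HomI functor_Arr[OF F] functor_Arr[OF G])
qed

lemma adjunction_comp: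
  assumes D: "category D" and E: "category E" and F: "category F"
    and adj: "adjunction D E L R \<eta> \<epsilon>" and adj': "adjunction E F L' R' \<eta>' \<epsilon>'"
  shows "\<exists>\<eta>'' \<epsilon>''. adjunction D F (comp_functor L' L) (comp_functor R R') \<eta>'' \<epsilon>''"
proof -
  interpret D: category D by fact
  interpret E: category E by fact
  interpret F: category F by fact
  have L: "is_functor D E L" and R: "is_functor E D R" and L': "is_functor E F L'" and R': "is_functor F E R'"
    and eta: "\<And>a. a \<in> Obj D \<Longrightarrow> \<eta> a \<in> Hom D a (FO R (FO L a))"
    and etan: "\<And>f a b. f \<in> Hom D a b \<Longrightarrow> FA R (FA L f) \<odot>\<^bsub>D\<^esub> \<eta> a = \<eta> b \<odot>\<^bsub>D\<^esub> f"
    and eta': "\<And>a. a \<in> Obj E \<Longrightarrow> \<eta>' a \<in> Hom E a (FO R' (FO L' a))"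
    and etan': "\<And>f a b. f \<in> Hom E a b \<Longrightarrow> FA R' (FA L' f) \<odot>\<^bsub>E\<^esub> \<eta>' a = \<eta>' b \<odot>\<^bsub>E\<^esub> f"
    using adj adj' by (auto simp: adjunction_def natural_def id_functor_def comp_functor_def Hom_def)
  define u where "u a = FA R (\<eta>' (FO L a)) \<odot>\<^bsub>D\<^esub> \<eta> a" for a
  have Reta': "FA R (\<eta>' (FO L a)) \<in> Hom D (FO R (FO L a)) (FO R (FO R' (FO L' (FO L a))))" if "a \<in> Obj D" for a
    using functor_Hom[OF R eta'[OF functor_Obj[OF L that]]] .
  have u: "u a \<in> Hom D a (FO R (FO R' (FO L' (FO L a))))" if "a \<in> Obj D" for a
    using D.Cmp_in[OF eta Reta'] that by (simp add: u_def)
  have fun1: "is_functor D F (comp_functor L' L)" and fun2: "is_functor F D (comp_functor R R')"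
    using is_functor_comp[OF L L'] is_functor_comp[OF R' R] by auto
  have nat: "natural D D id_functor (comp_functor (comp_functor R R') (comp_functor L' L)) u"
    unfolding natural_def comp_functor_def id_functor_def
  proof (simp add: u, intro ballI)
    fix f assume "f \<in> Arr D"
    then have f: "f \<in> Hom D (Dom D f) (Cod D f)" (is "f \<in> Hom D ?a ?b") by (simp add: Hom_def)
    have a: "?a \<in> Obj D" and b: "?b \<in> Obj D" using D.Hom_Obj[OF f] by auto
    let ?g = "FA R (FA R' (FA L' (FA L f)))"
    have Lf: "FA L f \<in> Hom E (FO L ?a) (FO L ?b)" using functor_Hom[OF L f] .
    have h: "FA R' (FA L' (FA L f)) \<in> Hom E (FO R' (FO L' (FO L ?a))) (FO R' (FO L' (FO L ?b)))"
      using functor_Hom[OF R' functor_Hom[OF L' Lf]] .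
    note La = functor_Obj[OF L a] functor_Obj[OF L b]
    have "?g \<odot>\<^bsub>D\<^esub> u ?a = (?g \<odot>\<^bsub>D\<^esub> FA R (\<eta>' (FO L ?a))) \<odot>\<^bsub>D\<^esub> \<eta> ?a"
      unfolding u_def using D.Cmp_assoc[OF eta[OF a] Reta'[OF a] functor_Hom[OF R h]] by simp
    also have "\<dots> = (FA R (\<eta>' (FO L ?b)) \<odot>\<^bsub>D\<^esub> FA R (FA L f)) \<odot>\<^bsub>D\<^esub> \<eta> ?a"
      using functor_comp[OF R eta'[OF La(1)] h] functor_comp[OF R Lf eta'[OF La(2)]] etan'[OF Lf] by simp
    also have "\<dots> = u ?b \<odot>\<^bsub>D\<^esub> f"
      unfolding u_def using D.Cmp_assoc[OF eta[OF a] functor_Hom[OF R Lf] Reta'[OF b]] etan[OF f]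
        D.Cmp_assoc[OF f eta[OF b] Reta'[OF b]] by simp
    finally show "?g \<odot>\<^bsub>D\<^esub> u ?a = u ?b \<odot>\<^bsub>D\<^esub> f" .
  qed
  have "\<exists>\<epsilon>''. adjunction D F (comp_functor L' L) (comp_functor R R') u \<epsilon>''"
  proof (rule natural_universal_arrows_adjunction[OF D F fun1 fun2 nat])
    fix a c h assume a: "a \<in> Obj D" and c: "c \<in> Obj F" and "h \<in> Hom D a (FO (comp_functor R R') c)"
    then have h: "h \<in> Hom D a (FO R (FO R' c))" by (simp add: comp_functor_def)
    have La: "FO L a \<in> Obj E" and R'c: "FO R' c \<in> Obj E" using functor_Obj L R' a c by metis+
    obtain k where k: "k \<in> Hom E (FO L a) (FO R' c)" "FA R k \<odot>\<^bsub>D\<^esub> \<eta> a = h"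
      and ku: "\<And>k'. k' \<in> Hom E (FO L a) (FO R' c) \<Longrightarrow> FA R k' \<odot>\<^bsub>D\<^esub> \<eta> a = h \<Longrightarrow> k' = k"
      using adjunction_left_universal[OF D E adj a R'c h] by blast
    obtain l where l: "l \<in> Hom F (FO L' (FO L a)) c" "FA R' l \<odot>\<^bsub>E\<^esub> \<eta>' (FO L a) = k"
      and lu: "\<And>l'. l' \<in> Hom F (FO L' (FO L a)) c \<Longrightarrow> FA R' l' \<odot>\<^bsub>E\<^esub> \<eta>' (FO L a) = k \<Longrightarrow> l' = l"
      using adjunction_left_universal[OF E F adj' La c k(1)] by blast
    have eq: "FA R (FA R' l') \<odot>\<^bsub>D\<^esub> u a = FA R (FA R' l' \<odot>\<^bsub>E\<^esub> \<eta>' (FO L a)) \<odot>\<^bsub>D\<^esub> \<eta> a"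
      if "l' \<in> Hom F (FO L' (FO L a)) c" for l'
      unfolding u_def using functor_comp[OF R eta'[OF La] functor_Hom[OF R' that]]
        D.Cmp_assoc[OF eta[OF a] Reta'[OF a] functor_Hom[OF R functor_Hom[OF R' that]]] by simp
    have "\<exists>!l. l \<in> Hom F (FO L' (FO L a)) c \<and> FA R (FA R' l) \<odot>\<^bsub>D\<^esub> u a = h"
    proof (rule ex1I[where a=l])
      show "l \<in> Hom F (FO L' (FO L a)) c \<and> FA R (FA R' l) \<odot>\<^bsub>D\<^esub> u a = h" using eq[OF l(1)] l k by simp
      fix l' assume l': "l' \<in> Hom F (FO L' (FO L a)) c \<and> FA R (FA R' l') \<odot>\<^bsub>D\<^esub> u a = h"
      then have "FA R' l' \<odot>\<^bsub>E\<^esub> \<eta>' (FO L a) = k"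
        using ku E.Cmp_in[OF eta'[OF La] functor_Hom[OF R']] eq by auto
      then show "l' = l" using lu l' by simp
    qed
    then show "\<exists>!k. k \<in> Hom F (FO (comp_functor L' L) a) c \<and> FA (comp_functor R R') k \<odot>\<^bsub>D\<^esub> u a = h"
      by (simp add: comp_functor_def)
  qed
  then show ?thesis by blast
qed

lemma left_exact_comp: "left_exact C D F \<Longrightarrow> left_exact D E G \<Longrightarrow> left_exact C E (comp_functor G F)"
  unfolding left_exact_def using is_functor_comp[of C D F E G] by (simp add: comp_functor_def)

lemma isomorphic_full_subcat:
  assumes "category E" "a \<in> T" "b \<in> T"
  shows "isomorphic (full_subcat E T) a b \<longleftrightarrow> isomorphic E a b"
proof -
  have "is_iso (full_subcat E T) f \<longleftrightarrow> is_iso E f" if "f \<in> Hom E a b" for f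
    using HomD[OF that] assms(2,3) by (simp add: is_iso_def Bex_def Hom_full_subcat)
  then show ?thesis
    using assms(2,3) unfolding isomorphic_def Bex_def Hom_full_subcat by blast
qed

lemma ST_trans:
  assumes E: "category E" and T: "T \<in> ST E" and S: "S \<in> ST (full_subcat E T)"
  shows "S \<in> ST E"
proof -
  have ST: "S \<subseteq> T" "S \<subseteq> Obj E" using S by (auto simp: ST_def)
  obtain r where r: "left_exact E (full_subcat E T) r" "\<exists>\<eta> \<epsilon>. adjunction E (full_subcat E T) r id_functor \<eta> \<epsilon>"
    using T by (auto simp: ST_def geometric_morphism_def)
  obtain r' where r': "left_exact (full_subcat E T) (full_subcat E S) r'"
    "\<exists>\<eta> \<epsilon>. adjunction (full_subcat E T) (full_subcat E S) r' id_functor \<eta> \<epsilon>"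
    using S by (auto simp: ST_def geometric_morphism_def full_subcat_full_subcat[OF ST(1)])
  have "comp_functor id_functor id_functor = id_functor" by (simp add: comp_functor_def id_functor_def)
  then have "\<exists>\<eta> \<epsilon>. adjunction E (full_subcat E S) (comp_functor r' r) id_functor \<eta> \<epsilon>"
    using adjunction_comp[OF E category_full_subcat[OF E] category_full_subcat[OF E]] r(2) r'(2) by metis
  moreover have "left_exact E (full_subcat E S) (comp_functor r' r)" using left_exact_comp[OF r(1) r'(1)] .
  moreover have "b \<in> S" if "a \<in> S" "b \<in> Obj E" "isomorphic E a b" for a b
  proof -
    have "b \<in> T" using T that ST unfolding ST_def by blast
    then show ?thesis using S that ST isomorphic_full_subcat[OF E, of a T b] by (auto simp: ST_def)
  qed
  ultimately show ?thesis using ST unfolding ST_def geometric_morphism_def by auto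
qed

section \<open>Sheaves for a topology form a subtopos\<close>

context sheaf_site
begin

lemma sheafification_adjunction:
  assumes J: "is_topology C J" and JK: "J \<subseteq> K"
  shows "\<exists>r \<eta> \<epsilon>. adjunction (Sh U C J) (Sh U C K) r id_functor \<eta> \<epsilon> \<and>
    (\<forall>P \<in> sheaves U C J. locally_bijective C K (\<eta> P))"
proof -
  interpret J: sheaf_site C U J using J by unfold_locales
  have KJ: "sheaves U C K \<subseteq> sheaves U C J" using sheaves_antimono[OF JK] .
  have "\<forall>P \<in> sheaves U C J. \<exists>w F. F \<in> sheaves U C K \<and> w \<in> hom P F \<and> locally_bijective C K w"
    using sheafification_exists sheaf_presheaf by blast
  then obtain w F where wF: "\<And>P. P \<in> sheaves U C J \<Longrightarrow> F P \<in> sheaves U C K \<and> w P \<in> hom P (F P) \<and> locally_bijective C K (w P)"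
    by metis
  have "is_functor (Sh U C K) (Sh U C J) id_functor"
    unfolding is_functor_def id_functor_def using KJ by (auto simp: Arr_Sh J.Hom_Sh)
  then have "\<exists>r \<epsilon>. FO r = F \<and> adjunction (Sh U C J) (Sh U C K) r id_functor w \<epsilon>"
  proof (rule universal_arrows_left_adjoint[OF J.category_Sh category_Sh])
    fix P G h assume P: "P \<in> Obj (Sh U C J)" and G: "G \<in> Obj (Sh U C K)" and h: "h \<in> Hom (Sh U C J) P (FO id_functor G)"
    have "\<exists>!k. k \<in> hom (F P) G \<and> k \<odot>\<^bsub>Psh U C\<^esub> w P = h"
      using locally_bijective_extend[of "w P" P "F P" G h] wF[of P] P G h by (auto simp: J.Hom_Sh id_functor_def)
    then show "\<exists>!k. k \<in> Hom (Sh U C K) (F P) G \<and> FA id_functor k \<odot>\<^bsub>Sh U C J\<^esub> w P = h"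
      using wF[of P] P G by (simp add: Hom_Sh id_functor_def)
  qed (use wF KJ in \<open>auto simp: J.Hom_Sh id_functor_def\<close>)
  then show ?thesis using wF by blast
qed

text \<open>Elements of a sheafification come locally from the presheaf, and coincide if preimages do so locally.
  Hence existence and uniqueness in a pullback of sheafifications are inherited, locally, from the pullback
  of presheaves, and then hold since the objects are sheaves.\<close>

lemma sheafification_left_exact:
  assumes J: "is_topology C J"
    and adj: "adjunction (Sh U C J) (Sh U C K) r id_functor \<eta> \<epsilon>"
    and lb: "\<And>P. P \<in> sheaves U C J \<Longrightarrow> locally_bijective C K (\<eta> P)"
  shows "left_exact (Sh U C J) (Sh U C K) r"
proof -
  interpret J: sheaf_site C U J using J by unfold_locales
  have r: "is_functor (Sh U C J) (Sh U C K) r" using adj by (simp add: adjunction_def)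
  have eta: "\<eta> P \<in> hom P (FO r P)" if "P \<in> sheaves U C J" for P
    using adj that by (auto simp: adjunction_def natural_def id_functor_def comp_functor_def J.Hom_Sh)
  have rO: "FO r P \<in> sheaves U C K" if "P \<in> sheaves U C J" for P using functor_Obj[OF r] that by simp
  have rH: "FA r k \<in> hom (FO r P) (FO r Q)" if "k \<in> Hom (Sh U C J) P Q" for k P Q
    using functor_Hom[OF r that] by (simp add: Hom_Sh)
  have nat: "cmpt (FA r k) a (cmpt (\<eta> P) a s) = cmpt (\<eta> Q) a (cmpt k a s)"
    if k: "k \<in> Hom (Sh U C J) P Q" and a: "a \<in> Obj C" and s: "s \<in> val P a" for k P Q a s
  proof -
    have kk: "k \<in> hom P Q" and P: "P \<in> sheaves U C J" using k by (auto simp: J.Hom_Sh)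
    have "FA r k \<odot>\<^bsub>Psh U C\<^esub> \<eta> P = \<eta> Q \<odot>\<^bsub>Psh U C\<^esub> k"
      using adj k by (auto simp: adjunction_def natural_def id_functor_def comp_functor_def Hom_def)
    from cmpt_comp_eq[OF this a] show ?thesis using a s hom_src[OF eta[OF P]] hom_src[OF kk] by simp
  qed
  have "is_terminal (Sh U C K) (FO r t)" if t: "is_terminal (Sh U C J) t" for t
  proof -
    have tJ: "t \<in> sheaves U C J" and t1: "\<And>a. a \<in> Obj C \<Longrightarrow> \<exists>!s. s \<in> val t a"
      using t J.terminal_Sh_iff by auto
    have "x = y" if a: "a \<in> Obj C" and x: "x \<in> val (FO r t) a" and y: "y \<in> val (FO r t) a" for a x y
    proof (rule sheaf_separated[OF rO[OF tJ] x y])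
      note ls = locally_bijective_surj[OF lb[OF tJ] eta[OF tJ] a]
      show "locally C K a (\<lambda>f. act (FO r t) f x = act (FO r t) f y)"
      proof (rule locally_mono[OF locally_conj[OF ls[OF x] ls[OF y]]])
        fix f assume f: "f \<in> Arr C"
          and "(\<exists>s\<in>val t (Dom C f). act (FO r t) f x = cmpt (\<eta> t) (Dom C f) s) \<and>
            (\<exists>s\<in>val t (Dom C f). act (FO r t) f y = cmpt (\<eta> t) (Dom C f) s)"
        then obtain s s' where "s \<in> val t (Dom C f)" "act (FO r t) f x = cmpt (\<eta> t) (Dom C f) s"
          "s' \<in> val t (Dom C f)" "act (FO r t) f y = cmpt (\<eta> t) (Dom C f) s'" by blast
        then show "act (FO r t) f x = act (FO r t) f y" using t1[OF Dom_Obj[OF f]] by metis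
      qed
    qed
    moreover have "\<exists>x. x \<in> val (FO r t) a" if "a \<in> Obj C" for a
      using t1[OF that] cmpt_in[OF eta[OF tJ] that] by blast
    ultimately show ?thesis using terminal_Sh_iff rO[OF tJ] by blast
  qed
  moreover have "is_pullback (Sh U C K) (FA r f) (FA r g) (FO r P) (FA r p) (FA r q)"
    if pbJ: "is_pullback (Sh U C J) f g P p q" for f g P p q
  proof -
    define F1 F2 F3 where "F1 = src f" and "F2 = src g" and "F3 = tgt f"
    have f: "f \<in> Hom (Sh U C J) F1 F3" and g: "g \<in> Hom (Sh U C J) F2 F3"
      using pbJ unfolding is_pullback_def F1_def F2_def F3_def by (auto simp: J.Hom_Sh J.Arr_Sh)
    have pb: "ptwise_pullback C f g p q" and P: "P \<in> sheaves U C J" and p: "p \<in> hom P F1" and q: "q \<in> hom P F2"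
      using pbJ J.pullback_Sh_iff[OF f g] by auto
    have F: "F1 \<in> sheaves U C J" "F2 \<in> sheaves U C J" "F3 \<in> sheaves U C J"
      and f': "f \<in> hom F1 F3" and g': "g \<in> hom F2 F3" using f g by (auto simp: J.Hom_Sh)
    have pS: "p \<in> Hom (Sh U C J) P F1" and qS: "q \<in> Hom (Sh U C J) P F2" using p q P F by (auto simp: J.Hom_Sh)
    have Fp: "psh F1" "psh F2" "psh F3" "psh P" using F P sheaf_presheaf by auto
    have rFp: "psh (FO r F1)" "psh (FO r F2)" "psh (FO r F3)" "psh (FO r P)"
      using F P rO sheaf_presheaf by blast+
    have u: "\<exists>!z. z \<in> val P a \<and> cmpt p a z = x \<and> cmpt q a z = y"
      if "a \<in> Obj C" "x \<in> val F1 a" "y \<in> val F2 a" "cmpt f a x = cmpt g a y" for a x y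
      using pb that by (simp add: ptwise_pullback_def hom_src[OF f'] hom_src[OF g'] hom_src[OF p])
    have c: "cmpt f a (cmpt p a z) = cmpt g a (cmpt q a z)" if "a \<in> Obj C" "z \<in> val P a" for a z
      using pb that by (simp add: ptwise_pullback_def hom_src[OF p])
    have comm: "cmpt (FA r f) a (cmpt (FA r p) a z) = cmpt (FA r g) a (cmpt (FA r q) a z)"
      if a: "a \<in> Obj C" and z: "z \<in> val (FO r P) a" for a z
    proof -
      have "f \<odot>\<^bsub>Sh U C J\<^esub> p = g \<odot>\<^bsub>Sh U C J\<^esub> q" using pbJ by (simp add: is_pullback_def)
      then have "FA r f \<odot>\<^bsub>Psh U C\<^esub> FA r p = FA r g \<odot>\<^bsub>Psh U C\<^esub> FA r q"
        using functor_comp[OF r pS f] functor_comp[OF r qS g] by simp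
      from cmpt_comp_eq[OF this a] show ?thesis
        using a z hom_src[OF rH[OF pS]] hom_src[OF rH[OF qS]] by simp
    qed
    have inj: "z = z'"
      if a: "a \<in> Obj C" and z: "z \<in> val (FO r P) a" and z': "z' \<in> val (FO r P) a"
        and e1: "cmpt (FA r p) a z = cmpt (FA r p) a z'" and e2: "cmpt (FA r q) a z = cmpt (FA r q) a z'" for a z z'
    proof (rule sheaf_separated[OF rO[OF P] z z'])
      note ls = locally_bijective_surj[OF lb[OF P] eta[OF P] a]
      show "locally C K a (\<lambda>f. act (FO r P) f z = act (FO r P) f z')"
      proof (rule locally_mono[OF locally_conj[OF ls[OF z] ls[OF z']]])
        fix h assume h: "h \<in> Arr C" "Cod C h = a"
          and "(\<exists>s\<in>val P (Dom C h). act (FO r P) h z = cmpt (\<eta> P) (Dom C h) s) \<and>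
            (\<exists>s\<in>val P (Dom C h). act (FO r P) h z' = cmpt (\<eta> P) (Dom C h) s)"
        then obtain s s' where s: "s \<in> val P (Dom C h)" "act (FO r P) h z = cmpt (\<eta> P) (Dom C h) s"
          and s': "s' \<in> val P (Dom C h)" "act (FO r P) h z' = cmpt (\<eta> P) (Dom C h) s'" by blast
        have d: "Dom C h \<in> Obj C" using h by simp
        have l1: "locally C K (Dom C h) (\<lambda>k. act F1 k (cmpt p (Dom C h) s) = act F1 k (cmpt p (Dom C h) s'))"
        proof (rule locally_bijective_inj[OF lb[OF F(1)] eta[OF F(1)] d])
          show "cmpt (\<eta> F1) (Dom C h) (cmpt p (Dom C h) s) = cmpt (\<eta> F1) (Dom C h) (cmpt p (Dom C h) s')"
            using nat[OF pS d s(1)] nat[OF pS d s'(1)] s s' e1 h z z'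
              cmpt_act[OF rH[OF pS] h(1), of z] cmpt_act[OF rH[OF pS] h(1), of z'] by simp
        qed (use cmpt_in[OF p d] s s' in auto)
        have l2: "locally C K (Dom C h) (\<lambda>k. act F2 k (cmpt q (Dom C h) s) = act F2 k (cmpt q (Dom C h) s'))"
        proof (rule locally_bijective_inj[OF lb[OF F(2)] eta[OF F(2)] d])
          show "cmpt (\<eta> F2) (Dom C h) (cmpt q (Dom C h) s) = cmpt (\<eta> F2) (Dom C h) (cmpt q (Dom C h) s')"
            using nat[OF qS d s(1)] nat[OF qS d s'(1)] s s' e2 h z z'
              cmpt_act[OF rH[OF qS] h(1), of z] cmpt_act[OF rH[OF qS] h(1), of z'] by simp
        qed (use cmpt_in[OF q d] s s' in auto)
        have "locally C K (Dom C h) (\<lambda>k. act P k s = act P k s')"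
        proof (rule locally_mono[OF locally_conj[OF l1 l2]])
          fix k assume k: "k \<in> Arr C" "Cod C k = Dom C h"
            and "act F1 k (cmpt p (Dom C h) s) = act F1 k (cmpt p (Dom C h) s') \<and>
              act F2 k (cmpt q (Dom C h) s) = act F2 k (cmpt q (Dom C h) s')"
          then have e: "cmpt p (Dom C k) (act P k s) = cmpt p (Dom C k) (act P k s')"
            "cmpt q (Dom C k) (act P k s) = cmpt q (Dom C k) (act P k s')"
            using cmpt_act[OF p k(1)] cmpt_act[OF q k(1)] s s' by auto
          have dk: "Dom C k \<in> Obj C" and v: "act P k s \<in> val P (Dom C k)" "act P k s' \<in> val P (Dom C k)"
            using k s s' Fp(4) act_in' by auto
          show "act P k s = act P k s'"
            using u[OF dk cmpt_in[OF p dk v(1)] cmpt_in[OF q dk v(1)] c[OF dk v(1)]] v e by metis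
        qed
        then show "act (FO r P) h z = act (FO r P) h z'"
          using sheaf_separated_hom[OF rO[OF P] eta[OF P] d s(1) s'(1)] s s' by simp
      qed
    qed
    have surj: "\<exists>z. z \<in> val (FO r P) a \<and> cmpt (FA r p) a z = x \<and> cmpt (FA r q) a z = y"
      if a: "a \<in> Obj C" and x: "x \<in> val (FO r F1) a" and y: "y \<in> val (FO r F2) a"
        and xy: "cmpt (FA r f) a x = cmpt (FA r g) a y" for a x y
    proof -
      define R where "R h z \<longleftrightarrow> z \<in> val (FO r P) (Dom C h) \<and> cmpt (FA r p) (Dom C h) z = act (FO r F1) h x \<and>
        cmpt (FA r q) (Dom C h) z = act (FO r F2) h y" for h z
      have R_restr: "R (h \<odot> k) (act (FO r P) k z)"
        if h: "h \<in> Arr C" "Cod C h = a" and R: "R h z" and k: "k \<in> Arr C" "Cod C k = Dom C h" for h k z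
        using R h k x y cmpt_act[OF rH[OF pS] k(1), of z] cmpt_act[OF rH[OF qS] k(1), of z] rFp act_in'[OF rFp(4) k]
        unfolding R_def by (simp add: act_comp)
      have d1: "locally C K a (\<lambda>h. (\<exists>s\<in>val F1 (Dom C h). act (FO r F1) h x = cmpt (\<eta> F1) (Dom C h) s) \<and>
          (\<exists>s\<in>val F2 (Dom C h). act (FO r F2) h y = cmpt (\<eta> F2) (Dom C h) s))"
        using locally_conj[OF locally_bijective_surj[OF lb[OF F(1)] eta[OF F(1)] a x]
          locally_bijective_surj[OF lb[OF F(2)] eta[OF F(2)] a y]] .
      have loc: "locally C K a (\<lambda>h. \<exists>z. R h z)"
      proof (rule locally_trans[OF d1])
        fix h assume h: "h \<in> Arr C" "Cod C h = a"
          and "(\<exists>s\<in>val F1 (Dom C h). act (FO r F1) h x = cmpt (\<eta> F1) (Dom C h) s) \<and>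
          (\<exists>s\<in>val F2 (Dom C h). act (FO r F2) h y = cmpt (\<eta> F2) (Dom C h) s)"
        then obtain s t where s: "s \<in> val F1 (Dom C h)" "act (FO r F1) h x = cmpt (\<eta> F1) (Dom C h) s"
          and t: "t \<in> val F2 (Dom C h)" "act (FO r F2) h y = cmpt (\<eta> F2) (Dom C h) t" by blast
        have d: "Dom C h \<in> Obj C" using h by simp
        have l3: "locally C K (Dom C h) (\<lambda>k. act F3 k (cmpt f (Dom C h) s) = act F3 k (cmpt g (Dom C h) t))"
        proof (rule locally_bijective_inj[OF lb[OF F(3)] eta[OF F(3)] d])
          show "cmpt (\<eta> F3) (Dom C h) (cmpt f (Dom C h) s) = cmpt (\<eta> F3) (Dom C h) (cmpt g (Dom C h) t)"
            using nat[OF f d s(1)] nat[OF g d t(1)] s t xy h x y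
              cmpt_act[OF rH[OF f] h(1), of x] cmpt_act[OF rH[OF g] h(1), of y] by simp
        qed (use cmpt_in[OF f' d] cmpt_in[OF g' d] s t in auto)
        show "locally C K (Dom C h) (\<lambda>k. \<exists>z. R (h \<odot> k) z)"
        proof (rule locally_mono[OF l3])
          fix k assume k: "k \<in> Arr C" "Cod C k = Dom C h" and e: "act F3 k (cmpt f (Dom C h) s) = act F3 k (cmpt g (Dom C h) t)"
          have dk: "Dom C k \<in> Obj C" using k by simp
          have sk: "act F1 k s \<in> val F1 (Dom C k)" "act F2 k t \<in> val F2 (Dom C k)"
            using act_in'[OF Fp(1) k s(1)] act_in'[OF Fp(2) k t(1)] by auto
          have "cmpt f (Dom C k) (act F1 k s) = cmpt g (Dom C k) (act F2 k t)"
            using e cmpt_act[OF f' k(1), of s] cmpt_act[OF g' k(1), of t] k s t by simp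
          then obtain z where z: "z \<in> val P (Dom C k)" "cmpt p (Dom C k) z = act F1 k s" "cmpt q (Dom C k) z = act F2 k t"
            using u[OF dk sk] by blast
          have "cmpt (FA r p) (Dom C k) (cmpt (\<eta> P) (Dom C k) z) = act (FO r F1) (h \<odot> k) x"
            using nat[OF pS dk z(1)] z(2) cmpt_act[OF eta[OF F(1)] k(1), of s] s k h x act_comp[OF rFp(1) k(1) h(1), of x] by simp
          moreover have "cmpt (FA r q) (Dom C k) (cmpt (\<eta> P) (Dom C k) z) = act (FO r F2) (h \<odot> k) y"
            using nat[OF qS dk z(1)] z(3) cmpt_act[OF eta[OF F(2)] k(1), of t] t k h y act_comp[OF rFp(2) k(1) h(1), of y] by simp
          ultimately have "R (h \<odot> k) (cmpt (\<eta> P) (Dom C k) z)"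
            unfolding R_def using cmpt_in[OF eta[OF P] dk z(1)] k h by simp
          then show "\<exists>z. R (h \<odot> k) z" by blast
        qed
      qed
      have "\<exists>z \<in> val (FO r P) a. \<forall>f z'. f \<in> Arr C \<longrightarrow> Cod C f = a \<longrightarrow> R f z' \<longrightarrow> act (FO r P) f z = z'"
      proof (rule sheaf_local_description[OF rO[OF P] loc])
        fix h z z' assume h: "h \<in> Arr C" "Cod C h = a" and "R h z" "R h z'"
        then show "z = z'" using inj[of "Dom C h" z z'] unfolding R_def by simp
      qed (use R_restr in \<open>auto simp: R_def\<close>)
      then obtain z where z: "z \<in> val (FO r P) a" and zR: "\<And>h z'. h \<in> Arr C \<Longrightarrow> Cod C h = a \<Longrightarrow> R h z' \<Longrightarrow> act (FO r P) h z = z'"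
        by blast
      have "cmpt (FA r p) a z = x"
      proof (rule sheaf_separated[OF rO[OF F(1)] cmpt_in[OF rH[OF pS] a z] x])
        show "locally C K a (\<lambda>h. act (FO r F1) h (cmpt (FA r p) a z) = act (FO r F1) h x)"
          by (rule locally_mono[OF loc])
            (use zR z cmpt_act[OF rH[OF pS], of _ z] in \<open>auto simp: R_def\<close>)
      qed
      moreover have "cmpt (FA r q) a z = y"
      proof (rule sheaf_separated[OF rO[OF F(2)] cmpt_in[OF rH[OF qS] a z] y])
        show "locally C K a (\<lambda>h. act (FO r F2) h (cmpt (FA r q) a z) = act (FO r F2) h y)"
          by (rule locally_mono[OF loc])
            (use zR z cmpt_act[OF rH[OF qS], of _ z] in \<open>auto simp: R_def\<close>)
      qed
      ultimately show ?thesis using z by blast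
    qed
    have "ptwise_pullback C (FA r f) (FA r g) (FA r p) (FA r q)"
      unfolding ptwise_pullback_def hom_src[OF rH[OF f]] hom_src[OF rH[OF g]] hom_src[OF rH[OF pS]]
    proof (intro ballI conjI impI)
      fix a x y assume a: "a \<in> Obj C" and xy: "x \<in> val (FO r F1) a" "y \<in> val (FO r F2) a" "cmpt (FA r f) a x = cmpt (FA r g) a y"
      show "\<exists>!z. z \<in> val (FO r P) a \<and> cmpt (FA r p) a z = x \<and> cmpt (FA r q) a z = y"
        by (rule ex_ex1I[OF surj[OF a xy]]) (use inj[OF a] in auto)
    qed (use comm in auto)
    then show ?thesis
      using pullback_Sh_iff[OF functor_Hom[OF r f] functor_Hom[OF r g]] rO[OF P] rH[OF pS] rH[OF qS] by simp
  qed
  ultimately show ?thesis using r unfolding left_exact_def by blast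
qed

lemma full_subcat_Sh: "J \<subseteq> K \<Longrightarrow> full_subcat (Sh U C J) (sheaves U C K) = Sh U C K"
  unfolding Sh_def by (rule full_subcat_full_subcat[OF sheaves_antimono])

lemma sheaves_ST:
  assumes J: "is_topology C J" and JK: "J \<subseteq> K"
  shows "sheaves U C K \<in> ST (Sh U C J)"
proof -
  interpret J: sheaf_site C U J using J by unfold_locales
  obtain r \<eta> \<epsilon> where adj: "adjunction (Sh U C J) (Sh U C K) r id_functor \<eta> \<epsilon>"
    and lb: "\<And>P. P \<in> sheaves U C J \<Longrightarrow> locally_bijective C K (\<eta> P)"
    using sheafification_adjunction[OF J JK] by blast
  have "geometric_morphism (full_subcat (Sh U C J) (sheaves U C K)) (Sh U C J) \<lparr>inv_im = r, dir_im = id_functor\<rparr>"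
    unfolding geometric_morphism_def full_subcat_Sh[OF JK]
    using sheafification_left_exact[OF J adj lb] adj by auto
  moreover have "Q \<in> sheaves U C K" if P: "P \<in> sheaves U C K" and Q: "Q \<in> sheaves U C J" and iso: "isomorphic (Sh U C J) P Q" for P Q
  proof -
    obtain m where m: "m \<in> Hom (Sh U C J) P Q" "is_iso (Sh U C J) m" using iso unfolding isomorphic_def by blast
    then show ?thesis using sheaf_transport[OF _ _ P, of m Q] J.iso_Sh_iff[OF m(1)] by (simp add: J.Hom_Sh)
  qed
  ultimately show ?thesis unfolding ST_def using sheaves_antimono[OF JK, of U C] by auto
qed

end

section \<open>The sheaf of closed sieves\<close>

context sheaf_site
begin

text \<open>The sections of the subobject classifier of the topos of sheaves.\<close>

definition closed_sieves :: "'o \<Rightarrow> 'm set set" where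
  "closed_sieves a = {S. is_sieve C a S \<and>
    (\<forall>f \<in> Arr C. Cod C f = a \<longrightarrow> locally C K (Dom C f) (\<lambda>g. f \<odot> g \<in> S) \<longrightarrow> f \<in> S)}"

lemma sieve_subset_skeletal:
  assumes T: "skeletal T" and S: "is_sieve C a S" and S': "is_sieve C a S'"
    and eq: "S \<inter> {f. Dom C f \<in> T} \<subseteq> S'"
  shows "S \<subseteq> S'"
proof
  fix f assume f: "f \<in> S"
  have fa: "f \<in> Arr C" using sieve_arr[OF S f] by simp
  obtain i j where ij: "i \<in> Arr C" "Dom C i = Dom C f" "Cod C i \<in> T" "j \<in> Arr C" "Dom C j = Cod C i"
    "Cod C j = Dom C f" "j \<odot> i = Ide C (Dom C f)" using skeletal_iso[OF T Dom_Obj[OF fa]] by blast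
  have "f \<odot> j \<in> S'" using sieve_closed[OF S f, of j] ij fa eq by auto
  then have "(f \<odot> j) \<odot> i \<in> S'" using sieve_closed[OF S', of "f \<odot> j" i] ij fa by simp
  then show "f \<in> S'" using ij fa by simp
qed

lemma closed_sieves_pullback:
  assumes S: "S \<in> closed_sieves a" and f: "f \<in> Arr C" "Cod C f = a"
  shows "pullback_sieve C f S \<in> closed_sieves (Dom C f)"
  unfolding closed_sieves_def
proof (intro CollectI conjI ballI impI)
  show "is_sieve C (Dom C f) (pullback_sieve C f S)"
    using is_sieve_pullback S f unfolding closed_sieves_def by blast
  fix h assume h: "h \<in> Arr C" "Cod C h = Dom C f" and loc: "locally C K (Dom C h) (\<lambda>g. h \<odot> g \<in> pullback_sieve C f S)"
  have "locally C K (Dom C h) (\<lambda>g. (f \<odot> h) \<odot> g \<in> S)"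
    using loc by (rule subst[OF locally_cong, rotated]) (use f h in \<open>auto simp: pullback_sieve_def\<close>)
  then have "f \<odot> h \<in> S" using S f h unfolding closed_sieves_def by simp
  then show "h \<in> pullback_sieve C f S" using h by (simp add: pullback_sieve_def)
qed

lemma closed_sieves_raw: "raw_presheaf closed_sieves (pullback_sieve C)"
  unfolding raw_presheaf_def
proof (intro conjI ballI impI)
  fix a assume a: "a \<in> Obj C"
  obtain T where T: "skeletal T" using skeletal_exists by blast
  let ?H = "\<Union>b\<in>T. Hom C b a"
  let ?r = "\<lambda>S. S \<inter> {f. Dom C f \<in> T}"
  have "small U ?H" by (rule small_UN[OF universe skeletal_small[OF T]], rule small_Hom) (use a skeletal_Obj[OF T] in auto)
  then have sB: "small U (Pow ?H)" by (rule small_Pow[OF universe])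
  show "small U (closed_sieves a)"
  proof (rule small_inj[OF sB, where f="?r"])
    show "inj_on ?r (closed_sieves a)"
    proof (rule inj_onI)
      fix S S' assume "S \<in> closed_sieves a" "S' \<in> closed_sieves a" and eq: "?r S = ?r S'"
      then have s: "is_sieve C a S" "is_sieve C a S'" by (auto simp: closed_sieves_def)
      have "?r S \<subseteq> S'" "?r S' \<subseteq> S" using eq by auto
      then show "S = S'" using sieve_subset_skeletal[OF T s] sieve_subset_skeletal[OF T s(2,1)] by blast
    qed
    show "?r ` closed_sieves a \<subseteq> Pow ?H"
      by (auto simp: closed_sieves_def is_sieve_def Hom_def)
  qed
next
  fix a S assume "a \<in> Obj C" "S \<in> closed_sieves a"
  then show "pullback_sieve C (Ide C a) S = S" using pullback_sieve_Ide unfolding closed_sieves_def by blast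
qed (use closed_sieves_pullback pullback_sieve_comp in auto)

lemma Omega_exists: "\<exists>\<Omega> e d. \<Omega> \<in> sheaves U C K \<and> encoding closed_sieves (pullback_sieve C) \<Omega> e d"
proof -
  obtain \<Omega> e d where e: "encoding closed_sieves (pullback_sieve C) \<Omega> e d"
    using encoding_exists[OF closed_sieves_raw] by blast
  have sub: "S \<subseteq> S'" if S: "S \<in> closed_sieves a" and S': "S' \<in> closed_sieves a"
    and loc: "locally C K a (\<lambda>f. pullback_sieve C f S = pullback_sieve C f S')" for a S S'
  proof
    fix f assume f: "f \<in> S"
    have sv: "is_sieve C a S" "is_sieve C a S'" using S S' by (auto simp: closed_sieves_def)
    have fa: "f \<in> Arr C" "Cod C f = a" using sieve_arr[OF sv(1) f] by auto
    have "locally C K (Dom C f) (\<lambda>g. f \<odot> g \<in> S')"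
    proof (rule locally_mono[OF locally_pull[OF loc fa]])
      fix g assume g: "g \<in> Arr C" "Cod C g = Dom C f"
        and eq: "pullback_sieve C (f \<odot> g) S = pullback_sieve C (f \<odot> g) S'"
      have "Ide C (Dom C g) \<in> pullback_sieve C (f \<odot> g) S"
        using g fa sieve_closed[OF sv(1) f, of g] comp_Ide(2)[of "f \<odot> g"] by (simp add: pullback_sieve_def)
      then show "f \<odot> g \<in> S'"
        unfolding eq using g fa comp_Ide(2)[of "f \<odot> g"] by (simp add: pullback_sieve_def)
    qed
    then show "f \<in> S'" using S' fa unfolding closed_sieves_def by blast
  qed
  have "\<Omega> \<in> sheaves U C K"
  proof (rule raw_sheaf_encoding[OF closed_sieves_raw e])
    fix a S S' assume "S \<in> closed_sieves a" "S' \<in> closed_sieves a" "locally C K a (\<lambda>f. pullback_sieve C f S = pullback_sieve C f S')"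
    then show "S = S'" using sub[of S a S'] sub[of S' a S] by (simp add: eq_commute)
  next
    fix a R x assume R: "(a, R) \<in> K" "is_sieve C a R" and x: "\<And>f. f \<in> R \<Longrightarrow> x f \<in> closed_sieves (Dom C f)"
      and xr: "\<And>f g. f \<in> R \<Longrightarrow> g \<in> Arr C \<Longrightarrow> Cod C g = Dom C f \<Longrightarrow> pullback_sieve C g (x f) = x (f \<odot> g)"
    define Q where "Q f \<longleftrightarrow> f \<in> R \<and> Ide C (Dom C f) \<in> x f" for f
    have Q1: "g \<in> x f \<longleftrightarrow> Q (f \<odot> g)" if f: "f \<in> R" and g: "g \<in> Arr C" "Cod C g = Dom C f" for f g
      using xr[OF f g, symmetric] sieve_closed[OF R(2) f g] sieve_arr[OF R(2) f] g comp_Ide(2)[OF g(1)]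
      by (simp add: Q_def pullback_sieve_def)
    define S where "S = {f \<in> Arr C. Cod C f = a \<and> locally C K (Dom C f) (\<lambda>g. Q (f \<odot> g))}"
    have S_eq: "f \<odot> g \<in> S \<longleftrightarrow> locally C K (Dom C g) (\<lambda>h. Q (f \<odot> (g \<odot> h)))"
      if "f \<in> Arr C" "Cod C f = a" "g \<in> Arr C" "Cod C g = Dom C f" for f g
    proof -
      have "locally C K (Dom C g) (\<lambda>h. Q ((f \<odot> g) \<odot> h)) \<longleftrightarrow> locally C K (Dom C g) (\<lambda>h. Q (f \<odot> (g \<odot> h)))"
        by (rule locally_cong) (use that in simp)
      then show ?thesis using that by (simp add: S_def del: comp_assoc)
    qed
    have "S \<in> closed_sieves a"
      unfolding closed_sieves_def
    proof (intro CollectI conjI ballI impI)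
      show "is_sieve C a S"
        unfolding is_sieve_def
      proof (intro conjI ballI impI)
        fix f g assume f: "f \<in> S" and g: "g \<in> Arr C" "Cod C g = Dom C f"
        then have fa: "f \<in> Arr C" "Cod C f = a" "locally C K (Dom C f) (\<lambda>g. Q (f \<odot> g))" by (auto simp: S_def)
        show "f \<odot> g \<in> S" using S_eq[OF fa(1,2) g] locally_pull[OF fa(3) g] by simp
      qed (use covering_obj[OF R(1)] in \<open>auto simp: S_def\<close>)
      fix f assume f: "f \<in> Arr C" "Cod C f = a" and loc: "locally C K (Dom C f) (\<lambda>g. f \<odot> g \<in> S)"
      have "locally C K (Dom C f) (\<lambda>g. Q (f \<odot> g))"
        by (rule locally_trans[OF loc]) (use S_eq f in auto)
      then show "f \<in> S" using f by (simp add: S_def)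
    qed
    moreover have "pullback_sieve C f S = x f" if f: "f \<in> R" for f
    proof -
      have fa: "f \<in> Arr C" "Cod C f = a" using sieve_arr[OF R(2) f] by auto
      have xs: "is_sieve C (Dom C f) (x f)" using x[OF f] by (simp add: closed_sieves_def)
      have "g \<in> pullback_sieve C f S \<longleftrightarrow> g \<in> x f" if g: "g \<in> Arr C" "Cod C g = Dom C f" for g
      proof -
        have "g \<in> pullback_sieve C f S \<longleftrightarrow> locally C K (Dom C g) (\<lambda>h. Q (f \<odot> (g \<odot> h)))"
          using S_eq[OF fa g] g by (simp add: pullback_sieve_def)
        also have "\<dots> \<longleftrightarrow> locally C K (Dom C g) (\<lambda>h. g \<odot> h \<in> x f)"
          by (rule locally_cong) (use Q1[OF f] g in simp)
        also have "\<dots> \<longleftrightarrow> g \<in> x f"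
        proof
          assume "locally C K (Dom C g) (\<lambda>h. g \<odot> h \<in> x f)"
          then show "g \<in> x f" using x[OF f] g unfolding closed_sieves_def by blast
        next
          assume "g \<in> x f"
          then show "locally C K (Dom C g) (\<lambda>h. g \<odot> h \<in> x f)"
            using sieve_closed[OF xs] g by (intro locally_triv) auto
        qed
        finally show ?thesis .
      qed
      moreover have "g \<in> Arr C \<and> Cod C g = Dom C f" if "g \<in> pullback_sieve C f S \<or> g \<in> x f" for g
        using that sieve_arr[OF xs] by (auto simp: pullback_sieve_def)
      ultimately have "g \<in> pullback_sieve C f S \<longleftrightarrow> g \<in> x f" for g by metis
      then show ?thesis by (simp add: set_eq_iff)
    qed
    ultimately show "\<exists>S\<in>closed_sieves a. \<forall>f\<in>R. pullback_sieve C f S = x f" by blast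
  qed
  then show ?thesis using e by blast
qed

lemma max_closed: "a \<in> Obj C \<Longrightarrow> {f \<in> Arr C. Cod C f = a} \<in> closed_sieves a"
  by (simp add: closed_sieves_def is_sieve_max)

lemma sieve_closure:
  assumes S: "is_sieve C a S"
  shows "{f \<in> Arr C. Cod C f = a \<and> locally C K (Dom C f) (\<lambda>g. f \<odot> g \<in> S)} \<in> closed_sieves a" (is "?S \<in> _")
proof -
  have S_eq: "f \<odot> g \<in> ?S \<longleftrightarrow> locally C K (Dom C g) (\<lambda>h. f \<odot> (g \<odot> h) \<in> S)"
    if "f \<in> Arr C" "Cod C f = a" "g \<in> Arr C" "Cod C g = Dom C f" for f g
  proof -
    have "locally C K (Dom C g) (\<lambda>h. (f \<odot> g) \<odot> h \<in> S) \<longleftrightarrow> locally C K (Dom C g) (\<lambda>h. f \<odot> (g \<odot> h) \<in> S)"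
      by (rule locally_cong) (use that in simp)
    then show ?thesis using that by (simp del: comp_assoc)
  qed
  have a: "a \<in> Obj C" using S by (simp add: is_sieve_def)
  have "is_sieve C a ?S"
    unfolding is_sieve_def
  proof (intro conjI ballI impI)
    fix f g assume f: "f \<in> ?S" and g: "g \<in> Arr C" "Cod C g = Dom C f"
    then have fa: "f \<in> Arr C" "Cod C f = a" "locally C K (Dom C f) (\<lambda>g. f \<odot> g \<in> S)" by auto
    show "f \<odot> g \<in> ?S" using S_eq[OF fa(1,2) g] locally_pull[OF fa(3) g] by simp
  qed (use a in auto)
  moreover have "f \<in> ?S" if f: "f \<in> Arr C" "Cod C f = a" and loc: "locally C K (Dom C f) (\<lambda>g. f \<odot> g \<in> ?S)" for f
  proof -
    have "locally C K (Dom C f) (\<lambda>g. f \<odot> g \<in> S)"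
      by (rule locally_trans[OF loc]) (use S_eq f in auto)
    then show ?thesis using f by simp
  qed
  ultimately show ?thesis unfolding closed_sieves_def by blast
qed

text \<open>For a \<open>J\<close>-covering sieve \<open>S\<close>, the \<open>K\<close>-closure of \<open>S\<close> and the maximal sieve have the same restrictions to \<open>S\<close>. If
  the sheaf of \<open>K\<close>-closed sieves is separated for \<open>J\<close>, they coincide, and then \<open>S\<close> is \<open>K\<close>-covering.\<close>

lemma topology_le_iff_sheaves:
  assumes J: "is_topology C J"
  shows "sheaves U C K \<subseteq> sheaves U C J \<longleftrightarrow> J \<subseteq> K"
proof
  assume sub: "sheaves U C K \<subseteq> sheaves U C J"
  interpret J: sheaf_site C U J using J by unfold_locales
  obtain \<Omega> e d where \<Omega>: "\<Omega> \<in> sheaves U C K" and e: "encoding closed_sieves (pullback_sieve C) \<Omega> e d"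
    using Omega_exists by blast
  show "J \<subseteq> K"
  proof
    fix z assume z: "z \<in> J"
    obtain a S where aS: "z = (a, S)" by fastforce
    have S: "is_sieve C a S" and a: "a \<in> Obj C" using J.covering_sieve J.covering_obj z aS by auto
    let ?S = "{f \<in> Arr C. Cod C f = a \<and> locally C K (Dom C f) (\<lambda>g. f \<odot> g \<in> S)}"
    let ?M = "{f \<in> Arr C. Cod C f = a}"
    have S': "?S \<in> closed_sieves a" "?M \<in> closed_sieves a" using sieve_closure[OF S] max_closed[OF a] by auto
    have "e a ?S = e a ?M"
    proof (rule J.sheaf_separated)
      show "\<Omega> \<in> sheaves U C J" using sub \<Omega> by blast
      have "locally C J a (\<lambda>f. f \<in> S)" using z aS J.sieve_locally[OF S] by simp
      then show "locally C J a (\<lambda>f. act \<Omega> f (e a ?S) = act \<Omega> f (e a ?M))"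
      proof (rule J.locally_mono)
        fix f assume f: "f \<in> Arr C" "Cod C f = a" "f \<in> S"
        have "f \<odot> g \<in> ?S" if g: "g \<in> Arr C" "Cod C g = Dom C f" for g
        proof -
          have "f \<odot> g \<odot> h \<in> S" if "h \<in> Arr C" "Cod C h = Dom C g" for h
            using sieve_closed[OF S f(3), of "g \<odot> h"] f g that by simp
          then show ?thesis using f g by (auto intro!: locally_triv)
        qed
        then have eq: "pullback_sieve C f ?S = pullback_sieve C f ?M"
          using f by (auto simp: pullback_sieve_def simp del: comp_assoc)
        have ac: "act \<Omega> f (e a X) = e (Dom C f) (pullback_sieve C f X)" if "X \<in> closed_sieves a" for X
          using act_enc[OF e f(1), of X] f(2) that by simp
        show "act \<Omega> f (e a ?S) = act \<Omega> f (e a ?M)" by (simp only: ac[OF S'(1)] ac[OF S'(2)] eq)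
      qed
    qed (use enc_in[OF e a] S' in auto)
    then have "d a (e a ?S) = d a (e a ?M)" by (rule arg_cong)
    then have eq: "?S = ?M" by (simp only: dec_enc[OF e a S'(1)] dec_enc[OF e a S'(2)])
    have "Ide C a \<in> ?M" using a by simp
    then have "Ide C a \<in> ?S" by (simp only: eq)
    then have "locally C K a (\<lambda>g. Ide C a \<odot> g \<in> S)" using a by simp
    then have "locally C K a (\<lambda>g. g \<in> S)"
      by (rule subst[OF locally_cong, rotated]) (use comp_Ide(1) in auto)
    then show "z \<in> K" using sieve_locally[OF S] aS by simp
  qed
qed (rule sheaves_antimono)

end

section \<open>The largest topology for which given presheaves are sheaves\<close>

context psh_cat
begin

definition unique_gluing :: "('o, 'm, 'u) presheaf \<Rightarrow> 'o \<Rightarrow> 'm set \<Rightarrow> bool" where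
  "unique_gluing F a S \<longleftrightarrow>
    (\<forall>x. matching_family C F S x \<longrightarrow> (\<exists>!s. s \<in> val F a \<and> (\<forall>f \<in> S. act F f s = x f)))"

text \<open>All base changes are included in order to obtain a topology.\<close>

definition local_topology :: "('o, 'm, 'u) presheaf set \<Rightarrow> ('o \<times> 'm set) set" where
  "local_topology \<F> = {(a, S). is_sieve C a S \<and>
    (\<forall>f \<in> Arr C. Cod C f = a \<longrightarrow> (\<forall>F \<in> \<F>. unique_gluing F (Dom C f) (pullback_sieve C f S)))}"

text \<open>The transitivity axiom: a matching family on \<open>T\<close> is first glued on the base changes of \<open>T\<close> along the arrows
  of \<open>S\<close>, and the resulting family on \<open>S\<close> is glued again.\<close>

lemma unique_gluing_trans:
  assumes F: "psh F" and S: "is_sieve C a S" and T: "is_sieve C a T"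
    and gS: "\<And>h. h \<in> Arr C \<Longrightarrow> Cod C h = a \<Longrightarrow> unique_gluing F (Dom C h) (pullback_sieve C h S)"
    and gT: "\<And>f. f \<in> S \<Longrightarrow> unique_gluing F (Dom C f) (pullback_sieve C f T)"
  shows "unique_gluing F a T"
  unfolding unique_gluing_def
proof (intro allI impI)
  fix x assume x: "matching_family C F T x"
  have a: "a \<in> Obj C" using S by (simp add: is_sieve_def)
  have xv: "x t \<in> val F (Dom C t)" if "t \<in> T" for t using x that unfolding matching_family_def by blast
  have xr: "act F g (x t) = x (t \<odot> g)" if "t \<in> T" "g \<in> Arr C" "Cod C g = Dom C t" for t g
    using x that unfolding matching_family_def by blast
  have Sa: "f \<in> Arr C" "Cod C f = a" if "f \<in> S" for f using sieve_arr[OF S that] .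
  have Ta: "f \<in> Arr C" "Cod C f = a" if "f \<in> T" for f using sieve_arr[OF T that] .
  have gS': "unique_gluing F a S" using gS[of "Ide C a"] a pullback_sieve_Ide[OF S] by simp
  have ung: "s = t" if g: "unique_gluing F b R" and R: "is_sieve C b R" and s: "s \<in> val F b" and t: "t \<in> val F b"
    and eq: "\<And>g. g \<in> R \<Longrightarrow> act F g s = act F g t" for b R s t
    using g[unfolded unique_gluing_def, rule_format, OF restrictions_matching[OF R F t]] s t eq by blast
  have "matching_family C F (pullback_sieve C f T) (\<lambda>g. x (f \<odot> g))" if f: "f \<in> S" for f
    unfolding matching_family_def
    using xv xr Sa[OF f] by (auto simp: pullback_sieve_def) (metis comp_Arr(2))
  then have "\<exists>y. y \<in> val F (Dom C f) \<and> (\<forall>g \<in> pullback_sieve C f T. act F g y = x (f \<odot> g))" if "f \<in> S" for f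
    using gT[OF that] that unfolding unique_gluing_def by blast
  then obtain y where y: "\<And>f. f \<in> S \<Longrightarrow> y f \<in> val F (Dom C f)"
    and yx: "\<And>f g. f \<in> S \<Longrightarrow> g \<in> pullback_sieve C f T \<Longrightarrow> act F g (y f) = x (f \<odot> g)" by metis
  have ym: "act F h (y f) = y (f \<odot> h)" if f: "f \<in> S" and h: "h \<in> Arr C" "Cod C h = Dom C f" for f h
  proof -
    note fa = Sa[OF f]
    have fh: "f \<odot> h \<in> S" using sieve_closed[OF S f h] .
    have sv: "is_sieve C (Dom C h) (pullback_sieve C (f \<odot> h) T)"
      using is_sieve_pullback[OF T, of "f \<odot> h"] fa h by simp
    have gl: "unique_gluing F (Dom C h) (pullback_sieve C (f \<odot> h) T)" using gT[OF fh] h fa by simp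
    show ?thesis
    proof (rule ung[OF gl sv])
      fix g assume g: "g \<in> pullback_sieve C (f \<odot> h) T"
      then have ga: "g \<in> Arr C" "Cod C g = Dom C h" and gT': "f \<odot> h \<odot> g \<in> T" using fa h by (auto simp: pullback_sieve_def)
      have "h \<odot> g \<in> pullback_sieve C f T" using ga gT' fa h by (simp add: pullback_sieve_def)
      then show "act F g (act F h (y f)) = act F g (y (f \<odot> h))"
        using yx[OF f] yx[OF fh g] ga fa h y[OF f] act_comp[OF F ga(1) h(1)] by simp
    qed (use act_in'[OF F h y[OF f]] y[OF fh] h fa in auto)
  qed
  have "matching_family C F S y" unfolding matching_family_def using y ym by blast
  then obtain s where s: "s \<in> val F a" "\<And>f. f \<in> S \<Longrightarrow> act F f s = y f"
    using gS' unfolding unique_gluing_def by blast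
  have st: "act F t s = x t" if t: "t \<in> T" for t
  proof (rule ung[OF gS[OF Ta[OF t]] is_sieve_pullback[OF S Ta[OF t]]])
    note ta = Ta[OF t]
    show "act F t s \<in> val F (Dom C t)" using act_in'[OF F ta s(1)] .
    show "x t \<in> val F (Dom C t)" using xv[OF t] .
    fix g assume g: "g \<in> pullback_sieve C t S"
    then have ga: "g \<in> Arr C" "Cod C g = Dom C t" and tg: "t \<odot> g \<in> S" by (auto simp: pullback_sieve_def)
    have d: "Dom C g \<in> Obj C" using ga by simp
    have e: "(t \<odot> g) \<odot> Ide C (Dom C g) = t \<odot> g" using comp_Ide(2)[of "t \<odot> g"] ga ta by simp
    have "Ide C (Dom C g) \<in> pullback_sieve C (t \<odot> g) T"
      using sieve_closed[OF T t ga] d e ga ta by (simp add: pullback_sieve_def del: comp_assoc)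
    then have "act F (Ide C (Dom C g)) (y (t \<odot> g)) = x (t \<odot> g)" using yx[OF tg] e by simp
    then have "y (t \<odot> g) = x (t \<odot> g)" using y[OF tg] d F ga ta by simp
    then show "act F g (act F t s) = act F g (x t)"
      using s(2)[OF tg] xr[OF t ga] act_comp[OF F ga(1) ta(1)] ga s(1) ta by simp
  qed
  show "\<exists>!s. s \<in> val F a \<and> (\<forall>f\<in>T. act F f s = x f)"
  proof (rule ex1I[where a=s])
    show "s \<in> val F a \<and> (\<forall>f\<in>T. act F f s = x f)" using s st by blast
    fix s' assume s': "s' \<in> val F a \<and> (\<forall>f\<in>T. act F f s' = x f)"
    show "s' = s"
    proof (rule ung[OF gS' S])
      fix f assume f: "f \<in> S"
      note fa = Sa[OF f]
      show "act F f s' = act F f s"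
      proof (rule ung[OF gT[OF f] is_sieve_pullback[OF T fa]])
        fix g assume "g \<in> pullback_sieve C f T"
        then have ga: "g \<in> Arr C" "Cod C g = Dom C f" and fg: "f \<odot> g \<in> T" by (auto simp: pullback_sieve_def)
        then show "act F g (act F f s') = act F g (act F f s)"
          using act_comp[OF F ga(1) fa(1)] s' s(1) st[OF fg] fa by simp
      qed (use act_in'[OF F fa] s' s in auto)
    qed (use s' s in auto)
  qed
qed

lemma local_topology:
  assumes \<F>: "\<F> \<subseteq> {P. psh P}"
  shows "is_topology C (local_topology \<F>)"
  unfolding is_topology_def
proof (intro conjI ballI impI allI)
  fix z assume "z \<in> local_topology \<F>"
  then show "case z of (a, S) \<Rightarrow> is_sieve C a S" by (auto simp: local_topology_def)
next
  fix a assume a: "a \<in> Obj C"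
  have "unique_gluing F (Dom C f) (pullback_sieve C f {f \<in> Arr C. Cod C f = a})"
    if f: "f \<in> Arr C" "Cod C f = a" and F: "F \<in> \<F>" for f F
  proof -
    have "pullback_sieve C f {f \<in> Arr C. Cod C f = a} = {g \<in> Arr C. Cod C g = Dom C f}"
      using f by (auto simp: pullback_sieve_def)
    moreover have "F \<in> sheaves U C (min_topology C)" using F \<F> sheaves_min by auto
    moreover have "(Dom C f, {g \<in> Arr C. Cod C g = Dom C f}) \<in> min_topology C"
      using f by (simp add: min_topology_def)
    ultimately have "unique_gluing F (Dom C f) {g \<in> Arr C. Cod C g = Dom C f}"
      unfolding unique_gluing_def sheaves_def by blast
    then show ?thesis using \<open>pullback_sieve C f {f \<in> Arr C. Cod C f = a} = {g \<in> Arr C. Cod C g = Dom C f}\<close> by simp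
  qed
  then show "(a, {f \<in> Arr C. Cod C f = a}) \<in> local_topology \<F>"
    unfolding local_topology_def using is_sieve_max[OF a] by blast
next
  fix z assume z: "z \<in> local_topology \<F>"
  obtain a S where aS: "z = (a, S)" by fastforce
  have S: "is_sieve C a S"
    and gS: "\<And>f F. f \<in> Arr C \<Longrightarrow> Cod C f = a \<Longrightarrow> F \<in> \<F> \<Longrightarrow> unique_gluing F (Dom C f) (pullback_sieve C f S)"
    using z aS by (auto simp: local_topology_def)
  have "unique_gluing F (Dom C g) (pullback_sieve C g (pullback_sieve C f S))"
    if "f \<in> Arr C" "Cod C f = a" "g \<in> Arr C" "Cod C g = Dom C f" "F \<in> \<F>" for f g F
    using gS[of "f \<odot> g" F] that by (simp add: pullback_sieve_comp)
  then have "(Dom C f, pullback_sieve C f S) \<in> local_topology \<F>" if "f \<in> Arr C" "Cod C f = a" for f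
    using that is_sieve_pullback[OF S] unfolding local_topology_def by simp
  then show "case z of (a, S) \<Rightarrow> \<forall>f\<in>Arr C. Cod C f = a \<longrightarrow> (Dom C f, pullback_sieve C f S) \<in> local_topology \<F>"
    using aS by simp
next
  fix z assume z: "z \<in> local_topology \<F>"
  obtain a S where aS: "z = (a, S)" by fastforce
  have S: "is_sieve C a S"
    and gS: "\<And>f F. f \<in> Arr C \<Longrightarrow> Cod C f = a \<Longrightarrow> F \<in> \<F> \<Longrightarrow> unique_gluing F (Dom C f) (pullback_sieve C f S)"
    using z aS by (auto simp: local_topology_def)
  have "(a, T) \<in> local_topology \<F>"
    if T: "is_sieve C a T" and fT: "\<forall>f\<in>S. (Dom C f, pullback_sieve C f T) \<in> local_topology \<F>" for T
  proof -
    have "unique_gluing F (Dom C k) (pullback_sieve C k T)" if k: "k \<in> Arr C" "Cod C k = a" and F: "F \<in> \<F>" for k F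
    proof (rule unique_gluing_trans)
      show "psh F" using \<F> F by auto
      show "is_sieve C (Dom C k) (pullback_sieve C k S)" "is_sieve C (Dom C k) (pullback_sieve C k T)"
        using is_sieve_pullback[OF S k] is_sieve_pullback[OF T k] by auto
      fix h assume "h \<in> Arr C" "Cod C h = Dom C k"
      then show "unique_gluing F (Dom C h) (pullback_sieve C h (pullback_sieve C k S))"
        using gS[of "k \<odot> h" F] k F by (simp add: pullback_sieve_comp)
    next
      fix f assume "f \<in> pullback_sieve C k S"
      then have f: "f \<in> Arr C" "Cod C f = Dom C k" "k \<odot> f \<in> S" by (auto simp: pullback_sieve_def)
      have "(Dom C (k \<odot> f), pullback_sieve C (k \<odot> f) T) \<in> local_topology \<F>" using fT f(3) by blast
      then have "(Dom C f, pullback_sieve C (k \<odot> f) T) \<in> local_topology \<F>" using f k by simp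
      then have "unique_gluing F (Dom C (Ide C (Dom C f))) (pullback_sieve C (Ide C (Dom C f)) (pullback_sieve C (k \<odot> f) T))"
        unfolding local_topology_def using Ide_Arr[OF Dom_Obj[OF f(1)]] F by blast
      then show "unique_gluing F (Dom C f) (pullback_sieve C f (pullback_sieve C k T))"
        using pullback_sieve_Ide[OF is_sieve_pullback[OF T, of "k \<odot> f"]] f k Ide_Arr[OF Dom_Obj[OF f(1)]] by (simp add: pullback_sieve_comp)
    qed
    then show ?thesis unfolding local_topology_def using T by blast
  qed
  then show "case z of (a, S) \<Rightarrow> \<forall>T. is_sieve C a T \<and> (\<forall>f\<in>S. (Dom C f, pullback_sieve C f T) \<in> local_topology \<F>)
      \<longrightarrow> (a, T) \<in> local_topology \<F>" using aS by simp
qed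

lemma local_topology_greatest:
  assumes K: "is_topology C K" and \<F>: "\<F> \<subseteq> sheaves U C K"
  shows "K \<subseteq> local_topology \<F>"
proof
  fix z assume z: "z \<in> K"
  obtain a S where aS: "z = (a, S)" by fastforce
  have "(Dom C f, pullback_sieve C f S) \<in> K" if "f \<in> Arr C" "Cod C f = a" for f
    using K z aS that unfolding is_topology_def by blast
  then have "unique_gluing F (Dom C f) (pullback_sieve C f S)" if "f \<in> Arr C" "Cod C f = a" "F \<in> \<F>" for f F
    using \<F> that unfolding sheaves_def unique_gluing_def by blast
  then show "z \<in> local_topology \<F>"
    using K z aS unfolding local_topology_def is_topology_def by blast
qed

lemma local_topology_sheaves:
  assumes \<F>: "\<F> \<subseteq> {P. psh P}" shows "\<F> \<subseteq> sheaves U C (local_topology \<F>)"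
proof
  fix F assume F: "F \<in> \<F>"
  have "unique_gluing F a S" if "(a, S) \<in> local_topology \<F>" for a S
  proof -
    have S: "is_sieve C a S" and a: "a \<in> Obj C" using that by (auto simp: local_topology_def is_sieve_def)
    have "unique_gluing F (Dom C (Ide C a)) (pullback_sieve C (Ide C a) S)"
      using that F Ide_Arr[OF a] unfolding local_topology_def by blast
    then show ?thesis using pullback_sieve_Ide[OF S] a by simp
  qed
  then show "F \<in> sheaves U C (local_topology \<F>)"
    using F \<F> unfolding sheaves_def unique_gluing_def by blast
qed

end

section \<open>Every subtopos is given by a topology\<close>

context psh_cat
begin

text \<open>A sieve as a subpresheaf of the representable presheaf.\<close>

definition sieve_val :: "'m set \<Rightarrow> 'o \<Rightarrow> 'm set" where
  "sieve_val R a = {f \<in> R. Dom C f = a}"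

abbreviation sieve_encoding where
  "sieve_encoding R Y e d \<equiv> encoding (sieve_val R) (\<lambda>g f. f \<odot> g) Y e d"

lemma sieve_raw:
  assumes R: "is_sieve C X R" shows "raw_presheaf (sieve_val R) (\<lambda>g f. f \<odot> g)"
  unfolding raw_presheaf_def
proof (intro conjI ballI impI)
  have X: "X \<in> Obj C" using R by (simp add: is_sieve_def)
  fix a assume "a \<in> Obj C"
  from small_Hom[OF this X] show "small U (sieve_val R a)"
    by (rule small_subset) (use sieve_arr[OF R] in \<open>auto simp: sieve_val_def Hom_def\<close>)
qed (use sieve_arr[OF R] sieve_closed[OF R] in \<open>auto simp: sieve_val_def\<close>)

lemma sieve_hom:
  assumes R: "is_sieve C X R" and e: "sieve_encoding R Y e d" and F: "psh F" and x: "matching_family C F R x"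
  shows "transf C Y F (\<lambda>a s. x (d a s)) \<in> hom Y F"
proof (rule transf_hom[OF enc_psh[OF e] F])
  fix a s assume a: "a \<in> Obj C" and s: "s \<in> val Y a"
  have "d a s \<in> R" "Dom C (d a s) = a" using dec_in[OF e a s] by (auto simp: sieve_val_def)
  then show "x (d a s) \<in> val F a" using x unfolding matching_family_def by auto
next
  fix f s assume f: "f \<in> Arr C" and s: "s \<in> val Y (Cod C f)"
  have "d (Cod C f) s \<in> R" "Dom C (d (Cod C f) s) = Cod C f"
    using dec_in[OF e Cod_Obj[OF f] s] by (auto simp: sieve_val_def)
  then show "act F f (x (d (Cod C f) s)) = x (d (Dom C f) (act Y f s))"
    using dec_act[OF sieve_raw[OF R] e f s] x f unfolding matching_family_def by simp
qed

lemma sieve_element: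
  assumes R: "is_sieve C X R" and e: "sieve_encoding R Y e d" and f: "f \<in> R"
  shows "e (Dom C f) f \<in> val Y (Dom C f)" "d (Dom C f) (e (Dom C f) f) = f"
  using enc_in[OF e, of "Dom C f" f] dec_enc[OF e, of "Dom C f" f] sieve_arr[OF R f] f
  by (auto simp: sieve_val_def)

lemma inclusion_matching:
  assumes R: "is_sieve C X R" and M: "is_sieve C X M" and RM: "R \<subseteq> M" and e: "sieve_encoding M Y e d"
  shows "matching_family C Y R (\<lambda>f. e (Dom C f) f)"
  unfolding matching_family_def
proof (intro conjI ballI impI)
  fix f assume f: "f \<in> R"
  then have fM: "f \<in> M" using RM by auto
  then show "e (Dom C f) f \<in> val Y (Dom C f)" using sieve_element[OF M e] by blast
  fix g assume g: "g \<in> Arr C" "Cod C g = Dom C f"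
  show "act Y g (e (Dom C f) f) = e (Dom C (f \<odot> g)) (f \<odot> g)"
    using act_enc[OF e g(1), of f] fM g sieve_arr[OF M fM] by (simp add: sieve_val_def)
qed

text \<open>By the Yoneda lemma, matching families are morphisms from the sieve and elements are morphisms from the
  representable presheaf, here encoded as the maximal sieve.\<close>

lemma orthogonal_unique_gluing:
  assumes R: "is_sieve C X R" and e: "sieve_encoding {f \<in> Arr C. Cod C f = X} Y e d"
    and e': "sieve_encoding R Y' e' d'" and F: "psh F"
    and orth: "\<And>h. h \<in> hom Y' F \<Longrightarrow>
      \<exists>!k. k \<in> hom Y F \<and> k \<odot>\<^bsub>Psh U C\<^esub> transf C Y' Y (\<lambda>a s. e (Dom C (d' a s)) (d' a s)) = h"
  shows "unique_gluing F X R"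
  unfolding unique_gluing_def
proof (intro allI impI)
  fix x assume x: "matching_family C F R x"
  let ?M = "{f \<in> Arr C. Cod C f = X}"
  let ?\<iota> = "transf C Y' Y (\<lambda>a s. e (Dom C (d' a s)) (d' a s))"
  have X: "X \<in> Obj C" using R by (simp add: is_sieve_def)
  have M: "is_sieve C X ?M" using is_sieve_max[OF X] .
  have RM: "R \<subseteq> ?M" using sieve_arr[OF R] by auto
  have h: "transf C Y' F (\<lambda>a s. x (d' a s)) \<in> hom Y' F" by (rule sieve_hom[OF R e' F x])
  have k: "\<exists>!k. k \<in> hom Y F \<and> k \<odot>\<^bsub>Psh U C\<^esub> ?\<iota> = transf C Y' F (\<lambda>a s. x (d' a s))" by (rule orth[OF h])
  have \<iota>: "?\<iota> \<in> hom Y' Y" by (rule sieve_hom[OF R e' enc_psh[OF e] inclusion_matching[OF R M RM e]])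
  have iX: "Ide C X \<in> ?M" using X by auto
  have el: "e X (Ide C X) \<in> val Y X" using sieve_element[OF M e iX] X by simp
  have sec: "act F f (cmpt k X (e X (Ide C X))) = x f"
    if k: "k \<in> hom Y F" "k \<odot>\<^bsub>Psh U C\<^esub> ?\<iota> = transf C Y' F (\<lambda>a s. x (d' a s))" and f: "f \<in> R" for k f
  proof -
    have fa: "f \<in> Arr C" "Cod C f = X" using sieve_arr[OF R f] by auto
    have "act Y f (e X (Ide C X)) = e (Dom C f) f"
      using act_enc[OF e fa(1), of "Ide C X"] fa X comp_Ide(1)[OF fa(1)] by (simp add: sieve_val_def)
    then have "act F f (cmpt k X (e X (Ide C X))) = cmpt k (Dom C f) (e (Dom C f) f)"
      using cmpt_act[OF k(1) fa(1), of "e X (Ide C X)"] fa el by simp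
    also have "\<dots> = cmpt k (Dom C f) (cmpt ?\<iota> (Dom C f) (e' (Dom C f) f))"
      using sieve_element[OF R e' f] fa by simp
    also have "\<dots> = x f"
      using cmpt_comp_eq[OF k(2), of "Dom C f" "e' (Dom C f) f"] sieve_element[OF R e' f] fa by simp
    finally show ?thesis .
  qed
  show "\<exists>!s. s \<in> val F X \<and> (\<forall>f\<in>R. act F f s = x f)"
  proof (rule ex_ex1I)
    obtain k where "k \<in> hom Y F" "k \<odot>\<^bsub>Psh U C\<^esub> ?\<iota> = transf C Y' F (\<lambda>a s. x (d' a s))" using k by blast
    then show "\<exists>s. s \<in> val F X \<and> (\<forall>f\<in>R. act F f s = x f)"
      using sec cmpt_in[OF _ X el] by blast
  next
    have un: "transf C Y F (\<lambda>a y. act F (d a y) s) \<in> hom Y F \<and>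
        transf C Y F (\<lambda>a y. act F (d a y) s) \<odot>\<^bsub>Psh U C\<^esub> ?\<iota> = transf C Y' F (\<lambda>a s. x (d' a s))"
      if s: "s \<in> val F X \<and> (\<forall>f\<in>R. act F f s = x f)" for s
    proof -
      have t: "transf C Y F (\<lambda>a y. act F (d a y) s) \<in> hom Y F"
        by (rule sieve_hom[OF M e F restrictions_matching[OF M F]]) (use s in simp)
      moreover have "transf C Y F (\<lambda>a y. act F (d a y) s) \<odot>\<^bsub>Psh U C\<^esub> ?\<iota> = transf C Y' F (\<lambda>a s. x (d' a s))"
      proof (rule Hom_Psh_eqI[OF comp_hom[OF \<iota> t] h])
        fix a y assume a: "a \<in> Obj C" and y: "y \<in> val Y' a"
        have dy: "d' a y \<in> R" "Dom C (d' a y) = a" using dec_in[OF e' a y] by (auto simp: sieve_val_def)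
        have dM: "d' a y \<in> ?M" using dy RM by blast
        show "cmpt (transf C Y F (\<lambda>a y. act F (d a y) s) \<odot>\<^bsub>Psh U C\<^esub> ?\<iota>) a y = cmpt (transf C Y' F (\<lambda>a s. x (d' a s))) a y"
          using a y s dy sieve_element[OF M e dM] by simp
      qed
      ultimately show ?thesis ..
    qed
    fix s t assume s: "s \<in> val F X \<and> (\<forall>f\<in>R. act F f s = x f)" and t: "t \<in> val F X \<and> (\<forall>f\<in>R. act F f t = x f)"
    have eq: "transf C Y F (\<lambda>a y. act F (d a y) s) = transf C Y F (\<lambda>a y. act F (d a y) t)"
      using k un[OF s] un[OF t] by blast
    have ev: "cmpt (transf C Y F (\<lambda>a y. act F (d a y) u)) X (e X (Ide C X)) = u" if "u \<in> val F X" for u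
      using el X sieve_element(2)[OF M e iX] F that by simp
    show "s = t" using ev[of s] ev[of t] s t unfolding eq by simp
  qed
qed

text \<open>Morphisms to an object of a reflective subcategory factor uniquely through the reflection, and cannot
  distinguish source and target of a morphism inverted by it.\<close>

lemma inverted_orthogonal:
  assumes D: "category D" and r: "is_functor D (full_subcat D S) r"
    and adj: "adjunction D (full_subcat D S) r id_functor \<eta> \<epsilon>"
    and w: "w \<in> Hom D A B" and inv: "is_iso (full_subcat D S) (FA r w)"
    and F: "F \<in> Obj D" "F \<in> S" and h: "h \<in> Hom D A F"
  shows "\<exists>!k. k \<in> Hom D B F \<and> k \<odot>\<^bsub>D\<^esub> w = h"
proof -
  interpret D: category D by fact
  let ?E = "full_subcat D S"
  interpret E: category ?E by (rule category_full_subcat[OF D])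
  have eta: "\<And>a. a \<in> Obj D \<Longrightarrow> \<eta> a \<in> Hom D a (FO r a)"
    and nat: "\<And>f a b. f \<in> Hom D a b \<Longrightarrow> FA r f \<odot>\<^bsub>D\<^esub> \<eta> a = \<eta> b \<odot>\<^bsub>D\<^esub> f"
    using adj by (auto simp: adjunction_def natural_def id_functor_def comp_functor_def Hom_def)
  have AB: "A \<in> Obj D" "B \<in> Obj D" using D.Hom_Obj[OF w] by auto
  have FE: "F \<in> Obj ?E" using F by simp
  have univ: "\<exists>!k. k \<in> Hom ?E (FO r a) F \<and> k \<odot>\<^bsub>D\<^esub> \<eta> a = h'" if "a \<in> Obj D" "h' \<in> Hom D a F" for a h'
    using adjunction_left_universal[OF D E.category_axioms adj that(1) FE] that by (simp add: id_functor_def)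
  have rw: "FA r w \<in> Hom ?E (FO r A) (FO r B)" using functor_Hom[OF r w] .
  obtain v where v: "v \<in> Hom ?E (FO r B) (FO r A)" "v \<odot>\<^bsub>D\<^esub> FA r w = Ide D (FO r A)" "FA r w \<odot>\<^bsub>D\<^esub> v = Ide D (FO r B)"
    using E.is_isoE[OF inv rw] by auto
  have rw': "FA r w \<in> Hom D (FO r A) (FO r B)" and v': "v \<in> Hom D (FO r B) (FO r A)"
    using rw v by (auto simp: Hom_full_subcat)
  have key: "(k \<odot>\<^bsub>D\<^esub> \<eta> B) \<odot>\<^bsub>D\<^esub> w = (k \<odot>\<^bsub>D\<^esub> FA r w) \<odot>\<^bsub>D\<^esub> \<eta> A" if k: "k \<in> Hom D (FO r B) F" for k
    using D.Cmp_assoc[OF w eta[OF AB(2)] k] D.Cmp_assoc[OF eta[OF AB(1)] rw' k] nat[OF w] by simp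
  obtain l where l: "l \<in> Hom ?E (FO r A) F" "l \<odot>\<^bsub>D\<^esub> \<eta> A = h"
    and lu: "\<And>l'. l' \<in> Hom ?E (FO r A) F \<Longrightarrow> l' \<odot>\<^bsub>D\<^esub> \<eta> A = h \<Longrightarrow> l' = l" using univ[OF AB(1) h] by blast
  have l': "l \<in> Hom D (FO r A) F" using l by (simp add: Hom_full_subcat)
  have lv: "l \<odot>\<^bsub>D\<^esub> v \<in> Hom D (FO r B) F" using D.Cmp_in[OF v' l'] .
  have lvw: "(l \<odot>\<^bsub>D\<^esub> v) \<odot>\<^bsub>D\<^esub> FA r w = l" using D.Cmp_assoc[OF rw' v' l'] v D.Ide_right[OF l'] by simp
  show ?thesis
  proof (rule ex1I[where a="(l \<odot>\<^bsub>D\<^esub> v) \<odot>\<^bsub>D\<^esub> \<eta> B"])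
    show "(l \<odot>\<^bsub>D\<^esub> v) \<odot>\<^bsub>D\<^esub> \<eta> B \<in> Hom D B F \<and> ((l \<odot>\<^bsub>D\<^esub> v) \<odot>\<^bsub>D\<^esub> \<eta> B) \<odot>\<^bsub>D\<^esub> w = h"
      using D.Cmp_in[OF eta[OF AB(2)] lv] key[OF lv] lvw l by simp
    fix k assume k: "k \<in> Hom D B F \<and> k \<odot>\<^bsub>D\<^esub> w = h"
    obtain m where m: "m \<in> Hom ?E (FO r B) F" "m \<odot>\<^bsub>D\<^esub> \<eta> B = k" using univ[OF AB(2)] k by blast
    have m': "m \<in> Hom D (FO r B) F" using m by (simp add: Hom_full_subcat)
    have "m \<odot>\<^bsub>D\<^esub> FA r w = l"
    proof (rule lu)
      show "m \<odot>\<^bsub>D\<^esub> FA r w \<in> Hom ?E (FO r A) F" using E.Cmp_in[OF rw m(1)] by simp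
      show "(m \<odot>\<^bsub>D\<^esub> FA r w) \<odot>\<^bsub>D\<^esub> \<eta> A = h" using key[OF m'] m k by simp
    qed
    then have "m = l \<odot>\<^bsub>D\<^esub> v" using D.Cmp_assoc[OF v' rw' m'] v D.Ide_right[OF m'] by simp
    then show "k = (l \<odot>\<^bsub>D\<^esub> v) \<odot>\<^bsub>D\<^esub> \<eta> B" using m by simp
  qed
qed

lemma reflection_inverts_unit:
  assumes D: "category D" and adj: "adjunction D (full_subcat D S) r id_functor \<eta> \<epsilon>"
    and P: "P \<in> Obj D"
  shows "is_iso (full_subcat D S) (FA r (\<eta> P))"
proof -
  interpret D: category D by fact
  let ?E = "full_subcat D S"
  interpret E: category ?E by (rule category_full_subcat[OF D])
  have r: "is_functor D ?E r" and eta: "\<And>a. a \<in> Obj D \<Longrightarrow> \<eta> a \<in> Hom D a (FO r a)"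
    and eps: "\<And>b. b \<in> Obj ?E \<Longrightarrow> \<epsilon> b \<in> Hom ?E (FO r b) b"
    and t1: "\<And>a. a \<in> Obj D \<Longrightarrow> \<epsilon> (FO r a) \<odot>\<^bsub>D\<^esub> FA r (\<eta> a) = Ide D (FO r a)"
    and t2: "\<And>b. b \<in> Obj ?E \<Longrightarrow> \<epsilon> b \<odot>\<^bsub>D\<^esub> \<eta> b = Ide D b"
    using adj by (auto simp: adjunction_def natural_def id_functor_def comp_functor_def)
  let ?b = "FO r P"
  have b: "?b \<in> Obj ?E" using functor_Obj[OF r P] .
  then have bD: "?b \<in> Obj D" "?b \<in> S" by auto
  have rb: "FO r ?b \<in> Obj ?E" using functor_Obj[OF r bD(1)] .
  have e: "\<epsilon> ?b \<in> Hom ?E (FO r ?b) ?b" using eps[OF b] .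
  have e': "\<epsilon> ?b \<in> Hom D (FO r ?b) ?b" using e by (simp add: Hom_full_subcat)
  have n: "\<eta> ?b \<in> Hom D ?b (FO r ?b)" using eta[OF bD(1)] .
  have nE: "\<eta> ?b \<in> Hom ?E ?b (FO r ?b)" using n bD rb by (simp add: Hom_full_subcat)
  have ne: "\<eta> ?b \<odot>\<^bsub>D\<^esub> \<epsilon> ?b = Ide D (FO r ?b)"
  proof -
    have "\<exists>!k. k \<in> Hom ?E (FO r ?b) (FO r ?b) \<and> FA id_functor k \<odot>\<^bsub>D\<^esub> \<eta> ?b = \<eta> ?b"
      using adjunction_left_universal[OF D E.category_axioms adj bD(1) rb, of "\<eta> ?b"] n by (simp add: id_functor_def)
    moreover have "(\<eta> ?b \<odot>\<^bsub>D\<^esub> \<epsilon> ?b) \<odot>\<^bsub>D\<^esub> \<eta> ?b = \<eta> ?b"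
      using D.Cmp_assoc[OF n e' n] t2[OF b] D.Ide_right[OF n] by simp
    moreover have "Ide D (FO r ?b) \<odot>\<^bsub>D\<^esub> \<eta> ?b = \<eta> ?b" using D.Ide_left[OF n] .
    moreover have "\<eta> ?b \<odot>\<^bsub>D\<^esub> \<epsilon> ?b \<in> Hom ?E (FO r ?b) (FO r ?b)" using E.Cmp_in[OF e nE] by simp
    moreover have "Ide D (FO r ?b) \<in> Hom ?E (FO r ?b) (FO r ?b)" using E.Ide_in[OF rb] by simp
    ultimately show ?thesis by (auto simp: id_functor_def)
  qed
  have rn: "FA r (\<eta> P) \<in> Hom D ?b (FO r ?b)"
    using functor_Hom[OF r eta[OF P]] by (simp add: Hom_full_subcat)
  have "FA r (\<eta> P) = \<eta> ?b"
    using D.Cmp_assoc[OF rn e' n] ne t1[OF P] D.Ide_left[OF rn] D.Ide_right[OF n] by simp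
  then show ?thesis using E.is_isoI[OF nE e] ne t2[OF b] by simp
qed

text \<open>A reflection which preserves pullbacks turns the pullback along \<open>y\<close> of an inverted monomorphism
  into an isomorphism; this pullback is a sieve.\<close>

lemma image_sieve_local:
  assumes S: "S \<subseteq> {P. psh P}" and lex: "left_exact (Psh U C) (full_subcat (Psh U C) S) r"
    and adj: "adjunction (Psh U C) (full_subcat (Psh U C) S) r id_functor \<eta> \<epsilon>"
    and w: "w \<in> hom A B" and inv: "is_iso (full_subcat (Psh U C) S) (FA r w)"
    and inj: "\<And>a. a \<in> Obj C \<Longrightarrow> inj_on (cmpt w a) (val A a)"
    and X: "X \<in> Obj C" and y: "y \<in> val B X"
  shows "(X, {f \<in> Arr C. Cod C f = X \<and> act B f y \<in> cmpt w (Dom C f) ` val A (Dom C f)}) \<in> local_topology S"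
proof -
  interpret M: sheaf_site C U "min_topology C" using min_topology by unfold_locales
  note AB = Hom_Psh_presheaf[OF w]
  define im where "im X y = {f \<in> Arr C. Cod C f = X \<and> act B f y \<in> cmpt w (Dom C f) ` val A (Dom C f)}" for X y
  have sv: "is_sieve C X (im X y)" if X: "X \<in> Obj C" and y: "y \<in> val B X" for X y
    unfolding is_sieve_def
  proof (intro conjI ballI impI)
    fix f g assume f: "f \<in> im X y" and g: "g \<in> Arr C" "Cod C g = Dom C f"
    then obtain s where fs: "f \<in> Arr C" "Cod C f = X" "s \<in> val A (Dom C f)" "act B f y = cmpt w (Dom C f) s"
      by (auto simp: im_def)
    have "act B (f \<odot> g) y = cmpt w (Dom C g) (act A g s)"
      using act_comp[OF AB(2) g(1) fs(1), of y] fs g y cmpt_act[OF w g(1), of s] by simp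
    then show "f \<odot> g \<in> im X y" using fs g act_in'[OF AB(1) g fs(3)] by (auto simp: im_def)
  qed (use X in \<open>auto simp: im_def\<close>)
  have glue: "unique_gluing F X (im X y)" if X: "X \<in> Obj C" and y: "y \<in> val B X" and F: "F \<in> S" for X y F
  proof -
    let ?R = "im X y" and ?M = "{f \<in> Arr C. Cod C f = X}"
    note R = sv[OF X y]
    have M: "is_sieve C X ?M" using is_sieve_max[OF X] .
    have RM: "?R \<subseteq> ?M" by (auto simp: im_def)
    obtain Y e d where e: "sieve_encoding ?M Y e d" using encoding_exists[OF sieve_raw[OF M]] by blast
    obtain Y' e' d' where e': "sieve_encoding ?R Y' e' d'" using encoding_exists[OF sieve_raw[OF R]] by blast
    let ?\<iota> = "transf C Y' Y (\<lambda>a s. e (Dom C (d' a s)) (d' a s))"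
    let ?k = "transf C Y B (\<lambda>a s. act B (d a s) y)"
    define q where "q f = inv_into (val A (Dom C f)) (cmpt w (Dom C f)) (act B f y)" for f
    let ?q = "transf C Y' A (\<lambda>a s. q (d' a s))"
    have q: "q f \<in> val A (Dom C f)" "cmpt w (Dom C f) (q f) = act B f y" if "f \<in> ?R" for f
      using that unfolding im_def q_def by (auto intro: inv_into_into f_inv_into_f)
    have qm: "matching_family C A ?R q"
      unfolding matching_family_def
    proof (intro conjI ballI impI)
      fix f g assume f: "f \<in> ?R" and g: "g \<in> Arr C" "Cod C g = Dom C f"
      have fa: "f \<in> Arr C" "Cod C f = X" using sieve_arr[OF R f] by auto
      have fg: "f \<odot> g \<in> ?R" using sieve_closed[OF R f g] .
      have d: "Dom C g \<in> Obj C" using g by simp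
      have "cmpt w (Dom C g) (act A g (q f)) = cmpt w (Dom C g) (q (f \<odot> g))"
        using q(2)[OF fg] q[OF f] cmpt_act[OF w g(1), of "q f"] g fa act_comp[OF AB(2) g(1) fa(1), of y] y by simp
      then show "act A g (q f) = q (f \<odot> g)"
        using inj_onD[OF inj[OF d]] act_in'[OF AB(1) g q(1)[OF f]] q(1)[OF fg] g fa by simp
    qed (use q in auto)
    have \<iota>: "?\<iota> \<in> hom Y' Y" by (rule sieve_hom[OF R e' enc_psh[OF e] inclusion_matching[OF R M RM e]])
    have k: "?k \<in> hom Y B" by (rule sieve_hom[OF M e AB(2) restrictions_matching[OF M AB(2) y]])
    have qh: "?q \<in> hom Y' A" by (rule sieve_hom[OF R e' AB(1) qm])
    have dec': "d' a z \<in> ?R" "Dom C (d' a z) = a" if "a \<in> Obj C" "z \<in> val Y' a" for a z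
      using dec_in[OF e' that] by (auto simp: sieve_val_def)
    have \<iota>c: "cmpt ?\<iota> a z = e a (d' a z)" "d a (e a (d' a z)) = d' a z" "e a (d' a z) \<in> val Y a"
      if "a \<in> Obj C" "z \<in> val Y' a" for a z
      using dec'[OF that] sieve_element[OF M e, of "d' a z"] RM that by auto
    have "ptwise_pullback C ?k w ?\<iota> ?q"
      unfolding ptwise_pullback_def hom_src[OF k] hom_src[OF w] hom_src[OF \<iota>]
    proof (intro ballI conjI impI)
      fix a z assume a: "a \<in> Obj C" and z: "z \<in> val Y' a"
      show "cmpt ?k a (cmpt ?\<iota> a z) = cmpt w a (cmpt ?q a z)"
        using \<iota>c[OF a z] a z q(2)[OF dec'(1)[OF a z]] dec'(2)[OF a z] by simp
    next
      fix a z s assume a: "a \<in> Obj C" and z: "z \<in> val Y a" and s: "s \<in> val A a" and eq: "cmpt ?k a z = cmpt w a s"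
      have dz: "d a z \<in> Arr C" "Cod C (d a z) = X" "Dom C (d a z) = a" using dec_in[OF e a z] by (auto simp: sieve_val_def)
      have dR: "d a z \<in> ?R" using dz eq a z s by (auto simp: im_def)
      let ?z = "e' a (d a z)"
      have z': "?z \<in> val Y' a" "d' a ?z = d a z" using sieve_element[OF R e' dR] dz by auto
      show "\<exists>!z'. z' \<in> val Y' a \<and> cmpt ?\<iota> a z' = z \<and> cmpt ?q a z' = s"
      proof (rule ex1I[where a="?z"])
        have "cmpt w a (q (d a z)) = cmpt w a s" using q(2)[OF dR] dz eq a z by simp
        then have "q (d a z) = s" using inj_onD[OF inj[OF a]] q(1)[OF dR] dz s by simp
        then show "?z \<in> val Y' a \<and> cmpt ?\<iota> a ?z = z \<and> cmpt ?q a ?z = s"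
          using z' \<iota>c(1)[OF a z'(1)] enc_dec[OF e a z] a by simp
        fix v assume v: "v \<in> val Y' a \<and> cmpt ?\<iota> a v = z \<and> cmpt ?q a v = s"
        then have "d' a v = d a z" using \<iota>c[OF a, of v] by auto
        then show "v = ?z" using enc_dec[OF e' a, of v] v by simp
      qed
    qed
    then have "is_pullback (Psh U C) ?k w Y' ?\<iota> ?q"
      using M.pullback_Sh_iff[unfolded Sh_min sheaves_min, OF k w] enc_psh[OF e'] \<iota> qh by blast
    then have "is_pullback (full_subcat (Psh U C) S) (FA r ?k) (FA r w) (FO r Y') (FA r ?\<iota>) (FA r ?q)"
      using lex unfolding left_exact_def by blast
    then have inv\<iota>: "is_iso (full_subcat (Psh U C) S) (FA r ?\<iota>)"
      by (rule pullback_iso[OF category_full_subcat[OF category_Psh] _ inv])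
    have r: "is_functor (Psh U C) (full_subcat (Psh U C) S) r" using lex by (simp add: left_exact_def)
    have Fp: "psh F" using F S by auto
    show ?thesis
      by (rule orthogonal_unique_gluing[OF R e e' Fp], rule inverted_orthogonal[OF category_Psh r adj \<iota> inv\<iota>])
        (use F Fp in auto)
  qed
  have "pullback_sieve C f (im X y) = im (Dom C f) (act B f y)" if "f \<in> Arr C" "Cod C f = X" for f
    using that act_comp[OF AB(2), of _ f y] y by (auto simp: pullback_sieve_def im_def)
  then show ?thesis
    unfolding local_topology_def im_def[symmetric] using sv[OF X y] glue act_in'[OF AB(2)] y by auto
qed

text \<open>Let \<open>F\<close> be a sheaf for the largest topology for which the objects of \<open>S\<close> are sheaves. The reflection inverts the
  unit \<open>\<eta> : F \<rightarrow> r F\<close>, hence also the diagonal \<open>\<delta>\<close> of its kernel pair, which is a monomorphism. The image sieves of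
  \<open>\<delta>\<close> are thus covering: elements identified by \<open>\<eta>\<close> agree locally, and \<open>\<eta>\<close> is injective. Now the image sieves of \<open>\<eta>\<close>
  are covering too, \<open>\<eta>\<close> is surjective by gluing, and \<open>F\<close> is isomorphic to an object of \<open>S\<close>.\<close>

theorem ST_Psh_sheaves:
  assumes ST: "S \<in> ST (Psh U C)"
  shows "S = sheaves U C (local_topology S)"
proof
  interpret M: sheaf_site C U "min_topology C" using min_topology by unfold_locales
  have S: "S \<subseteq> {P. psh P}" using ST by (auto simp: ST_def)
  show sub: "S \<subseteq> sheaves U C (local_topology S)" by (rule local_topology_sheaves[OF S])
  interpret K: sheaf_site C U "local_topology S" using local_topology[OF S] by unfold_locales
  obtain r \<eta> \<epsilon> where lex: "left_exact (Psh U C) (full_subcat (Psh U C) S) r"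
    and adj: "adjunction (Psh U C) (full_subcat (Psh U C) S) r id_functor \<eta> \<epsilon>"
    using ST by (auto simp: ST_def geometric_morphism_def)
  have r: "is_functor (Psh U C) (full_subcat (Psh U C) S) r" using lex by (simp add: left_exact_def)
  interpret E: category "full_subcat (Psh U C) S" by (rule category_full_subcat[OF category_Psh])
  interpret Psh: category "Psh U C" by (rule category_Psh)
  show "sheaves U C (local_topology S) \<subseteq> S"
  proof
    fix F assume F: "F \<in> sheaves U C (local_topology S)"
    have Fp: "psh F" using F by (rule sheaf_presheaf)
    have FO: "F \<in> Obj (Psh U C)" using Fp by simp
    have eta: "\<eta> F \<in> hom F (FO r F)"
      using adj FO by (auto simp: adjunction_def natural_def id_functor_def comp_functor_def)
    have rF: "FO r F \<in> S" using functor_Obj[OF r FO] by simp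
    have rFp: "psh (FO r F)" using rF S by auto
    have inv_eta: "is_iso (full_subcat (Psh U C) S) (FA r (\<eta> F))" by (rule reflection_inverts_unit[OF category_Psh adj FO])
    obtain N p q where p: "p \<in> hom N F" and q: "q \<in> hom N F" and pb: "ptwise_pullback C (\<eta> F) (\<eta> F) p q"
      using ptwise_pullback_exists[OF eta eta] .
    have Np: "psh N" using Hom_Psh_presheaf[OF p] by simp
    have pbP: "is_pullback (Psh U C) (\<eta> F) (\<eta> F) N p q"
      using M.pullback_Sh_iff[unfolded Sh_min sheaves_min, OF eta eta] Np p q pb by blast
    have iF: "Ide (Psh U C) F \<in> hom F F" using Ide_hom[OF Fp] .
    obtain \<delta> where \<delta>: "\<delta> \<in> hom F N" "p \<odot>\<^bsub>Psh U C\<^esub> \<delta> = Ide (Psh U C) F" "q \<odot>\<^bsub>Psh U C\<^esub> \<delta> = Ide (Psh U C) F"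
      using pbP iF FO unfolding is_pullback_def by (metis Psh_simps(3) hom_src(1)[OF eta])
    have "is_pullback (full_subcat (Psh U C) S) (FA r (\<eta> F)) (FA r (\<eta> F)) (FO r N) (FA r p) (FA r q)"
      using lex pbP unfolding left_exact_def by blast
    from pullback_iso[OF E.category_axioms this inv_eta]
    have inv_p: "is_iso (full_subcat (Psh U C) S) (FA r p)" .
    have rp: "FA r p \<in> Hom (full_subcat (Psh U C) S) (FO r N) (FO r F)" using functor_Hom[OF r p] .
    have rd: "FA r \<delta> \<in> Hom (full_subcat (Psh U C) S) (FO r F) (FO r N)" using functor_Hom[OF r \<delta>(1)] .
    obtain v where v: "v \<in> Hom (full_subcat (Psh U C) S) (FO r F) (FO r N)"
      "v \<odot>\<^bsub>Psh U C\<^esub> FA r p = Ide (Psh U C) (FO r N)" "FA r p \<odot>\<^bsub>Psh U C\<^esub> v = Ide (Psh U C) (FO r F)"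
      using E.is_isoE[OF inv_p rp] by (auto simp del: Psh_simps)
    have pd: "FA r p \<odot>\<^bsub>Psh U C\<^esub> FA r \<delta> = Ide (Psh U C) (FO r F)"
      using functor_comp[OF r \<delta>(1) p] \<delta>(2) functor_Ide[OF r FO] by (simp del: Psh_simps)
    have "FA r \<delta> = v"
      using E.Cmp_assoc[OF rd rp v(1)] v pd E.Ide_left[OF rd] E.Ide_right[OF v(1)] by (simp del: Psh_simps)
    then have inv_d: "is_iso (full_subcat (Psh U C) S) (FA r \<delta>)"
      using E.is_isoI[OF v(1) rp] v by (simp del: Psh_simps)
    have pd1: "cmpt p a (cmpt \<delta> a s) = s" and qd1: "cmpt q a (cmpt \<delta> a s) = s" if "a \<in> Obj C" "s \<in> val F a" for a s
      using cmpt_comp_eq[OF \<delta>(2) that(1)] cmpt_comp_eq[OF \<delta>(3) that(1)] that by (auto simp: hom_src[OF \<delta>(1)])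
    \<comment> \<open>\<open>\<delta>\<close> is a section of \<open>p\<close>.\<close>
    have inj_d: "inj_on (cmpt \<delta> a) (val F a)" if "a \<in> Obj C" for a
      by (rule inj_on_inverseI[where g="cmpt p a"]) (use pd1 that in auto)
    have inj: "inj_on (cmpt (\<eta> F) a) (val F a)" if a: "a \<in> Obj C" for a
    proof (rule inj_onI)
      fix s t assume s: "s \<in> val F a" and t: "t \<in> val F a" and eq: "cmpt (\<eta> F) a s = cmpt (\<eta> F) a t"
      obtain y where y: "y \<in> val N a" "cmpt p a y = s" "cmpt q a y = t"
        using pb a s t eq unfolding ptwise_pullback_def hom_src[OF p] hom_src[OF eta] by metis
      have loc: "locally C (local_topology S) a (\<lambda>f. act N f y \<in> cmpt \<delta> (Dom C f) ` val F (Dom C f))"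
        by (rule K.locallyI[OF image_sieve_local[OF S lex adj \<delta>(1) inv_d inj_d a y(1)]]) auto
      show "s = t"
      proof (rule K.sheaf_separated[OF F s t])
        show "locally C (local_topology S) a (\<lambda>f. act F f s = act F f t)"
        proof (rule K.locally_mono[OF loc])
          fix f assume f: "f \<in> Arr C" "Cod C f = a" "act N f y \<in> cmpt \<delta> (Dom C f) ` val F (Dom C f)"
          then obtain u where u: "u \<in> val F (Dom C f)" "act N f y = cmpt \<delta> (Dom C f) u" by auto
          show "act F f s = act F f t"
            using cmpt_act[OF p f(1), of y] cmpt_act[OF q f(1), of y] f u y pd1[of "Dom C f" u] qd1[of "Dom C f" u] by simp
        qed
      qed
    qed
    have surj: "t \<in> cmpt (\<eta> F) a ` val F a" if a: "a \<in> Obj C" and t: "t \<in> val (FO r F) a" for a t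
    proof -
      have loc: "locally C (local_topology S) a (\<lambda>f. \<exists>s. s \<in> val F (Dom C f) \<and> act (FO r F) f t = cmpt (\<eta> F) (Dom C f) s)"
        by (rule K.locallyI[OF image_sieve_local[OF S lex adj eta inv_eta inj a t]]) auto
      have "\<exists>s \<in> val F a. \<forall>f s'. f \<in> Arr C \<longrightarrow> Cod C f = a \<longrightarrow>
          s' \<in> val F (Dom C f) \<and> act (FO r F) f t = cmpt (\<eta> F) (Dom C f) s' \<longrightarrow> act F f s = s'"
      proof (rule K.sheaf_local_description[OF F loc])
        fix f g z assume f: "f \<in> Arr C" "Cod C f = a" and z: "z \<in> val F (Dom C f) \<and> act (FO r F) f t = cmpt (\<eta> F) (Dom C f) z"
          and g: "g \<in> Arr C" "Cod C g = Dom C f"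
        show "act F g z \<in> val F (Dom C (f \<odot> g)) \<and> act (FO r F) (f \<odot> g) t = cmpt (\<eta> F) (Dom C (f \<odot> g)) (act F g z)"
          using act_in'[OF Fp g] z f g act_comp[OF rFp g(1) f(1), of t] t cmpt_act[OF eta g(1), of z] by simp
      next
        fix f z z' assume f: "f \<in> Arr C" and "z \<in> val F (Dom C f) \<and> act (FO r F) f t = cmpt (\<eta> F) (Dom C f) z"
          "z' \<in> val F (Dom C f) \<and> act (FO r F) f t = cmpt (\<eta> F) (Dom C f) z'"
        then show "z = z'" using inj_onD[OF inj[of "Dom C f"], of z z'] by simp
      qed auto
      then obtain s where s: "s \<in> val F a" and sf: "\<And>f s'. f \<in> Arr C \<Longrightarrow> Cod C f = a \<Longrightarrow>
          s' \<in> val F (Dom C f) \<Longrightarrow> act (FO r F) f t = cmpt (\<eta> F) (Dom C f) s' \<Longrightarrow> act F f s = s'" by blast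
      have es: "cmpt (\<eta> F) a s \<in> val (FO r F) a" using cmpt_in[OF eta a s] .
      have "cmpt (\<eta> F) a s = t"
      proof (rule K.sheaf_separated[OF _ es t])
        show "FO r F \<in> sheaves U C (local_topology S)" using sub rF by blast
        show "locally C (local_topology S) a (\<lambda>f. act (FO r F) f (cmpt (\<eta> F) a s) = act (FO r F) f t)"
        proof (rule K.locally_mono[OF loc])
          fix f assume f: "f \<in> Arr C" "Cod C f = a" and "\<exists>s. s \<in> val F (Dom C f) \<and> act (FO r F) f t = cmpt (\<eta> F) (Dom C f) s"
          then obtain s' where s': "s' \<in> val F (Dom C f)" "act (FO r F) f t = cmpt (\<eta> F) (Dom C f) s'" by blast
          show "act (FO r F) f (cmpt (\<eta> F) a s) = act (FO r F) f t"
            using cmpt_act[OF eta f(1), of s] sf[OF f s'] f s s' by simp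
        qed
      qed
      then show ?thesis using s by blast
    qed
    have "ptwise_bij C (\<eta> F)"
      unfolding ptwise_bij_def hom_src[OF eta] bij_betw_def
    proof (intro ballI conjI)
      fix a assume a: "a \<in> Obj C"
      show "inj_on (cmpt (\<eta> F) a) (val F a)" by (rule inj[OF a])
      show "cmpt (\<eta> F) a ` val F a = val (FO r F) a"
        using surj[OF a] cmpt_in[OF eta a] by (intro equalityI subsetI) auto
    qed
    from ptwise_bij_inverse[OF eta this] obtain n where n: "n \<in> hom (FO r F) F" "ptwise_bij C n" by metis
    have "is_iso (Psh U C) n" using M.iso_Sh_iff[unfolded Sh_min, OF n(1)] n(2) by simp
    then have "isomorphic (Psh U C) (FO r F) F" unfolding isomorphic_def using n(1) by blast
    then show "F \<in> S" using ST rF FO unfolding ST_def by blast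
  qed
qed

lemma ST_Sh_sheaves:
  assumes J: "is_topology C J" and S: "S \<in> ST (Sh U C J)"
  shows "S = sheaves U C (local_topology S)" "J \<subseteq> local_topology S" "is_topology C (local_topology S)"
proof -
  interpret J: sheaf_site C U J using J by unfold_locales
  have SJ: "S \<subseteq> sheaves U C J" using S by (auto simp: ST_def)
  have "sheaves U C J \<in> ST (Psh U C)"
    using J.sheaves_ST[OF min_topology min_topology_least[OF J]] by (simp add: Sh_min)
  then have "S \<in> ST (Psh U C)" using ST_trans[OF category_Psh] S by (simp add: Sh_def)
  then show "S = sheaves U C (local_topology S)" by (rule ST_Psh_sheaves)
  show "J \<subseteq> local_topology S" by (rule local_topology_greatest[OF J SJ])
  show "is_topology C (local_topology S)" by (rule local_topology) (use SJ sheaf_presheaf in blast)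
qed

lemma ST_Sh_iff:
  assumes J: "is_topology C J"
  shows "S \<in> ST (Sh U C J) \<longleftrightarrow> (\<exists>K. is_topology C K \<and> J \<subseteq> K \<and> S = sheaves U C K)"
proof
  assume "\<exists>K. is_topology C K \<and> J \<subseteq> K \<and> S = sheaves U C K"
  then obtain K where K: "is_topology C K" "J \<subseteq> K" "S = sheaves U C K" by blast
  interpret K: sheaf_site C U K using K(1) by unfold_locales
  show "S \<in> ST (Sh U C J)" using K.sheaves_ST[OF J K(2)] K(3) by simp
qed (use ST_Sh_sheaves[OF J] in blast)

lemma ST_Inter:
  assumes J: "is_topology C J" and \<S>: "\<S> \<subseteq> ST (Sh U C J)"
  shows "sheaves U C J \<inter> \<Inter>\<S> \<in> ST (Sh U C J)"
proof -
  let ?F = "sheaves U C J \<inter> \<Inter>\<S>"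
  have Fp: "?F \<subseteq> {P. psh P}" using sheaf_presheaf by auto
  have JK: "J \<subseteq> local_topology ?F" by (rule local_topology_greatest[OF J]) auto
  have "sheaves U C (local_topology ?F) \<subseteq> S" if S: "S \<in> \<S>" for S
  proof -
    obtain K where K: "is_topology C K" "S = sheaves U C K" using ST_Sh_iff[OF J] S \<S> by blast
    have "K \<subseteq> local_topology ?F" by (rule local_topology_greatest[OF K(1)]) (use K S in auto)
    then show ?thesis using sheaves_antimono K by metis
  qed
  moreover have "sheaves U C (local_topology ?F) \<subseteq> sheaves U C J" by (rule sheaves_antimono[OF JK])
  moreover have "?F \<subseteq> sheaves U C (local_topology ?F)" by (rule local_topology_sheaves[OF Fp])
  ultimately have "?F = sheaves U C (local_topology ?F)" by blast
  then show ?thesis using ST_Sh_iff[OF J] JK local_topology[OF Fp] by metis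
qed

end

section \<open>Fibrations and the Giraud topology\<close>

locale small_functor = CC: psh_cat C U + BB: psh_cat B U
  for C :: "('o, 'm) cat" and B :: "('b, 'n) cat" and U :: "'u set" +
  fixes p :: "('o, 'm, 'b, 'n) cat_functor"
  assumes p_functor: "is_functor C B p"
begin

abbreviation compC (infixl "\<odot>\<^sub>C" 70) where "g \<odot>\<^sub>C f \<equiv> g \<odot>\<^bsub>C\<^esub> f"
abbreviation compB (infixl "\<odot>\<^sub>B" 70) where "g \<odot>\<^sub>B f \<equiv> g \<odot>\<^bsub>B\<^esub> f"

lemma p_simps [simp]:
  "a \<in> Obj C \<Longrightarrow> FO p a \<in> Obj B"
  "f \<in> Arr C \<Longrightarrow> FA p f \<in> Arr B"
  "f \<in> Arr C \<Longrightarrow> Dom B (FA p f) = FO p (Dom C f)"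
  "f \<in> Arr C \<Longrightarrow> Cod B (FA p f) = FO p (Cod C f)"
  "a \<in> Obj C \<Longrightarrow> FA p (Ide C a) = Ide B (FO p a)"
  "f \<in> Arr C \<Longrightarrow> g \<in> Arr C \<Longrightarrow> Cod C f = Dom C g \<Longrightarrow> FA p (g \<odot>\<^sub>C f) = FA p g \<odot>\<^sub>B FA p f"
  using functor_comp[OF p_functor, of f "Dom C f" "Cod C f" g "Cod C g"]
  by (simp_all add: functor_Obj[OF p_functor] functor_Arr[OF p_functor] functor_Ide[OF p_functor] Hom_def)

abbreviation pb where "pb \<equiv> pullback_functor C p"

lemma pb_val [simp]: "a \<in> Obj C \<Longrightarrow> val (FO pb P) a = val P (FO p a)"
  and pb_act [simp]: "f \<in> Arr C \<Longrightarrow> act (FO pb P) f = act P (FA p f)"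
  and pb_cmpt [simp]: "a \<in> Obj C \<Longrightarrow> cmpt (FA pb t) a = cmpt t (FO p a)"
  and pb_src [simp]: "src (FA pb t) = FO pb (src t)"
  and pb_tgt [simp]: "tgt (FA pb t) = FO pb (tgt t)"
  by (simp_all add: pullback_functor_def Let_def)

lemma pb_psh:
  assumes P: "BB.psh P" shows "CC.psh (FO pb P)"
  unfolding is_presheaf_def
proof (intro conjI ballI impI)
  show "val (FO pb P) \<in> (\<Pi>\<^sub>E a\<in>Obj C. {A. A \<subseteq> U \<and> small U A})"
    using P by (auto simp: pullback_functor_def Let_def is_presheaf_def PiE_iff)
  show "act (FO pb P) \<in> (\<Pi>\<^sub>E f\<in>Arr C. val (FO pb P) (Cod C f) \<rightarrow>\<^sub>E val (FO pb P) (Dom C f))"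
  proof (rule PiE_I)
    fix f assume f: "f \<in> Arr C"
    have "act P (FA p f) \<in> val P (Cod B (FA p f)) \<rightarrow>\<^sub>E val P (Dom B (FA p f))"
      using P f unfolding is_presheaf_def by (meson PiE_mem p_simps(2))
    then show "act (FO pb P) f \<in> val (FO pb P) (Cod C f) \<rightarrow>\<^sub>E val (FO pb P) (Dom C f)" using f by simp
  qed (simp add: pullback_functor_def Let_def)
qed (use P in \<open>auto simp: BB.act_comp\<close>)

lemma pb_hom:
  assumes t: "t \<in> BB.hom P Q" shows "FA pb t \<in> CC.hom (FO pb P) (FO pb Q)"
proof -
  have "FA pb t = transf C (FO pb P) (FO pb Q) (\<lambda>a. cmpt t (FO p a))"
  proof -
    have "(\<lambda>s \<in> val P (FO p a). cmpt t (FO p a) s) = cmpt t (FO p a)" if a: "a \<in> Obj C" for a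
    proof -
      have "cmpt t (FO p a) \<in> extensional (val P (FO p a))"
        using t a by (auto simp: Hom_Psh is_nattrans_def PiE_iff)
      then show ?thesis by (rule extensional_restrict)
    qed
    then show ?thesis
      by (auto simp: pullback_functor_def Let_def transf_def BB.hom_src[OF t] intro!: ext)
  qed
  also have "\<dots> \<in> CC.hom (FO pb P) (FO pb Q)"
  proof (rule CC.transf_hom)
    fix f s assume f: "f \<in> Arr C" and "s \<in> val (FO pb P) (Cod C f)"
    then show "act (FO pb Q) f (cmpt t (FO p (Cod C f)) s) = cmpt t (FO p (Dom C f)) (act (FO pb P) f s)"
      using cmpt_act[OF t, of "FA p f" s] by simp
  qed (use Hom_Psh_presheaf[OF t] cmpt_in[OF t] in \<open>auto intro: pb_psh\<close>)
  finally show ?thesis .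
qed

lemma pb_functor: "is_functor (Psh U B) (Psh U C) pb"
proof -
  have 1: "FA pb (Ide (Psh U B) P) = Ide (Psh U C) (FO pb P)" if P: "BB.psh P" for P
    by (rule Hom_Psh_eqI[OF pb_hom[OF BB.Ide_hom[OF P]] CC.Ide_hom[OF pb_psh[OF P]]]) simp
  have 2: "FA pb (g \<odot>\<^bsub>Psh U B\<^esub> f) = FA pb g \<odot>\<^bsub>Psh U C\<^esub> FA pb f"
    if f: "f \<in> BB.hom P Q" and g: "g \<in> BB.hom Q R" for f g P Q R
    by (rule Hom_Psh_eqI[OF pb_hom[OF BB.comp_hom[OF f g]] CC.comp_hom[OF pb_hom[OF f] pb_hom[OF g]]])
      (simp add: BB.hom_src[OF f])
  show ?thesis
    unfolding is_functor_def
  proof (intro conjI ballI impI)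
    fix f assume "f \<in> Arr (Psh U B)"
    then have "f \<in> BB.hom (src f) (tgt f)" by (simp add: Hom_Psh)
    then show "FA pb f \<in> CC.hom (FO pb (Dom (Psh U B) f)) (FO pb (Cod (Psh U B) f))" using pb_hom by simp
  next
    fix f g assume "f \<in> Arr (Psh U B)" "g \<in> Arr (Psh U B)" "Cod (Psh U B) f = Dom (Psh U B) g"
    then show "FA pb (g \<odot>\<^bsub>Psh U B\<^esub> f) = FA pb g \<odot>\<^bsub>Psh U C\<^esub> FA pb f"
      by (intro 2[of f "src f" "tgt f" g "tgt g"]) (auto simp: Hom_Psh)
  qed (use 1 pb_psh in auto)
qed

end

locale small_fibration = small_functor +
  assumes fibration: "is_fibration C B p"
begin

lemma horizontal_factor:
  assumes "horizontal C B p x" "x1 \<in> Arr C" "Cod C x1 = Cod C x"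
    "\<beta> \<in> Arr B" "Dom B \<beta> = FO p (Dom C x1)" "Cod B \<beta> = FO p (Dom C x)" "FA p x1 = FA p x \<odot>\<^sub>B \<beta>"
  shows "\<exists>v. v \<in> Arr C \<and> Dom C v = Dom C x1 \<and> Cod C v = Dom C x \<and> x1 = x \<odot>\<^sub>C v \<and> FA p v = \<beta>"
proof -
  have "\<beta> \<in> Hom B (FO p (Dom C x1)) (FO p (Dom C x))" using assms by (simp add: Hom_def)
  then have "\<exists>!x'. x' \<in> Hom C (Dom C x1) (Dom C x) \<and> x1 = x \<odot>\<^sub>C x' \<and> FA p x' = \<beta>"
    using assms unfolding horizontal_def by blast
  then show ?thesis by (auto simp: Hom_def)
qed

lemma horizontal_liftingD:
  assumes "horizontal_lifting C B p a b x" "b \<in> Arr B"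
  shows "\<exists>i j. horizontal C B p x \<and> x \<in> Arr C \<and> Cod C x = a \<and> i \<in> Arr B \<and> Dom B i = FO p (Dom C x) \<and> Cod B i = Dom B b \<and>
    j \<in> Arr B \<and> Dom B j = Dom B b \<and> Cod B j = FO p (Dom C x) \<and> i \<odot>\<^sub>B j = Ide B (Dom B b) \<and>
    j \<odot>\<^sub>B i = Ide B (FO p (Dom C x)) \<and> b \<odot>\<^sub>B i = FA p x \<and> FA p x \<odot>\<^sub>B j = b"
proof -
  obtain i where x: "horizontal C B p x" "Cod C x = a" and i: "i \<in> Hom B (FO p (Dom C x)) (Dom B b)" "is_iso B i"
    and bi: "b \<odot>\<^sub>B i = FA p x"
    using assms unfolding horizontal_lifting_def by blast
  obtain j where j: "j \<in> Hom B (Dom B b) (FO p (Dom C x))" "j \<odot>\<^sub>B i = Ide B (FO p (Dom C x))" "i \<odot>\<^sub>B j = Ide B (Dom B b)"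
    using BB.is_isoE[OF i(2,1)] .
  have xa: "x \<in> Arr C" using x by (simp add: horizontal_def)
  note ij = HomD[OF i(1)] HomD[OF j(1)]
  have "FA p x \<odot>\<^sub>B j = b"
  proof -
    have "FA p x \<odot>\<^sub>B j = (b \<odot>\<^sub>B i) \<odot>\<^sub>B j" using bi by simp
    also have "\<dots> = b \<odot>\<^sub>B (i \<odot>\<^sub>B j)" using ij assms(2) by (intro BB.comp_assoc) auto
    also have "\<dots> = b" using j(3) BB.comp_Ide(2)[OF assms(2)] by simp
    finally show ?thesis .
  qed
  then show ?thesis using x xa ij j bi by blast
qed

lemma lifting_exists:
  assumes "a \<in> Obj C" "b \<in> Arr B" "Cod B b = FO p a"
  shows "\<exists>x. horizontal_lifting C B p a b x"
  using fibration assms unfolding is_fibration_def by blast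

text \<open>The sieve \<open>S\<^sub>p\<close> is the largest sieve of \<open>B\<close> all of whose lifts belong to \<open>S\<close>: membership may be
  tested on arbitrary lifts instead of horizontal ones.\<close>

lemma sieve_image_iff:
  assumes S: "is_sieve C a S"
  shows "b \<in> sieve_image C B p a S \<longleftrightarrow> b \<in> Arr B \<and> Cod B b = FO p a \<and>
    (\<forall>f \<in> Arr C. Cod C f = a \<longrightarrow> (\<forall>c \<in> Arr B. Dom B c = FO p (Dom C f) \<longrightarrow> Cod B c = Dom B b \<longrightarrow>
      FA p f = b \<odot>\<^sub>B c \<longrightarrow> f \<in> S))"
proof
  have a: "a \<in> Obj C" using S by (simp add: is_sieve_def)
  assume "b \<in> sieve_image C B p a S"
  then obtain x where b: "b \<in> Arr B" "Cod B b = FO p a" and x: "x \<in> S" "horizontal_lifting C B p a b x"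
    by (auto simp: sieve_image_def)
  obtain i j where xh: "horizontal C B p x" and xa: "x \<in> Arr C" "Cod C x = a"
    and i: "i \<in> Arr B" "Dom B i = FO p (Dom C x)" "Cod B i = Dom B b"
    and j: "j \<in> Arr B" "Dom B j = Dom B b" "Cod B j = FO p (Dom C x)" and xj: "FA p x \<odot>\<^sub>B j = b"
    using horizontal_liftingD[OF x(2) b(1)] by blast
  have "f \<in> S" if f: "f \<in> Arr C" "Cod C f = a" and c: "c \<in> Arr B" "Dom B c = FO p (Dom C f)" "Cod B c = Dom B b"
    and fc: "FA p f = b \<odot>\<^sub>B c" for f c
  proof -
    have "FA p f = (FA p x \<odot>\<^sub>B j) \<odot>\<^sub>B c" using fc xj by simp
    also have "\<dots> = FA p x \<odot>\<^sub>B (j \<odot>\<^sub>B c)" using c j xa by (intro BB.comp_assoc) auto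
    finally have "FA p f = FA p x \<odot>\<^sub>B (j \<odot>\<^sub>B c)" .
    then obtain v where "v \<in> Arr C" "Cod C v = Dom C x" "f = x \<odot>\<^sub>C v"
      using horizontal_factor[OF xh f(1), of "j \<odot>\<^sub>B c"] f xa c j by auto
    then show "f \<in> S" using sieve_closed[OF S x(1)] by simp
  qed
  then show "b \<in> Arr B \<and> Cod B b = FO p a \<and>
    (\<forall>f \<in> Arr C. Cod C f = a \<longrightarrow> (\<forall>c \<in> Arr B. Dom B c = FO p (Dom C f) \<longrightarrow> Cod B c = Dom B b \<longrightarrow>
      FA p f = b \<odot>\<^sub>B c \<longrightarrow> f \<in> S))" using b by blast
next
  have a: "a \<in> Obj C" using S by (simp add: is_sieve_def)
  assume r: "b \<in> Arr B \<and> Cod B b = FO p a \<and>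
    (\<forall>f \<in> Arr C. Cod C f = a \<longrightarrow> (\<forall>c \<in> Arr B. Dom B c = FO p (Dom C f) \<longrightarrow> Cod B c = Dom B b \<longrightarrow>
      FA p f = b \<odot>\<^sub>B c \<longrightarrow> f \<in> S))"
  then obtain x where x: "horizontal_lifting C B p a b x" using lifting_exists[OF a, of b] by blast
  obtain i where "x \<in> Arr C" "Cod C x = a" "i \<in> Arr B" "Dom B i = FO p (Dom C x)" "Cod B i = Dom B b" "b \<odot>\<^sub>B i = FA p x"
    using horizontal_liftingD[OF x] r by blast
  then have "x \<in> S" using r by auto
  then show "b \<in> sieve_image C B p a S" using r x by (auto simp: sieve_image_def)
qed

lemma sieve_imageD:
  assumes S: "is_sieve C a S" and b: "b \<in> sieve_image C B p a S"
  shows "b \<in> Arr B" "Cod B b = FO p a"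
    and "\<And>f c. f \<in> Arr C \<Longrightarrow> Cod C f = a \<Longrightarrow> c \<in> Arr B \<Longrightarrow> Dom B c = FO p (Dom C f) \<Longrightarrow> Cod B c = Dom B b \<Longrightarrow>
      FA p f = b \<odot>\<^sub>B c \<Longrightarrow> f \<in> S"
  using b unfolding sieve_image_iff[OF S] by blast+

lemma sieve_imageI:
  assumes S: "is_sieve C a S" and b: "b \<in> Arr B" "Cod B b = FO p a"
    and "\<And>f c. f \<in> Arr C \<Longrightarrow> Cod C f = a \<Longrightarrow> c \<in> Arr B \<Longrightarrow> Dom B c = FO p (Dom C f) \<Longrightarrow> Cod B c = Dom B b \<Longrightarrow>
      FA p f = b \<odot>\<^sub>B c \<Longrightarrow> f \<in> S"
  shows "b \<in> sieve_image C B p a S"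
  using assms(4) b unfolding sieve_image_iff[OF S] by blast

lemma is_sieve_image:
  assumes S: "is_sieve C a S" shows "is_sieve B (FO p a) (sieve_image C B p a S)"
  unfolding is_sieve_def
proof (intro conjI ballI impI)
  fix b c assume b: "b \<in> sieve_image C B p a S" and c: "c \<in> Arr B" "Cod B c = Dom B b"
  note bD = sieve_imageD[OF S b]
  show "b \<odot>\<^sub>B c \<in> sieve_image C B p a S"
  proof (rule sieve_imageI[OF S])
    fix f d assume "f \<in> Arr C" "Cod C f = a" "d \<in> Arr B" "Dom B d = FO p (Dom C f)" "Cod B d = Dom B (b \<odot>\<^sub>B c)"
      "FA p f = (b \<odot>\<^sub>B c) \<odot>\<^sub>B d"
    then show "f \<in> S" using bD(3)[of f "c \<odot>\<^sub>B d"] bD(1,2) c by simp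
  qed (use bD(1,2) c in auto)
qed (use S sieve_imageD[OF S] in \<open>auto simp: is_sieve_def\<close>)

text \<open>The map \<open>S \<mapsto> S\<^sub>p\<close> is right adjoint to the preimage of sieves.\<close>

lemma preimage_subset_iff:
  assumes S: "is_sieve C a S" and R: "is_sieve B (FO p a) R"
  shows "R \<subseteq> sieve_image C B p a S \<longleftrightarrow> {f \<in> Arr C. Cod C f = a \<and> FA p f \<in> R} \<subseteq> S"
proof
  have a: "a \<in> Obj C" using S by (simp add: is_sieve_def)
  assume RS: "R \<subseteq> sieve_image C B p a S"
  show "{f \<in> Arr C. Cod C f = a \<and> FA p f \<in> R} \<subseteq> S"
  proof
    fix f assume "f \<in> {f \<in> Arr C. Cod C f = a \<and> FA p f \<in> R}"
    then have f: "f \<in> Arr C" "Cod C f = a" "FA p f \<in> sieve_image C B p a S" using RS by auto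
    have "FA p f = FA p f \<odot>\<^sub>B Ide B (FO p (Dom C f))" using BB.comp_Ide(2)[of "FA p f"] f by simp
    then show "f \<in> S" using sieve_imageD(3)[OF S f(3) f(1,2), of "Ide B (FO p (Dom C f))"] f by simp
  qed
next
  assume RS: "{f \<in> Arr C. Cod C f = a \<and> FA p f \<in> R} \<subseteq> S"
  show "R \<subseteq> sieve_image C B p a S"
  proof
    fix b assume b: "b \<in> R"
    show "b \<in> sieve_image C B p a S"
    proof (rule sieve_imageI[OF S])
      fix f c assume f: "f \<in> Arr C" "Cod C f = a" and c: "c \<in> Arr B" "Dom B c = FO p (Dom C f)" "Cod B c = Dom B b"
        and fc: "FA p f = b \<odot>\<^sub>B c"
      show "f \<in> S" using sieve_closed[OF R b c(1,3)] f fc RS by auto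
    qed (use sieve_arr[OF R b] in auto)
  qed
qed

text \<open>For transitivity, an arrow of \<open>S\<^sub>p\<close> has a horizontal lifting \<open>x\<close> in \<open>S\<close>; the sieve on the source of \<open>x\<close> which is
  covering by assumption is transported along the isomorphism which belongs to \<open>x\<close>.\<close>

lemma giraud_topology:
  assumes J: "is_topology B J" shows "is_topology C (giraud_topology C B p J)"
proof -
  interpret J: site B J using J by unfold_locales
  show ?thesis
    unfolding is_topology_def
  proof (intro conjI ballI impI allI)
    fix z assume "z \<in> giraud_topology C B p J"
    then show "case z of (a, S) \<Rightarrow> is_sieve C a S" by (auto simp: giraud_topology_def)
  next
    fix a assume a: "a \<in> Obj C"
    have M: "is_sieve C a {f \<in> Arr C. Cod C f = a}" by (rule CC.is_sieve_max[OF a])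
    have "sieve_image C B p a {f \<in> Arr C. Cod C f = a} = {f \<in> Arr B. Cod B f = FO p a}"
      by (auto simp: sieve_image_iff[OF M])
    then show "(a, {f \<in> Arr C. Cod C f = a}) \<in> giraud_topology C B p J"
      using J M a unfolding giraud_topology_def is_topology_def by auto
  next
    fix z assume z: "z \<in> giraud_topology C B p J"
    obtain a S where aS: "z = (a, S)" by fastforce
    have S: "is_sieve C a S" and Sp: "(FO p a, sieve_image C B p a S) \<in> J" using z aS by (auto simp: giraud_topology_def)
    have "(Dom C f, pullback_sieve C f S) \<in> giraud_topology C B p J" if f: "f \<in> Arr C" "Cod C f = a" for f
    proof -
      have fS: "is_sieve C (Dom C f) (pullback_sieve C f S)" by (rule CC.is_sieve_pullback[OF S f])
      have "(Dom B (FA p f), pullback_sieve B (FA p f) (sieve_image C B p a S)) \<in> J"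
        using J.covering_pullback[OF Sp, of "FA p f"] f by simp
      moreover have "pullback_sieve B (FA p f) (sieve_image C B p a S) \<subseteq> sieve_image C B p (Dom C f) (pullback_sieve C f S)"
      proof
        fix c assume "c \<in> pullback_sieve B (FA p f) (sieve_image C B p a S)"
        then have c: "c \<in> Arr B" "Cod B c = FO p (Dom C f)" and fc: "FA p f \<odot>\<^sub>B c \<in> sieve_image C B p a S"
          using f by (auto simp: pullback_sieve_def)
        show "c \<in> sieve_image C B p (Dom C f) (pullback_sieve C f S)"
        proof (rule sieve_imageI[OF fS c])
          fix h d assume "h \<in> Arr C" "Cod C h = Dom C f" "d \<in> Arr B" "Dom B d = FO p (Dom C h)" "Cod B d = Dom B c" "FA p h = c \<odot>\<^sub>B d"
          then show "h \<in> pullback_sieve C f S"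
            using sieve_imageD(3)[OF S fc, of "f \<odot>\<^sub>C h" d] f c by (simp add: pullback_sieve_def)
        qed
      qed
      ultimately have "(FO p (Dom C f), sieve_image C B p (Dom C f) (pullback_sieve C f S)) \<in> J"
        using J.covering_superset is_sieve_image[OF fS] f by simp
      then show ?thesis using fS by (simp add: giraud_topology_def)
    qed
    then show "case z of (a, S) \<Rightarrow> \<forall>f\<in>Arr C. Cod C f = a \<longrightarrow> (Dom C f, pullback_sieve C f S) \<in> giraud_topology C B p J"
      using aS by simp
  next
    fix z assume z: "z \<in> giraud_topology C B p J"
    obtain a S where aS: "z = (a, S)" by fastforce
    have S: "is_sieve C a S" and Sp: "(FO p a, sieve_image C B p a S) \<in> J" using z aS by (auto simp: giraud_topology_def)
    have "(a, T) \<in> giraud_topology C B p J"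
      if T: "is_sieve C a T" and fT: "\<forall>f\<in>S. (Dom C f, pullback_sieve C f T) \<in> giraud_topology C B p J" for T
    proof -
      note Tp = is_sieve_image[OF T]
      have "locally B J (FO p a) (\<lambda>b. b \<in> sieve_image C B p a S)"
        using Sp J.sieve_locally[OF is_sieve_image[OF S]] by simp
      then have "locally B J (FO p a) (\<lambda>b. b \<in> sieve_image C B p a T)"
      proof (rule J.locally_trans)
        fix b assume b: "b \<in> Arr B" "Cod B b = FO p a" and bS: "b \<in> sieve_image C B p a S"
        then obtain x where x: "x \<in> S" "horizontal_lifting C B p a b x" by (auto simp: sieve_image_def)
        obtain i j where xh: "horizontal C B p x" and xa: "x \<in> Arr C" "Cod C x = a"
          and j: "j \<in> Arr B" "Dom B j = Dom B b" "Cod B j = FO p (Dom C x)" and xj: "FA p x \<odot>\<^sub>B j = b"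
          using horizontal_liftingD[OF x(2) b(1)] by blast
        have xT: "is_sieve C (Dom C x) (pullback_sieve C x T)" by (rule CC.is_sieve_pullback[OF T xa])
        have "(FO p (Dom C x), sieve_image C B p (Dom C x) (pullback_sieve C x T)) \<in> J"
          using fT x(1) by (auto simp: giraud_topology_def)
        then have "locally B J (FO p (Dom C x)) (\<lambda>c. c \<in> sieve_image C B p (Dom C x) (pullback_sieve C x T))"
          using J.sieve_locally[OF is_sieve_image[OF xT]] by simp
        from J.locally_pull[OF this j(1,3)]
        have "locally B J (Dom B b) (\<lambda>c. j \<odot>\<^sub>B c \<in> sieve_image C B p (Dom C x) (pullback_sieve C x T))" using j by simp
        then show "locally B J (Dom B b) (\<lambda>c. b \<odot>\<^sub>B c \<in> sieve_image C B p a T)"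
        proof (rule J.locally_mono)
          fix c assume c: "c \<in> Arr B" "Cod B c = Dom B b" and jc: "j \<odot>\<^sub>B c \<in> sieve_image C B p (Dom C x) (pullback_sieve C x T)"
          show "b \<odot>\<^sub>B c \<in> sieve_image C B p a T"
          proof (rule sieve_imageI[OF T])
            fix f d assume f: "f \<in> Arr C" "Cod C f = a" and d: "d \<in> Arr B" "Dom B d = FO p (Dom C f)" "Cod B d = Dom B (b \<odot>\<^sub>B c)"
              and fd: "FA p f = (b \<odot>\<^sub>B c) \<odot>\<^sub>B d"
            have dc: "Cod B d = Dom B c" using d c b by simp
            have "FA p f = FA p x \<odot>\<^sub>B (j \<odot>\<^sub>B (c \<odot>\<^sub>B d))"
            proof -
              have "FA p f = ((FA p x \<odot>\<^sub>B j) \<odot>\<^sub>B c) \<odot>\<^sub>B d" using fd xj by simp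
              also have "\<dots> = FA p x \<odot>\<^sub>B (j \<odot>\<^sub>B (c \<odot>\<^sub>B d))" using dc d(1) c j xa by simp
              finally show ?thesis .
            qed
            then obtain v where v: "v \<in> Arr C" "Dom C v = Dom C f" "Cod C v = Dom C x" "f = x \<odot>\<^sub>C v" "FA p v = j \<odot>\<^sub>B (c \<odot>\<^sub>B d)"
              using horizontal_factor[OF xh f(1), of "j \<odot>\<^sub>B (c \<odot>\<^sub>B d)"] f xa c j d dc by auto
            have "v \<in> pullback_sieve C x T"
              using sieve_imageD(3)[OF xT jc v(1,3), of d] v d dc c j by simp
            then show "f \<in> T" using v by (simp add: pullback_sieve_def)
          qed (use b c in auto)
        qed
      qed
      then have "(FO p a, sieve_image C B p a T) \<in> J" using J.sieve_locally[OF Tp] by simp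
      then show ?thesis using T by (simp add: giraud_topology_def)
    qed
    then show "case z of (a, S) \<Rightarrow> \<forall>T. is_sieve C a T \<and> (\<forall>f\<in>S. (Dom C f, pullback_sieve C f T) \<in> giraud_topology C B p J)
        \<longrightarrow> (a, T) \<in> giraud_topology C B p J" using aS by simp
  qed
qed

lemma giraud_locally:
  assumes J: "is_topology B J" and loc: "locally B J (FO p a) \<Phi>" and a: "a \<in> Obj C"
  shows "locally C (giraud_topology C B p J) a (\<lambda>f. \<Phi> (FA p f))"
proof -
  interpret J: site B J using J by unfold_locales
  obtain R where RJ: "(FO p a, R) \<in> J" and R\<Phi>: "\<forall>b \<in> R. \<Phi> b" using loc unfolding locally_def by blast
  let ?S = "{f \<in> Arr C. Cod C f = a \<and> FA p f \<in> R}"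
  note R = J.covering_sieve[OF RJ]
  have S: "is_sieve C a ?S"
    using sieve_closed[OF R] a by (auto simp: is_sieve_def)
  have "R \<subseteq> sieve_image C B p a ?S" unfolding preimage_subset_iff[OF S R] ..
  then have "(FO p a, sieve_image C B p a ?S) \<in> J" by (rule J.covering_superset[OF RJ is_sieve_image[OF S]])
  then have "(a, ?S) \<in> giraud_topology C B p J" using S by (simp add: giraud_topology_def)
  then show ?thesis unfolding locally_def using R\<Phi> by blast
qed

lemma giraud_min: "giraud_topology C B p (min_topology B) = min_topology C"
proof -
  have "S = {f \<in> Arr C. Cod C f = a}"
    if S: "is_sieve C a S" and Sp: "sieve_image C B p a S = {f \<in> Arr B. Cod B f = FO p a}" for a S
  proof -
    have a: "a \<in> Obj C" using S by (simp add: is_sieve_def)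
    have R: "is_sieve B (FO p a) {f \<in> Arr B. Cod B f = FO p a}" using a by (intro BB.is_sieve_max) simp
    have "{f \<in> Arr C. Cod C f = a \<and> FA p f \<in> {f \<in> Arr B. Cod B f = FO p a}} \<subseteq> S"
      using preimage_subset_iff[OF S R] Sp by simp
    then show ?thesis using sieve_arr[OF S] by auto
  qed
  moreover have "min_topology C \<subseteq> giraud_topology C B p (min_topology B)"
    by (rule min_topology_least[OF giraud_topology[OF BB.min_topology]])
  ultimately show ?thesis by (auto simp: giraud_topology_def min_topology_def is_sieve_def)
qed

section \<open>The inverse image functor preserves sheaves\<close>

text \<open>A matching family on \<open>S\<close> is to be extended from the arrows \<open>p f\<close>, with \<open>f\<close> in \<open>S\<close>, to the covering sieve \<open>S\<^sub>p\<close>. The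
  value at \<open>b\<close> is transported from a horizontal lifting of \<open>b\<close>; the relation \<open>R\<close> characterizes it by all
  liftings of restrictions of \<open>b\<close>, hence independently of choices.\<close>

lemma pb_sheaf:
  assumes J: "is_topology B J" and F: "F \<in> sheaves U B J"
  shows "FO pb F \<in> sheaves U C (giraud_topology C B p J)"
proof -
  interpret J: sheaf_site B U J using J by unfold_locales
  interpret G: sheaf_site C U "giraud_topology C B p J" using giraud_topology[OF J] by unfold_locales
  have Fp: "BB.psh F" using F by (rule sheaf_presheaf)
  show ?thesis
  proof (rule G.sheafI[OF pb_psh[OF Fp]])
    fix a s t assume a: "a \<in> Obj C" and s: "s \<in> val (FO pb F) a" and t: "t \<in> val (FO pb F) a"
      and loc: "locally C (giraud_topology C B p J) a (\<lambda>f. act (FO pb F) f s = act (FO pb F) f t)"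
    obtain S where S: "is_sieve C a S" and Sp: "(FO p a, sieve_image C B p a S) \<in> J"
      and eq: "\<And>f. f \<in> S \<Longrightarrow> act (FO pb F) f s = act (FO pb F) f t"
      using loc unfolding locally_def giraud_topology_def by blast
    have st: "s \<in> val F (FO p a)" "t \<in> val F (FO p a)" using s t a by auto
    show "s = t"
    proof (rule J.sheaf_separated[OF F st])
      show "locally B J (FO p a) (\<lambda>b. act F b s = act F b t)"
      proof (rule J.locallyI[OF Sp])
        fix b assume bS: "b \<in> sieve_image C B p a S"
        then have b: "b \<in> Arr B" "Cod B b = FO p a" using sieve_imageD[OF S] by auto
        obtain x where x: "x \<in> S" "horizontal_lifting C B p a b x" using bS by (auto simp: sieve_image_def)
        obtain j where xa: "x \<in> Arr C" "Cod C x = a"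
          and j: "j \<in> Arr B" "Dom B j = Dom B b" "Cod B j = FO p (Dom C x)" and xj: "FA p x \<odot>\<^sub>B j = b"
          using horizontal_liftingD[OF x(2) b(1)] by blast
        have "act F j (act F (FA p x) s) = act F j (act F (FA p x) t)" using eq[OF x(1)] xa by simp
        then show "act F b s = act F b t" using xj j xa st by (simp add: BB.act_comp[OF Fp])
      qed
    qed
  next
    fix a S x assume Sg: "(a, S) \<in> giraud_topology C B p J" and S: "is_sieve C a S" and x: "matching_family C (FO pb F) S x"
    have a: "a \<in> Obj C" using S by (simp add: is_sieve_def)
    note SI = is_sieve_image[OF S]
    have loc: "locally B J (FO p a) (\<lambda>b. b \<in> sieve_image C B p a S)"
      using Sg J.sieve_locally[OF SI] by (simp add: giraud_topology_def)
    have xv: "x f \<in> val F (FO p (Dom C f))" if "f \<in> S" for f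
      using x that sieve_arr[OF S that] unfolding matching_family_def by auto
    have xr: "act F (FA p g) (x f) = x (f \<odot>\<^sub>C g)" if "f \<in> S" "g \<in> Arr C" "Cod C g = Dom C f" for f g
      using x that unfolding matching_family_def by auto
    define R where "R b z \<longleftrightarrow> b \<in> sieve_image C B p a S \<and> z \<in> val F (Dom B b) \<and>
      (\<forall>f c. f \<in> Arr C \<longrightarrow> Cod C f = a \<longrightarrow> c \<in> Arr B \<longrightarrow> Dom B c = FO p (Dom C f) \<longrightarrow> Cod B c = Dom B b \<longrightarrow>
        FA p f = b \<odot>\<^sub>B c \<longrightarrow> act F c z = x f)" for b z
    have R_ex: "\<exists>z. R b z" if b: "b \<in> sieve_image C B p a S" for b
    proof -
      have ba: "b \<in> Arr B" "Cod B b = FO p a" using sieve_imageD[OF S b] by auto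
      obtain h where h: "h \<in> S" "horizontal_lifting C B p a b h" using b by (auto simp: sieve_image_def)
      obtain j where hh: "horizontal C B p h" and ha: "h \<in> Arr C" "Cod C h = a"
        and j: "j \<in> Arr B" "Dom B j = Dom B b" "Cod B j = FO p (Dom C h)" and hj: "FA p h \<odot>\<^sub>B j = b"
        using horizontal_liftingD[OF h(2) ba(1)] by blast
      have jv: "act F j (x h) \<in> val F (Dom B b)" using BB.act_in'[OF Fp j(1,3) xv[OF h(1)]] j by simp
      have "act F c (act F j (x h)) = x f"
        if f: "f \<in> Arr C" "Cod C f = a" and c: "c \<in> Arr B" "Dom B c = FO p (Dom C f)" "Cod B c = Dom B b"
          and fc: "FA p f = b \<odot>\<^sub>B c" for f c
      proof -
        have "FA p f = (FA p h \<odot>\<^sub>B j) \<odot>\<^sub>B c" using fc hj by simp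
        also have "\<dots> = FA p h \<odot>\<^sub>B (j \<odot>\<^sub>B c)" using c j ha by (intro BB.comp_assoc) auto
        finally have "FA p f = FA p h \<odot>\<^sub>B (j \<odot>\<^sub>B c)" .
        then obtain v where v: "v \<in> Arr C" "Cod C v = Dom C h" "f = h \<odot>\<^sub>C v" "FA p v = j \<odot>\<^sub>B c"
          using horizontal_factor[OF hh f(1), of "j \<odot>\<^sub>B c"] f ha c j by auto
        show ?thesis using xr[OF h(1) v(1,2)] v c j xv[OF h(1)] by (simp add: BB.act_comp[OF Fp])
      qed
      then show ?thesis using b jv unfolding R_def by blast
    qed
    have "\<exists>s \<in> val F (FO p a). \<forall>f z'. f \<in> Arr B \<longrightarrow> Cod B f = FO p a \<longrightarrow> R f z' \<longrightarrow> act F f s = z'"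
    proof (rule J.sheaf_local_description[OF F])
      have R_restr: "R (b \<odot>\<^sub>B g) (act F g z)"
        if b: "b \<in> Arr B" "Cod B b = FO p a" and R: "R b z" and g: "g \<in> Arr B" "Cod B g = Dom B b" for b g z
      proof -
        have 1: "b \<in> sieve_image C B p a S" "z \<in> val F (Dom B b)"
          and 2: "\<And>f c. f \<in> Arr C \<Longrightarrow> Cod C f = a \<Longrightarrow> c \<in> Arr B \<Longrightarrow> Dom B c = FO p (Dom C f) \<Longrightarrow> Cod B c = Dom B b \<Longrightarrow>
            FA p f = b \<odot>\<^sub>B c \<Longrightarrow> act F c z = x f" using R unfolding R_def by blast+
        have "act F c (act F g z) = x f"
          if f: "f \<in> Arr C" "Cod C f = a" and c: "c \<in> Arr B" "Dom B c = FO p (Dom C f)" "Cod B c = Dom B (b \<odot>\<^sub>B g)"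
          and fc: "FA p f = (b \<odot>\<^sub>B g) \<odot>\<^sub>B c" for f c
          using 2[OF f, of "g \<odot>\<^sub>B c"] c fc b g 1 by (simp add: BB.act_comp[OF Fp])
        then show ?thesis
          unfolding R_def using sieve_closed[OF SI 1(1) g] BB.act_in'[OF Fp g 1(2)] b g by simp
      qed
      show "locally B J (FO p a) (\<lambda>b. \<exists>z. R b z)"
        by (rule J.locally_mono[OF loc]) (use R_ex in auto)
      show "\<And>b g z. b \<in> Arr B \<Longrightarrow> Cod B b = FO p a \<Longrightarrow> R b z \<Longrightarrow> g \<in> Arr B \<Longrightarrow> Cod B g = Dom B b \<Longrightarrow>
        R (b \<odot>\<^sub>B g) (act F g z)" by (rule R_restr)
      fix b z z' assume b: "b \<in> Arr B" "Cod B b = FO p a" and R: "R b z" "R b z'"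
      obtain h where h: "horizontal_lifting C B p a b h" using lifting_exists[OF a b] by blast
      obtain i j where ha: "h \<in> Arr C" "Cod C h = a"
        and i: "i \<in> Arr B" "Dom B i = FO p (Dom C h)" "Cod B i = Dom B b"
        and j: "j \<in> Arr B" "Dom B j = Dom B b" "Cod B j = FO p (Dom C h)"
        and ij: "i \<odot>\<^sub>B j = Ide B (Dom B b)" and bi: "b \<odot>\<^sub>B i = FA p h"
        using horizontal_liftingD[OF h b(1)] by blast
      have v: "z \<in> val F (Dom B b)" "z' \<in> val F (Dom B b)" using R by (auto simp: R_def)
      have "act F i z = x h" "act F i z' = x h" using R ha i bi[symmetric] unfolding R_def by blast+
      then have "act F j (act F i z) = act F j (act F i z')" by simp
      then show "z = z'" using v i j ij b by (simp add: BB.act_comp[OF Fp] Fp)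
    qed (auto simp: R_def)
    then obtain s where s: "s \<in> val F (FO p a)" and sR: "\<And>b z. b \<in> Arr B \<Longrightarrow> Cod B b = FO p a \<Longrightarrow> R b z \<Longrightarrow> act F b s = z"
      by blast
    have "act (FO pb F) f s = x f" if f: "f \<in> S" for f
    proof -
      have fa: "f \<in> Arr C" "Cod C f = a" using sieve_arr[OF S f] by auto
      have fs: "act F (FA p f) s \<in> val F (FO p (Dom C f))" using BB.act_in'[OF Fp, of "FA p f" "FO p a" s] fa s by simp
      have "act F (FA p f) s = x f"
      proof (rule J.sheaf_separated[OF F fs xv[OF f]])
        have "locally B J (FO p (Dom C f)) (\<lambda>c. FA p f \<odot>\<^sub>B c \<in> sieve_image C B p a S)"
          using J.locally_pull[OF loc, of "FA p f"] fa by simp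
        then show "locally B J (FO p (Dom C f)) (\<lambda>c. act F c (act F (FA p f) s) = act F c (x f))"
        proof (rule J.locally_mono)
          fix c assume c: "c \<in> Arr B" "Cod B c = FO p (Dom C f)" and fc: "FA p f \<odot>\<^sub>B c \<in> sieve_image C B p a S"
          obtain z where z: "R (FA p f \<odot>\<^sub>B c) z" using R_ex[OF fc] by blast
          have sz: "act F (FA p f \<odot>\<^sub>B c) s = z" using sR[OF _ _ z] fa c by simp
          have zv: "z \<in> val F (Dom B c)" using z fa c by (simp add: R_def)
          obtain h where h: "horizontal_lifting C B p (Dom C f) c h" using lifting_exists[of "Dom C f" c] c fa by auto
          obtain i j where ha: "h \<in> Arr C" "Cod C h = Dom C f"
            and i: "i \<in> Arr B" "Dom B i = FO p (Dom C h)" "Cod B i = Dom B c"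
            and j: "j \<in> Arr B" "Dom B j = Dom B c" "Cod B j = FO p (Dom C h)"
            and ij: "i \<odot>\<^sub>B j = Ide B (Dom B c)" and ci: "c \<odot>\<^sub>B i = FA p h"
            using horizontal_liftingD[OF h c(1)] by blast
          have "FA p (f \<odot>\<^sub>C h) = (FA p f \<odot>\<^sub>B c) \<odot>\<^sub>B i" using ha fa ci c i by simp
          then have "act F i z = x (f \<odot>\<^sub>C h)"
            using z ha fa i c unfolding R_def by simp
          also have "\<dots> = act F i (act F c (x f))"
            using xr[OF f ha] xv[OF f] c i ci by (simp add: BB.act_comp[OF Fp])
          finally have "act F j (act F i z) = act F j (act F i (act F c (x f)))" by simp
          moreover have "act F c (x f) \<in> val F (Dom B c)" using BB.act_in'[OF Fp c xv[OF f]] .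
          moreover have "act F j (act F i y) = y" if "y \<in> val F (Dom B c)" for y
            using that i j ij c by (simp add: BB.act_comp[OF Fp] Fp)
          ultimately have "z = act F c (x f)" using zv by simp
          then show "act F c (act F (FA p f) s) = act F c (x f)"
            using sz c fa s by (simp add: BB.act_comp[OF Fp])
        qed
      qed
      then show ?thesis using fa by simp
    qed
    then show "\<exists>s\<in>val (FO pb F) a. \<forall>f\<in>S. act (FO pb F) f s = x f" using s a by auto
  qed
qed

lemma pb_functor_Sh:
  assumes J: "is_topology B J"
  shows "is_functor (Sh U B J) (Sh U C (giraud_topology C B p J)) pb"
proof -
  interpret J: sheaf_site B U J using J by unfold_locales
  interpret G: sheaf_site C U "giraud_topology C B p J" using giraud_topology[OF J] by unfold_locales
  have "FA pb (Ide (Psh U B) P) = Ide (Psh U C) (FO pb P)" if "P \<in> sheaves U B J" for P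
    using functor_Ide[OF pb_functor] sheaf_presheaf[OF that] by simp
  moreover have "FA pb (g \<odot>\<^bsub>Psh U B\<^esub> f) = FA pb g \<odot>\<^bsub>Psh U C\<^esub> FA pb f"
    if "f \<in> BB.hom (src f) (tgt f)" "g \<in> BB.hom (src g) (tgt g)" "tgt f = src g" for f g
    using functor_comp[OF pb_functor that(1), of g "tgt g"] that by simp
  then have "\<forall>f\<in>Arr (Sh U B J). \<forall>g\<in>Arr (Sh U B J). tgt f = src g \<longrightarrow>
      FA pb (g \<odot>\<^bsub>Psh U B\<^esub> f) = FA pb g \<odot>\<^bsub>Psh U C\<^esub> FA pb f"
    using J.Arr_Sh by blast
  ultimately show ?thesis
    unfolding is_functor_def using pb_sheaf[OF J] pb_hom by (simp add: J.Arr_Sh G.Hom_Sh del: Psh_simps)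
qed

lemma pb_left_exact:
  assumes J: "is_topology B J"
  shows "left_exact (Sh U B J) (Sh U C (giraud_topology C B p J)) pb"
proof -
  interpret J: sheaf_site B U J using J by unfold_locales
  interpret G: sheaf_site C U "giraud_topology C B p J" using giraud_topology[OF J] by unfold_locales
  have "is_terminal (Sh U C (giraud_topology C B p J)) (FO pb t)" if "is_terminal (Sh U B J) t" for t
    using that pb_sheaf[OF J] by (simp add: J.terminal_Sh_iff G.terminal_Sh_iff)
  moreover have "is_pullback (Sh U C (giraud_topology C B p J)) (FA pb f) (FA pb g) (FO pb P) (FA pb q) (FA pb r)"
    if pbJ: "is_pullback (Sh U B J) f g P q r" for f g P q r
  proof -
    have f: "f \<in> Hom (Sh U B J) (src f) (tgt f)" and g: "g \<in> Hom (Sh U B J) (src g) (tgt f)"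
      using pbJ unfolding is_pullback_def by (auto simp: J.Hom_Sh J.Arr_Sh)
    have P: "P \<in> sheaves U B J" and q: "q \<in> BB.hom P (src f)" and r: "r \<in> BB.hom P (src g)"
      and pt: "ptwise_pullback B f g q r" using pbJ unfolding J.pullback_Sh_iff[OF f g] by auto
    have "ptwise_pullback C (FA pb f) (FA pb g) (FA pb q) (FA pb r)"
      using pt unfolding ptwise_pullback_def by simp
    then show ?thesis
      using G.pullback_Sh_iff[OF functor_Hom[OF pb_functor_Sh[OF J] f] functor_Hom[OF pb_functor_Sh[OF J] g]]
        pb_sheaf[OF J P] pb_hom[OF q] pb_hom[OF r] by simp
  qed
  ultimately show ?thesis unfolding left_exact_def using pb_functor_Sh[OF J] by blast
qed

end

section \<open>The direct image functor\<close>

context small_functor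
begin

text \<open>The pointwise right Kan extension along \<open>p\<close>: an element over \<open>b\<close> is a natural family indexed by the arrows
  \<open>\<beta> : p a \<rightarrow> b\<close>.\<close>

definition ran_idx :: "'b \<Rightarrow> ('o \<times> 'n) set" where
  "ran_idx b = {(a, \<beta>). a \<in> Obj C \<and> \<beta> \<in> Hom B (FO p a) b}"

definition ran_val :: "('o, 'm, 'u) presheaf \<Rightarrow> 'b \<Rightarrow> ('o \<times> 'n \<Rightarrow> 'u) set" where
  "ran_val P b = {x. x \<in> extensional (ran_idx b) \<and> (\<forall>a \<beta>. (a, \<beta>) \<in> ran_idx b \<longrightarrow> x (a, \<beta>) \<in> val P a) \<and>
    (\<forall>f \<in> Arr C. \<forall>\<beta>. (Cod C f, \<beta>) \<in> ran_idx b \<longrightarrow> act P f (x (Cod C f, \<beta>)) = x (Dom C f, \<beta> \<odot>\<^sub>B FA p f))}"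

definition ran_act :: "'n \<Rightarrow> ('o \<times> 'n \<Rightarrow> 'u) \<Rightarrow> 'o \<times> 'n \<Rightarrow> 'u" where
  "ran_act c x = restrict (\<lambda>(a, \<beta>). x (a, c \<odot>\<^sub>B \<beta>)) (ran_idx (Dom B c))"

lemma ran_idx_iff [simp]:
  "(a, \<beta>) \<in> ran_idx b \<longleftrightarrow> a \<in> Obj C \<and> \<beta> \<in> Arr B \<and> Dom B \<beta> = FO p a \<and> Cod B \<beta> = b"
  by (simp add: ran_idx_def Hom_def)

lemma ran_act_app [simp]: "(a, \<beta>) \<in> ran_idx (Dom B c) \<Longrightarrow> ran_act c x (a, \<beta>) = x (a, c \<odot>\<^sub>B \<beta>)"
  by (simp add: ran_act_def del: ran_idx_iff)

lemma
  assumes "x \<in> ran_val P b"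
  shows ran_ext: "x \<in> extensional (ran_idx b)"
    and ran_in: "\<And>a \<beta>. (a, \<beta>) \<in> ran_idx b \<Longrightarrow> x (a, \<beta>) \<in> val P a"
    and ran_nat: "\<And>f \<beta>. f \<in> Arr C \<Longrightarrow> (Cod C f, \<beta>) \<in> ran_idx b \<Longrightarrow>
      act P f (x (Cod C f, \<beta>)) = x (Dom C f, \<beta> \<odot>\<^sub>B FA p f)"
  using assms by (auto simp: ran_val_def simp del: ran_idx_iff)

lemma ran_valI:
  assumes "x \<in> extensional (ran_idx b)" "\<And>a \<beta>. (a, \<beta>) \<in> ran_idx b \<Longrightarrow> x (a, \<beta>) \<in> val P a"
    "\<And>f \<beta>. f \<in> Arr C \<Longrightarrow> (Cod C f, \<beta>) \<in> ran_idx b \<Longrightarrow>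
      act P f (x (Cod C f, \<beta>)) = x (Dom C f, \<beta> \<odot>\<^sub>B FA p f)"
  shows "x \<in> ran_val P b"
  using assms unfolding ran_val_def by blast

lemma ran_eqI:
  assumes "x \<in> ran_val P b" "y \<in> ran_val P b"
    and eq: "\<And>a \<beta>. (a, \<beta>) \<in> ran_idx b \<Longrightarrow> x (a, \<beta>) = y (a, \<beta>)"
  shows "x = y"
  by (rule extensionalityI[OF ran_ext[OF assms(1)] ran_ext[OF assms(2)]]) (use eq in auto)

lemma ran_act_val:
  assumes c: "c \<in> Arr B" and x: "x \<in> ran_val P (Cod B c)"
  shows "ran_act c x \<in> ran_val P (Dom B c)"
proof (rule ran_valI)
  fix f \<beta> assume f: "f \<in> Arr C" and \<beta>: "(Cod C f, \<beta>) \<in> ran_idx (Dom B c)"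
  then show "act P f (ran_act c x (Cod C f, \<beta>)) = ran_act c x (Dom C f, \<beta> \<odot>\<^sub>B FA p f)"
    using ran_nat[OF x f, of "c \<odot>\<^sub>B \<beta>"] c by simp
qed (use ran_in[OF x] c in \<open>auto simp: ran_act_def simp del: ran_idx_iff, auto\<close>)

lemma ran_raw:
  assumes P: "CC.psh P" shows "BB.raw_presheaf (ran_val P) ran_act"
  unfolding BB.raw_presheaf_def
proof (intro conjI ballI impI)
  fix b assume b: "b \<in> Obj B"
  obtain T where T: "CC.skeletal T" using CC.skeletal_exists by blast
  note TC = CC.skeletal_Obj[OF T]
  let ?I = "SIGMA a:T. Hom B (FO p a) b"
  let ?G = "SIGMA z:?I. val P (fst z)"
  let ?r = "\<lambda>x :: 'o \<times> 'n \<Rightarrow> 'u. (\<lambda>z. (z, x z)) ` ?I"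
  have "small U ?I"
    by (rule small_Sigma[OF CC.universe CC.skeletal_small[OF T]], rule BB.small_Hom) (use TC b in auto)
  then have "small U ?G"
    by (rule small_Sigma[OF CC.universe]) (use TC CC.val_small[OF P] in auto)
  then have sG: "small U (Pow ?G)" by (rule small_Pow[OF CC.universe])
  show "small U (ran_val P b)"
  proof (rule small_inj[OF sG, where f="?r"])
    show "inj_on ?r (ran_val P b)"
    proof (rule inj_onI)
      fix x y assume x: "x \<in> ran_val P b" and y: "y \<in> ran_val P b" and eq: "?r x = ?r y"
      have eqT: "x (a, \<beta>) = y (a, \<beta>)" if "a \<in> T" "\<beta> \<in> Hom B (FO p a) b" for a \<beta>
      proof -
        have "((a, \<beta>), x (a, \<beta>)) \<in> ?r x" using that by (intro image_eqI[where x="(a, \<beta>)"]) auto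
        then have "((a, \<beta>), x (a, \<beta>)) \<in> ?r y" unfolding eq .
        then show ?thesis by auto
      qed
      show "x = y"
      proof (rule ran_eqI[OF x y])
        fix a \<beta> assume i: "(a, \<beta>) \<in> ran_idx b"
        then have a: "a \<in> Obj C" and \<beta>: "\<beta> \<in> Arr B" "Dom B \<beta> = FO p a" "Cod B \<beta> = b" by auto
        obtain k l where kl: "k \<in> Arr C" "Dom C k = a" "Cod C k \<in> T" "l \<in> Arr C" "Dom C l = Cod C k" "Cod C l = a"
          "l \<odot>\<^sub>C k = Ide C a" using CC.skeletal_iso[OF T a] by blast
        have e: "(\<beta> \<odot>\<^sub>B FA p l) \<odot>\<^sub>B FA p k = \<beta>"
        proof -
          have "(\<beta> \<odot>\<^sub>B FA p l) \<odot>\<^sub>B FA p k = \<beta> \<odot>\<^sub>B FA p (l \<odot>\<^sub>C k)" using \<beta> kl(1-6) by simp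
          also have "\<dots> = \<beta>" using kl a \<beta> BB.comp_Ide(2)[OF \<beta>(1)] by simp
          finally show ?thesis .
        qed
        have it: "(Cod C k, \<beta> \<odot>\<^sub>B FA p l) \<in> ran_idx b" using \<beta> kl by simp
        have "x (Cod C k, \<beta> \<odot>\<^sub>B FA p l) = y (Cod C k, \<beta> \<odot>\<^sub>B FA p l)"
          by (rule eqT[OF kl(3)]) (use it kl in \<open>simp add: Hom_def\<close>)
        then show "x (a, \<beta>) = y (a, \<beta>)"
          using ran_nat[OF x kl(1) it] ran_nat[OF y kl(1) it] e kl by simp
      qed
    qed
    show "?r ` ran_val P b \<subseteq> Pow ?G"
    proof clarsimp
      fix x a \<beta> assume "x \<in> ran_val P b" "a \<in> T" "\<beta> \<in> Hom B (FO p a) b"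
      then show "x (a, \<beta>) \<in> val P a" using ran_in[of x P b a \<beta>] TC by (auto simp: Hom_def)
    qed
  qed
next
  fix c x assume "c \<in> Arr B" "x \<in> ran_val P (Cod B c)"
  then show "ran_act c x \<in> ran_val P (Dom B c)" by (rule ran_act_val)
next
  fix b x assume b: "b \<in> Obj B" and x: "x \<in> ran_val P b"
  have "ran_act (Ide B b) x \<in> ran_val P b" using ran_act_val[of "Ide B b" x P] b x by simp
  then show "ran_act (Ide B b) x = x"
  proof (rule ran_eqI[OF _ x])
    fix a \<beta> assume "(a, \<beta>) \<in> ran_idx b"
    then show "ran_act (Ide B b) x (a, \<beta>) = x (a, \<beta>)" using b BB.comp_Ide(1)[of \<beta>] by simp
  qed
next
  fix f g x assume f: "f \<in> Arr B" and g: "g \<in> Arr B" and fg: "Cod B f = Dom B g" and x: "x \<in> ran_val P (Cod B g)"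
  have 1: "ran_act (g \<odot>\<^sub>B f) x \<in> ran_val P (Dom B f)" using ran_act_val[of "g \<odot>\<^sub>B f" x P] f g fg x by simp
  have 2: "ran_act f (ran_act g x) \<in> ran_val P (Dom B f)" using ran_act_val[OF f, of "ran_act g x" P] ran_act_val[OF g x] fg by simp
  show "ran_act (g \<odot>\<^sub>B f) x = ran_act f (ran_act g x)"
    by (rule ran_eqI[OF 1 2]) (use f g fg in simp)
qed

lemma ran_exists:
  "\<exists>R \<eta> \<epsilon>. adjunction (Psh U B) (Psh U C) pb R \<eta> \<epsilon> \<and>
    (\<forall>P. CC.psh P \<longrightarrow> (\<exists>e d. BB.encoding (ran_val P) ran_act (FO R P) e d))"
proof -
  have "\<forall>P. \<exists>G e d. CC.psh P \<longrightarrow> BB.encoding (ran_val P) ran_act G e d"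
    using BB.encoding_exists[OF ran_raw] by blast
  then obtain G e d where enc: "\<And>P. CC.psh P \<Longrightarrow> BB.encoding (ran_val P) ran_act (G P) (e P) (d P)" by metis
  define \<epsilon> where "\<epsilon> P = transf C (FO pb (G P)) P (\<lambda>a s. d P (FO p a) s (a, Ide B (FO p a)))" for P
  have Gp: "BB.psh (G P)" if "CC.psh P" for P using BB.enc_psh[OF enc[OF that]] .
  have dv: "d P b s \<in> ran_val P b" if "CC.psh P" "b \<in> Obj B" "s \<in> val (G P) b" for P b s
    using BB.dec_in[OF enc[OF that(1)] that(2,3)] .
  have \<epsilon>: "\<epsilon> P \<in> CC.hom (FO pb (G P)) P" if P: "CC.psh P" for P
    unfolding \<epsilon>_def
  proof (rule CC.transf_hom[OF pb_psh[OF Gp[OF P]] P])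
    fix a s assume a: "a \<in> Obj C" and s: "s \<in> val (FO pb (G P)) a"
    then show "d P (FO p a) s (a, Ide B (FO p a)) \<in> val P a"
      using ran_in[OF dv[OF P, of "FO p a" s]] by simp
  next
    fix f s assume f: "f \<in> Arr C" and "s \<in> val (FO pb (G P)) (Cod C f)"
    then have s: "s \<in> val (G P) (FO p (Cod C f))" by simp
    have x: "d P (FO p (Cod C f)) s \<in> ran_val P (FO p (Cod C f))" using dv[OF P _ s] f by simp
    have "act P f (d P (FO p (Cod C f)) s (Cod C f, Ide B (FO p (Cod C f)))) = d P (FO p (Cod C f)) s (Dom C f, FA p f)"
      using ran_nat[OF x f, of "Ide B (FO p (Cod C f))"] f BB.comp_Ide(1)[of "FA p f"] by simp
    also have "\<dots> = d P (FO p (Dom C f)) (act (G P) (FA p f) s) (Dom C f, Ide B (FO p (Dom C f)))"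
      using BB.dec_act[OF ran_raw[OF P] enc[OF P], of "FA p f" s] f s BB.comp_Ide(2)[of "FA p f"] by simp
    finally show "act P f (d P (FO p (Cod C f)) s (Cod C f, Ide B (FO p (Cod C f)))) =
      d P (FO p (Dom C f)) (act (FO pb (G P)) f s) (Dom C f, Ide B (FO p (Dom C f)))" using f by simp
  qed
  have "\<exists>R \<eta>. FO R = G \<and> adjunction (Psh U B) (Psh U C) pb R \<eta> \<epsilon>"
  proof (rule universal_arrows_right_adjoint[OF BB.category_Psh CC.category_Psh pb_functor])
    fix Q P h assume "Q \<in> Obj (Psh U B)" "P \<in> Obj (Psh U C)" and h: "h \<in> CC.hom (FO pb Q) P"
    then have Q: "BB.psh Q" and P: "CC.psh P" by auto
    note en = enc[OF P] and raw = ran_raw[OF P]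
    define k where "k b y = restrict (\<lambda>(a, \<beta>). cmpt h a (act Q \<beta> y)) (ran_idx b)" for b y
    have k_app: "k b y (a, \<beta>) = cmpt h a (act Q \<beta> y)" if "(a, \<beta>) \<in> ran_idx b" for a b \<beta> y
      using that by (simp add: k_def del: ran_idx_iff)
    have k_val: "k b y \<in> ran_val P b" if b: "b \<in> Obj B" and y: "y \<in> val Q b" for b y
    proof (rule ran_valI)
      show "k b y \<in> extensional (ran_idx b)" by (simp add: k_def)
      fix a \<beta> assume i: "(a, \<beta>) \<in> ran_idx b"
      then have "act Q \<beta> y \<in> val Q (FO p a)" using BB.act_in'[OF Q, of \<beta> b y] y by auto
      then show "k b y (a, \<beta>) \<in> val P a" unfolding k_app[OF i] using cmpt_in[OF h, of a] i by simp
    next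
      fix f \<beta> assume f: "f \<in> Arr C" and i: "(Cod C f, \<beta>) \<in> ran_idx b"
      then have v: "act Q \<beta> y \<in> val Q (FO p (Cod C f))" using BB.act_in'[OF Q, of \<beta> b y] y by auto
      have i': "(Dom C f, \<beta> \<odot>\<^sub>B FA p f) \<in> ran_idx b" using i f by simp
      show "act P f (k b y (Cod C f, \<beta>)) = k b y (Dom C f, \<beta> \<odot>\<^sub>B FA p f)"
        unfolding k_app[OF i] k_app[OF i']
        using cmpt_act[OF h f, of "act Q \<beta> y"] v f i y by (simp add: BB.act_comp[OF Q])
    qed
    let ?k = "transf B Q (G P) (\<lambda>b y. e P b (k b y))"
    have kh: "?k \<in> BB.hom Q (G P)"
    proof (rule BB.transf_hom[OF Q Gp[OF P]])
      fix c y assume c: "c \<in> Arr B" and y: "y \<in> val Q (Cod B c)"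
      have cy: "act Q c y \<in> val Q (Dom B c)" using c y Q by simp
      have "ran_act c (k (Cod B c) y) = k (Dom B c) (act Q c y)"
      proof (rule ran_eqI[OF ran_act_val[OF c k_val[OF _ y]] k_val[OF _ cy]])
        fix a \<beta> assume i: "(a, \<beta>) \<in> ran_idx (Dom B c)"
        then have i': "(a, c \<odot>\<^sub>B \<beta>) \<in> ran_idx (Cod B c)" using c by simp
        show "ran_act c (k (Cod B c) y) (a, \<beta>) = k (Dom B c) (act Q c y) (a, \<beta>)"
          unfolding ran_act_app[OF i] k_app[OF i] k_app[OF i'] using i c y by (simp add: BB.act_comp[OF Q])
      qed (use c in auto)
      then show "act (G P) c (e P (Cod B c) (k (Cod B c) y)) = e P (Dom B c) (k (Dom B c) (act Q c y))"
        using BB.act_enc[OF en c k_val[OF _ y]] c by simp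
    qed (use BB.enc_in[OF en] k_val in auto)
    show "\<exists>!k. k \<in> BB.hom Q (G P) \<and> \<epsilon> P \<odot>\<^bsub>Psh U C\<^esub> FA pb k = h"
    proof (rule ex1I[where a="?k"])
      have "\<epsilon> P \<odot>\<^bsub>Psh U C\<^esub> FA pb ?k = h"
      proof (rule Hom_Psh_eqI[OF CC.comp_hom[OF pb_hom[OF kh] \<epsilon>[OF P]] h])
        fix a s assume a: "a \<in> Obj C" and "s \<in> val (FO pb Q) a"
        then have s: "s \<in> val Q (FO p a)" by simp
        have "d P (FO p a) (e P (FO p a) (k (FO p a) s)) = k (FO p a) s"
          using BB.dec_enc[OF en _ k_val[OF _ s]] a by simp
        then show "cmpt (\<epsilon> P \<odot>\<^bsub>Psh U C\<^esub> FA pb ?k) a s = cmpt h a s"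
          using a s BB.enc_in[OF en _ k_val[OF _ s]] k_app[of a "Ide B (FO p a)" "FO p a" s] Q
          by (simp add: \<epsilon>_def)
      qed
      then show "?k \<in> BB.hom Q (G P) \<and> \<epsilon> P \<odot>\<^bsub>Psh U C\<^esub> FA pb ?k = h" using kh by simp
    next
      fix l assume l: "l \<in> BB.hom Q (G P) \<and> \<epsilon> P \<odot>\<^bsub>Psh U C\<^esub> FA pb l = h"
      then have lh: "l \<in> BB.hom Q (G P)" by simp
      show "l = ?k"
      proof (rule Hom_Psh_eqI[OF lh kh])
        fix b y assume b: "b \<in> Obj B" and y: "y \<in> val Q b"
        have ly: "cmpt l b y \<in> val (G P) b" using cmpt_in[OF lh b y] .
        have "d P b (cmpt l b y) = k b y"
        proof (rule ran_eqI[OF dv[OF P b ly] k_val[OF b y]])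
          fix a \<beta> assume i: "(a, \<beta>) \<in> ran_idx b"
          then have \<beta>: "a \<in> Obj C" "\<beta> \<in> Arr B" "Dom B \<beta> = FO p a" "Cod B \<beta> = b" by auto
          have bv: "act Q \<beta> y \<in> val Q (FO p a)" using BB.act_in'[OF Q \<beta>(2,4) y] \<beta> by simp
          have "cmpt h a (act Q \<beta> y) = d P (FO p a) (cmpt l (FO p a) (act Q \<beta> y)) (a, Ide B (FO p a))"
          proof -
            have "cmpt (\<epsilon> P) a (cmpt (FA pb l) a (act Q \<beta> y)) = cmpt h a (act Q \<beta> y)"
              using cmpt_comp_eq[of U C "\<epsilon> P" "FA pb l" h a "act Q \<beta> y"] l \<beta> bv by (simp add: BB.hom_src[OF lh])
            then show ?thesis
              using \<beta> cmpt_in[OF lh _ bv] by (simp add: \<epsilon>_def)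
          qed
          also have "cmpt l (FO p a) (act Q \<beta> y) = act (G P) \<beta> (cmpt l b y)"
            using cmpt_act[OF lh \<beta>(2), of y] \<beta> y by simp
          also have "d P (FO p a) (act (G P) \<beta> (cmpt l b y)) (a, Ide B (FO p a)) = d P b (cmpt l b y) (a, \<beta>)"
            using BB.dec_act[OF raw en \<beta>(2), of "cmpt l b y"] ly \<beta> BB.comp_Ide(2)[OF \<beta>(2)] by simp
          finally show "d P b (cmpt l b y) (a, \<beta>) = k b y (a, \<beta>)" unfolding k_app[OF i] by simp
        qed
        then show "cmpt l b y = cmpt ?k b y" using BB.enc_dec[OF en b ly] b y by simp
      qed
    qed
  qed (use Gp \<epsilon> in auto)
  then show ?thesis using enc by blast
qed

end

context small_fibration
begin

text \<open>A covering sieve of \<open>b\<close> pulls back along \<open>\<beta> : p a \<rightarrow> b\<close> to a covering sieve of \<open>p a\<close>, whose preimage covers \<open>a\<close>. So each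
  component of a family over \<open>b\<close> is determined, and glued, in the sheaf \<open>P\<close>.\<close>

lemma ran_sheaf:
  assumes J: "is_topology B J" and P: "P \<in> sheaves U C (giraud_topology C B p J)"
    and e: "BB.encoding (ran_val P) ran_act G e d"
  shows "G \<in> sheaves U B J"
proof -
  interpret J: sheaf_site B U J using J by unfold_locales
  interpret G: sheaf_site C U "giraud_topology C B p J" using giraud_topology[OF J] by unfold_locales
  have Pp: "CC.psh P" using P by (rule sheaf_presheaf)
  note raw = ran_raw[OF Pp]
  have loc_pull: "locally C (giraud_topology C B p J) a (\<lambda>f. \<Phi> (\<beta> \<odot>\<^sub>B FA p f))"
    if loc: "locally B J b \<Phi>" and i: "(a, \<beta>) \<in> ran_idx b" for a b \<beta> \<Phi>
  proof -
    have "locally B J (FO p a) (\<lambda>c. \<Phi> (\<beta> \<odot>\<^sub>B c))" using J.locally_pull[OF loc, of \<beta>] i by simp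
    then show ?thesis using giraud_locally[OF J, of a "\<lambda>c. \<Phi> (\<beta> \<odot>\<^sub>B c)"] i by simp
  qed
  show ?thesis
  proof (rule J.raw_sheaf_encoding[OF raw e])
    fix b x y assume b: "b \<in> Obj B" and x: "x \<in> ran_val P b" and y: "y \<in> ran_val P b"
      and loc: "locally B J b (\<lambda>c. ran_act c x = ran_act c y)"
    show "x = y"
    proof (rule ran_eqI[OF x y])
      fix a \<beta> assume i: "(a, \<beta>) \<in> ran_idx b"
      show "x (a, \<beta>) = y (a, \<beta>)"
      proof (rule G.sheaf_separated[OF P ran_in[OF x i] ran_in[OF y i]])
        show "locally C (giraud_topology C B p J) a (\<lambda>f. act P f (x (a, \<beta>)) = act P f (y (a, \<beta>)))"
        proof (rule G.locally_mono[OF loc_pull[OF loc i]])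
          fix f assume f: "f \<in> Arr C" "Cod C f = a" and eq: "ran_act (\<beta> \<odot>\<^sub>B FA p f) x = ran_act (\<beta> \<odot>\<^sub>B FA p f) y"
          let ?c = "\<beta> \<odot>\<^sub>B FA p f"
          have c: "?c \<in> Arr B" "Dom B ?c = FO p (Dom C f)" using i f by auto
          have ci: "?c \<odot>\<^sub>B Ide B (FO p (Dom C f)) = ?c" using BB.comp_Ide(2)[OF c(1)] c(2) by simp
          have idx: "(Dom C f, Ide B (FO p (Dom C f))) \<in> ran_idx (Dom B ?c)" using f c by simp
          have "x (Dom C f, ?c) = y (Dom C f, ?c)"
            using fun_cong[OF eq, of "(Dom C f, Ide B (FO p (Dom C f)))"] unfolding ran_act_app[OF idx] ci .
          then show "act P f (x (a, \<beta>)) = act P f (y (a, \<beta>))"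
            using ran_nat[OF x f(1), of \<beta>] ran_nat[OF y f(1), of \<beta>] i f by simp
        qed
      qed
    qed
  next
    fix b S x assume S: "(b, S) \<in> J" "is_sieve B b S" and x: "\<And>c. c \<in> S \<Longrightarrow> x c \<in> ran_val P (Dom B c)"
      and xr: "\<And>c g. c \<in> S \<Longrightarrow> g \<in> Arr B \<Longrightarrow> Cod B g = Dom B c \<Longrightarrow> ran_act g (x c) = x (c \<odot>\<^sub>B g)"
    have locS: "locally B J b (\<lambda>c. c \<in> S)" using S J.sieve_locally[OF S(2)] by simp
    have Sa: "c \<in> Arr B" "Cod B c = b" if "c \<in> S" for c using sieve_arr[OF S(2) that] .
    have xid: "x c (a, \<beta>) = x (c \<odot>\<^sub>B \<beta>) (a, Ide B (FO p a))" if c: "c \<in> S" and i: "(a, \<beta>) \<in> ran_idx (Dom B c)" for c a \<beta>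
    proof -
      have \<beta>: "a \<in> Obj C" "\<beta> \<in> Arr B" "Dom B \<beta> = FO p a" "Cod B \<beta> = Dom B c" using i by auto
      have "ran_act \<beta> (x c) (a, Ide B (FO p a)) = x c (a, \<beta>)" using \<beta> BB.comp_Ide(2)[OF \<beta>(2)] by simp
      then show ?thesis using xr[OF c \<beta>(2,4)] by simp
    qed
    define R where "R \<beta> f z \<longleftrightarrow> \<beta> \<odot>\<^sub>B FA p f \<in> S \<and> z = x (\<beta> \<odot>\<^sub>B FA p f) (Dom C f, Ide B (FO p (Dom C f)))" for \<beta> f z
    have xnat: "act P g (x c (a, Ide B (FO p a))) = x (c \<odot>\<^sub>B FA p g) (Dom C g, Ide B (FO p (Dom C g)))"
      if c: "c \<in> S" "Dom B c = FO p a" and g: "g \<in> Arr C" "Cod C g = a" for c a g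
    proof -
      have i: "(Cod C g, Ide B (FO p a)) \<in> ran_idx (Dom B c)" using c g by auto
      have "act P g (x c (a, Ide B (FO p a))) = x c (Dom C g, FA p g)"
        using ran_nat[OF x[OF c(1)] g(1) i] g BB.comp_Ide(1)[of "FA p g"] by simp
      then show ?thesis using xid[OF c(1), of "Dom C g" "FA p g"] c g by simp
    qed
    have R_restr: "R \<beta> (f \<odot>\<^sub>C g) (act P g z)"
      if i: "(a, \<beta>) \<in> ran_idx b" and f: "f \<in> Arr C" "Cod C f = a" and R: "R \<beta> f z" and g: "g \<in> Arr C" "Cod C g = Dom C f" for a \<beta> f g z
    proof -
      let ?c = "\<beta> \<odot>\<^sub>B FA p f"
      have c: "?c \<in> S" "Dom B ?c = FO p (Dom C f)" and z: "z = x ?c (Dom C f, Ide B (FO p (Dom C f)))"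
        using R i f by (auto simp: R_def)
      have e: "\<beta> \<odot>\<^sub>B FA p (f \<odot>\<^sub>C g) = ?c \<odot>\<^sub>B FA p g" using i f g by simp
      have "?c \<odot>\<^sub>B FA p g \<in> S" using sieve_closed[OF S(2) c(1), of "FA p g"] c g by simp
      then show ?thesis unfolding R_def e using xnat[OF c g] z f g by simp
    qed
    have "\<exists>z \<in> val P a. \<forall>f z'. f \<in> Arr C \<longrightarrow> Cod C f = a \<longrightarrow> R \<beta> f z' \<longrightarrow> act P f z = z'"
      if i: "(a, \<beta>) \<in> ran_idx b" for a \<beta>
    proof (rule G.sheaf_local_description[OF P])
      show "locally C (giraud_topology C B p J) a (\<lambda>f. \<exists>z. R \<beta> f z)"
        using loc_pull[OF locS i] unfolding R_def by simp
      fix f z assume f: "f \<in> Arr C" "Cod C f = a" and R: "R \<beta> f z"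
      then show "z \<in> val P (Dom C f)"
        using ran_in[OF x, of "\<beta> \<odot>\<^sub>B FA p f" "Dom C f" "Ide B (FO p (Dom C f))"] i unfolding R_def by simp
    next
      fix f g z assume "f \<in> Arr C" "Cod C f = a" "R \<beta> f z" "g \<in> Arr C" "Cod C g = Dom C f"
      then show "R \<beta> (f \<odot>\<^sub>C g) (act P g z)" by (rule R_restr[OF i])
    qed (simp add: R_def)
    then have "\<forall>a \<beta>. \<exists>z. (a, \<beta>) \<in> ran_idx b \<longrightarrow> z \<in> val P a \<and> (\<forall>f z'. f \<in> Arr C \<longrightarrow> Cod C f = a \<longrightarrow> R \<beta> f z' \<longrightarrow> act P f z = z')"
      by blast
    then obtain w where w: "\<And>a \<beta>. (a, \<beta>) \<in> ran_idx b \<Longrightarrow> w a \<beta> \<in> val P a"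
      and wR: "\<And>a \<beta> f z'. (a, \<beta>) \<in> ran_idx b \<Longrightarrow> f \<in> Arr C \<Longrightarrow> Cod C f = a \<Longrightarrow> R \<beta> f z' \<Longrightarrow> act P f (w a \<beta>) = z'"
      by metis
    define y where "y = restrict (\<lambda>(a, \<beta>). w a \<beta>) (ran_idx b)"
    have y_app: "y (a, \<beta>) = w a \<beta>" if "(a, \<beta>) \<in> ran_idx b" for a \<beta> using that by (simp add: y_def del: ran_idx_iff)
    have yv: "y \<in> ran_val P b"
    proof (rule ran_valI)
      show "y \<in> extensional (ran_idx b)" by (simp add: y_def)
      show "y (a, \<beta>) \<in> val P a" if "(a, \<beta>) \<in> ran_idx b" for a \<beta> using w[OF that] y_app[OF that] by simp
      fix f \<beta> assume f: "f \<in> Arr C" and i: "(Cod C f, \<beta>) \<in> ran_idx b"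
      have i': "(Dom C f, \<beta> \<odot>\<^sub>B FA p f) \<in> ran_idx b" using i f by simp
      have fw: "act P f (w (Cod C f) \<beta>) \<in> val P (Dom C f)" using CC.act_in[OF Pp f w[OF i]] .
      have "act P f (w (Cod C f) \<beta>) = w (Dom C f) (\<beta> \<odot>\<^sub>B FA p f)"
      proof (rule G.sheaf_separated[OF P fw w[OF i']])
        show "locally C (giraud_topology C B p J) (Dom C f)
          (\<lambda>g. act P g (act P f (w (Cod C f) \<beta>)) = act P g (w (Dom C f) (\<beta> \<odot>\<^sub>B FA p f)))"
        proof (rule G.locally_mono[OF loc_pull[OF locS i']])
          fix g assume g: "g \<in> Arr C" "Cod C g = Dom C f" and "(\<beta> \<odot>\<^sub>B FA p f) \<odot>\<^sub>B FA p g \<in> S"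
          then have R1: "R (\<beta> \<odot>\<^sub>B FA p f) g (x ((\<beta> \<odot>\<^sub>B FA p f) \<odot>\<^sub>B FA p g) (Dom C g, Ide B (FO p (Dom C g))))"
            by (simp add: R_def)
          then have R2: "R \<beta> (f \<odot>\<^sub>C g) (x ((\<beta> \<odot>\<^sub>B FA p f) \<odot>\<^sub>B FA p g) (Dom C g, Ide B (FO p (Dom C g))))"
            using f g i by (simp add: R_def)
          show "act P g (act P f (w (Cod C f) \<beta>)) = act P g (w (Dom C f) (\<beta> \<odot>\<^sub>B FA p f))"
            using wR[OF i' g R1] wR[OF i _ _ R2] f g CC.act_comp[OF Pp g(1) f g(2) w[OF i]] by simp
        qed
      qed
      then show "act P f (y (Cod C f, \<beta>)) = y (Dom C f, \<beta> \<odot>\<^sub>B FA p f)" using y_app[OF i] y_app[OF i'] by simp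
    qed
    moreover have "ran_act c y = x c" if c: "c \<in> S" for c
    proof (rule ran_eqI[OF ran_act_val[OF Sa(1)[OF c]] x[OF c]])
      show "y \<in> ran_val P (Cod B c)" using yv Sa[OF c] by simp
      fix a \<beta> assume i: "(a, \<beta>) \<in> ran_idx (Dom B c)"
      then have i': "(a, c \<odot>\<^sub>B \<beta>) \<in> ran_idx b" using Sa[OF c] by simp
      have cS: "c \<odot>\<^sub>B \<beta> \<in> S" using sieve_closed[OF S(2) c, of \<beta>] i by simp
      have a: "a \<in> Obj C" using i by simp
      have e: "(c \<odot>\<^sub>B \<beta>) \<odot>\<^sub>B FA p (Ide C a) = c \<odot>\<^sub>B \<beta>"
      proof -
        have "\<beta> \<in> Arr B" using i by simp
        from BB.comp_Ide(2)[OF this] show ?thesis using a i Sa[OF c] by simp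
      qed
      have "R (c \<odot>\<^sub>B \<beta>) (Ide C a) (x (c \<odot>\<^sub>B \<beta>) (a, Ide B (FO p a)))"
        unfolding R_def e using cS a by simp
      from wR[OF i' _ _ this] have "act P (Ide C a) (w a (c \<odot>\<^sub>B \<beta>)) = x c (a, \<beta>)"
        using a xid[OF c i] by simp
      then show "ran_act c y (a, \<beta>) = x c (a, \<beta>)"
        using ran_act_app[OF i] y_app[OF i'] CC.act_Ide[OF Pp a w[OF i']] by simp
    qed
    ultimately show "\<exists>s\<in>ran_val P b. \<forall>f\<in>S. ran_act f s = x f" by blast
  qed
qed

text \<open>The test object is the sheaf \<open>\<Omega>\<close> of \<open>L\<close>-closed sieves. For \<open>S\<close> with \<open>S\<^sub>p\<close> covering for \<open>T\<close>, the family \<open>x\<close> of closures of the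
  preimages of \<open>S\<^sub>p\<close> and the family \<open>y\<close> of maximal sieves are elements of the Kan extension of \<open>\<Omega>\<close> over \<open>p a\<close> with the
  same restrictions to \<open>S\<^sub>p\<close>. So they are equal, and at the identity of \<open>p a\<close> this says that \<open>S\<close> is \<open>L\<close>-covering.\<close>

lemma ran_detects:
  assumes T: "is_topology B T" and L: "is_topology C L"
    and sh: "\<And>P. P \<in> sheaves U C L \<Longrightarrow> \<exists>G e d. BB.encoding (ran_val P) ran_act G e d \<and> G \<in> sheaves U B T"
  shows "giraud_topology C B p T \<subseteq> L"
proof
  interpret T: sheaf_site B U T using T by unfold_locales
  interpret L: sheaf_site C U L using L by unfold_locales
  fix z assume z: "z \<in> giraud_topology C B p T"
  obtain a0 S where aS: "z = (a0, S)" by fastforce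
  have S: "is_sieve C a0 S" and Sp: "(FO p a0, sieve_image C B p a0 S) \<in> T" using z aS by (auto simp: giraud_topology_def)
  have a0: "a0 \<in> Obj C" using S by (simp add: is_sieve_def)
  let ?R = "sieve_image C B p a0 S"
  note R = is_sieve_image[OF S]
  obtain \<Omega> eo dd where \<Omega>: "\<Omega> \<in> sheaves U C L" and eo: "CC.encoding L.closed_sieves (pullback_sieve C) \<Omega> eo dd"
    using L.Omega_exists by blast
  obtain G e d where e: "BB.encoding (ran_val \<Omega>) ran_act G e d" and G: "G \<in> sheaves U B T" using sh[OF \<Omega>] by blast
  define cl where "cl a \<beta> = {f \<in> Arr C. Cod C f = a \<and> locally C L (Dom C f) (\<lambda>g. f \<odot>\<^sub>C g \<in> {h \<in> Arr C. Cod C h = a \<and> \<beta> \<odot>\<^sub>B FA p h \<in> ?R})}" for a \<beta>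
  define mx where "mx a = {f \<in> Arr C. Cod C f = a}" for a
  have pre: "is_sieve C a {h \<in> Arr C. Cod C h = a \<and> \<beta> \<odot>\<^sub>B FA p h \<in> ?R}" if i: "(a, \<beta>) \<in> ran_idx (FO p a0)" for a \<beta>
    unfolding is_sieve_def
  proof (intro conjI ballI impI)
    fix h g assume h: "h \<in> {h \<in> Arr C. Cod C h = a \<and> \<beta> \<odot>\<^sub>B FA p h \<in> ?R}" and g: "g \<in> Arr C" "Cod C g = Dom C h"
    then have h': "h \<in> Arr C" "Cod C h = a" "\<beta> \<odot>\<^sub>B FA p h \<in> ?R" by auto
    have "(\<beta> \<odot>\<^sub>B FA p h) \<odot>\<^sub>B FA p g \<in> ?R" using sieve_closed[OF R h'(3), of "FA p g"] g h' i by simp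
    then show "h \<odot>\<^sub>C g \<in> {h \<in> Arr C. Cod C h = a \<and> \<beta> \<odot>\<^sub>B FA p h \<in> ?R}" using h' g i by simp
  qed (use i in auto)
  have cl: "cl a \<beta> \<in> L.closed_sieves a" if "(a, \<beta>) \<in> ran_idx (FO p a0)" for a \<beta>
    unfolding cl_def by (rule L.sieve_closure[OF pre[OF that]])
  have mx: "mx a \<in> L.closed_sieves a" if "a \<in> Obj C" for a unfolding mx_def by (rule L.max_closed[OF that])
  have cl_pull: "pullback_sieve C f (cl (Cod C f) \<beta>) = cl (Dom C f) (\<beta> \<odot>\<^sub>B FA p f)"
    if f: "f \<in> Arr C" and i: "(Cod C f, \<beta>) \<in> ran_idx (FO p a0)" for f \<beta>
  proof -
    have "locally C L (Dom C h) (\<lambda>g. (f \<odot>\<^sub>C h) \<odot>\<^sub>C g \<in> {h \<in> Arr C. Cod C h = Cod C f \<and> \<beta> \<odot>\<^sub>B FA p h \<in> ?R}) \<longleftrightarrow>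
      locally C L (Dom C h) (\<lambda>g. h \<odot>\<^sub>C g \<in> {h \<in> Arr C. Cod C h = Dom C f \<and> (\<beta> \<odot>\<^sub>B FA p f) \<odot>\<^sub>B FA p h \<in> ?R})"
      if h: "h \<in> Arr C" "Cod C h = Dom C f" for h
      by (rule L.locally_cong) (use h f i in simp)
    then show ?thesis using f unfolding cl_def pullback_sieve_def by (auto simp del: CC.comp_assoc)
  qed
  have mx_pull: "pullback_sieve C f (mx (Cod C f)) = mx (Dom C f)" if f: "f \<in> Arr C" for f
    using f by (auto simp: mx_def pullback_sieve_def)
  define x where "x = restrict (\<lambda>(a, \<beta>). eo a (cl a \<beta>)) (ran_idx (FO p a0))"
  define y where "y = restrict (\<lambda>(a, \<beta>). eo a (mx a)) (ran_idx (FO p a0))"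
  have x_app: "x (a, \<beta>) = eo a (cl a \<beta>)" if "(a, \<beta>) \<in> ran_idx (FO p a0)" for a \<beta> using that by (simp add: x_def del: ran_idx_iff)
  have y_app: "y (a, \<beta>) = eo a (mx a)" if "(a, \<beta>) \<in> ran_idx (FO p a0)" for a \<beta> using that by (simp add: y_def del: ran_idx_iff)
  have xv: "x \<in> ran_val \<Omega> (FO p a0)"
  proof (rule ran_valI)
    fix f \<beta> assume f: "f \<in> Arr C" and i: "(Cod C f, \<beta>) \<in> ran_idx (FO p a0)"
    have i': "(Dom C f, \<beta> \<odot>\<^sub>B FA p f) \<in> ran_idx (FO p a0)" using i f by simp
    show "act \<Omega> f (x (Cod C f, \<beta>)) = x (Dom C f, \<beta> \<odot>\<^sub>B FA p f)"
      unfolding x_app[OF i] x_app[OF i'] using CC.act_enc[OF eo f cl[OF i]] cl_pull[OF f i] by simp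
  qed (use x_app CC.enc_in[OF eo _ cl] in \<open>auto simp: x_def simp del: ran_idx_iff, auto\<close>)
  have yv: "y \<in> ran_val \<Omega> (FO p a0)"
  proof (rule ran_valI)
    fix f \<beta> assume f: "f \<in> Arr C" and i: "(Cod C f, \<beta>) \<in> ran_idx (FO p a0)"
    have i': "(Dom C f, \<beta> \<odot>\<^sub>B FA p f) \<in> ran_idx (FO p a0)" using i f by simp
    show "act \<Omega> f (y (Cod C f, \<beta>)) = y (Dom C f, \<beta> \<odot>\<^sub>B FA p f)"
      unfolding y_app[OF i] y_app[OF i'] using CC.act_enc[OF eo f mx] mx_pull[OF f] f by simp
  qed (use y_app CC.enc_in[OF eo _ mx] in \<open>auto simp: y_def simp del: ran_idx_iff, auto\<close>)
  have b0: "FO p a0 \<in> Obj B" using a0 by simp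
  have ex: "e (FO p a0) x \<in> val G (FO p a0)" "e (FO p a0) y \<in> val G (FO p a0)"
    using BB.enc_in[OF e b0] xv yv by auto
  have "e (FO p a0) x = e (FO p a0) y"
  proof (rule T.sheaf_separated[OF G ex])
    have "locally B T (FO p a0) (\<lambda>c. c \<in> ?R)" using Sp T.sieve_locally[OF R] by simp
    then show "locally B T (FO p a0) (\<lambda>c. act G c (e (FO p a0) x) = act G c (e (FO p a0) y))"
    proof (rule T.locally_mono)
      fix c assume c: "c \<in> Arr B" "Cod B c = FO p a0" "c \<in> ?R"
      have "ran_act c x = ran_act c y"
      proof (rule ran_eqI[OF ran_act_val[OF c(1)] ran_act_val[OF c(1)]])
        show "x \<in> ran_val \<Omega> (Cod B c)" "y \<in> ran_val \<Omega> (Cod B c)" using xv yv c by auto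
        fix a \<beta> assume i: "(a, \<beta>) \<in> ran_idx (Dom B c)"
        then have i': "(a, c \<odot>\<^sub>B \<beta>) \<in> ran_idx (FO p a0)" using c by simp
        have cR: "c \<odot>\<^sub>B (\<beta> \<odot>\<^sub>B FA p h) \<in> ?R" if "h \<in> Arr C" "Cod C h = a" for h
          using sieve_closed[OF R c(3), of "\<beta> \<odot>\<^sub>B FA p h"] i that by simp
        have "cl a (c \<odot>\<^sub>B \<beta>) = mx a"
        proof -
          have "c \<odot>\<^sub>B (\<beta> \<odot>\<^sub>B (FA p h \<odot>\<^sub>B FA p g)) \<in> ?R"
            if "h \<in> Arr C" "Cod C h = a" "g \<in> Arr C" "Cod C g = Dom C h" for h g
            using cR[of "h \<odot>\<^sub>C g"] that by simp
          then show ?thesis unfolding cl_def mx_def using c i by (auto intro!: L.locally_triv)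
        qed
        then show "ran_act c x (a, \<beta>) = ran_act c y (a, \<beta>)"
          unfolding ran_act_app[OF i] x_app[OF i'] y_app[OF i'] by simp
      qed
      then show "act G c (e (FO p a0) x) = act G c (e (FO p a0) y)"
        using BB.act_enc[OF e c(1), of x] BB.act_enc[OF e c(1), of y] xv yv c by simp
    qed
  qed
  then have "d (FO p a0) (e (FO p a0) x) = d (FO p a0) (e (FO p a0) y)" by simp
  then have "x = y" using BB.dec_enc[OF e b0 xv] BB.dec_enc[OF e b0 yv] by simp
  then have "x (a0, Ide B (FO p a0)) = y (a0, Ide B (FO p a0))" by simp
  moreover have i0: "(a0, Ide B (FO p a0)) \<in> ran_idx (FO p a0)" using a0 by simp
  ultimately have "eo a0 (cl a0 (Ide B (FO p a0))) = eo a0 (mx a0)" using x_app[OF i0] y_app[OF i0] by simp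
  then have "dd a0 (eo a0 (cl a0 (Ide B (FO p a0)))) = dd a0 (eo a0 (mx a0))" by simp
  then have eq: "cl a0 (Ide B (FO p a0)) = mx a0"
    using CC.dec_enc[OF eo a0 cl[OF i0]] CC.dec_enc[OF eo a0 mx[OF a0]] by simp
  have "Ide C a0 \<in> cl a0 (Ide B (FO p a0))" unfolding eq using a0 by (simp add: mx_def)
  then have loc: "locally C L a0 (\<lambda>g. Ide C a0 \<odot>\<^sub>C g \<in> {h \<in> Arr C. Cod C h = a0 \<and> Ide B (FO p a0) \<odot>\<^sub>B FA p h \<in> ?R})"
    using a0 by (simp add: cl_def)
  have "locally C L a0 (\<lambda>f. f \<in> S)"
  proof (rule L.locally_mono[OF loc])
    fix f assume f: "f \<in> Arr C" "Cod C f = a0"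
      and "Ide C a0 \<odot>\<^sub>C f \<in> {h \<in> Arr C. Cod C h = a0 \<and> Ide B (FO p a0) \<odot>\<^sub>B FA p h \<in> ?R}"
    then have "FA p f \<in> ?R" using CC.comp_Ide(1)[OF f(1)] BB.comp_Ide(1)[of "FA p f"] by simp
    then show "f \<in> S" using preimage_subset_iff[OF S R] f by auto
  qed
  then show "z \<in> L" using L.sieve_locally[OF S] aS by simp
qed

text \<open>The right adjoint \<open>R\<close> is arbitrary; being a sheaf is invariant under the isomorphism of its values with
  Kan extensions.\<close>

theorem direct_image_sheaves_iff:
  assumes adj: "adjunction (Psh U B) (Psh U C) pb R \<eta> \<epsilon>" and T: "is_topology B T" and L: "is_topology C L"
  shows "FO R ` sheaves U C L \<subseteq> sheaves U B T \<longleftrightarrow> giraud_topology C B p T \<subseteq> L"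
proof -
  obtain R' \<eta>' \<epsilon>' where adj': "adjunction (Psh U B) (Psh U C) pb R' \<eta>' \<epsilon>'"
    and enc: "\<And>P. CC.psh P \<Longrightarrow> \<exists>e d. BB.encoding (ran_val P) ran_act (FO R' P) e d" using ran_exists by blast
  have "sheaves U B T \<in> ST (Psh U B)"
    using BB.ST_Sh_iff[OF BB.min_topology] T min_topology_least[OF T] unfolding BB.Sh_min by blast
  then have replete: "isomorphic (Psh U B) X Y \<Longrightarrow> X \<in> sheaves U B T \<Longrightarrow> Y \<in> Obj (Psh U B) \<Longrightarrow> Y \<in> sheaves U B T" for X Y
    unfolding ST_def by blast
  have iso: "isomorphic (Psh U B) (FO R P) (FO R' P)" "isomorphic (Psh U B) (FO R' P) (FO R P)" if "CC.psh P" for P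
    using right_adjoint_unique[OF BB.category_Psh CC.category_Psh] adj adj' that by auto
  have ob: "FO R P \<in> Obj (Psh U B)" "FO R' P \<in> Obj (Psh U B)" if "CC.psh P" for P
    using functor_Obj[of "Psh U C" "Psh U B"] adj adj' that unfolding adjunction_def by auto
  have eq: "FO R P \<in> sheaves U B T \<longleftrightarrow> FO R' P \<in> sheaves U B T" if "CC.psh P" for P
    using replete iso[OF that] ob[OF that] by blast
  show ?thesis
  proof
    assume sub: "FO R ` sheaves U C L \<subseteq> sheaves U B T"
    show "giraud_topology C B p T \<subseteq> L"
    proof (rule ran_detects[OF T L])
      fix P assume P: "P \<in> sheaves U C L"
      have "FO R' P \<in> sheaves U B T" using sub P eq[OF sheaf_presheaf[OF P]] by blast
      then show "\<exists>G e d. BB.encoding (ran_val P) ran_act G e d \<and> G \<in> sheaves U B T"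
        using enc[OF sheaf_presheaf[OF P]] by blast
    qed
  next
    assume TL: "giraud_topology C B p T \<subseteq> L"
    have "FO R P \<in> sheaves U B T" if P: "P \<in> sheaves U C L" for P
    proof -
      have Pp: "CC.psh P" using sheaf_presheaf[OF P] .
      have "P \<in> sheaves U C (giraud_topology C B p T)" using sheaves_antimono[OF TL] P by blast
      then have "FO R' P \<in> sheaves U B T" using ran_sheaf[OF T] enc[OF Pp] by blast
      then show ?thesis using eq[OF Pp] by simp
    qed
    then show "FO R ` sheaves U C L \<subseteq> sheaves U B T" by blast
  qed
qed

end

section \<open>The left adjoint of the inverse image functor\<close>

context small_functor
begin

text \<open>The pointwise left Kan extension along \<open>p\<close>: an element over \<open>b\<close> is represented by an arrow \<open>\<beta> : b \<rightarrow> p a\<close> and an element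
  over \<open>a\<close>, up to zigzags of arrows of \<open>C\<close>.\<close>

definition lan_idx :: "('o, 'm, 'u) presheaf \<Rightarrow> 'b \<Rightarrow> ('o \<times> 'n \<times> 'u) set" where
  "lan_idx P b = {(a, \<beta>, s). a \<in> Obj C \<and> \<beta> \<in> Arr B \<and> Dom B \<beta> = b \<and> Cod B \<beta> = FO p a \<and> s \<in> val P a}"

definition lan_step :: "('o, 'm, 'u) presheaf \<Rightarrow> 'b \<Rightarrow> 'o \<times> 'n \<times> 'u \<Rightarrow> 'o \<times> 'n \<times> 'u \<Rightarrow> bool" where
  "lan_step P b t t' \<longleftrightarrow> (\<exists>f \<beta> s. f \<in> Arr C \<and> (Dom C f, \<beta>, act P f s) \<in> lan_idx P b \<and> s \<in> val P (Cod C f) \<and>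
    t = (Dom C f, \<beta>, act P f s) \<and> t' = (Cod C f, FA p f \<odot>\<^sub>B \<beta>, s))"

abbreviation lan_eq where "lan_eq P b \<equiv> equivclp (lan_step P b)"

definition lan_cls :: "('o, 'm, 'u) presheaf \<Rightarrow> 'b \<Rightarrow> 'o \<times> 'n \<times> 'u \<Rightarrow> ('o \<times> 'n \<times> 'u) set" where
  "lan_cls P b t = {t'. lan_eq P b t t'}"

definition lan_act :: "('o, 'm, 'u) presheaf \<Rightarrow> 'n \<Rightarrow> ('o \<times> 'n \<times> 'u) set \<Rightarrow> ('o \<times> 'n \<times> 'u) set" where
  "lan_act P c A = (\<Union>(a, \<beta>, s) \<in> A. lan_cls P (Dom B c) (a, \<beta> \<odot>\<^sub>B c, s))"

lemma lan_idx_iff [simp]: "(a, \<beta>, s) \<in> lan_idx P b \<longleftrightarrow>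
    a \<in> Obj C \<and> \<beta> \<in> Arr B \<and> Dom B \<beta> = b \<and> Cod B \<beta> = FO p a \<and> s \<in> val P a"
  by (simp add: lan_idx_def)

lemma lan_cls_eq: "lan_cls P b t = lan_cls P b t' \<longleftrightarrow> lan_eq P b t t'"
  unfolding lan_cls_def set_eq_iff mem_Collect_eq
  by (metis equivclp_refl equivclp_sym equivclp_trans)

lemma lan_eq_step: "f \<in> Arr C \<Longrightarrow> \<beta> \<in> Arr B \<Longrightarrow> Dom B \<beta> = b \<Longrightarrow> Cod B \<beta> = FO p (Dom C f) \<Longrightarrow> s \<in> val P (Cod C f) \<Longrightarrow>
    CC.psh P \<Longrightarrow> lan_eq P b (Dom C f, \<beta>, act P f s) (Cod C f, FA p f \<odot>\<^sub>B \<beta>, s)"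
  by (rule r_into_equivclp) (auto simp: lan_step_def)

lemma lan_eq_pull:
  assumes c: "c \<in> Arr B" and eq: "lan_eq P (Cod B c) (a, \<beta>, s) (a', \<beta>', s')"
  shows "lan_eq P (Dom B c) (a, \<beta> \<odot>\<^sub>B c, s) (a', \<beta>' \<odot>\<^sub>B c, s')"
proof -
  define pl where "pl t = (fst t, fst (snd t) \<odot>\<^sub>B c, snd (snd t))" for t :: "'o \<times> 'n \<times> 'u"
  have st: "lan_step P (Dom B c) (pl t) (pl t')" if stp: "lan_step P (Cod B c) t t'" for t t'
  proof -
    obtain f \<beta> s where f: "f \<in> Arr C" "(Dom C f, \<beta>, act P f s) \<in> lan_idx P (Cod B c)" "s \<in> val P (Cod C f)"
      "t = (Dom C f, \<beta>, act P f s)" "t' = (Cod C f, FA p f \<odot>\<^sub>B \<beta>, s)"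
      using stp unfolding lan_step_def by blast
    show ?thesis
      unfolding lan_step_def by (rule exI[of _ f], rule exI[of _ "\<beta> \<odot>\<^sub>B c"], rule exI[of _ s]) (use f c in \<open>simp add: pl_def\<close>)
  qed
  have "lan_eq P (Dom B c) (pl (a, \<beta>, s)) (pl t')" if "lan_eq P (Cod B c) (a, \<beta>, s) t'" for t'
    using that
  proof (induction rule: equivclp_induct)
    case base show ?case by simp
  next
    case (step y z)
    then have "lan_eq P (Dom B c) (pl y) (pl z)"
      using st r_into_equivclp converse_r_into_equivclp by metis
    with step show ?case using equivclp_trans by metis
  qed
  from this[OF eq] show ?thesis by (simp add: pl_def)
qed

lemma lan_act_cls:
  assumes c: "c \<in> Arr B"
  shows "lan_act P c (lan_cls P (Cod B c) (a, \<beta>, s)) = lan_cls P (Dom B c) (a, \<beta> \<odot>\<^sub>B c, s)"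
proof -
  have "lan_cls P (Dom B c) (a', \<beta>' \<odot>\<^sub>B c, s') = lan_cls P (Dom B c) (a, \<beta> \<odot>\<^sub>B c, s)"
    if "(a', \<beta>', s') \<in> lan_cls P (Cod B c) (a, \<beta>, s)" for a' \<beta>' s'
    unfolding lan_cls_eq using lan_eq_pull[OF c, of P a \<beta> s a' \<beta>' s'] that equivclp_sym
    unfolding lan_cls_def by (metis mem_Collect_eq)
  moreover have "(a, \<beta>, s) \<in> lan_cls P (Cod B c) (a, \<beta>, s)" by (simp add: lan_cls_def)
  ultimately show ?thesis unfolding lan_act_def by fast
qed

lemma lan_raw:
  assumes P: "CC.psh P"
  shows "BB.raw_presheaf (\<lambda>b. lan_cls P b ` lan_idx P b) (lan_act P)"
  unfolding BB.raw_presheaf_def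
proof (intro conjI ballI impI)
  fix b assume b: "b \<in> Obj B"
  obtain T where T: "CC.skeletal T" using CC.skeletal_exists by blast
  let ?I = "SIGMA a:T. Hom B b (FO p a) \<times> val P a"
  have "small U ?I"
  proof (rule small_Sigma[OF CC.universe CC.skeletal_small[OF T]])
    fix a assume "a \<in> T"
    then have a: "a \<in> Obj C" using CC.skeletal_Obj[OF T] by auto
    show "small U (Hom B b (FO p a) \<times> val P a)"
      by (rule small_Sigma[OF CC.universe BB.small_Hom]) (use a b CC.val_small[OF P] in auto)
  qed
  then show "small U (lan_cls P b ` lan_idx P b)"
  proof (rule small_surj[where f="lan_cls P b"])
    show "lan_cls P b ` lan_idx P b \<subseteq> lan_cls P b ` ?I"
    proof
      fix A assume "A \<in> lan_cls P b ` lan_idx P b"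
      then obtain a \<beta> s where A: "A = lan_cls P b (a, \<beta>, s)" and i: "(a, \<beta>, s) \<in> lan_idx P b" by auto
      have a: "a \<in> Obj C" and s: "s \<in> val P a" and \<beta>: "\<beta> \<in> Arr B" "Dom B \<beta> = b" "Cod B \<beta> = FO p a" using i by auto
      obtain k l where kl: "k \<in> Arr C" "Dom C k = a" "Cod C k \<in> T" "l \<in> Arr C" "Dom C l = Cod C k" "Cod C l = a"
        "l \<odot>\<^sub>C k = Ide C a" using CC.skeletal_iso[OF T a] by blast
      have ls: "act P l s \<in> val P (Cod C k)" using CC.act_in'[OF P kl(4,6) s] kl by simp
      have "act P k (act P l s) = s" using CC.act_comp[OF P kl(1,4)] kl s a P by simp
      then have "lan_eq P b (a, \<beta>, s) (Cod C k, FA p k \<odot>\<^sub>B \<beta>, act P l s)"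
        using lan_eq_step[OF kl(1) \<beta>(1,2), of "act P l s" P] \<beta> kl ls P by simp
      then have "A = lan_cls P b (Cod C k, FA p k \<odot>\<^sub>B \<beta>, act P l s)" using A lan_cls_eq by simp
      moreover have "(Cod C k, FA p k \<odot>\<^sub>B \<beta>, act P l s) \<in> ?I" using kl \<beta> ls by (simp add: Hom_def)
      ultimately show "A \<in> lan_cls P b ` ?I" by blast
    qed
  qed
next
  fix c A assume c: "c \<in> Arr B" and "A \<in> lan_cls P (Cod B c) ` lan_idx P (Cod B c)"
  then obtain a \<beta> s where "A = lan_cls P (Cod B c) (a, \<beta>, s)" "(a, \<beta>, s) \<in> lan_idx P (Cod B c)" by auto
  then show "lan_act P c A \<in> lan_cls P (Dom B c) ` lan_idx P (Dom B c)"
    using c by (simp add: lan_act_cls del: image_iff)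
next
  fix b A assume b: "b \<in> Obj B" and "A \<in> lan_cls P b ` lan_idx P b"
  then obtain a \<beta> s where "A = lan_cls P b (a, \<beta>, s)" "(a, \<beta>, s) \<in> lan_idx P b" by auto
  then show "lan_act P (Ide B b) A = A"
    using lan_act_cls[of "Ide B b" P a \<beta> s] b BB.comp_Ide(2)[of \<beta>] by auto
next
  fix f g A assume f: "f \<in> Arr B" and g: "g \<in> Arr B" and fg: "Cod B f = Dom B g"
    and "A \<in> lan_cls P (Cod B g) ` lan_idx P (Cod B g)"
  then obtain a \<beta> s where "A = lan_cls P (Cod B g) (a, \<beta>, s)" "(a, \<beta>, s) \<in> lan_idx P (Cod B g)" by auto
  then show "lan_act P (g \<odot>\<^sub>B f) A = lan_act P f (lan_act P g A)"
    using lan_act_cls[OF g, of P a \<beta> s] lan_act_cls[OF f, of P a "\<beta> \<odot>\<^sub>B g" s] lan_act_cls[of "g \<odot>\<^sub>B f" P a \<beta> s] f g fg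
    by simp
qed

text \<open>The Kan extension is characterized by its elements: they are all represented, and representatives of the
  same element are joined by a zigzag.\<close>

definition is_lan :: "('o, 'm, 'u) presheaf \<Rightarrow> ('b, 'n, 'u) presheaf \<Rightarrow> ('o, 'm, 'u) nattrans \<Rightarrow> bool" where
  "is_lan P G w \<longleftrightarrow> w \<in> CC.hom P (FO pb G) \<and> BB.psh G \<and>
    (\<forall>b \<in> Obj B. \<forall>y \<in> val G b. \<exists>a \<beta> s. (a, \<beta>, s) \<in> lan_idx P b \<and> y = act G \<beta> (cmpt w a s)) \<and>
    (\<forall>b a \<beta> s a' \<beta>' s'. (a, \<beta>, s) \<in> lan_idx P b \<longrightarrow> (a', \<beta>', s') \<in> lan_idx P b \<longrightarrow>
      act G \<beta> (cmpt w a s) = act G \<beta>' (cmpt w a' s') \<longrightarrow> lan_eq P b (a, \<beta>, s) (a', \<beta>', s'))"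

lemma lan_exists:
  assumes P: "CC.psh P" shows "\<exists>G w. is_lan P G w"
proof -
  note raw = lan_raw[OF P]
  obtain G e d where e: "BB.encoding (\<lambda>b. lan_cls P b ` lan_idx P b) (lan_act P) G e d"
    using BB.encoding_exists[OF raw] by blast
  have Gp: "BB.psh G" using BB.enc_psh[OF e] .
  let ?c = "\<lambda>b t. e b (lan_cls P b t)"
  have cv: "?c b t \<in> val G b" if "b \<in> Obj B" "t \<in> lan_idx P b" for b t
    using BB.enc_in[OF e that(1)] that(2) by blast
  have act_c: "act G c (?c (Cod B c) (a, \<beta>, s)) = ?c (Dom B c) (a, \<beta> \<odot>\<^sub>B c, s)"
    if c: "c \<in> Arr B" and i: "(a, \<beta>, s) \<in> lan_idx P (Cod B c)" for c a \<beta> s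
    using BB.act_enc[OF e c imageI[OF i]] lan_act_cls[OF c] by simp
  let ?w = "transf C P (FO pb G) (\<lambda>a s. ?c (FO p a) (a, Ide B (FO p a), s))"
  have w: "?w \<in> CC.hom P (FO pb G)"
  proof (rule CC.transf_hom[OF P pb_psh[OF Gp]])
    fix a s assume a: "a \<in> Obj C" and s: "s \<in> val P a"
    then show "?c (FO p a) (a, Ide B (FO p a), s) \<in> val (FO pb G) a" using cv[of "FO p a" "(a, Ide B (FO p a), s)"] by simp
  next
    fix f s assume f: "f \<in> Arr C" and s: "s \<in> val P (Cod C f)"
    have "lan_eq P (FO p (Dom C f)) (Dom C f, Ide B (FO p (Dom C f)), act P f s) (Cod C f, FA p f, s)"
      using lan_eq_step[OF f _ _ _ s P, of "Ide B (FO p (Dom C f))"] f BB.comp_Ide(2)[of "FA p f"] by simp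
    then have "lan_cls P (FO p (Dom C f)) (Cod C f, FA p f, s) = lan_cls P (FO p (Dom C f)) (Dom C f, Ide B (FO p (Dom C f)), act P f s)"
      using lan_cls_eq by metis
    then show "act (FO pb G) f (?c (FO p (Cod C f)) (Cod C f, Ide B (FO p (Cod C f)), s)) =
        ?c (FO p (Dom C f)) (Dom C f, Ide B (FO p (Dom C f)), act P f s)"
      using act_c[of "FA p f" "Cod C f" "Ide B (FO p (Cod C f))" s] f s BB.comp_Ide(1)[of "FA p f"] by simp
  qed
  have wc: "act G \<beta> (cmpt ?w a s) = ?c b (a, \<beta>, s)" if i: "(a, \<beta>, s) \<in> lan_idx P b" for a \<beta> s b
  proof -
    have \<beta>: "a \<in> Obj C" "\<beta> \<in> Arr B" "Dom B \<beta> = b" "Cod B \<beta> = FO p a" "s \<in> val P a" using i by auto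
    show ?thesis using act_c[OF \<beta>(2), of a "Ide B (FO p a)" s] \<beta> BB.comp_Ide(1)[OF \<beta>(2)] by simp
  qed
  have "is_lan P G ?w"
    unfolding is_lan_def
  proof (intro conjI ballI allI impI w Gp)
    fix b y assume b: "b \<in> Obj B" and y: "y \<in> val G b"
    obtain t where t: "t \<in> lan_idx P b" "d b y = lan_cls P b t" using BB.dec_in[OF e b y] by blast
    obtain a \<beta> s where tt: "t = (a, \<beta>, s)" by (cases t) auto
    have ti: "(a, \<beta>, s) \<in> lan_idx P b" using t(1) unfolding tt .
    have "y = ?c b (a, \<beta>, s)" using BB.enc_dec[OF e b y] unfolding t(2) tt by simp
    then have "y = act G \<beta> (cmpt ?w a s)" by (rule trans[OF _ wc[OF ti, symmetric]])
    then show "\<exists>a \<beta> s. (a, \<beta>, s) \<in> lan_idx P b \<and> y = act G \<beta> (cmpt ?w a s)" using ti by blast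
  next
    fix b a \<beta> s a' \<beta>' s' assume i: "(a, \<beta>, s) \<in> lan_idx P b" and i': "(a', \<beta>', s') \<in> lan_idx P b"
      and eq: "act G \<beta> (cmpt ?w a s) = act G \<beta>' (cmpt ?w a' s')"
    have b: "b \<in> Obj B" using i by auto
    have "d b (?c b (a, \<beta>, s)) = d b (?c b (a', \<beta>', s'))" using eq unfolding wc[OF i] wc[OF i'] by simp
    then show "lan_eq P b (a, \<beta>, s) (a', \<beta>', s')"
      using BB.dec_enc[OF e b imageI[OF i]] BB.dec_enc[OF e b imageI[OF i']] lan_cls_eq by simp
  qed
  then show ?thesis by blast
qed

lemma lan_eq_sound:
  assumes P: "CC.psh P" and H: "BB.psh H" and h: "h \<in> CC.hom P (FO pb H)"
    and eq: "lan_eq P b (a, \<beta>, s) (a', \<beta>', s')"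
  shows "act H \<beta> (cmpt h a s) = act H \<beta>' (cmpt h a' s')"
proof -
  define v where "v t = act H (fst (snd t)) (cmpt h (fst t) (snd (snd t)))" for t
  have st: "v t = v t'" if stp: "lan_step P b t t'" for t t'
  proof -
    obtain f \<beta> s where f: "f \<in> Arr C" "(Dom C f, \<beta>, act P f s) \<in> lan_idx P b" "s \<in> val P (Cod C f)"
      "t = (Dom C f, \<beta>, act P f s)" "t' = (Cod C f, FA p f \<odot>\<^sub>B \<beta>, s)"
      using stp unfolding lan_step_def by blast
    have hs: "cmpt h (Cod C f) s \<in> val H (FO p (Cod C f))" using cmpt_in[OF h, of "Cod C f" s] f by simp
    show ?thesis
      using f hs cmpt_act[OF h f(1,3), symmetric] BB.act_comp[OF H, of \<beta> "FA p f" "cmpt h (Cod C f) s"]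
      by (simp add: v_def)
  qed
  have "v (a, \<beta>, s) = v t'" if "lan_eq P b (a, \<beta>, s) t'" for t'
    using that by (induction rule: equivclp_induct) (use st in metis)+
  from this[OF eq] show ?thesis by (simp add: v_def)
qed

lemma lan_universal:
  assumes P: "CC.psh P" and lan: "is_lan P G w" and H: "BB.psh H" and h: "h \<in> CC.hom P (FO pb H)"
  shows "\<exists>!k. k \<in> BB.hom G H \<and> FA pb k \<odot>\<^bsub>Psh U C\<^esub> w = h"
proof -
  have w: "w \<in> CC.hom P (FO pb G)" and G: "BB.psh G"
    and surj: "\<And>b y. b \<in> Obj B \<Longrightarrow> y \<in> val G b \<Longrightarrow> \<exists>a \<beta> s. (a, \<beta>, s) \<in> lan_idx P b \<and> y = act G \<beta> (cmpt w a s)"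
    and inj: "\<And>b a \<beta> s a' \<beta>' s'. (a, \<beta>, s) \<in> lan_idx P b \<Longrightarrow> (a', \<beta>', s') \<in> lan_idx P b \<Longrightarrow>
      act G \<beta> (cmpt w a s) = act G \<beta>' (cmpt w a' s') \<Longrightarrow> lan_eq P b (a, \<beta>, s) (a', \<beta>', s')"
    using lan unfolding is_lan_def by blast+
  define k where "k b y = (THE z. \<exists>a \<beta> s. (a, \<beta>, s) \<in> lan_idx P b \<and> y = act G \<beta> (cmpt w a s) \<and> z = act H \<beta> (cmpt h a s))" for b y
  have k: "k b (act G \<beta> (cmpt w a s)) = act H \<beta> (cmpt h a s)" if i: "(a, \<beta>, s) \<in> lan_idx P b" for a \<beta> s b
    unfolding k_def
  proof (rule the_equality)
    show "\<exists>a' \<beta>' s'. (a', \<beta>', s') \<in> lan_idx P b \<and> act G \<beta> (cmpt w a s) = act G \<beta>' (cmpt w a' s') \<and>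
      act H \<beta> (cmpt h a s) = act H \<beta>' (cmpt h a' s')" using i by blast
    fix z assume "\<exists>a' \<beta>' s'. (a', \<beta>', s') \<in> lan_idx P b \<and> act G \<beta> (cmpt w a s) = act G \<beta>' (cmpt w a' s') \<and>
      z = act H \<beta>' (cmpt h a' s')"
    then show "z = act H \<beta> (cmpt h a s)" using lan_eq_sound[OF P H h inj[OF i]] by metis
  qed
  have wv: "cmpt w a s \<in> val G (FO p a)" "cmpt h a s \<in> val H (FO p a)" if "a \<in> Obj C" "s \<in> val P a" for a s
    using cmpt_in[OF w that] cmpt_in[OF h that] that by auto
  have kh: "transf B G H k \<in> BB.hom G H"
  proof (rule BB.transf_hom[OF G H])
    fix b y assume b: "b \<in> Obj B" and y: "y \<in> val G b"
    obtain a \<beta> s where i: "(a, \<beta>, s) \<in> lan_idx P b" "y = act G \<beta> (cmpt w a s)" using surj[OF b y] by blast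
    then show "k b y \<in> val H b" using k[OF i(1)] BB.act_in'[OF H, of \<beta> "FO p a"] wv by auto
  next
    fix c y assume c: "c \<in> Arr B" and y: "y \<in> val G (Cod B c)"
    obtain a \<beta> s where i: "(a, \<beta>, s) \<in> lan_idx P (Cod B c)" "y = act G \<beta> (cmpt w a s)" using surj[OF _ y] c by auto
    have i': "(a, \<beta> \<odot>\<^sub>B c, s) \<in> lan_idx P (Dom B c)" using i c by simp
    have "act G c y = act G (\<beta> \<odot>\<^sub>B c) (cmpt w a s)"
      using BB.act_comp[OF G c, of \<beta> "cmpt w a s"] i wv by simp
    moreover have "act H c (act H \<beta> (cmpt h a s)) = act H (\<beta> \<odot>\<^sub>B c) (cmpt h a s)"
      using BB.act_comp[OF H c, of \<beta> "cmpt h a s"] i wv by simp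
    ultimately show "act H c (k (Cod B c) y) = k (Dom B c) (act G c y)" using k[OF i(1)] k[OF i'] i by simp
  qed
  show ?thesis
  proof (rule ex1I[where a="transf B G H k"])
    have "FA pb (transf B G H k) \<odot>\<^bsub>Psh U C\<^esub> w = h"
    proof (rule Hom_Psh_eqI[OF CC.comp_hom[OF w pb_hom[OF kh]] h])
      fix a s assume a: "a \<in> Obj C" and s: "s \<in> val P a"
      have i: "(a, Ide B (FO p a), s) \<in> lan_idx P (FO p a)" using a s by simp
      show "cmpt (FA pb (transf B G H k) \<odot>\<^bsub>Psh U C\<^esub> w) a s = cmpt h a s"
        using k[OF i] a s wv[OF a s] G H by (simp add: CC.hom_src[OF w])
    qed
    then show "transf B G H k \<in> BB.hom G H \<and> FA pb (transf B G H k) \<odot>\<^bsub>Psh U C\<^esub> w = h" using kh by simp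
  next
    fix l assume l: "l \<in> BB.hom G H \<and> FA pb l \<odot>\<^bsub>Psh U C\<^esub> w = h"
    then have lh: "l \<in> BB.hom G H" by simp
    show "l = transf B G H k"
    proof (rule Hom_Psh_eqI[OF lh kh])
      fix b y assume b: "b \<in> Obj B" and y: "y \<in> val G b"
      obtain a \<beta> s where i: "(a, \<beta>, s) \<in> lan_idx P b" "y = act G \<beta> (cmpt w a s)" using surj[OF b y] by blast
      have "cmpt l (FO p a) (cmpt w a s) = cmpt h a s"
        using cmpt_comp_eq[of U C "FA pb l" w h a s] l i by (simp add: CC.hom_src[OF w])
      then have "cmpt l b y = act H \<beta> (cmpt h a s)"
        using cmpt_act[OF lh, of \<beta> "cmpt w a s"] i wv by simp
      then show "cmpt l b y = cmpt (transf B G H k) b y" using k[OF i(1)] i b y by simp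
    qed
  qed
qed

text \<open>The sheafified Kan extension, which is the value of the left adjoint between sheaves: representatives exist
  locally, and are joined by zigzags locally.\<close>

definition is_local_lan :: "('b \<times> 'n set) set \<Rightarrow> ('o, 'm, 'u) presheaf \<Rightarrow> ('b, 'n, 'u) presheaf \<Rightarrow> ('o, 'm, 'u) nattrans \<Rightarrow> bool" where
  "is_local_lan J P F w \<longleftrightarrow> w \<in> CC.hom P (FO pb F) \<and> F \<in> sheaves U B J \<and>
    (\<forall>b \<in> Obj B. \<forall>y \<in> val F b. locally B J b (\<lambda>c. \<exists>a \<beta> s. (a, \<beta>, s) \<in> lan_idx P (Dom B c) \<and>
      act F c y = act F \<beta> (cmpt w a s))) \<and>
    (\<forall>b a \<beta> s a' \<beta>' s'. (a, \<beta>, s) \<in> lan_idx P b \<longrightarrow> (a', \<beta>', s') \<in> lan_idx P b \<longrightarrow>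
      act F \<beta> (cmpt w a s) = act F \<beta>' (cmpt w a' s') \<longrightarrow>
      locally B J b (\<lambda>c. lan_eq P (Dom B c) (a, \<beta> \<odot>\<^sub>B c, s) (a', \<beta>' \<odot>\<^sub>B c, s')))"

lemma local_lan_exists:
  assumes J: "is_topology B J" and P: "CC.psh P"
  shows "\<exists>F w. is_local_lan J P F w \<and> (\<forall>H h. H \<in> sheaves U B J \<longrightarrow> h \<in> CC.hom P (FO pb H) \<longrightarrow>
    (\<exists>!k. k \<in> BB.hom F H \<and> FA pb k \<odot>\<^bsub>Psh U C\<^esub> w = h))"
proof -
  interpret J: sheaf_site B U J using J by unfold_locales
  obtain G w where lan: "is_lan P G w" using lan_exists[OF P] by blast
  have w: "w \<in> CC.hom P (FO pb G)" and G: "BB.psh G"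
    and surj: "\<And>b y. b \<in> Obj B \<Longrightarrow> y \<in> val G b \<Longrightarrow> \<exists>a \<beta> s. (a, \<beta>, s) \<in> lan_idx P b \<and> y = act G \<beta> (cmpt w a s)"
    and inj: "\<And>b a \<beta> s a' \<beta>' s'. (a, \<beta>, s) \<in> lan_idx P b \<Longrightarrow> (a', \<beta>', s') \<in> lan_idx P b \<Longrightarrow>
      act G \<beta> (cmpt w a s) = act G \<beta>' (cmpt w a' s') \<Longrightarrow> lan_eq P b (a, \<beta>, s) (a', \<beta>', s')"
    using lan unfolding is_lan_def by blast+
  obtain v F where F: "F \<in> sheaves U B J" and v: "v \<in> BB.hom G F" and lb: "locally_bijective B J v"
    using J.sheafification_exists[OF G] by blast
  let ?w = "FA pb v \<odot>\<^bsub>Psh U C\<^esub> w"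
  have w': "?w \<in> CC.hom P (FO pb F)" using CC.comp_hom[OF w pb_hom[OF v]] .
  have wv: "cmpt w a s \<in> val G (FO p a)" if "a \<in> Obj C" "s \<in> val P a" for a s
    using cmpt_in[OF w that] that by auto
  have wc: "act F \<beta> (cmpt ?w a s) = cmpt v b (act G \<beta> (cmpt w a s))" if "(a, \<beta>, s) \<in> lan_idx P b" for a \<beta> s b
    using that cmpt_act[OF v, of \<beta> "cmpt w a s"] wv by (simp add: CC.hom_src[OF w])
  have "is_local_lan J P F ?w"
    unfolding is_local_lan_def
  proof (intro conjI ballI allI impI w' F)
    fix b y assume b: "b \<in> Obj B" and y: "y \<in> val F b"
    show "locally B J b (\<lambda>c. \<exists>a \<beta> s. (a, \<beta>, s) \<in> lan_idx P (Dom B c) \<and> act F c y = act F \<beta> (cmpt ?w a s))"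
    proof (rule J.locally_mono[OF J.locally_bijective_surj[OF lb v b y]])
      fix c assume c: "c \<in> Arr B" "Cod B c = b" and "\<exists>s\<in>val G (Dom B c). act F c y = cmpt v (Dom B c) s"
      then obtain z where z: "z \<in> val G (Dom B c)" "act F c y = cmpt v (Dom B c) z" by blast
      obtain a \<beta> s where "(a, \<beta>, s) \<in> lan_idx P (Dom B c)" "z = act G \<beta> (cmpt w a s)" using surj[OF _ z(1)] c by auto
      then show "\<exists>a \<beta> s. (a, \<beta>, s) \<in> lan_idx P (Dom B c) \<and> act F c y = act F \<beta> (cmpt ?w a s)" using wc z by metis
    qed
  next
    fix b a \<beta> s a' \<beta>' s' assume i: "(a, \<beta>, s) \<in> lan_idx P b" and i': "(a', \<beta>', s') \<in> lan_idx P b"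
      and eq: "act F \<beta> (cmpt ?w a s) = act F \<beta>' (cmpt ?w a' s')"
    have b: "b \<in> Obj B" using i by auto
    have g: "act G \<beta> (cmpt w a s) \<in> val G b" "act G \<beta>' (cmpt w a' s') \<in> val G b"
      using i i' wv BB.act_in'[OF G, of \<beta> "FO p a"] BB.act_in'[OF G, of \<beta>' "FO p a'"] by auto
    have loc: "locally B J b (\<lambda>c. act G c (act G \<beta> (cmpt w a s)) = act G c (act G \<beta>' (cmpt w a' s')))"
      by (rule J.locally_bijective_inj[OF lb v b g]) (use eq in \<open>simp only: wc[OF i] wc[OF i']\<close>)
    then show "locally B J b (\<lambda>c. lan_eq P (Dom B c) (a, \<beta> \<odot>\<^sub>B c, s) (a', \<beta>' \<odot>\<^sub>B c, s'))"
    proof (rule J.locally_mono)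
      fix c assume c: "c \<in> Arr B" "Cod B c = b" and "act G c (act G \<beta> (cmpt w a s)) = act G c (act G \<beta>' (cmpt w a' s'))"
      then have "act G (\<beta> \<odot>\<^sub>B c) (cmpt w a s) = act G (\<beta>' \<odot>\<^sub>B c) (cmpt w a' s')"
        using BB.act_comp[OF G c(1), of \<beta> "cmpt w a s"] BB.act_comp[OF G c(1), of \<beta>' "cmpt w a' s'"] i i' wv by simp
      then show "lan_eq P (Dom B c) (a, \<beta> \<odot>\<^sub>B c, s) (a', \<beta>' \<odot>\<^sub>B c, s')" using i i' c by (intro inj) auto
    qed
  qed
  moreover have "\<exists>!k. k \<in> BB.hom F H \<and> FA pb k \<odot>\<^bsub>Psh U C\<^esub> ?w = h"
    if H: "H \<in> sheaves U B J" and h: "h \<in> CC.hom P (FO pb H)" for H h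
  proof -
    interpret PC: category "Psh U C" by (rule CC.category_Psh)
    have assoc: "FA pb k \<odot>\<^bsub>Psh U C\<^esub> ?w = FA pb (k \<odot>\<^bsub>Psh U B\<^esub> v) \<odot>\<^bsub>Psh U C\<^esub> w" if k: "k \<in> BB.hom F H" for k
      using functor_comp[OF pb_functor v k] PC.Cmp_assoc[OF w pb_hom[OF v] pb_hom[OF k]] by simp
    obtain k0 where k0: "k0 \<in> BB.hom G H" "FA pb k0 \<odot>\<^bsub>Psh U C\<^esub> w = h"
      and k0u: "\<And>k. k \<in> BB.hom G H \<Longrightarrow> FA pb k \<odot>\<^bsub>Psh U C\<^esub> w = h \<Longrightarrow> k = k0"
      using lan_universal[OF P lan sheaf_presheaf[OF H] h] by blast
    obtain k where k: "k \<in> BB.hom F H" "k \<odot>\<^bsub>Psh U B\<^esub> v = k0"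
      and ku: "\<And>k'. k' \<in> BB.hom F H \<Longrightarrow> k' \<odot>\<^bsub>Psh U B\<^esub> v = k0 \<Longrightarrow> k' = k"
      using J.locally_bijective_extend[OF v lb H k0(1)] by blast
    show ?thesis
    proof (rule ex1I[where a=k])
      show "k \<in> BB.hom F H \<and> FA pb k \<odot>\<^bsub>Psh U C\<^esub> ?w = h" using k k0 assoc[OF k(1)] by simp
      fix k' assume k': "k' \<in> BB.hom F H \<and> FA pb k' \<odot>\<^bsub>Psh U C\<^esub> ?w = h"
      then have "k' \<odot>\<^bsub>Psh U B\<^esub> v = k0" using k0u[OF BB.comp_hom[OF v]] assoc[of k'] by simp
      then show "k' = k" using ku k' by simp
    qed
  qed
  ultimately show ?thesis by blast
qed

end

section \<open>The projection formula\<close>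

text \<open>\<open>N\<close> is the fibre product of \<open>X\<close> and \<open>p\<^sup>* E2\<close> over \<open>p\<^sup>* E1\<close>, and \<open>F0\<close>, \<open>FN\<close> are the values at \<open>X\<close>, \<open>N\<close> of the left adjoint of \<open>p\<^sup>*\<close>.
  The morphism \<open>m\<close> compares \<open>FN\<close> with the fibre product \<open>Q\<close> of \<open>F0\<close> and \<open>E2\<close> over \<open>E1\<close>.\<close>

locale projection = small_fibration C B U p
  for C :: "('o, 'm) cat" and B :: "('b, 'n) cat" and U :: "'u set" and p +
  fixes J X N E1 E2 F0 FN Q u v p1 p2 w0 wN wu q1 q2 m
  assumes J: "is_topology B J"
    and u: "u \<in> CC.hom X (FO pb E1)" and v: "v \<in> BB.hom E2 E1"
    and p1: "p1 \<in> CC.hom N X" and p2: "p2 \<in> CC.hom N (FO pb E2)" and pbC: "ptwise_pullback C u (FA pb v) p1 p2"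
    and lan0: "is_local_lan J X F0 w0" and lanN: "is_local_lan J N FN wN"
    and wu: "wu \<in> BB.hom F0 E1" and wu_w0: "FA pb wu \<odot>\<^bsub>Psh U C\<^esub> w0 = u"
    and q1: "q1 \<in> BB.hom Q F0" and q2: "q2 \<in> BB.hom Q E2" and pbB: "ptwise_pullback B wu v q1 q2"
    and Q: "Q \<in> sheaves U B J"
    and m: "m \<in> BB.hom FN Q"
    and m1: "FA pb (q1 \<odot>\<^bsub>Psh U B\<^esub> m) \<odot>\<^bsub>Psh U C\<^esub> wN = w0 \<odot>\<^bsub>Psh U C\<^esub> p1"
    and m2: "FA pb (q2 \<odot>\<^bsub>Psh U B\<^esub> m) \<odot>\<^bsub>Psh U C\<^esub> wN = p2"
begin

lemma psh_facts: "CC.psh X" "CC.psh N" "BB.psh E1" "BB.psh E2" "BB.psh F0" "BB.psh FN" "BB.psh Q"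
  using Hom_Psh_presheaf[OF p1] Hom_Psh_presheaf[OF v] Hom_Psh_presheaf[OF q1] Hom_Psh_presheaf[OF m] by auto

lemma w0: "w0 \<in> CC.hom X (FO pb F0)" and wN: "wN \<in> CC.hom N (FO pb FN)"
  using lan0 lanN by (auto simp: is_local_lan_def)

lemma val_facts:
  assumes "a \<in> Obj C"
  shows "s \<in> val X a \<Longrightarrow> cmpt u a s \<in> val E1 (FO p a)" "s \<in> val X a \<Longrightarrow> cmpt w0 a s \<in> val F0 (FO p a)"
    "t \<in> val N a \<Longrightarrow> cmpt p1 a t \<in> val X a" "t \<in> val N a \<Longrightarrow> cmpt p2 a t \<in> val E2 (FO p a)"
    "t \<in> val N a \<Longrightarrow> cmpt wN a t \<in> val FN (FO p a)"
  using cmpt_in[OF u assms] cmpt_in[OF w0 assms] cmpt_in[OF p1 assms] cmpt_in[OF p2 assms] cmpt_in[OF wN assms] assms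
  by auto

lemma nat_facts:
  assumes "f \<in> Arr C"
  shows "s \<in> val X (Cod C f) \<Longrightarrow> act E1 (FA p f) (cmpt u (Cod C f) s) = cmpt u (Dom C f) (act X f s)"
    "s \<in> val X (Cod C f) \<Longrightarrow> act F0 (FA p f) (cmpt w0 (Cod C f) s) = cmpt w0 (Dom C f) (act X f s)"
    "t \<in> val N (Cod C f) \<Longrightarrow> act X f (cmpt p1 (Cod C f) t) = cmpt p1 (Dom C f) (act N f t)"
    "t \<in> val N (Cod C f) \<Longrightarrow> act E2 (FA p f) (cmpt p2 (Cod C f) t) = cmpt p2 (Dom C f) (act N f t)"
    "t \<in> val N (Cod C f) \<Longrightarrow> act FN (FA p f) (cmpt wN (Cod C f) t) = cmpt wN (Dom C f) (act N f t)"
  using cmpt_act[OF u assms] cmpt_act[OF w0 assms] cmpt_act[OF p1 assms] cmpt_act[OF p2 assms] cmpt_act[OF wN assms] assms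
  by auto

lemma N_comm: "a \<in> Obj C \<Longrightarrow> t \<in> val N a \<Longrightarrow> cmpt u a (cmpt p1 a t) = cmpt v (FO p a) (cmpt p2 a t)"
  using pbC unfolding ptwise_pullback_def by (auto simp: CC.hom_src[OF p1])

lemma N_ex: "a \<in> Obj C \<Longrightarrow> s \<in> val X a \<Longrightarrow> e \<in> val E2 (FO p a) \<Longrightarrow> cmpt u a s = cmpt v (FO p a) e \<Longrightarrow>
    \<exists>!t. t \<in> val N a \<and> cmpt p1 a t = s \<and> cmpt p2 a t = e"
  using pbC unfolding ptwise_pullback_def by (auto simp: CC.hom_src[OF p1] CC.hom_src[OF u] BB.hom_src[OF v])

lemma N_eqI:
  assumes "a \<in> Obj C" "t \<in> val N a" "t' \<in> val N a" "cmpt p1 a t = cmpt p1 a t'" "cmpt p2 a t = cmpt p2 a t'"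
  shows "t = t'"
  using N_ex[OF assms(1) val_facts(3)[OF assms(1,3)] val_facts(4)[OF assms(1,3)] N_comm[OF assms(1,3)]] assms by metis

lemma Q_eqI:
  assumes "b \<in> Obj B" "t \<in> val Q b" "t' \<in> val Q b" "cmpt q1 b t = cmpt q1 b t'" "cmpt q2 b t = cmpt q2 b t'"
  shows "t = t'"
proof -
  have c: "cmpt wu b (cmpt q1 b t') = cmpt v b (cmpt q2 b t')"
    using pbB assms unfolding ptwise_pullback_def by (auto simp: BB.hom_src[OF q1])
  have "\<exists>!z. z \<in> val Q b \<and> cmpt q1 b z = cmpt q1 b t' \<and> cmpt q2 b z = cmpt q2 b t'"
    using pbB assms(1) c cmpt_in[OF q1 assms(1,3)] cmpt_in[OF q2 assms(1,3)] unfolding ptwise_pullback_def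
    by (simp add: BB.hom_src[OF q1] BB.hom_src[OF wu] BB.hom_src[OF v])
  then show ?thesis using assms by metis
qed

lemma m_comp:
  assumes "a \<in> Obj C" "t \<in> val N a"
  shows "cmpt q1 (FO p a) (cmpt m (FO p a) (cmpt wN a t)) = cmpt w0 a (cmpt p1 a t)"
    and "cmpt q2 (FO p a) (cmpt m (FO p a) (cmpt wN a t)) = cmpt p2 a t"
proof -
  have o: "FO p a \<in> Obj B" "cmpt wN a t \<in> val FN (FO p a)" using assms val_facts by auto
  show "cmpt q1 (FO p a) (cmpt m (FO p a) (cmpt wN a t)) = cmpt w0 a (cmpt p1 a t)"
    using cmpt_comp_eq[OF m1 assms(1), of t] assms o by (simp add: CC.hom_src[OF wN] CC.hom_src[OF p1] BB.hom_src[OF m])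
  show "cmpt q2 (FO p a) (cmpt m (FO p a) (cmpt wN a t)) = cmpt p2 a t"
    using cmpt_comp_eq[OF m2 assms(1), of t] assms o by (simp add: CC.hom_src[OF wN] BB.hom_src[OF m])
qed

text \<open>A triple \<open>(a, \<beta>, s)\<close> representing an element over \<open>b\<close>, together with an element \<open>e\<close> over \<open>b\<close>, is
  lifted to \<open>N\<close> by replacing \<open>\<beta>\<close> with an isomorphism, along which \<open>e\<close> can be transported.\<close>

definition lifted :: "'b \<Rightarrow> 'u \<Rightarrow> 'o \<times> 'n \<times> 'u \<Rightarrow> 'u \<Rightarrow> bool" where
  "lifted b e t z \<longleftrightarrow> (\<exists>x \<gamma> \<gamma>' n. x \<in> Arr C \<and> Cod C x = fst t \<and> \<gamma> \<in> Arr B \<and> Dom B \<gamma> = b \<and> Cod B \<gamma> = FO p (Dom C x) \<and>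
    \<gamma>' \<in> Arr B \<and> Dom B \<gamma>' = FO p (Dom C x) \<and> Cod B \<gamma>' = b \<and> \<gamma>' \<odot>\<^sub>B \<gamma> = Ide B b \<and> \<gamma> \<odot>\<^sub>B \<gamma>' = Ide B (FO p (Dom C x)) \<and>
    FA p x \<odot>\<^sub>B \<gamma> = fst (snd t) \<and> n \<in> val N (Dom C x) \<and> cmpt p1 (Dom C x) n = act X x (snd (snd t)) \<and>
    act E2 \<gamma> (cmpt p2 (Dom C x) n) = e \<and> z = act FN \<gamma> (cmpt wN (Dom C x) n))"

lemma liftedE:
  assumes "lifted b e (a, \<beta>, s) z"
  obtains x \<gamma> \<gamma>' n where "x \<in> Arr C" "Cod C x = a" "\<gamma> \<in> Arr B" "Dom B \<gamma> = b" "Cod B \<gamma> = FO p (Dom C x)"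
    "\<gamma>' \<in> Arr B" "Dom B \<gamma>' = FO p (Dom C x)" "Cod B \<gamma>' = b" "\<gamma>' \<odot>\<^sub>B \<gamma> = Ide B b"
    "\<gamma> \<odot>\<^sub>B \<gamma>' = Ide B (FO p (Dom C x))" "FA p x \<odot>\<^sub>B \<gamma> = \<beta>" "n \<in> val N (Dom C x)"
    "cmpt p1 (Dom C x) n = act X x s" "act E2 \<gamma> (cmpt p2 (Dom C x) n) = e" "z = act FN \<gamma> (cmpt wN (Dom C x) n)"
  using assms unfolding lifted_def fst_conv snd_conv by blast

lemma liftedI:
  assumes "x \<in> Arr C" "Cod C x = a" "\<gamma> \<in> Arr B" "Dom B \<gamma> = b" "Cod B \<gamma> = FO p (Dom C x)"
    "\<gamma>' \<in> Arr B" "Dom B \<gamma>' = FO p (Dom C x)" "Cod B \<gamma>' = b" "\<gamma>' \<odot>\<^sub>B \<gamma> = Ide B b"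
    "\<gamma> \<odot>\<^sub>B \<gamma>' = Ide B (FO p (Dom C x))" "FA p x \<odot>\<^sub>B \<gamma> = \<beta>" "n \<in> val N (Dom C x)"
    "cmpt p1 (Dom C x) n = act X x s" "act E2 \<gamma> (cmpt p2 (Dom C x) n) = e" "z = act FN \<gamma> (cmpt wN (Dom C x) n)"
  shows "lifted b e (a, \<beta>, s) z"
  unfolding lifted_def fst_conv snd_conv using assms by blast

lemma lifted_step:
  assumes l: "lifted b e (Dom C y, \<beta>, act X y s) z" and y: "y \<in> Arr C" and s: "s \<in> val X (Cod C y)"
  shows "lifted b e (Cod C y, FA p y \<odot>\<^sub>B \<beta>, s) z"
proof -
  obtain x \<gamma> \<gamma>' n where x: "x \<in> Arr C" "Cod C x = Dom C y" and g: "\<gamma> \<in> Arr B" "Dom B \<gamma> = b" "Cod B \<gamma> = FO p (Dom C x)"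
    "\<gamma>' \<in> Arr B" "Dom B \<gamma>' = FO p (Dom C x)" "Cod B \<gamma>' = b" "\<gamma>' \<odot>\<^sub>B \<gamma> = Ide B b"
    "\<gamma> \<odot>\<^sub>B \<gamma>' = Ide B (FO p (Dom C x))" and xg: "FA p x \<odot>\<^sub>B \<gamma> = \<beta>" and n: "n \<in> val N (Dom C x)"
    "cmpt p1 (Dom C x) n = act X x (act X y s)" "act E2 \<gamma> (cmpt p2 (Dom C x) n) = e" "z = act FN \<gamma> (cmpt wN (Dom C x) n)"
    using liftedE[OF l] by metis
  show ?thesis
  proof (rule liftedI[where x="y \<odot>\<^sub>C x" and \<gamma>=\<gamma> and \<gamma>'=\<gamma>' and n=n])
    have "FA p (y \<odot>\<^sub>C x) \<odot>\<^sub>B \<gamma> = FA p y \<odot>\<^sub>B (FA p x \<odot>\<^sub>B \<gamma>)" using x y g by simp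
    then show "FA p (y \<odot>\<^sub>C x) \<odot>\<^sub>B \<gamma> = FA p y \<odot>\<^sub>B \<beta>" unfolding xg .
    show "cmpt p1 (Dom C (y \<odot>\<^sub>C x)) n = act X (y \<odot>\<^sub>C x) s"
      using n(2) x y CC.act_comp[OF psh_facts(1) x(1) y x(2) s] by simp
  qed (use x y g n in auto)
qed

text \<open>A horizontal lifting of \<open>\<beta>\<close> provides a lift. Every other lift is a restriction of it, by the universal
  property of horizontal arrows, hence represents the same element.\<close>

lemma lifted_unique_exists:
  assumes i: "(a, \<beta>, s) \<in> lan_idx X b" and e: "e \<in> val E2 b"
    and compat: "act E1 \<beta> (cmpt u a s) = cmpt v b e"
  shows "\<exists>z0. lifted b e (a, \<beta>, s) z0 \<and> (\<forall>z. lifted b e (a, \<beta>, s) z \<longrightarrow> z = z0)"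
proof -
  have \<beta>: "a \<in> Obj C" "\<beta> \<in> Arr B" "Dom B \<beta> = b" "Cod B \<beta> = FO p a" and s: "s \<in> val X a" using i by auto
  obtain h where "horizontal_lifting C B p a \<beta> h" using lifting_exists[OF \<beta>(1,2,4)] by blast
  from horizontal_liftingD[OF this \<beta>(2)] obtain \<iota> \<kappa> where hh: "horizontal C B p h" and h: "h \<in> Arr C" "Cod C h = a"
    and \<iota>: "\<iota> \<in> Arr B" "Dom B \<iota> = FO p (Dom C h)" "Cod B \<iota> = Dom B \<beta>"
    and \<kappa>: "\<kappa> \<in> Arr B" "Dom B \<kappa> = Dom B \<beta>" "Cod B \<kappa> = FO p (Dom C h)"
    and ik: "\<iota> \<odot>\<^sub>B \<kappa> = Ide B (Dom B \<beta>)" "\<kappa> \<odot>\<^sub>B \<iota> = Ide B (FO p (Dom C h))"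
    and bi: "\<beta> \<odot>\<^sub>B \<iota> = FA p h" and hk: "FA p h \<odot>\<^sub>B \<kappa> = \<beta>" by blast
  note P = psh_facts
  have dh: "Dom C h \<in> Obj C" using h by simp
  have b: "b \<in> Obj B" using BB.Dom_Obj[OF \<beta>(2)] \<beta> by simp
  have hs: "act X h s \<in> val X (Dom C h)" using CC.act_in'[OF P(1) h s] .
  have eh: "act E2 \<iota> e \<in> val E2 (FO p (Dom C h))" using BB.act_in'[OF P(4) \<iota>(1), of b e] \<iota> \<beta> e by simp
  have us: "cmpt u a s \<in> val E1 (FO p a)" using val_facts(1)[OF \<beta>(1) s] .
  have "cmpt u (Dom C h) (act X h s) = act E1 (FA p h) (cmpt u a s)" using nat_facts(1)[OF h(1), of s] h s by simp
  also have "\<dots> = act E1 \<iota> (act E1 \<beta> (cmpt u a s))"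
    using BB.act_comp[OF P(3) \<iota>(1) \<beta>(2) \<iota>(3)] us \<beta> bi by simp
  also have "\<dots> = cmpt v (FO p (Dom C h)) (act E2 \<iota> e)"
    unfolding compat using cmpt_act[OF v \<iota>(1), of e] \<iota> \<beta> e by simp
  finally obtain nh where nh: "nh \<in> val N (Dom C h)" "cmpt p1 (Dom C h) nh = act X h s" "cmpt p2 (Dom C h) nh = act E2 \<iota> e"
    using N_ex[OF dh hs eh] by blast
  have "act E2 \<kappa> (cmpt p2 (Dom C h) nh) = e"
    unfolding nh(3) using BB.act_comp[OF P(4) \<kappa>(1) \<iota>(1), of e] \<kappa> \<iota> \<beta> e ik BB.act_Ide[OF P(4) b e] by simp
  then have "lifted b e (a, \<beta>, s) (act FN \<kappa> (cmpt wN (Dom C h) nh))"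
    using h \<kappa> \<iota> ik hk nh \<beta> by (intro liftedI[where x=h and \<gamma>=\<kappa> and \<gamma>'=\<iota> and n=nh]) auto
  moreover have "z = act FN \<kappa> (cmpt wN (Dom C h) nh)" if l: "lifted b e (a, \<beta>, s) z" for z
  proof -
    obtain x \<gamma> \<gamma>' n where x: "x \<in> Arr C" "Cod C x = a" and g: "\<gamma> \<in> Arr B" "Dom B \<gamma> = b" "Cod B \<gamma> = FO p (Dom C x)"
      "\<gamma>' \<in> Arr B" "Dom B \<gamma>' = FO p (Dom C x)" "Cod B \<gamma>' = b" and g1: "\<gamma>' \<odot>\<^sub>B \<gamma> = Ide B b"
      and g2: "\<gamma> \<odot>\<^sub>B \<gamma>' = Ide B (FO p (Dom C x))" and xg: "FA p x \<odot>\<^sub>B \<gamma> = \<beta>" and n: "n \<in> val N (Dom C x)"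
      "cmpt p1 (Dom C x) n = act X x s" "act E2 \<gamma> (cmpt p2 (Dom C x) n) = e" "z = act FN \<gamma> (cmpt wN (Dom C x) n)"
      using liftedE[OF l] by metis
    have dx: "Dom C x \<in> Obj C" using x by simp
    have "FA p x = FA p x \<odot>\<^sub>B (\<gamma> \<odot>\<^sub>B \<gamma>')" using g2 BB.comp_Ide(2)[of "FA p x"] x by simp
    also have "\<dots> = (FA p x \<odot>\<^sub>B \<gamma>) \<odot>\<^sub>B \<gamma>'" using x g by simp
    also have "\<dots> = (FA p h \<odot>\<^sub>B \<kappa>) \<odot>\<^sub>B \<gamma>'" using xg hk by simp
    also have "\<dots> = FA p h \<odot>\<^sub>B (\<kappa> \<odot>\<^sub>B \<gamma>')" using h \<kappa> g \<beta> by simp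
    finally obtain w where w: "w \<in> Arr C" "Dom C w = Dom C x" "Cod C w = Dom C h" "x = h \<odot>\<^sub>C w"
      and pw: "FA p w = \<kappa> \<odot>\<^sub>B \<gamma>'"
      using horizontal_factor[OF hh x(1), of "\<kappa> \<odot>\<^sub>B \<gamma>'"] x h \<kappa> g \<beta> by auto
    have wn: "act N w nh \<in> val N (Dom C x)" using CC.act_in'[OF P(2) w(1,3) nh(1)] w(2) by simp
    have "act X (h \<odot>\<^sub>C w) s = act X w (act X h s)"
      using CC.act_comp[OF P(1) w(1) h(1) w(3), of s] h s by simp
    then have p1n: "cmpt p1 (Dom C x) n = act X w (act X h s)" using n(2) unfolding w(4)[symmetric] by simp
    have "act N w nh = n"
    proof (rule N_eqI[OF dx wn n(1)])
      show "cmpt p1 (Dom C x) (act N w nh) = cmpt p1 (Dom C x) n"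
        using nat_facts(3)[OF w(1), of nh] w(1-3) nh p1n by simp
      have "cmpt p2 (Dom C x) (act N w nh) = act E2 (FA p w) (act E2 \<iota> e)"
        using nat_facts(4)[OF w(1), of nh] w(1-3) nh by simp
      also have "\<dots> = act E2 (\<iota> \<odot>\<^sub>B (\<kappa> \<odot>\<^sub>B \<gamma>')) e"
        unfolding pw using BB.act_comp[OF P(4), of "\<kappa> \<odot>\<^sub>B \<gamma>'" \<iota> e] \<kappa> \<iota> g \<beta> e by simp
      also have "\<iota> \<odot>\<^sub>B (\<kappa> \<odot>\<^sub>B \<gamma>') = (\<iota> \<odot>\<^sub>B \<kappa>) \<odot>\<^sub>B \<gamma>'" using \<kappa> \<iota> g \<beta> by simp
      also have "\<dots> = \<gamma>'" unfolding ik(1) using BB.comp_Ide(1)[OF g(4)] g \<beta> by simp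
      also have "act E2 \<gamma>' e = act E2 \<gamma>' (act E2 \<gamma> (cmpt p2 (Dom C x) n))" using n(3) by simp
      also have "\<dots> = cmpt p2 (Dom C x) n"
        using BB.act_comp[OF P(4) g(4,1), of "cmpt p2 (Dom C x) n"] g g2 val_facts(4)[OF dx n(1)] P(4) dx by simp
      finally show "cmpt p2 (Dom C x) (act N w nh) = cmpt p2 (Dom C x) n" .
    qed
    then have "cmpt wN (Dom C x) n = act FN (\<kappa> \<odot>\<^sub>B \<gamma>') (cmpt wN (Dom C h) nh)"
      using nat_facts(5)[OF w(1), of nh] w(1-3) nh pw by simp
    then have "z = act FN ((\<kappa> \<odot>\<^sub>B \<gamma>') \<odot>\<^sub>B \<gamma>) (cmpt wN (Dom C h) nh)"
      unfolding n(4) using BB.act_comp[OF P(6) g(1), of "\<kappa> \<odot>\<^sub>B \<gamma>'" "cmpt wN (Dom C h) nh"] \<kappa> g \<beta> val_facts(5)[OF dh nh(1)] by simp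
    also have "(\<kappa> \<odot>\<^sub>B \<gamma>') \<odot>\<^sub>B \<gamma> = \<kappa> \<odot>\<^sub>B (\<gamma>' \<odot>\<^sub>B \<gamma>)" using \<kappa> g \<beta> by simp
    also have "\<dots> = \<kappa>" unfolding g1 using BB.comp_Ide(2)[OF \<kappa>(1)] \<kappa> \<beta> by simp
    finally show ?thesis .
  qed
  ultimately show ?thesis by blast
qed

lemma lifted_compat:
  assumes i: "(a, \<beta>, s) \<in> lan_idx X b" and l: "lifted b e (a, \<beta>, s) z"
  shows "act E1 \<beta> (cmpt u a s) = cmpt v b e"
proof -
  have \<beta>: "a \<in> Obj C" and s: "s \<in> val X a" using i by auto
  obtain x \<gamma> \<gamma>' n where x: "x \<in> Arr C" "Cod C x = a" and g: "\<gamma> \<in> Arr B" "Dom B \<gamma> = b" "Cod B \<gamma> = FO p (Dom C x)"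
    and xg: "FA p x \<odot>\<^sub>B \<gamma> = \<beta>" and n: "n \<in> val N (Dom C x)"
    "cmpt p1 (Dom C x) n = act X x s" "act E2 \<gamma> (cmpt p2 (Dom C x) n) = e"
    using liftedE[OF l] by metis
  have dx: "Dom C x \<in> Obj C" using x by simp
  have "act E1 \<beta> (cmpt u a s) = act E1 \<gamma> (act E1 (FA p x) (cmpt u a s))"
    using BB.act_comp[OF psh_facts(3) g(1), of "FA p x" "cmpt u a s"] x g xg val_facts(1)[OF \<beta> s] by simp
  also have "\<dots> = act E1 \<gamma> (cmpt v (FO p (Dom C x)) (cmpt p2 (Dom C x) n))"
    using nat_facts(1)[OF x(1), of s] x s n N_comm[OF dx n(1)] by simp
  also have "\<dots> = cmpt v b e"
    using cmpt_act[OF v g(1), of "cmpt p2 (Dom C x) n"] g n val_facts(4)[OF dx n(1)] by simp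
  finally show ?thesis .
qed

text \<open>Along a zigzag the element \<open>z\<close> does not change. A forward step composes the arrow \<open>x\<close> of the lift; for a backward
  step, a lift exists by compatibility, and uniqueness of lifts identifies the elements.\<close>

lemma lifted_eq:
  assumes e: "e \<in> val E2 b" and i: "(a, \<beta>, s) \<in> lan_idx X b" and l: "lifted b e (a, \<beta>, s) z"
    and eq: "lan_eq X b (a, \<beta>, s) (a', \<beta>', s')"
  shows "lifted b e (a', \<beta>', s') z"
proof -
  have "t' \<in> lan_idx X b \<and> lifted b e t' z" if "lan_eq X b (a, \<beta>, s) t'" for t'
    using that
  proof (induction rule: equivclp_induct)
    case base show ?case using i l by blast
  next
    case (step t t')
    note t = step.IH
    show ?case
    proof (cases "lan_step X b t t'")
      case True
      then obtain f \<beta> s where f: "f \<in> Arr C" "(Dom C f, \<beta>, act X f s) \<in> lan_idx X b" "s \<in> val X (Cod C f)"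
        "t = (Dom C f, \<beta>, act X f s)" "t' = (Cod C f, FA p f \<odot>\<^sub>B \<beta>, s)" unfolding lan_step_def by blast
      then show ?thesis using lifted_step[of b e f \<beta> s z] t by simp
    next
      case False
      then have "lan_step X b t' t" using step.hyps by blast
      then obtain f \<beta> s where f: "f \<in> Arr C" "(Dom C f, \<beta>, act X f s) \<in> lan_idx X b" "s \<in> val X (Cod C f)"
        "t' = (Dom C f, \<beta>, act X f s)" "t = (Cod C f, FA p f \<odot>\<^sub>B \<beta>, s)" unfolding lan_step_def by blast
      have lt: "lifted b e (Cod C f, FA p f \<odot>\<^sub>B \<beta>, s) z" and it: "(Cod C f, FA p f \<odot>\<^sub>B \<beta>, s) \<in> lan_idx X b"
        using t f by auto
      have c: "act E1 (FA p f \<odot>\<^sub>B \<beta>) (cmpt u (Cod C f) s) = cmpt v b e" by (rule lifted_compat[OF it lt])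
      have "act E1 \<beta> (cmpt u (Dom C f) (act X f s)) = cmpt v b e"
        using c nat_facts(1)[OF f(1,3), symmetric] BB.act_comp[OF psh_facts(3), of \<beta> "FA p f" "cmpt u (Cod C f) s"] f
          val_facts(1)[of "Cod C f" s] by simp
      then obtain z' where z': "lifted b e (Dom C f, \<beta>, act X f s) z'"
        using lifted_unique_exists[OF f(2) e] by blast
      have "lifted b e (Cod C f, FA p f \<odot>\<^sub>B \<beta>, s) z'" by (rule lifted_step[OF z' f(1,3)])
      then have "z' = z" using lifted_unique_exists[OF it e c] lt by blast
      then show ?thesis using z' f by simp
    qed
  qed
  from this[OF eq] show ?thesis by blast
qed

lemma lifted_start:
  assumes i: "(a, \<beta>, n) \<in> lan_idx N b"
  shows "lifted b (act E2 \<beta> (cmpt p2 a n)) (a, \<beta>, cmpt p1 a n) (act FN \<beta> (cmpt wN a n))"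
proof -
  have \<beta>: "a \<in> Obj C" "\<beta> \<in> Arr B" "Dom B \<beta> = b" "Cod B \<beta> = FO p a" and n: "n \<in> val N a" using i by auto
  obtain h where "horizontal_lifting C B p a \<beta> h" using lifting_exists[OF \<beta>(1,2,4)] by blast
  from horizontal_liftingD[OF this \<beta>(2)] obtain \<iota> \<kappa> where h: "h \<in> Arr C" "Cod C h = a"
    and \<iota>: "\<iota> \<in> Arr B" "Dom B \<iota> = FO p (Dom C h)" "Cod B \<iota> = Dom B \<beta>"
    and \<kappa>: "\<kappa> \<in> Arr B" "Dom B \<kappa> = Dom B \<beta>" "Cod B \<kappa> = FO p (Dom C h)"
    and ik: "\<iota> \<odot>\<^sub>B \<kappa> = Ide B (Dom B \<beta>)" "\<kappa> \<odot>\<^sub>B \<iota> = Ide B (FO p (Dom C h))"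
    and hk: "FA p h \<odot>\<^sub>B \<kappa> = \<beta>" by blast
  note P = psh_facts
  show ?thesis
  proof (rule liftedI[where x=h and \<gamma>=\<kappa> and \<gamma>'=\<iota> and n="act N h n"])
    show "act N h n \<in> val N (Dom C h)" using CC.act_in'[OF P(2) h n] .
    show "cmpt p1 (Dom C h) (act N h n) = act X h (cmpt p1 a n)" using nat_facts(3)[OF h(1), of n] h n by simp
    show "act E2 \<kappa> (cmpt p2 (Dom C h) (act N h n)) = act E2 \<beta> (cmpt p2 a n)"
      using nat_facts(4)[OF h(1), of n, symmetric] h n BB.act_comp[OF P(4) \<kappa>(1), of "FA p h" "cmpt p2 a n"] \<kappa> hk val_facts(4)[OF \<beta>(1) n] by simp
    show "act FN \<beta> (cmpt wN a n) = act FN \<kappa> (cmpt wN (Dom C h) (act N h n))"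
      using nat_facts(5)[OF h(1), of n, symmetric] h n BB.act_comp[OF P(6) \<kappa>(1), of "FA p h" "cmpt wN a n"] \<kappa> hk val_facts(5)[OF \<beta>(1) n] by simp
  qed (use h \<iota> \<kappa> ik hk \<beta> in auto)
qed

text \<open>Injectivity of the comparison before sheafification.\<close>

lemma lan_determined:
  assumes i: "(a, \<beta>, n) \<in> lan_idx N b" and i': "(a', \<beta>', n') \<in> lan_idx N b"
    and eq: "lan_eq X b (a, \<beta>, cmpt p1 a n) (a', \<beta>', cmpt p1 a' n')"
    and e: "act E2 \<beta> (cmpt p2 a n) = act E2 \<beta>' (cmpt p2 a' n')"
  shows "act FN \<beta> (cmpt wN a n) = act FN \<beta>' (cmpt wN a' n')"
proof -
  let ?e = "act E2 \<beta> (cmpt p2 a n)"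
  have j: "(a, \<beta>, cmpt p1 a n) \<in> lan_idx X b" and j': "(a', \<beta>', cmpt p1 a' n') \<in> lan_idx X b" using i i' val_facts(3) by auto
  have ev: "?e \<in> val E2 b" using BB.act_in'[OF psh_facts(4), of \<beta> "FO p a"] i val_facts(4)[of a n] by auto
  have "lifted b ?e (a', \<beta>', cmpt p1 a' n') (act FN \<beta> (cmpt wN a n))"
    by (rule lifted_eq[OF ev j lifted_start[OF i] eq])
  moreover have l': "lifted b ?e (a', \<beta>', cmpt p1 a' n') (act FN \<beta>' (cmpt wN a' n'))"
    unfolding e by (rule lifted_start[OF i'])
  ultimately show ?thesis using lifted_unique_exists[OF j' ev lifted_compat[OF j' l']] by blast
qed

lemma m_value:
  assumes i: "(a, \<beta>, n) \<in> lan_idx N b"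
  shows "cmpt q1 b (cmpt m b (act FN \<beta> (cmpt wN a n))) = act F0 \<beta> (cmpt w0 a (cmpt p1 a n))"
    and "cmpt q2 b (cmpt m b (act FN \<beta> (cmpt wN a n))) = act E2 \<beta> (cmpt p2 a n)"
proof -
  have \<beta>: "a \<in> Obj C" "\<beta> \<in> Arr B" "Dom B \<beta> = b" "Cod B \<beta> = FO p a" and n: "n \<in> val N a" using i by auto
  have o: "FO p a \<in> Obj B" "cmpt wN a n \<in> val FN (FO p a)" using \<beta> n val_facts by auto
  have mv: "cmpt m (FO p a) (cmpt wN a n) \<in> val Q (FO p a)" using cmpt_in[OF m o] .
  show "cmpt q1 b (cmpt m b (act FN \<beta> (cmpt wN a n))) = act F0 \<beta> (cmpt w0 a (cmpt p1 a n))"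
    "cmpt q2 b (cmpt m b (act FN \<beta> (cmpt wN a n))) = act E2 \<beta> (cmpt p2 a n)"
    using cmpt_act[OF m \<beta>(2), of "cmpt wN a n"] cmpt_act[OF q1 \<beta>(2), of "cmpt m (FO p a) (cmpt wN a n)"]
      cmpt_act[OF q2 \<beta>(2), of "cmpt m (FO p a) (cmpt wN a n)"] m_comp[OF \<beta>(1) n] \<beta> o mv by auto
qed

text \<open>An element \<open>y\<close> of \<open>Q\<close> consists of an element of \<open>F0\<close>, locally represented by a triple, and an element of \<open>E2\<close>; the
  lift of the triple is a local preimage of \<open>y\<close>. Injectivity is local as well, and the preimages glue.\<close>

theorem projection_formula: "ptwise_bij B m"
proof -
  interpret J: sheaf_site B U J using J by unfold_locales
  have FN: "FN \<in> sheaves U B J" and F0: "F0 \<in> sheaves U B J" using lanN lan0 by (auto simp: is_local_lan_def)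
  have surjN: "locally B J b (\<lambda>c. \<exists>a \<beta> s. (a, \<beta>, s) \<in> lan_idx N (Dom B c) \<and> act FN c y = act FN \<beta> (cmpt wN a s))"
    if "b \<in> Obj B" "y \<in> val FN b" for b y using lanN that unfolding is_local_lan_def by blast
  have surj0: "locally B J b (\<lambda>c. \<exists>a \<beta> s. (a, \<beta>, s) \<in> lan_idx X (Dom B c) \<and> act F0 c y = act F0 \<beta> (cmpt w0 a s))"
    if "b \<in> Obj B" "y \<in> val F0 b" for b y using lan0 that unfolding is_local_lan_def by blast
  have inj0: "locally B J b (\<lambda>c. lan_eq X (Dom B c) (a, \<beta> \<odot>\<^sub>B c, s) (a', \<beta>' \<odot>\<^sub>B c, s'))"
    if "(a, \<beta>, s) \<in> lan_idx X b" "(a', \<beta>', s') \<in> lan_idx X b" "act F0 \<beta> (cmpt w0 a s) = act F0 \<beta>' (cmpt w0 a' s')"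
    for b a \<beta> s a' \<beta>' s' using lan0 that unfolding is_local_lan_def by blast
  note P = psh_facts
  have inj: "y = y'" if b: "b \<in> Obj B" and y: "y \<in> val FN b" and y': "y' \<in> val FN b" and eq: "cmpt m b y = cmpt m b y'" for b y y'
  proof (rule J.sheaf_separated[OF FN y y'])
    show "locally B J b (\<lambda>c. act FN c y = act FN c y')"
    proof (rule J.locally_trans[OF J.locally_conj[OF surjN[OF b y] surjN[OF b y']]])
      fix c assume c: "c \<in> Arr B" "Cod B c = b"
        and "(\<exists>a \<beta> s. (a, \<beta>, s) \<in> lan_idx N (Dom B c) \<and> act FN c y = act FN \<beta> (cmpt wN a s)) \<and>
          (\<exists>a \<beta> s. (a, \<beta>, s) \<in> lan_idx N (Dom B c) \<and> act FN c y' = act FN \<beta> (cmpt wN a s))"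
      then obtain a \<beta> n a' \<beta>' n' where i: "(a, \<beta>, n) \<in> lan_idx N (Dom B c)" "act FN c y = act FN \<beta> (cmpt wN a n)"
        and i': "(a', \<beta>', n') \<in> lan_idx N (Dom B c)" "act FN c y' = act FN \<beta>' (cmpt wN a' n')" by blast
      have j: "(a, \<beta>, cmpt p1 a n) \<in> lan_idx X (Dom B c)" and j': "(a', \<beta>', cmpt p1 a' n') \<in> lan_idx X (Dom B c)"
        using i i' val_facts(3) by auto
      have meq: "cmpt m (Dom B c) (act FN c y) = cmpt m (Dom B c) (act FN c y')"
        using cmpt_act[OF m c(1), of y] cmpt_act[OF m c(1), of y'] eq c y y' by simp
      have e: "act E2 \<beta> (cmpt p2 a n) = act E2 \<beta>' (cmpt p2 a' n')"
        and f: "act F0 \<beta> (cmpt w0 a (cmpt p1 a n)) = act F0 \<beta>' (cmpt w0 a' (cmpt p1 a' n'))"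
        using m_value[OF i(1)] m_value[OF i'(1)] meq unfolding i(2) i'(2) by simp_all
      show "locally B J (Dom B c) (\<lambda>g. act FN (c \<odot>\<^sub>B g) y = act FN (c \<odot>\<^sub>B g) y')"
      proof (rule J.locally_mono[OF inj0[OF j j' f]])
        fix g assume g: "g \<in> Arr B" "Cod B g = Dom B c"
          and le: "lan_eq X (Dom B g) (a, \<beta> \<odot>\<^sub>B g, cmpt p1 a n) (a', \<beta>' \<odot>\<^sub>B g, cmpt p1 a' n')"
        have k: "(a, \<beta> \<odot>\<^sub>B g, n) \<in> lan_idx N (Dom B g)" "(a', \<beta>' \<odot>\<^sub>B g, n') \<in> lan_idx N (Dom B g)" using i i' g by auto
        have ge: "act E2 (\<beta> \<odot>\<^sub>B g) (cmpt p2 a n) = act E2 (\<beta>' \<odot>\<^sub>B g) (cmpt p2 a' n')"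
          using e BB.act_comp[OF P(4) g(1), of \<beta> "cmpt p2 a n"] BB.act_comp[OF P(4) g(1), of \<beta>' "cmpt p2 a' n'"] i i' g val_facts(4)
          by simp
        have "act FN (\<beta> \<odot>\<^sub>B g) (cmpt wN a n) = act FN (\<beta>' \<odot>\<^sub>B g) (cmpt wN a' n')"
          by (rule lan_determined[OF k le ge])
        then have "act FN g (act FN c y) = act FN g (act FN c y')"
          unfolding i(2) i'(2)
          using BB.act_comp[OF P(6) g(1), of \<beta> "cmpt wN a n"] BB.act_comp[OF P(6) g(1), of \<beta>' "cmpt wN a' n'"] i i' g val_facts(5)
          by simp
        then show "act FN (c \<odot>\<^sub>B g) y = act FN (c \<odot>\<^sub>B g) y'"
          using BB.act_comp[OF P(6) g(1) c(1), of y] BB.act_comp[OF P(6) g(1) c(1), of y'] g c y y' by simp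
      qed
    qed
  qed
  have surj: "\<exists>z \<in> val FN b. cmpt m b z = y" if b: "b \<in> Obj B" and y: "y \<in> val Q b" for b y
  proof -
    define R where "R c z \<longleftrightarrow> z \<in> val FN (Dom B c) \<and> cmpt m (Dom B c) z = act Q c y" for c z
    have R_restr: "R (c \<odot>\<^sub>B g) (act FN g z)"
      if c: "c \<in> Arr B" "Cod B c = b" and R: "R c z" and g: "g \<in> Arr B" "Cod B g = Dom B c" for c g z
      using R c g y BB.act_in'[OF P(6) g, of z] cmpt_act[OF m g(1), of z] BB.act_comp[OF P(7) g(1) c(1) g(2), of y]
      unfolding R_def by simp
    have y1: "cmpt q1 b y \<in> val F0 b" and y2: "cmpt q2 b y \<in> val E2 b" using cmpt_in[OF q1 b y] cmpt_in[OF q2 b y] .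
    have loc: "locally B J b (\<lambda>c. \<exists>z. R c z)"
    proof (rule J.locally_mono[OF surj0[OF b y1]])
      fix c assume c: "c \<in> Arr B" "Cod B c = b"
        and "\<exists>a \<beta> s. (a, \<beta>, s) \<in> lan_idx X (Dom B c) \<and> act F0 c (cmpt q1 b y) = act F0 \<beta> (cmpt w0 a s)"
      then obtain a \<beta> s where i: "(a, \<beta>, s) \<in> lan_idx X (Dom B c)" and s0: "act F0 c (cmpt q1 b y) = act F0 \<beta> (cmpt w0 a s)" by blast
      have \<beta>: "a \<in> Obj C" "\<beta> \<in> Arr B" "Dom B \<beta> = Dom B c" "Cod B \<beta> = FO p a" and s: "s \<in> val X a" using i by auto
      have cy: "act Q c y \<in> val Q (Dom B c)" using BB.act_in'[OF P(7) c y] .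
      let ?e = "cmpt q2 (Dom B c) (act Q c y)"
      have dc: "Dom B c \<in> Obj B" using c by simp
      have e: "?e \<in> val E2 (Dom B c)" using cmpt_in[OF q2 dc cy] .
      have q1c: "cmpt q1 (Dom B c) (act Q c y) = act F0 \<beta> (cmpt w0 a s)"
        using cmpt_act[OF q1 c(1), of y] c y s0 by simp
      have wus: "cmpt wu (FO p a) (cmpt w0 a s) = cmpt u a s"
        using cmpt_comp_eq[OF wu_w0 \<beta>(1), of s] s \<beta> by (simp add: CC.hom_src[OF w0])
      have "act E1 \<beta> (cmpt u a s) = cmpt wu (Dom B c) (act F0 \<beta> (cmpt w0 a s))"
        using cmpt_act[OF wu \<beta>(2), of "cmpt w0 a s"] wus \<beta> val_facts(2)[OF \<beta>(1) s] by simp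
      also have "\<dots> = cmpt v (Dom B c) ?e"
        using pbB dc cy unfolding ptwise_pullback_def q1c[symmetric] by (auto simp: BB.hom_src[OF q1])
      finally obtain z where z: "lifted (Dom B c) ?e (a, \<beta>, s) z" using lifted_unique_exists[OF i e] by blast
      obtain x \<gamma> \<gamma>' n where x: "x \<in> Arr C" "Cod C x = a" and g: "\<gamma> \<in> Arr B" "Dom B \<gamma> = Dom B c" "Cod B \<gamma> = FO p (Dom C x)"
        and xg: "FA p x \<odot>\<^sub>B \<gamma> = \<beta>" and n: "n \<in> val N (Dom C x)"
        "cmpt p1 (Dom C x) n = act X x s" "act E2 \<gamma> (cmpt p2 (Dom C x) n) = ?e" "z = act FN \<gamma> (cmpt wN (Dom C x) n)"
        using liftedE[OF z] by metis
      have ix: "(Dom C x, \<gamma>, n) \<in> lan_idx N (Dom B c)" using x g n by simp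
      have zv: "z \<in> val FN (Dom B c)" using BB.act_in'[OF P(6) g(1), of _ "cmpt wN (Dom C x) n"] g n val_facts(5)[of "Dom C x" n] x by simp
      have mz: "cmpt m (Dom B c) z \<in> val Q (Dom B c)" using cmpt_in[OF m dc zv] .
      have "cmpt m (Dom B c) z = act Q c y"
      proof (rule Q_eqI[OF dc mz cy])
        have "cmpt q1 (Dom B c) (cmpt m (Dom B c) z) = act F0 \<gamma> (act F0 (FA p x) (cmpt w0 a s))"
          using m_value(1)[OF ix] n nat_facts(2)[OF x(1), of s] x s by simp
        also have "\<dots> = act F0 \<beta> (cmpt w0 a s)"
          using BB.act_comp[OF P(5) g(1), of "FA p x" "cmpt w0 a s"] x g xg val_facts(2)[OF \<beta>(1) s] by simp
        finally show "cmpt q1 (Dom B c) (cmpt m (Dom B c) z) = cmpt q1 (Dom B c) (act Q c y)" using q1c by simp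
        show "cmpt q2 (Dom B c) (cmpt m (Dom B c) z) = cmpt q2 (Dom B c) (act Q c y)"
          using m_value(2)[OF ix] n by simp
      qed
      then show "\<exists>z. R c z" using zv unfolding R_def by blast
    qed
    have "\<exists>z \<in> val FN b. \<forall>f z'. f \<in> Arr B \<longrightarrow> Cod B f = b \<longrightarrow> R f z' \<longrightarrow> act FN f z = z'"
    proof (rule J.sheaf_local_description[OF FN loc])
      fix f z z' assume "f \<in> Arr B" "R f z" "R f z'"
      then show "z = z'" using inj[of "Dom B f" z z'] unfolding R_def by simp
    qed (use R_restr in \<open>auto simp: R_def\<close>)
    then obtain z where z: "z \<in> val FN b" and zR: "\<And>c z'. c \<in> Arr B \<Longrightarrow> Cod B c = b \<Longrightarrow> R c z' \<Longrightarrow> act FN c z = z'" by blast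
    have mz: "cmpt m b z \<in> val Q b" using cmpt_in[OF m b z] .
    have "cmpt m b z = y"
    proof (rule J.sheaf_separated[OF Q mz y])
      show "locally B J b (\<lambda>c. act Q c (cmpt m b z) = act Q c y)"
      proof (rule J.locally_mono[OF loc])
        fix c assume c: "c \<in> Arr B" "Cod B c = b" and "\<exists>z. R c z"
        then obtain z' where z': "R c z'" by blast
        then show "act Q c (cmpt m b z) = act Q c y"
          using zR[OF c z'] cmpt_act[OF m c(1), of z] c z unfolding R_def by simp
      qed
    qed
    then show ?thesis using z by blast
  qed
  show ?thesis
    unfolding ptwise_bij_def BB.hom_src[OF m] bij_betw_def
  proof (intro ballI conjI)
    fix b assume b: "b \<in> Obj B"
    show "inj_on (cmpt m b) (val FN b)" by (rule inj_onI) (rule inj[OF b])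
    show "cmpt m b ` val FN b = val Q b"
    proof
      show "cmpt m b ` val FN b \<subseteq> val Q b" using cmpt_in[OF m b] by blast
      show "val Q b \<subseteq> cmpt m b ` val FN b" using surj[OF b] by (metis image_eqI subsetI)
    qed
  qed
qed

end

section \<open>Local connectedness\<close>

lemma adjunction_full_subcat:
  assumes adj: "adjunction D E L R \<eta> \<epsilon>" and L: "FO L ` S \<subseteq> T" and R: "FO R ` T \<subseteq> S"
  shows "adjunction (full_subcat D S) (full_subcat E T) L R \<eta> \<epsilon>"
proof -
  have LS: "FO L a \<in> T" if "a \<in> S" for a using L that by blast
  have RT: "FO R b \<in> S" if "b \<in> T" for b using R that by blast
  show ?thesis
    using adj unfolding adjunction_def natural_def is_functor_def Hom_full_subcat
    by (simp add: LS RT Hom_full_subcat id_functor_def comp_functor_def)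
qed

context small_fibration
begin

text \<open>The value of the left adjoint at each sheaf is given by \<open>local_lan_exists\<close>. In the canonical morphism to the fibre
  product, \<open>\<epsilon> \<odot> L u\<close> is the transpose of \<open>u\<close>, so that the data are those of the projection formula.\<close>

theorem locally_connected_Sh:
  assumes J: "is_topology B J"
    and f: "inv_im f = pb" and geo: "geometric_morphism (Sh U C (giraud_topology C B p J)) (Sh U B J) f"
  shows "locally_connected (Sh U C (giraud_topology C B p J)) (Sh U B J) f"
proof -
  interpret J: sheaf_site B U J using J by unfold_locales
  interpret G: sheaf_site C U "giraud_topology C B p J" using giraud_topology[OF J] by unfold_locales
  let ?E' = "Sh U C (giraud_topology C B p J)" and ?E = "Sh U B J"
  interpret E': category ?E' by (rule G.category_Sh)
  interpret E: category ?E by (rule J.category_Sh)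
  note R = pb_functor_Sh[OF J]
  have "\<forall>P. \<exists>F w. P \<in> Obj ?E' \<longrightarrow> is_local_lan J P F w \<and> (\<forall>H h. H \<in> sheaves U B J \<longrightarrow> h \<in> CC.hom P (FO pb H) \<longrightarrow>
    (\<exists>!k. k \<in> BB.hom F H \<and> FA pb k \<odot>\<^bsub>Psh U C\<^esub> w = h))"
    using local_lan_exists[OF J] sheaf_presheaf by (metis G.Sh_simps(1))
  then obtain F \<eta> where lan: "\<And>P. P \<in> Obj ?E' \<Longrightarrow> is_local_lan J P (F P) (\<eta> P)"
    and univ: "\<And>P H h. P \<in> Obj ?E' \<Longrightarrow> H \<in> sheaves U B J \<Longrightarrow> h \<in> CC.hom P (FO pb H) \<Longrightarrow>
      \<exists>!k. k \<in> BB.hom (F P) H \<and> FA pb k \<odot>\<^bsub>Psh U C\<^esub> \<eta> P = h" by metis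
  have F: "F P \<in> sheaves U B J" and \<eta>h: "\<eta> P \<in> CC.hom P (FO pb (F P))" if "P \<in> Obj ?E'" for P
    using lan[OF that] by (auto simp: is_local_lan_def)
  have "\<exists>L \<epsilon>. FO L = F \<and> adjunction ?E' ?E L pb \<eta> \<epsilon>"
  proof (rule universal_arrows_left_adjoint[OF G.category_Sh J.category_Sh R])
    fix P assume P: "P \<in> Obj ?E'"
    show "F P \<in> Obj ?E" using F[OF P] by simp
    show "\<eta> P \<in> Hom ?E' P (FO pb (F P))" using \<eta>h[OF P] P pb_sheaf[OF J F[OF P]] by (simp add: G.Hom_Sh)
    fix H h assume "H \<in> Obj ?E" "h \<in> Hom ?E' P (FO pb H)"
    then show "\<exists>!k. k \<in> Hom ?E (F P) H \<and> FA pb k \<odot>\<^bsub>?E'\<^esub> \<eta> P = h"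
      using univ[OF P, of H h] F[OF P] by (simp add: G.Hom_Sh J.Hom_Sh)
  qed
  then obtain L \<epsilon> where FL: "FO L = F" and adj: "adjunction ?E' ?E L pb \<eta> \<epsilon>" by blast
  have L: "is_functor ?E' ?E L"
    and \<eta>: "\<And>P. P \<in> Obj ?E' \<Longrightarrow> \<eta> P \<in> Hom ?E' P (FO pb (FO L P))"
    and nat: "\<And>k P Q. k \<in> Hom ?E' P Q \<Longrightarrow> FA pb (FA L k) \<odot>\<^bsub>Psh U C\<^esub> \<eta> P = \<eta> Q \<odot>\<^bsub>Psh U C\<^esub> k"
    and \<epsilon>: "\<And>H. H \<in> Obj ?E \<Longrightarrow> \<epsilon> H \<in> Hom ?E (FO L (FO pb H)) H"
    and tri: "\<And>H. H \<in> Obj ?E \<Longrightarrow> FA pb (\<epsilon> H) \<odot>\<^bsub>Psh U C\<^esub> \<eta> (FO pb H) = Ide (Psh U C) (FO pb H)"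
    using adj by (auto simp: adjunction_def natural_def id_functor_def comp_functor_def Hom_def simp del: Psh_simps)
  have transpose: "FA pb (\<epsilon> H \<odot>\<^bsub>Psh U B\<^esub> FA L k) \<odot>\<^bsub>Psh U C\<^esub> \<eta> P = k"
    if k: "k \<in> Hom ?E' P (FO pb H)" and H: "H \<in> Obj ?E" for k P H
  proof -
    have P: "P \<in> Obj ?E'" "FO pb H \<in> Obj ?E'" using E'.Hom_Obj[OF k] by auto
    note Lk = functor_Hom[OF L k]
    have "FA pb (\<epsilon> H \<odot>\<^bsub>Psh U B\<^esub> FA L k) \<odot>\<^bsub>Psh U C\<^esub> \<eta> P = FA pb (\<epsilon> H) \<odot>\<^bsub>Psh U C\<^esub> (FA pb (FA L k) \<odot>\<^bsub>Psh U C\<^esub> \<eta> P)"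
      using functor_comp[OF R Lk \<epsilon>[OF H]] E'.Cmp_assoc[OF \<eta>[OF P(1)] functor_Hom[OF R Lk] functor_Hom[OF R \<epsilon>[OF H]]] by simp
    also have "\<dots> = (FA pb (\<epsilon> H) \<odot>\<^bsub>Psh U C\<^esub> \<eta> (FO pb H)) \<odot>\<^bsub>Psh U C\<^esub> k"
      using nat[OF k] E'.Cmp_assoc[OF k \<eta>[OF P(2)] functor_Hom[OF R \<epsilon>[OF H]]] by simp
    also have "\<dots> = k" unfolding tri[OF H] using E'.Ide_left[OF k] by simp
    finally show ?thesis .
  qed
  have "is_iso ?E m"
    if u: "u \<in> Arr ?E'" and v: "v \<in> Arr ?E" and uv: "Cod ?E' u = FO pb (Cod ?E v)"
      and pbC: "is_pullback ?E' u (FA pb v) P p1 p2"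
      and pbB: "is_pullback ?E (\<epsilon> (Cod ?E v) \<odot>\<^bsub>?E\<^esub> FA L u) v Q q1 q2"
      and m: "m \<in> Hom ?E (FO L P) Q"
      and m1: "q1 \<odot>\<^bsub>?E\<^esub> m = FA L p1" and m2: "q2 \<odot>\<^bsub>?E\<^esub> m = \<epsilon> (Dom ?E v) \<odot>\<^bsub>?E\<^esub> FA L p2"
    for u v P p1 p2 Q q1 q2 m
  proof -
    define X E1 E2 where "X = src u" and "E1 = tgt v" and "E2 = src v"
    have uH: "u \<in> Hom ?E' X (FO pb E1)" using u uv by (auto simp: G.Arr_Sh G.Hom_Sh X_def E1_def)
    have vH: "v \<in> Hom ?E E2 E1" using v by (auto simp: J.Arr_Sh J.Hom_Sh E1_def E2_def)
    have O: "X \<in> Obj ?E'" "E1 \<in> Obj ?E" "E2 \<in> Obj ?E" using E'.Hom_Obj[OF uH] E.Hom_Obj[OF vH] by auto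
    have u': "u \<in> CC.hom X (FO pb E1)" and v': "v \<in> BB.hom E2 E1" using uH vH by (auto simp: G.Hom_Sh J.Hom_Sh)
    note pC = pbC[unfolded G.pullback_Sh_iff[OF uH functor_Hom[OF R vH]]]
    have P: "P \<in> Obj ?E'" using pC by simp
    have p1H: "p1 \<in> Hom ?E' P X" and p2H: "p2 \<in> Hom ?E' P (FO pb E2)"
      using pC O functor_Obj[OF R O(3)] by (auto simp: G.Hom_Sh)
    let ?wu = "\<epsilon> E1 \<odot>\<^bsub>Psh U B\<^esub> FA L u"
    have wuH: "?wu \<in> Hom ?E (FO L X) E1" using E.Cmp_in[OF functor_Hom[OF L uH] \<epsilon>[OF O(2)]] by simp
    have pbB': "is_pullback ?E ?wu v Q q1 q2" using pbB by (simp add: E1_def)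
    note pB = pbB'[unfolded J.pullback_Sh_iff[OF wuH vH]]
    have m': "m \<in> BB.hom (FO L P) Q" using m by (simp add: J.Hom_Sh)
    interpret proj: projection C B U p J X P E1 E2 "FO L X" "FO L P" Q u v p1 p2 "\<eta> X" "\<eta> P" ?wu q1 q2 m
    proof unfold_locales
      show "is_local_lan J X (FO L X) (\<eta> X)" "is_local_lan J P (FO L P) (\<eta> P)" using lan[OF O(1)] lan[OF P] by (simp_all add: FL)
      show "FA pb ?wu \<odot>\<^bsub>Psh U C\<^esub> \<eta> X = u" by (rule transpose[OF uH O(2)])
      show "FA pb (q1 \<odot>\<^bsub>Psh U B\<^esub> m) \<odot>\<^bsub>Psh U C\<^esub> \<eta> P = \<eta> X \<odot>\<^bsub>Psh U C\<^esub> p1" using m1 nat[OF p1H] by simp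
      show "FA pb (q2 \<odot>\<^bsub>Psh U B\<^esub> m) \<odot>\<^bsub>Psh U C\<^esub> \<eta> P = p2" using m2 transpose[OF p2H O(3)] by (simp add: E2_def)
      show "?wu \<in> BB.hom (FO L X) E1" using wuH by (simp add: J.Hom_Sh)
    qed (use J u' v' pC pB m' in auto)
    show ?thesis using J.iso_Sh_iff[OF m] proj.projection_formula by simp
  qed
  then show ?thesis unfolding locally_connected_def f using geo adj by blast
qed

lemma pb_left_exact_Psh: "left_exact (Psh U B) (Psh U C) pb"
  using pb_left_exact[OF BB.min_topology] by (simp add: giraud_min BB.Sh_min CC.Sh_min)

lemma direct_image_exists:
  "\<exists>p_star. geometric_morphism (Psh U C) (Psh U B) \<lparr>inv_im = pb, dir_im = p_star\<rparr>"
  unfolding geometric_morphism_def using pb_left_exact_Psh ran_exists by auto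

text \<open>Both functors preserve sheaves, hence the adjunction restricts to full subcategories.\<close>

lemma restricted_geometric_morphism:
  assumes J: "is_topology B J" and f: "inv_im f = pb" and geo: "geometric_morphism (Psh U C) (Psh U B) f"
  shows "geometric_morphism (Sh U C (giraud_topology C B p J)) (Sh U B J) f"
proof -
  obtain \<eta> \<epsilon> where adj: "adjunction (Psh U B) (Psh U C) pb (dir_im f) \<eta> \<epsilon>"
    using geo f unfolding geometric_morphism_def by auto
  have R: "FO (dir_im f) ` sheaves U C (giraud_topology C B p J) \<subseteq> sheaves U B J"
    using direct_image_sheaves_iff[OF adj J giraud_topology[OF J]] by simp
  have "FO pb ` sheaves U B J \<subseteq> sheaves U C (giraud_topology C B p J)" using pb_sheaf[OF J] by blast
  from adjunction_full_subcat[OF adj this R]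
  have "adjunction (Sh U B J) (Sh U C (giraud_topology C B p J)) pb (dir_im f) \<eta> \<epsilon>" unfolding Sh_def .
  then show ?thesis unfolding geometric_morphism_def f using pb_left_exact[OF J] by blast
qed

section \<open>Inverse, direct and extraordinary direct images of subtoposes\<close>

lemma giraud_mono: "J \<subseteq> T \<Longrightarrow> giraud_topology C B p J \<subseteq> giraud_topology C B p T"
  by (auto simp: giraud_topology_def)

text \<open>All subtoposes being classes of sheaves for topologies \<open>L\<close>, both inclusions in the definition of the inverse
  image say that the Giraud topology of \<open>T\<close> is contained in \<open>L\<close>.\<close>

lemma sheaves_inverse_image:
  assumes adj: "adjunction (Psh U B) (Psh U C) pb (dir_im f) \<eta> \<epsilon>"
    and J: "is_topology B J" and T: "is_topology B T" and JT: "J \<subseteq> T"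
  shows "is_inverse_image (Sh U C (giraud_topology C B p J)) (Sh U B J) f (sheaves U B T)
    (sheaves U C (giraud_topology C B p T))"
  unfolding is_inverse_image_def
proof (intro conjI ballI)
  note J' = giraud_topology[OF J] and T' = giraud_topology[OF T]
  show "sheaves U C (giraud_topology C B p T) \<in> ST (Sh U C (giraud_topology C B p J))"
    using CC.ST_Sh_iff[OF J'] T' giraud_mono[OF JT] by blast
  have ST: "sheaves U B T \<in> ST (Sh U B J)" using BB.ST_Sh_iff[OF J] T JT by blast
  fix S' assume "S' \<in> ST (Sh U C (giraud_topology C B p J))"
  then obtain L where L: "is_topology C L" "S' = sheaves U C L" using CC.ST_Sh_iff[OF J'] by blast
  interpret L: sheaf_site C U L using L(1) by unfold_locales
  have "S' \<subseteq> sheaves U C (giraud_topology C B p T) \<longleftrightarrow> giraud_topology C B p T \<subseteq> L"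
    unfolding L(2) by (rule L.topology_le_iff_sheaves[OF T'])
  also have "\<dots> \<longleftrightarrow> FO (dir_im f) ` S' \<subseteq> sheaves U B T"
    unfolding L(2) by (rule direct_image_sheaves_iff[OF adj T L(1), symmetric])
  also have "\<dots> \<longleftrightarrow> direct_image (Sh U B J) f S' \<subseteq> sheaves U B T"
    unfolding direct_image_def by (rule subset_hull[where S="\<lambda>T. T \<in> ST (Sh U B J)", OF ST, symmetric])
  finally show "S' \<subseteq> sheaves U C (giraud_topology C B p T) \<longleftrightarrow> direct_image (Sh U B J) f S' \<subseteq> sheaves U B T" .
qed

end

lemma inverse_image_eqI:
  assumes "is_inverse_image E' E f S S'" shows "inverse_image E' E f S = S'"
  unfolding inverse_image_def
proof (rule the_equality)
  show "is_inverse_image E' E f S S'" by (rule assms)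
next
  fix S'' assume "is_inverse_image E' E f S S''"
  then show "S'' = S'" using assms unfolding is_inverse_image_def by blast
qed

lemma ext_direct_image_eqI:
  assumes "is_ext_direct_image E' E f S' S" shows "ext_direct_image E' E f S' = S"
  unfolding ext_direct_image_def
proof (rule the_equality)
  show "is_ext_direct_image E' E f S' S" by (rule assms)
next
  fix T assume "is_ext_direct_image E' E f S' T"
  then show "T = S" using assms unfolding is_ext_direct_image_def by blast
qed

lemma (in plain_category) all_sieves_topology: "is_topology C {(a, S). is_sieve C a S}"
  unfolding is_topology_def using is_sieve_max is_sieve_pullback by auto

lemma is_topology_Inter:
  assumes ne: "\<K> \<noteq> {}" and top: "\<And>K. K \<in> \<K> \<Longrightarrow> is_topology C K" shows "is_topology C (\<Inter>\<K>)"
proof -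
  obtain K0 where K0: "K0 \<in> \<K>" using ne by blast
  have 1: "is_sieve C a S" if "(a, S) \<in> \<Inter>\<K>" for a S
    using that K0 top[OF K0] unfolding is_topology_def by blast
  have 2: "(a, {f \<in> Arr C. Cod C f = a}) \<in> \<Inter>\<K>" if "a \<in> Obj C" for a
    using that top unfolding is_topology_def by blast
  have 3: "(Dom C f, pullback_sieve C f S) \<in> \<Inter>\<K>" if S: "(a, S) \<in> \<Inter>\<K>" and f: "f \<in> Arr C" "Cod C f = a" for a S f
  proof
    fix K assume "K \<in> \<K>"
    then have "\<forall>(a, S)\<in>K. \<forall>f\<in>Arr C. Cod C f = a \<longrightarrow> (Dom C f, pullback_sieve C f S) \<in> K" "(a, S) \<in> K"
      using top S unfolding is_topology_def by auto
    then show "(Dom C f, pullback_sieve C f S) \<in> K" using f by blast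
  qed
  have 4: "(a, T) \<in> \<Inter>\<K>" if S: "(a, S) \<in> \<Inter>\<K>" and T: "is_sieve C a T" "\<forall>f \<in> S. (Dom C f, pullback_sieve C f T) \<in> \<Inter>\<K>" for a S T
  proof
    fix K assume K: "K \<in> \<K>"
    then have "\<forall>(a, S)\<in>K. \<forall>T. is_sieve C a T \<and> (\<forall>f\<in>S. (Dom C f, pullback_sieve C f T) \<in> K) \<longrightarrow> (a, T) \<in> K" "(a, S) \<in> K"
      using top S unfolding is_topology_def by auto
    then show "(a, T) \<in> K" using T K by blast
  qed
  show ?thesis
    unfolding is_topology_def
  proof (intro conjI)
    show "\<forall>(a, S)\<in>\<Inter>\<K>. is_sieve C a S" using 1 by (intro ballI) (clarify, blast)
    show "\<forall>a\<in>Obj C. (a, {f \<in> Arr C. Cod C f = a}) \<in> \<Inter>\<K>" using 2 by blast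
    show "\<forall>(a, S)\<in>\<Inter>\<K>. \<forall>f\<in>Arr C. Cod C f = a \<longrightarrow> (Dom C f, pullback_sieve C f S) \<in> \<Inter>\<K>"
      using 3 by (intro ballI) (clarify, blast)
    show "\<forall>(a, S)\<in>\<Inter>\<K>. \<forall>T. is_sieve C a T \<and> (\<forall>f\<in>S. (Dom C f, pullback_sieve C f T) \<in> \<Inter>\<K>) \<longrightarrow> (a, T) \<in> \<Inter>\<K>"
      using 4 by (intro ballI) (clarify, blast)
  qed
qed

lemma (in plain_category) generated_topology:
  assumes J: "is_topology C J" and G: "G \<subseteq> {(a, S). is_sieve C a S}"
  shows "is_topology C (generated_topology C J G)" "J \<subseteq> generated_topology C J G"
    "\<And>T. is_topology C T \<Longrightarrow> generated_topology C J G \<subseteq> T \<longleftrightarrow> J \<subseteq> T \<and> G \<subseteq> T"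
proof -
  have "\<And>a S. (a, S) \<in> J \<Longrightarrow> is_sieve C a S" using J unfolding is_topology_def by blast
  then have "J \<union> G \<subseteq> {(a, S). is_sieve C a S}" using G by auto
  then have "{t. is_topology C t \<and> J \<union> G \<subseteq> t} \<noteq> {}" using all_sieves_topology by blast
  then show "is_topology C (generated_topology C J G)"
    unfolding generated_topology_def hull_def by (rule is_topology_Inter) simp
  show "J \<subseteq> generated_topology C J G" unfolding generated_topology_def using hull_subset[of "J \<union> G"] by blast
  show "generated_topology C J G \<subseteq> T \<longleftrightarrow> J \<subseteq> T \<and> G \<subseteq> T" if "is_topology C T" for T
    unfolding generated_topology_def by (simp add: subset_hull[where S="is_topology C", OF that])
qed

context small_fibration
begin

text \<open>By definition of the Giraud topology, \<open>T\<close> contains \<open>(R i)\<^sub>p\<close> iff the Giraud topology of \<open>T\<close> contains \<open>R i\<close>. So the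
  universal properties of \<open>K\<close> and \<open>L\<close> correspond to each other.\<close>

lemma sheaves_ext_direct_image:
  assumes adj: "adjunction (Psh U B) (Psh U C) pb (dir_im f) \<eta> \<epsilon>"
    and J: "is_topology B J" and R: "\<And>i. i \<in> I \<Longrightarrow> is_sieve C (X i) (R i)"
    and L: "L = generated_topology C (giraud_topology C B p J) ((\<lambda>i. (X i, R i)) ` I)"
    and K: "K = generated_topology B J ((\<lambda>i. (FO p (X i), sieve_image C B p (X i) (R i))) ` I)"
  shows "is_topology C L" "is_topology B K" "giraud_topology C B p J \<subseteq> L" "J \<subseteq> K"
    "is_ext_direct_image (Sh U C (giraud_topology C B p J)) (Sh U B J) f (sheaves U C L) (sheaves U B K)"
proof -
  note J' = giraud_topology[OF J]
  have RI: "(\<lambda>i. (X i, R i)) ` I \<subseteq> {(a, S). is_sieve C a S}" using R by auto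
  have KI: "(\<lambda>i. (FO p (X i), sieve_image C B p (X i) (R i))) ` I \<subseteq> {(a, S). is_sieve B a S}"
    using R is_sieve_image by auto
  note gL = CC.generated_topology[OF J' RI, folded L] and gK = BB.generated_topology[OF J KI, folded K]
  show Lt: "is_topology C L" and Kt: "is_topology B K" and "giraud_topology C B p J \<subseteq> L" and JK: "J \<subseteq> K"
    using gL(1,2) gK(1,2) by auto
  have iff: "K \<subseteq> T \<longleftrightarrow> L \<subseteq> giraud_topology C B p T" if T: "is_topology B T" and JT: "J \<subseteq> T" for T
  proof -
    have "K \<subseteq> T \<longleftrightarrow> (\<forall>i \<in> I. (FO p (X i), sieve_image C B p (X i) (R i)) \<in> T)" using gK(3)[OF T] JT by auto
    also have "\<dots> \<longleftrightarrow> (\<forall>i \<in> I. (X i, R i) \<in> giraud_topology C B p T)" using R by (auto simp: giraud_topology_def)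
    also have "\<dots> \<longleftrightarrow> L \<subseteq> giraud_topology C B p T"
      using gL(3)[OF giraud_topology[OF T]] giraud_mono[OF JT] by auto
    finally show ?thesis .
  qed
  show "is_ext_direct_image (Sh U C (giraud_topology C B p J)) (Sh U B J) f (sheaves U C L) (sheaves U B K)"
    unfolding is_ext_direct_image_def
  proof (intro conjI ballI)
    show "sheaves U B K \<in> ST (Sh U B J)" using BB.ST_Sh_iff[OF J] Kt JK by blast
    fix S assume "S \<in> ST (Sh U B J)"
    then obtain T where T: "is_topology B T" "J \<subseteq> T" and S: "S = sheaves U B T" using BB.ST_Sh_iff[OF J] by blast
    interpret T: sheaf_site B U T using T(1) by unfold_locales
    interpret T': sheaf_site C U "giraud_topology C B p T" using giraud_topology[OF T(1)] by unfold_locales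
    have "inverse_image (Sh U C (giraud_topology C B p J)) (Sh U B J) f S = sheaves U C (giraud_topology C B p T)"
      unfolding S by (rule inverse_image_eqI[OF sheaves_inverse_image[OF adj J T]])
    then show "S \<subseteq> sheaves U B K \<longleftrightarrow> inverse_image (Sh U C (giraud_topology C B p J)) (Sh U B J) f S \<subseteq> sheaves U C L"
      using T.topology_le_iff_sheaves[OF Kt] T'.topology_le_iff_sheaves[OF Lt] iff[OF T] S by simp
  qed
qed

end

lemma adjoints_preserve_union_intersection:
  assumes g: "\<And>S. S \<in> ST E \<Longrightarrow> g S \<in> ST E'"
    and d: "\<And>S'. S' \<in> ST E' \<Longrightarrow> d S' \<in> ST E" "\<And>S' S. S' \<in> ST E' \<Longrightarrow> S \<in> ST E \<Longrightarrow> S' \<subseteq> g S \<longleftrightarrow> d S' \<subseteq> S"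
    and x: "\<And>S'. S' \<in> ST E' \<Longrightarrow> x S' \<in> ST E" "\<And>S' S. S' \<in> ST E' \<Longrightarrow> S \<in> ST E \<Longrightarrow> g S \<subseteq> S' \<longleftrightarrow> S \<subseteq> x S'"
    and \<S>: "\<S> \<subseteq> ST E"
  shows "is_union E \<S> V \<Longrightarrow> is_union E' (g ` \<S>) (g V)"
    and "is_intersection E \<S> V \<Longrightarrow> is_intersection E' (g ` \<S>) (g V)"
proof -
  have mono: "g S \<subseteq> g T" if "S \<in> ST E" "T \<in> ST E" "S \<subseteq> T" for S T
    using d(2)[OF g[OF that(1)] that(1)] d(2)[OF g[OF that(1)] that(2)] that by simp
  show "is_union E' (g ` \<S>) (g V)" if V: "is_union E \<S> V"
  proof -
    have VE: "V \<in> ST E" and up: "\<And>S. S \<in> \<S> \<Longrightarrow> S \<subseteq> V"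
      and least: "\<And>T. T \<in> ST E \<Longrightarrow> (\<And>S. S \<in> \<S> \<Longrightarrow> S \<subseteq> T) \<Longrightarrow> V \<subseteq> T" using V unfolding is_union_def by blast+
    have "g V \<subseteq> T'" if T': "T' \<in> ST E'" "\<And>S. S \<in> \<S> \<Longrightarrow> g S \<subseteq> T'" for T'
    proof -
      have "S \<subseteq> x T'" if S: "S \<in> \<S>" for S using x(2)[OF T'(1), of S] T'(2)[OF S] subsetD[OF \<S> S] by simp
      then show ?thesis using least[OF x(1)[OF T'(1)]] x(2)[OF T'(1) VE] by simp
    qed
    moreover have "g S \<subseteq> g V" if "S \<in> \<S>" for S using mono[OF _ VE up] \<S> that by blast
    ultimately show ?thesis unfolding is_union_def using g[OF VE] by simp
  qed
  show "is_intersection E' (g ` \<S>) (g V)" if V: "is_intersection E \<S> V"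
  proof -
    have VE: "V \<in> ST E" and lo: "\<And>S. S \<in> \<S> \<Longrightarrow> V \<subseteq> S"
      and greatest: "\<And>T. T \<in> ST E \<Longrightarrow> (\<And>S. S \<in> \<S> \<Longrightarrow> T \<subseteq> S) \<Longrightarrow> T \<subseteq> V" using V unfolding is_intersection_def by blast+
    have "T' \<subseteq> g V" if T': "T' \<in> ST E'" "\<And>S. S \<in> \<S> \<Longrightarrow> T' \<subseteq> g S" for T'
    proof -
      have "d T' \<subseteq> S" if S: "S \<in> \<S>" for S using d(2)[OF T'(1), of S] T'(2)[OF S] subsetD[OF \<S> S] by simp
      then show ?thesis using greatest[OF d(1)[OF T'(1)]] d(2)[OF T'(1) VE] by simp
    qed
    moreover have "g V \<subseteq> g S" if "S \<in> \<S>" for S using mono[OF VE _ lo] \<S> that by blast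
    ultimately show ?thesis unfolding is_intersection_def using g[OF VE] by simp
  qed
qed

text \<open>The union is the intersection of all upper bounds.\<close>

lemma (in sheaf_site) unions_intersections_exist:
  assumes \<S>: "\<S> \<subseteq> ST (Sh U C K)"
  shows "\<exists>V. is_union (Sh U C K) \<S> V" "\<exists>V. is_intersection (Sh U C K) \<S> V"
proof -
  have sub: "S \<subseteq> sheaves U C K" if "S \<in> ST (Sh U C K)" for S using that by (auto simp: ST_def)
  let ?T = "{T \<in> ST (Sh U C K). \<forall>S \<in> \<S>. S \<subseteq> T}"
  have "sheaves U C K \<inter> \<Inter>?T \<in> ST (Sh U C K)" by (rule ST_Inter[OF topology]) blast
  moreover have "S \<subseteq> sheaves U C K" if "S \<in> \<S>" for S using sub \<S> that by blast
  ultimately have "is_union (Sh U C K) \<S> (sheaves U C K \<inter> \<Inter>?T)" unfolding is_union_def by blast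
  then show "\<exists>V. is_union (Sh U C K) \<S> V" by blast
  have "is_intersection (Sh U C K) \<S> (sheaves U C K \<inter> \<Inter>\<S>)"
    unfolding is_intersection_def using ST_Inter[OF topology \<S>] sub by blast
  then show "\<exists>V. is_intersection (Sh U C K) \<S> V" by blast
qed

lemma (in sheaf_site) ST_hull:
  assumes A: "A \<subseteq> sheaves U C K" shows "(\<lambda>T. T \<in> ST (Sh U C K)) hull A \<in> ST (Sh U C K)"
proof -
  have "sheaves U C K \<in> ST (Sh U C K)" using ST_Sh_iff[OF topology] topology by blast
  then have "(\<lambda>T. T \<in> ST (Sh U C K)) hull A = sheaves U C K \<inter> \<Inter>{T \<in> ST (Sh U C K). A \<subseteq> T}"
    using A unfolding hull_def by blast
  also have "\<dots> \<in> ST (Sh U C K)" by (rule ST_Inter[OF topology]) blast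
  finally show ?thesis .
qed

theorem mainTheorem20:
  fixes U :: "'u set"
    and C :: "('o, 'm) cat" and B :: "('b, 'n) cat"
    and p :: "('o, 'm, 'b, 'n) cat_functor"
    and J :: "('b \<times> 'n set) set"
  assumes "universe U"
    and "category C" and "category B"
    and "essentially_small U C" and "essentially_small U B"
    and "is_fibration C B p"
    and "is_topology B J"
  shows "let J' = giraud_topology C B p J; E' = Sh U C J'; E = Sh U B J in
    (\<exists>p_star. geometric_morphism (Psh U C) (Psh U B)
        \<lparr>inv_im = pullback_functor C p, dir_im = p_star\<rparr>) \<and>
    (\<forall>f. inv_im f = pullback_functor C p \<and> geometric_morphism (Psh U C) (Psh U B) f \<longrightarrow>
      locally_connected (Psh U C) (Psh U B) f \<and>
      is_topology C J' \<and>
      sheaves U B J \<in> ST (Psh U B) \<and>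
      is_inverse_image (Psh U C) (Psh U B) f (sheaves U B J) (sheaves U C J') \<and>

      locally_connected E' E f \<and>

      (\<forall>S \<in> ST E. is_inverse_image E' E f S (inverse_image E' E f S)) \<and>
      (\<forall>\<S> \<subseteq> ST E.
        (\<exists>V. is_union E \<S> V) \<and> (\<exists>V. is_intersection E \<S> V) \<and>
        (\<forall>V. is_union E \<S> V \<longrightarrow>
          is_union E' (inverse_image E' E f ` \<S>) (inverse_image E' E f V)) \<and>
        (\<forall>V. is_intersection E \<S> V \<longrightarrow>
          is_intersection E' (inverse_image E' E f ` \<S>) (inverse_image E' E f V))) \<and>
      (\<forall>S' \<in> ST E'. direct_image E f S' \<in> ST E \<and>
        (\<forall>S \<in> ST E. inverse_image E' E f S \<supseteq> S' \<longleftrightarrow> S \<supseteq> direct_image E f S')) \<and>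
      (\<forall>S' \<in> ST E'. ext_direct_image E' E f S' \<in> ST E \<and>
        (\<forall>S \<in> ST E. ext_direct_image E' E f S' \<supseteq> S \<longleftrightarrow> S' \<supseteq> inverse_image E' E f S)) \<and>

      (\<forall>(I :: 'i set) X R K' K.
        (\<forall>i \<in> I. is_sieve C (X i) (R i)) \<and>
        K' = generated_topology C J' ((\<lambda>i. (X i, R i)) ` I) \<and>
        K = generated_topology B J ((\<lambda>i. (FO p (X i), sieve_image C B p (X i) (R i))) ` I)
        \<longrightarrow>
        sheaves U C K' \<in> ST E' \<and> sheaves U B K \<in> ST E \<and>
        ext_direct_image E' E f (sheaves U C K') = sheaves U B K))"
proof -
  interpret small_fibration C B U p
    using assms by (intro small_fibration.intro small_functor.intro psh_cat.intro plain_category.intro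
        psh_cat_axioms.intro small_functor_axioms.intro small_fibration_axioms.intro) (auto simp: is_fibration_def)
  note J = \<open>is_topology B J\<close>
  define J' where "J' = giraud_topology C B p J"
  have J': "is_topology C J'" unfolding J'_def by (rule giraud_topology[OF J])
  interpret J: sheaf_site B U J using J by unfold_locales
  interpret J': sheaf_site C U J' using J' by unfold_locales
  let ?E' = "Sh U C J'" and ?E = "Sh U B J"
  show ?thesis
    unfolding Let_def J'_def[symmetric]
  proof (rule conjI[OF direct_image_exists], rule allI, rule impI, elim conjE, intro conjI)
    fix f
    assume f: "inv_im f = pb" and geo: "geometric_morphism (Psh U C) (Psh U B) f"
    obtain \<eta> \<epsilon> where adj: "adjunction (Psh U B) (Psh U C) pb (dir_im f) \<eta> \<epsilon>"
      using geo f unfolding geometric_morphism_def by auto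
    have lcP: "locally_connected (Psh U C) (Psh U B) f"
      using locally_connected_Sh[OF BB.min_topology f] geo by (simp add: giraud_min BB.Sh_min CC.Sh_min)
    have STJ: "sheaves U B J \<in> ST (Psh U B)"
      using BB.ST_Sh_iff[OF BB.min_topology] J min_topology_least[OF J] unfolding BB.Sh_min by blast
    have invP: "is_inverse_image (Psh U C) (Psh U B) f (sheaves U B J) (sheaves U C J')"
      using sheaves_inverse_image[OF adj BB.min_topology J min_topology_least[OF J]]
      by (simp add: giraud_min BB.Sh_min CC.Sh_min J'_def)
    have lc: "locally_connected ?E' ?E f"
      unfolding J'_def by (rule locally_connected_Sh[OF J f restricted_geometric_morphism[OF J f geo]])
    have inv: "is_inverse_image ?E' ?E f S (inverse_image ?E' ?E f S)" if S: "S \<in> ST ?E" for S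
    proof -
      obtain T where T: "is_topology B T" "J \<subseteq> T" "S = sheaves U B T" using S BB.ST_Sh_iff[OF J] by blast
      have "is_inverse_image ?E' ?E f S (sheaves U C (giraud_topology C B p T))"
        unfolding T(3) J'_def by (rule sheaves_inverse_image[OF adj J T(1,2)])
      with inverse_image_eqI[OF this] show ?thesis by (simp only:)
    qed
    then have invST: "inverse_image ?E' ?E f S \<in> ST ?E'" if "S \<in> ST ?E" for S
      using that unfolding is_inverse_image_def by blast
    have dir: "direct_image ?E f S' \<in> ST ?E" if S': "S' \<in> ST ?E'" for S'
      unfolding direct_image_def
    proof (rule J.ST_hull)
      have "FO (dir_im f) ` sheaves U C J' \<subseteq> sheaves U B J"
        using direct_image_sheaves_iff[OF adj J J'] by (simp add: J'_def)
      moreover have "S' \<subseteq> sheaves U C J'" using S' by (auto simp: ST_def)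
      ultimately show "FO (dir_im f) ` S' \<subseteq> sheaves U B J" by blast
    qed
    have dir_adj: "S' \<subseteq> inverse_image ?E' ?E f S \<longleftrightarrow> direct_image ?E f S' \<subseteq> S" if "S' \<in> ST ?E'" "S \<in> ST ?E" for S S'
      using inv[OF that(2)] that(1) unfolding is_inverse_image_def by blast
    have ext: "is_ext_direct_image ?E' ?E f S' (ext_direct_image ?E' ?E f S')" if S': "S' \<in> ST ?E'" for S'
    proof -
      obtain L where L: "is_topology C L" "J' \<subseteq> L" "S' = sheaves U C L" using S' CC.ST_Sh_iff[OF J'] by blast
      have sv: "is_sieve C (fst z) (snd z)" if "z \<in> L" for z
        using L(1) that unfolding is_topology_def by (cases z) auto
      \<comment> \<open>Every topology containing \<open>J'\<close> is generated by its own sieves, so that the description of the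
        extraordinary direct image by generators also proves its existence.\<close>
      have gen: "generated_topology C J' ((\<lambda>z. (fst z, snd z)) ` L) = L"
        using hull_same[where S="is_topology C", OF L(1)] L(2) by (simp add: generated_topology_def Un_absorb1)
      have "is_ext_direct_image ?E' ?E f (sheaves U C (generated_topology C J' ((\<lambda>z. (fst z, snd z)) ` L)))
          (sheaves U B (generated_topology B J ((\<lambda>z. (FO p (fst z), sieve_image C B p (fst z) (snd z))) ` L)))"
        unfolding J'_def by (rule sheaves_ext_direct_image(5)[OF adj J _ refl refl]) (rule sv)
      then have "is_ext_direct_image ?E' ?E f S' (sheaves U B (generated_topology B J
          ((\<lambda>z. (FO p (fst z), sieve_image C B p (fst z) (snd z))) ` L)))" unfolding gen L(3)[symmetric] .
      with ext_direct_image_eqI[OF this] show ?thesis by (simp only:)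
    qed
    then have extST: "ext_direct_image ?E' ?E f S' \<in> ST ?E"
      and ext_adj: "S \<in> ST ?E \<Longrightarrow> inverse_image ?E' ?E f S \<subseteq> S' \<longleftrightarrow> S \<subseteq> ext_direct_image ?E' ?E f S'"
      if "S' \<in> ST ?E'" for S S'
      using that unfolding is_ext_direct_image_def by blast+
    have un: "is_union ?E' (inverse_image ?E' ?E f ` \<S>) (inverse_image ?E' ?E f V)"
      if \<S>: "\<S> \<subseteq> ST ?E" and V: "is_union ?E \<S> V" for \<S> V
      by (rule adjoints_preserve_union_intersection(1)[where E="?E" and d="direct_image ?E f" and
          x="ext_direct_image ?E' ?E f", OF _ _ _ _ _ \<S> V]) (fact invST dir dir_adj extST ext_adj)+
    have isn: "is_intersection ?E' (inverse_image ?E' ?E f ` \<S>) (inverse_image ?E' ?E f V)"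
      if \<S>: "\<S> \<subseteq> ST ?E" and V: "is_intersection ?E \<S> V" for \<S> V
      by (rule adjoints_preserve_union_intersection(2)[where E="?E" and d="direct_image ?E f" and
          x="ext_direct_image ?E' ?E f", OF _ _ _ _ _ \<S> V]) (fact invST dir dir_adj extST ext_adj)+
    have iii: "sheaves U C K' \<in> ST ?E' \<and> sheaves U B K \<in> ST ?E \<and>
        ext_direct_image ?E' ?E f (sheaves U C K') = sheaves U B K"
      if R: "\<forall>i \<in> I. is_sieve C (X i) (R i)"
        and K': "K' = generated_topology C J' ((\<lambda>i. (X i, R i)) ` I)"
        and K: "K = generated_topology B J ((\<lambda>i. (FO p (X i), sieve_image C B p (X i) (R i))) ` I)"
      for I :: "'i set" and X R K' K
    proof -
      have "\<And>i. i \<in> I \<Longrightarrow> is_sieve C (X i) (R i)" using R by blast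
      note e = sheaves_ext_direct_image[OF adj J this K'[unfolded J'_def] K]
      have "sheaves U C K' \<in> ST ?E'" "sheaves U B K \<in> ST ?E"
        using CC.ST_Sh_iff[OF J'] BB.ST_Sh_iff[OF J] e(1-4) unfolding J'_def by blast+
      then show ?thesis using ext_direct_image_eqI e(5) unfolding J'_def by blast
    qed
    show "locally_connected (Psh U C) (Psh U B) f" by (rule lcP)
    show "is_topology C J'" by (rule J')
    show "sheaves U B J \<in> ST (Psh U B)" by (rule STJ)
    show "is_inverse_image (Psh U C) (Psh U B) f (sheaves U B J) (sheaves U C J')" by (rule invP)
    show "locally_connected ?E' ?E f" by (rule lc)
    show "\<forall>S \<in> ST ?E. is_inverse_image ?E' ?E f S (inverse_image ?E' ?E f S)" using inv by (rule ballI)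
    show "\<forall>\<S> \<subseteq> ST ?E.
      (\<exists>V. is_union ?E \<S> V) \<and> (\<exists>V. is_intersection ?E \<S> V) \<and>
      (\<forall>V. is_union ?E \<S> V \<longrightarrow>
        is_union ?E' (inverse_image ?E' ?E f ` \<S>) (inverse_image ?E' ?E f V)) \<and>
      (\<forall>V. is_intersection ?E \<S> V \<longrightarrow>
        is_intersection ?E' (inverse_image ?E' ?E f ` \<S>) (inverse_image ?E' ?E f V))"
    proof (intro allI impI conjI)
      fix \<S> assume \<S>: "\<S> \<subseteq> ST ?E"
      show "\<exists>V. is_union ?E \<S> V" "\<exists>V. is_intersection ?E \<S> V"
        by (rule J.unions_intersections_exist[OF \<S>])+
      fix V
      show "is_union ?E' (inverse_image ?E' ?E f ` \<S>) (inverse_image ?E' ?E f V)" if "is_union ?E \<S> V"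
        by (rule un[OF \<S> that])
      show "is_intersection ?E' (inverse_image ?E' ?E f ` \<S>) (inverse_image ?E' ?E f V)"
        if "is_intersection ?E \<S> V" by (rule isn[OF \<S> that])
    qed
    show "\<forall>S' \<in> ST ?E'. direct_image ?E f S' \<in> ST ?E \<and>
      (\<forall>S \<in> ST ?E. S' \<subseteq> inverse_image ?E' ?E f S \<longleftrightarrow> direct_image ?E f S' \<subseteq> S)"
      by (intro ballI conjI dir dir_adj)
    show "\<forall>S' \<in> ST ?E'. ext_direct_image ?E' ?E f S' \<in> ST ?E \<and>
      (\<forall>S \<in> ST ?E. S \<subseteq> ext_direct_image ?E' ?E f S' \<longleftrightarrow> inverse_image ?E' ?E f S \<subseteq> S')"
      by (intro ballI conjI extST) (simp_all only: ext_adj)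
    show "\<forall>(I :: 'i set) X R K' K.
      (\<forall>i \<in> I. is_sieve C (X i) (R i)) \<and>
      K' = generated_topology C J' ((\<lambda>i. (X i, R i)) ` I) \<and>
      K = generated_topology B J ((\<lambda>i. (FO p (X i), sieve_image C B p (X i) (R i))) ` I)
      \<longrightarrow>
      sheaves U C K' \<in> ST ?E' \<and> sheaves U B K \<in> ST ?E \<and>
      ext_direct_image ?E' ?E f (sheaves U C K') = sheaves U B K"
      by (intro allI impI, elim conjE) (rule iii)
  qed
qed

end
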